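(* Let $(G,o)$ be an ergodic unimodular random graph and let $\mathcal{B}$ be its Bernoulli graphing. Then $\mathcal{B}$ is Ramanujan relative to its skeleton, that is, $$\sigma_R(\mathcal{B}) \subseteq [-\rho(G,o), \rho(G,o)],$$ where $\sigma_R(\mathcal B)$ is the random part of the spectrum of $\mathcal B$ and $\rho(G,o)$ is the (almost surely constant) spectral radius of $(G,o)$.
   Context: All graphs have vertex degrees bounded by a fixed $D\in\mathbb{N}$ and no isolated vertices. $\mathbb{G}_\bullet$ is the standard Borel space of isomorphism classes of connected rooted graphs $(G,o)$; $\mathbb{G}_{\bullet\bullet}$ is the space of isomorphism classes of connected doubly rooted graphs $(G,o,o')$; $\mathbb{G}_\bullet^+$ is the space of isomorphism classes of connected rooted graphs $(G,\xi,o)$ with a vertex labelling $\xi: V(G)\to[0,1]$ (isomorphisms preserve roots and labels). A unimodular random graph is a random element $(G,o)$ of $\mathbb{G}_\bullet$, with law $\nu$, satisfying the Mass Transport Principle: for every Borel $f:\mathbb{G}_{\bullet\bullet}\to\mathbb{R}_{\ge 0}$, $\int \sum_{o'\in V(G)} f(G,o',o)\,d\nu(G,o) = \int \sum_{o'\in V(G)} f(G,o,o')\,d\nu(G,o)$. It is ergodic if every Borel $U\subseteq\mathbb{G}_\bullet$ that is rerooting invariant ($(G,o)\in U$ implies $(G,o')\in U$ for all $o'\in V(G)$) has $\nu(U)\in\{0,1\}$. For a connected graph $G$, $\ell^2(G,\deg)$ is the Hilbert space of functions on $V(G)$ with inner product $\langle f,g\rangle=\sum_u f(u)\overline{g(u)}\deg(u)$,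 and $M_G$ is the self-adjoint Markov operator $(M_Gf)(u)=\frac{1}{\deg(u)}\sum_{(u,v)\in E(G)}f(v)$. Put $\rho(G,o)=\sup\{|\lambda| : \lambda\in\sigma(M_G)\}$; this does not depend on the root, so it is almost surely constant when $(G,o)$ is ergodic. The Bernoulli graphing of $(G,o)$ is the triple $(\mathcal{B},\mathbb{G}_\bullet^+,\mu)$, where $\mathcal B$ is the Borel graph on $\mathbb{G}_\bullet^+$ with an edge between $(G,\xi,o)$ and $(H,\eta,p)$ iff there is a neighbour $o'$ of $o$ in $G$ with $(G,\xi,o')\cong(H,\eta,p)$, and $\mu$ is given by $\int f\,d\mu=\int_{\mathbb{G}_\bullet}\int_{[0,1]^{V(G)}} f(G,\xi,o)\,d\beta_G(\xi)\,d\nu(G,o)$ with $\beta_G=\mathrm{Leb}^{\otimes V(G)}$ (i.e. the vertices of $(G,o)$ receive iid uniform $[0,1]$ labels). The degree-biased measure $\mu^*$ is given by $\int f\,d\mu^*=\int f\deg\,d\mu/\int\deg\,d\mu$, and $\nu^*$ is defined from $\nu$ in the same way using $\deg_G(o)$. The Markov operator $\mathcal{M}$ of $\mathcal{B}$ is the self-adjoint operator on $L^2(\mathbb{G}_\bullet^+,\mu^* )$ with $(\mathcal{M}f)(x)=\frac{1}{\deg(x)}\sum_{(x,y)\in\mathcal{B}} f(y)$. Let $s:\mathbb{G}_\bullet^+\to\mathbb{G}_\bullet$, $s(G,\xi,o)=(G,o)$, and let $\iota:L^2(\mathbb{G}_\bullet,\nu^* )\to L^2(\mathbb{G}_\bullet^+,\mu^*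 )$ be the isometric embedding $\iota f=f\circ s$. The structured subspace is $S=\mathrm{Ran}(\iota)$ and the random subspace is $R=S^\perp$. Both are $\mathcal{M}$-invariant. The random spectrum is $\sigma_R(\mathcal{B})=\sigma(\mathcal{M}|_R)$. (The phrase "relative to its skeleton" refers to the fact that only the part of the spectrum on $R$ is required to satisfy the bound.) *)

theory Defs
  imports "HOL-Probability.Probability"
begin

section \<open>Graphs\<close>

text \<open>
  A graph is a pair of a vertex set and a symmetric irreflexive edge relation. Connected graphs
  of bounded degree are countable, so vertices are natural numbers without loss of generality.
\<close>

type_synonym graph = "nat set \<times> (nat \<times> nat) set"

abbreviation verts :: "graph \<Rightarrow> nat set" where "verts G \<equiv> fst G"
abbreviation edges :: "graph \<Rightarrow> (nat \<times> nat) set" where "edges G \<equiv> snd G"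

definition simple_graph :: "graph \<Rightarrow> bool" where
  "simple_graph G \<longleftrightarrow> edges G \<subseteq> verts G \<times> verts G \<and> sym (edges G) \<and> irrefl (edges G)"

text \<open>The degree of a point in a relation is used both for a graph and for a graphing.\<close>

definition deg :: "('a \<times> 'a) set \<Rightarrow> 'a \<Rightarrow> nat" where
  "deg E x = card (E `` {x})"

definition bounded_graph :: "nat \<Rightarrow> graph \<Rightarrow> bool" where
  "bounded_graph D G \<longleftrightarrow> simple_graph G
     \<and> (\<forall>u\<in>verts G. \<forall>v\<in>verts G. (u, v) \<in> (edges G)\<^sup>*)
     \<and> (\<forall>u\<in>verts G. edges G `` {u} \<noteq> {} \<and> finite (edges G `` {u}) \<and> deg (edges G) u \<le> D)"

definition graph_iso :: "(nat \<Rightarrow> nat) \<Rightarrow> graph \<Rightarrow> graph \<Rightarrow> bool" where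
  "graph_iso \<phi> G H \<longleftrightarrow> bij_betw \<phi> (verts G) (verts H)
     \<and> (\<forall>u\<in>verts G. \<forall>v\<in>verts G. (u, v) \<in> edges G \<longleftrightarrow> (\<phi> u, \<phi> v) \<in> edges H)"

text \<open>The subgraph induced on the vertices at distance at most \<open>n\<close> from \<open>p\<close>.\<close>

definition graph_ball :: "graph \<Rightarrow> nat \<Rightarrow> nat \<Rightarrow> graph" where
  "graph_ball G p n =
     (let B = {v \<in> verts G. \<exists>k\<le>n. (p, v) \<in> edges G ^^ k} in (B, edges G \<inter> B \<times> B))"


section \<open>Spaces of isomorphism classes\<close>

text \<open>
  The three spaces are quotients of sets of concrete graphs. Each carries the Borel sigma-algebra
  of the local topology; this topology is second countable and has the basic neighbourhoods
  used as generators below as a base.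
\<close>

type_synonym rgraph = "graph \<times> nat"
type_synonym bgraph = "graph \<times> nat \<times> nat"
type_synonym lgraph = "graph \<times> (nat \<Rightarrow> real) \<times> nat"

definition rep :: "'a set \<Rightarrow> 'a" where
  "rep X = (SOME x. x \<in> X)"

definition rooted :: "nat \<Rightarrow> rgraph set" where
  "rooted D = {(G, p). bounded_graph D G \<and> p \<in> verts G}"

definition rooted_iso :: "(rgraph \<times> rgraph) set" where
  "rooted_iso = {((G, p), (H, q)). simple_graph G \<and> p \<in> verts G \<and> simple_graph H \<and> q \<in> verts H
     \<and> (\<exists>\<phi>. graph_iso \<phi> G H \<and> \<phi> p = q)}"

definition rclass :: "rgraph \<Rightarrow> rgraph set" where
  "rclass x = rooted_iso `` {x}"

definition rooted_nbhd :: "nat \<Rightarrow> rgraph \<Rightarrow> nat \<Rightarrow> rgraph set set" where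
  "rooted_nbhd D = (\<lambda>(G, p) n. {rclass (H, q) |H q. (H, q) \<in> rooted D
     \<and> (\<exists>\<phi>. graph_iso \<phi> (graph_ball G p n) (graph_ball H q n) \<and> \<phi> p = q)})"

definition rooted_space :: "nat \<Rightarrow> rgraph set measure" where
  "rooted_space D = sigma (rooted D // rooted_iso) {rooted_nbhd D x n |x n. x \<in> rooted D}"

definition birooted :: "nat \<Rightarrow> bgraph set" where
  "birooted D = {(G, p, p'). bounded_graph D G \<and> p \<in> verts G \<and> p' \<in> verts G}"

definition birooted_iso :: "(bgraph \<times> bgraph) set" where
  "birooted_iso = {((G, p, p'), (H, q, q')).
     simple_graph G \<and> p \<in> verts G \<and> p' \<in> verts G
     \<and> simple_graph H \<and> q \<in> verts H \<and> q' \<in> verts H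
     \<and> (\<exists>\<phi>. graph_iso \<phi> G H \<and> \<phi> p = q \<and> \<phi> p' = q')}"

definition bclass :: "bgraph \<Rightarrow> bgraph set" where
  "bclass x = birooted_iso `` {x}"

definition birooted_nbhd :: "nat \<Rightarrow> bgraph \<Rightarrow> nat \<Rightarrow> bgraph set set" where
  "birooted_nbhd D = (\<lambda>(G, p, p') n. {bclass (H, q, q') |H q q'. (H, q, q') \<in> birooted D
     \<and> (\<exists>\<phi>. graph_iso \<phi> (graph_ball G p n) (graph_ball H q n) \<and> \<phi> p = q \<and> \<phi> p' = q')})"

text \<open>Only radii large enough for the ball around the first root to contain the second are used.\<close>

definition birooted_space :: "nat \<Rightarrow> bgraph set measure" where
  "birooted_space D = sigma (birooted D // birooted_iso)
     {birooted_nbhd D (G, p, p') n |G p p' n.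
        (G, p, p') \<in> birooted D \<and> p' \<in> verts (graph_ball G p n)}"

text \<open>
  A labelling is a function on the vertex set only, i.e. it is \<^const>\<open>undefined\<close> elsewhere.
\<close>

definition labelled :: "nat \<Rightarrow> lgraph set" where
  "labelled D = {(G, \<xi>, p). bounded_graph D G \<and> p \<in> verts G \<and> \<xi> \<in> verts G \<rightarrow>\<^sub>E {0..1}}"

definition labelled_iso :: "(lgraph \<times> lgraph) set" where
  "labelled_iso = {((G, \<xi>, p), (H, \<eta>, q)).
     simple_graph G \<and> p \<in> verts G \<and> \<xi> \<in> verts G \<rightarrow>\<^sub>E {0..1}
     \<and> simple_graph H \<and> q \<in> verts H \<and> \<eta> \<in> verts H \<rightarrow>\<^sub>E {0..1}
     \<and> (\<exists>\<phi>. graph_iso \<phi> G H \<and> \<phi> p = q \<and> (\<forall>v\<in>verts G. \<eta> (\<phi> v) = \<xi> v))}"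

definition lclass :: "lgraph \<Rightarrow> lgraph set" where
  "lclass x = labelled_iso `` {x}"

definition labelled_nbhd :: "nat \<Rightarrow> lgraph \<Rightarrow> nat \<Rightarrow> real \<Rightarrow> lgraph set set" where
  "labelled_nbhd D = (\<lambda>(G, \<xi>, p) n \<epsilon>. {lclass (H, \<eta>, q) |H \<eta> q. (H, \<eta>, q) \<in> labelled D
     \<and> (\<exists>\<phi>. graph_iso \<phi> (graph_ball G p n) (graph_ball H q n) \<and> \<phi> p = q
          \<and> (\<forall>v\<in>verts (graph_ball G p n). \<bar>\<eta> (\<phi> v) - \<xi> v\<bar> < \<epsilon>))})"

definition labelled_space :: "nat \<Rightarrow> lgraph set measure" where
  "labelled_space D = sigma (labelled D // labelled_iso)
     {labelled_nbhd D x n \<epsilon> |x n \<epsilon>. x \<in> labelled D \<and> 0 < \<epsilon>}"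


section \<open>Unimodular random graphs\<close>

text \<open>A random rooted graph is given by its law \<open>\<nu>\<close>.\<close>

definition unimodular_random_graph :: "nat \<Rightarrow> rgraph set measure \<Rightarrow> bool" where
  "unimodular_random_graph D \<nu> \<longleftrightarrow>
     prob_space \<nu> \<and> sets \<nu> = sets (rooted_space D) \<and>
     (\<forall>f::bgraph set \<Rightarrow> real. f \<in> borel_measurable (birooted_space D) \<longrightarrow>
        (\<forall>x\<in>space (birooted_space D). 0 \<le> f x) \<longrightarrow>
        (\<integral>\<^sup>+X. (case rep X of (G, p) \<Rightarrow>
            \<integral>\<^sup>+p'. ennreal (f (bclass (G, p', p))) \<partial>count_space (verts G)) \<partial>\<nu>)
      = (\<integral>\<^sup>+X. (case rep X of (G, p) \<Rightarrow>
            \<integral>\<^sup>+p'. ennreal (f (bclass (G, p, p'))) \<partial>count_space (verts G)) \<partial>\<nu>))"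

definition rerooting_invariant :: "nat \<Rightarrow> rgraph set set \<Rightarrow> bool" where
  "rerooting_invariant D U \<longleftrightarrow>
     (\<forall>G p p'. (G, p) \<in> rooted D \<longrightarrow> p' \<in> verts G \<longrightarrow> rclass (G, p) \<in> U \<longrightarrow> rclass (G, p') \<in> U)"

definition ergodic_random_graph :: "nat \<Rightarrow> rgraph set measure \<Rightarrow> bool" where
  "ergodic_random_graph D \<nu> \<longleftrightarrow>
     (\<forall>U\<in>sets (rooted_space D). rerooting_invariant D U \<longrightarrow> measure \<nu> U \<in> {0, 1})"


section \<open>Square-integrable functions, spectra and Markov operators\<close>

text \<open>
  Elements of an \<open>L\<^sup>2\<close> space are represented by functions, and equality is equality almost
  everywhere; a subspace is a set of functions closed under almost everywhere equality.
\<close>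

definition L2_space :: "'a measure \<Rightarrow> ('a \<Rightarrow> complex) set" where
  "L2_space M = {f \<in> borel_measurable M. integrable M (\<lambda>x. (cmod (f x))\<^sup>2)}"

definition L2_inner :: "'a measure \<Rightarrow> ('a \<Rightarrow> complex) \<Rightarrow> ('a \<Rightarrow> complex) \<Rightarrow> complex" where
  "L2_inner M f g = (LINT x|M. f x * cnj (g x))"

definition L2_norm :: "'a measure \<Rightarrow> ('a \<Rightarrow> complex) \<Rightarrow> real" where
  "L2_norm M f = sqrt (LINT x|M. (cmod (f x))\<^sup>2)"

text \<open>
  The spectrum of the restriction of \<open>T\<close> to an invariant closed subspace \<open>H\<close> of \<open>L\<^sup>2(M)\<close>:
  all \<open>z\<close> for which \<open>T - z\<close> has no bounded two-sided inverse \<open>S\<close> on \<open>H\<close>.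
  Linearity of \<open>S\<close> (almost everywhere) is automatic for an inverse of a linear operator.
\<close>

definition L2_spectrum ::
    "'a measure \<Rightarrow> ('a \<Rightarrow> complex) set \<Rightarrow> (('a \<Rightarrow> complex) \<Rightarrow> 'a \<Rightarrow> complex) \<Rightarrow> complex set" where
  "L2_spectrum M H T = {z. \<not> (\<exists>S C. \<forall>f\<in>H.
      S f \<in> H \<and> L2_norm M (S f) \<le> C * L2_norm M f
      \<and> (AE x in M. T (S f) x - z * S f x = f x)
      \<and> (AE x in M. S (\<lambda>y. T f y - z * f y) x = f x))}"

definition markov_op :: "('a \<times> 'a) set \<Rightarrow> ('a \<Rightarrow> complex) \<Rightarrow> 'a \<Rightarrow> complex" where
  "markov_op E f x = (\<Sum>y\<in>E `` {x}. f y) / of_nat (deg E x)"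

text \<open>The space \<open>\<ell>\<^sup>2(G, deg)\<close> is the \<open>L\<^sup>2\<close> space of the following measure.\<close>

definition deg_measure :: "graph \<Rightarrow> nat measure" where
  "deg_measure G = point_measure (verts G) (\<lambda>u. ennreal (real (deg (edges G) u)))"

definition spectral_radius :: "rgraph set \<Rightarrow> real" where
  "spectral_radius X = (case rep X of (G, p) \<Rightarrow>
     (SUP z\<in>L2_spectrum (deg_measure G) (L2_space (deg_measure G)) (markov_op (edges G)). cmod z))"


section \<open>The Bernoulli graphing\<close>

definition bernoulli_graph :: "nat \<Rightarrow> (lgraph set \<times> lgraph set) set" where
  "bernoulli_graph D =
     {(lclass (G, \<xi>, p), lclass (G, \<xi>, p')) |G \<xi> p p'. (G, \<xi>, p) \<in> labelled D \<and> (p, p') \<in> edges G}"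

definition bernoulli_measure :: "nat \<Rightarrow> rgraph set measure \<Rightarrow> lgraph set measure" where
  "bernoulli_measure D \<nu> = bind \<nu> (\<lambda>X. case rep X of (G, p) \<Rightarrow>
     distr (PiM (verts G) (\<lambda>_. restrict_space lborel {0..1})) (labelled_space D)
       (\<lambda>\<xi>. lclass (G, \<xi>, p)))"

definition degree_biased :: "'a measure \<Rightarrow> ('a \<Rightarrow> nat) \<Rightarrow> 'a measure" where
  "degree_biased M d = density M (\<lambda>x. ennreal (real (d x) / (LINT y|M. real (d y))))"

definition root_deg :: "rgraph set \<Rightarrow> nat" where
  "root_deg X = (case rep X of (G, p) \<Rightarrow> deg (edges G) p)"

definition nu_star :: "rgraph set measure \<Rightarrow> rgraph set measure" where
  "nu_star \<nu> = degree_biased \<nu> root_deg"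

definition mu_star :: "nat \<Rightarrow> rgraph set measure \<Rightarrow> lgraph set measure" where
  "mu_star D \<nu> = degree_biased (bernoulli_measure D \<nu>) (deg (bernoulli_graph D))"

definition forget_labels :: "lgraph set \<Rightarrow> rgraph set" where
  "forget_labels X = (case rep X of (G, \<xi>, p) \<Rightarrow> rclass (G, p))"

definition structured_subspace :: "nat \<Rightarrow> rgraph set measure \<Rightarrow> (lgraph set \<Rightarrow> complex) set" where
  "structured_subspace D \<nu> = {g \<in> L2_space (mu_star D \<nu>).
     \<exists>f\<in>L2_space (nu_star \<nu>). AE x in mu_star D \<nu>. g x = (f \<circ> forget_labels) x}"

definition random_subspace :: "nat \<Rightarrow> rgraph set measure \<Rightarrow> (lgraph set \<Rightarrow> complex) set" where
  "random_subspace D \<nu> = {g \<in> L2_space (mu_star D \<nu>).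
     \<forall>f\<in>structured_subspace D \<nu>. L2_inner (mu_star D \<nu>) g f = 0}"

definition random_spectrum :: "nat \<Rightarrow> rgraph set measure \<Rightarrow> complex set" where
  "random_spectrum D \<nu> =
     L2_spectrum (mu_star D \<nu>) (random_subspace D \<nu>) (markov_op (bernoulli_graph D))"

end

theory Submission
  imports Defs
begin

text \<open>
  Let \<open>T\<close> average a function on labelled graphs over the neighbours of the root. It is the Markov
  operator of the Bernoulli graphing, up to a null set: the graphing could identify two neighbours
  of the root, but almost surely their labels differ (\<open>bernoulli_graph_nbrs\<close>, \<open>AE_markov_op\<close>). The
  proof bounds the norm of \<open>T\<close> on the random subspace by the spectral radius \<open>\<rho>\<close> of the graph.

  \<^item> \<open>T\<close> is self-adjoint on \<open>L\<^sup>2(\<mu>\<^sup>*)\<close>, i.e. the walk on labelled graphs is reversible. For events \<open>A\<close> and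
  \<open>B\<close> that depend on a finite ball around the root, let \<open>p\<close> send to its neighbour \<open>p'\<close> the probability
  that the random labels put \<open>p\<close> into \<open>A\<close> and \<open>p'\<close> into \<open>B\<close>; mass transport is reversibility for \<open>A\<close>
  and \<open>B\<close> (\<open>labelled_mass_transport\<close>), and such events generate the \<open>\<sigma>\<close>-algebra. As \<open>T\<close> preserves
  the structured subspace, it preserves its orthogonal complement (\<open>random_symmetric_operator\<close>).
  The spectrum of a symmetric operator of norm at most \<open>\<rho>\<close> lies in \<open>[-\<rho>, \<rho>]\<close>
  (\<open>spectrum_in_interval\<close>), so it remains to prove \<open>\<parallel>T h\<parallel> \<le> \<rho> \<parallel>h\<parallel>\<close> for random \<open>h\<close>.

  \<^item> Let \<open>f\<close> be bounded, depend on the labels in the ball of radius \<open>n\<close> only, and have mean zero over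
  the labels of every graph. Then \<open>\<langle>T\<^sup>k f, f\<rangle>\<close> is the average over the graph of the sum over \<open>v\<close> of the
  probability that the walk from the root \<open>p\<close> is at \<open>v\<close> after \<open>k\<close> steps, times the correlation of \<open>f\<close>
  at \<open>v\<close> with \<open>f\<close> at \<open>p\<close>. Labels in disjoint balls are independent, so only the boundedly many \<open>v\<close>
  within distance \<open>2n\<close> of \<open>p\<close> contribute (\<open>far_correlation_zero\<close>), and for each of them the
  probability is at most \<open>sqrt D * \<rho>\<^sup>k\<close> because \<open>\<rho>\<close> is the norm of the Markov operator of the graph.
  Hence \<open>\<bar>\<langle>T\<^sup>k f, f\<rangle>\<bar> \<le> C \<rho>\<^sup>k\<close> (\<open>local_correlations_decay\<close>). The constant \<open>C\<close> depends on \<open>f\<close> badly, but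
  \<open>\<parallel>T\<^sup>k f\<parallel>\<close> is log-convex in \<open>k\<close>, and a log-convex sequence that grows at most like \<open>\<rho>\<^sup>k\<close> has first ratio
  at most \<open>\<rho>\<close>. So \<open>\<parallel>T f\<parallel> \<le> \<rho> \<parallel>f\<parallel>\<close> with no loss (\<open>norm_le_if_correlations_decay\<close>).

  \<^item> Such functions approximate every \<open>h\<close> in the random subspace. Functions that depend on the labels of
  a finite ball are dense (\<open>local_closure_eq\<close>). If \<open>g\<close> is such a function close to \<open>h\<close>, its mean given
  the graph is its projection to the structured subspace, which is small since \<open>h\<close> is orthogonal
  to that subspace; subtracting it gives a centred \<open>f\<close> close to \<open>h\<close> (\<open>random_norm_le\<close>).

  \<^item> The spectral radius is almost surely constant, because it is the norm of the Markov operator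
  (\<open>Sup_spectrum_le_iff\<close>), which is the supremum of a sequence of quantities that depend on balls, hence
  a Borel function, and independent of the root (\<open>spectral_radius_constant\<close>).
\<close>

section \<open>The semi-Hilbert space of square-integrable functions\<close>

lemma L2_measurable: "f \<in> L2_space M \<Longrightarrow> f \<in> borel_measurable M"
  and L2_square_integrable: "f \<in> L2_space M \<Longrightarrow> integrable M (\<lambda>x. (cmod (f x))\<^sup>2)"
  by (auto simp: L2_space_def)

lemma L2_spaceI:
  "f \<in> borel_measurable M \<Longrightarrow> integrable M (\<lambda>x. (cmod (f x))\<^sup>2) \<Longrightarrow> f \<in> L2_space M"
  by (auto simp: L2_space_def)

lemma borel_measurable_cnj[measurable]:
  "f \<in> borel_measurable M \<Longrightarrow> (\<lambda>x. cnj (f x)) \<in> borel_measurable M"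
  by (rule measurable_compose[OF _ borel_measurable_continuous_onI]) (auto intro!: continuous_intros)

lemma L2_zero: "(\<lambda>x. 0) \<in> L2_space M"
  by (auto simp: L2_space_def)

lemma L2_scale:
  assumes "f \<in> L2_space M" shows "(\<lambda>x. c * f x) \<in> L2_space M"
  using assms by (auto simp: L2_space_def norm_mult power_mult_distrib)

lemma norm_add_sq_le: "(norm (a + b))\<^sup>2 \<le> 2 * (norm a)\<^sup>2 + 2 * (norm b)\<^sup>2"
  for a b :: "'a::real_normed_vector"
proof -
  have "(norm (a + b))\<^sup>2 \<le> (norm a + norm b)\<^sup>2" by (simp add: norm_triangle_ineq power_mono)
  also have "\<dots> \<le> 2 * (norm a)\<^sup>2 + 2 * (norm b)\<^sup>2"
    using sum_squares_bound[of "norm a" "norm b"] by (simp add: power2_sum)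
  finally show ?thesis .
qed

lemma L2_add:
  assumes f: "f \<in> L2_space M" and g: "g \<in> L2_space M"
  shows "(\<lambda>x. f x + g x) \<in> L2_space M"
proof (rule L2_spaceI)
  note [measurable] = L2_measurable[OF f] L2_measurable[OF g]
  show "(\<lambda>x. f x + g x) \<in> borel_measurable M" by measurable
  show "integrable M (\<lambda>x. (cmod (f x + g x))\<^sup>2)"
  proof (rule Bochner_Integration.integrable_bound)
    show "integrable M (\<lambda>x. 2 * (cmod (f x))\<^sup>2 + 2 * (cmod (g x))\<^sup>2)"
      using L2_square_integrable[OF f] L2_square_integrable[OF g] by simp
    show "AE x in M. norm ((cmod (f x + g x))\<^sup>2) \<le> norm (2 * (cmod (f x))\<^sup>2 + 2 * (cmod (g x))\<^sup>2)"
      using norm_add_sq_le[of "f _" "g _"] by (auto intro!: AE_I2)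
  qed measurable
qed

lemma L2_diff:
  assumes "f \<in> L2_space M" "g \<in> L2_space M"
  shows "(\<lambda>x. f x - g x) \<in> L2_space M"
  using L2_add[OF assms(1) L2_scale[OF assms(2), of "-1"]] by simp

lemma L2_cong_AE:
  assumes f: "f \<in> L2_space M" and g: "g \<in> borel_measurable M" and ae: "AE x in M. g x = f x"
  shows "g \<in> L2_space M"
proof (rule L2_spaceI[OF g])
  note [measurable] = L2_measurable[OF f] g
  show "integrable M (\<lambda>x. (cmod (g x))\<^sup>2)"
    by (rule Bochner_Integration.integrable_cong_AE_imp[OF L2_square_integrable[OF f]])
      (use ae in auto)
qed

lemma L2_bounded:
  assumes "finite_measure M" "f \<in> borel_measurable M" "\<And>x. x \<in> space M \<Longrightarrow> cmod (f x) \<le> c"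
  shows "f \<in> L2_space M"
proof (rule L2_spaceI[OF assms(2)])
  interpret finite_measure M by fact
  note [measurable] = assms(2)
  show "integrable M (\<lambda>x. (cmod (f x))\<^sup>2)"
    by (rule integrable_const_bound[where B="c\<^sup>2"]) (auto intro!: AE_I2 power_mono assms(3))
qed

lemma L2_norm_nonneg[simp]: "0 \<le> L2_norm M f"
  by (simp add: L2_norm_def)

lemma L2_norm_power2: "(L2_norm M f)\<^sup>2 = (LINT x|M. (cmod (f x))\<^sup>2)"
  by (simp add: L2_norm_def)

lemma L2_inner_self: "L2_inner M f f = of_real ((L2_norm M f)\<^sup>2)"
  unfolding L2_inner_def L2_norm_power2 complex_norm_square[symmetric] of_real_power[symmetric]
  by (rule integral_complex_of_real)

lemma L2_norm_cong:
  assumes f: "f \<in> L2_space M" and g: "g \<in> borel_measurable M" and ae: "AE x in M. f x = g x"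
  shows "L2_norm M f = L2_norm M g"
  unfolding L2_norm_def using L2_measurable[OF f] g ae
  by (intro arg_cong[where f=sqrt] integral_cong_AE) auto

lemma L2_norm_scale: "L2_norm M (\<lambda>x. c * f x) = cmod c * L2_norm M f"
  by (simp add: L2_norm_def norm_mult power_mult_distrib real_sqrt_mult)

lemma L2_norm_minus_commute: "L2_norm M (\<lambda>x. f x - g x) = L2_norm M (\<lambda>x. g x - f x)"
  by (simp add: L2_norm_def norm_minus_commute)

lemma integrable_L2_product_norm:
  assumes f: "f \<in> L2_space M" and g: "g \<in> L2_space M"
  shows "integrable M (\<lambda>x. cmod (f x) * cmod (g x))"
proof (rule Bochner_Integration.integrable_bound)
  note [measurable] = L2_measurable[OF f] L2_measurable[OF g]
  show "integrable M (\<lambda>x. (cmod (f x))\<^sup>2 + (cmod (g x))\<^sup>2)"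
    using L2_square_integrable[OF f] L2_square_integrable[OF g] by simp
  have "norm (cmod a * cmod b) \<le> norm ((cmod a)\<^sup>2 + (cmod b)\<^sup>2)" for a b
  proof -
    have "2 * (cmod a * cmod b) \<le> (cmod a)\<^sup>2 + (cmod b)\<^sup>2"
      using sum_squares_bound[of "cmod a" "cmod b"] by (simp add: mult.assoc)
    moreover have "0 \<le> cmod a * cmod b" by simp
    ultimately show ?thesis unfolding real_norm_def by linarith
  qed
  then show "AE x in M. norm (cmod (f x) * cmod (g x)) \<le> norm ((cmod (f x))\<^sup>2 + (cmod (g x))\<^sup>2)"
    by (intro AE_I2)
qed (use L2_measurable[OF f] L2_measurable[OF g] in measurable)

lemma integrable_L2_inner:
  assumes f: "f \<in> L2_space M" and g: "g \<in> L2_space M"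
  shows "integrable M (\<lambda>x. f x * cnj (g x))"
proof (rule Bochner_Integration.integrable_bound[OF integrable_L2_product_norm[OF f g]])
  note [measurable] = L2_measurable[OF f] L2_measurable[OF g]
  show "(\<lambda>x. f x * cnj (g x)) \<in> borel_measurable M"
    by measurable
qed (auto simp: norm_mult)

lemma L2_inner_add_left:
  assumes "f \<in> L2_space M" "g \<in> L2_space M" "h \<in> L2_space M"
  shows "L2_inner M (\<lambda>x. f x + g x) h = L2_inner M f h + L2_inner M g h"
  using Bochner_Integration.integral_add[OF integrable_L2_inner[OF assms(1,3)]
      integrable_L2_inner[OF assms(2,3)]]
  by (simp add: L2_inner_def ring_distribs)

lemma L2_inner_scale_left: "L2_inner M (\<lambda>x. c * f x) g = c * L2_inner M f g"
  unfolding L2_inner_def by (simp add: mult.assoc)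

lemma L2_inner_commute: "L2_inner M f g = cnj (L2_inner M g f)"
proof -
  have "(\<lambda>x. f x * cnj (g x)) = (\<lambda>x. cnj (g x * cnj (f x)))" by (simp add: mult.commute)
  then show ?thesis unfolding L2_inner_def by (simp only: Bochner_Integration.integral_cnj)
qed

lemma L2_inner_scale_right: "L2_inner M f (\<lambda>x. c * g x) = cnj c * L2_inner M f g"
proof -
  have "(\<lambda>x. f x * cnj (c * g x)) = (\<lambda>x. cnj c * (f x * cnj (g x)))" by (simp add: mult_ac)
  then show ?thesis by (simp add: L2_inner_def)
qed

lemma L2_inner_add_right:
  assumes "f \<in> L2_space M" "g \<in> L2_space M" "h \<in> L2_space M"
  shows "L2_inner M f (\<lambda>x. g x + h x) = L2_inner M f g + L2_inner M f h"
  using Bochner_Integration.integral_add[OF integrable_L2_inner[OF assms(1,2)]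
      integrable_L2_inner[OF assms(1,3)]]
  by (simp add: L2_inner_def ring_distribs)

lemma L2_inner_diff_left:
  assumes "f \<in> L2_space M" "g \<in> L2_space M" "h \<in> L2_space M"
  shows "L2_inner M (\<lambda>x. f x - g x) h = L2_inner M f h - L2_inner M g h"
  using L2_inner_add_left[OF assms(1) L2_scale[OF assms(2), of "-1"] assms(3)]
    L2_inner_scale_left[of M "-1" g h] by simp

lemma L2_inner_diff_right:
  assumes "f \<in> L2_space M" "g \<in> L2_space M" "h \<in> L2_space M"
  shows "L2_inner M f (\<lambda>x. g x - h x) = L2_inner M f g - L2_inner M f h"
  using L2_inner_add_right[OF assms(1,2) L2_scale[OF assms(3), of "-1"]]
    L2_inner_scale_right[of M f "-1" h] by simp

lemma L2_Cauchy_Schwarz: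
  assumes f: "f \<in> L2_space M" and g: "g \<in> L2_space M"
  shows "cmod (L2_inner M f g) \<le> L2_norm M f * L2_norm M g"
proof -
  note [measurable] = L2_measurable[OF f] L2_measurable[OF g]
  let ?B = "LINT x|M. cmod (f x) * cmod (g x)"
  have "(\<integral>\<^sup>+x. ennreal (cmod (f x)) * ennreal (cmod (g x)) \<partial>M)\<^sup>2
      \<le> (\<integral>\<^sup>+x. (ennreal (cmod (f x)))\<^sup>2 \<partial>M) * (\<integral>\<^sup>+x. (ennreal (cmod (g x)))\<^sup>2 \<partial>M)"
    by (rule Cauchy_Schwarz_nn_integral) measurable
  also have "(\<integral>\<^sup>+x. ennreal (cmod (f x)) * ennreal (cmod (g x)) \<partial>M) = ennreal ?B"
    using nn_integral_eq_integral[OF integrable_L2_product_norm[OF f g]] by (simp add: ennreal_mult')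
  also have "(\<integral>\<^sup>+x. (ennreal (cmod (f x)))\<^sup>2 \<partial>M) = ennreal ((L2_norm M f)\<^sup>2)"
    using nn_integral_eq_integral[OF L2_square_integrable[OF f]]
    by (simp add: L2_norm_power2 ennreal_power)
  also have "(\<integral>\<^sup>+x. (ennreal (cmod (g x)))\<^sup>2 \<partial>M) = ennreal ((L2_norm M g)\<^sup>2)"
    using nn_integral_eq_integral[OF L2_square_integrable[OF g]]
    by (simp add: L2_norm_power2 ennreal_power)
  finally have "ennreal (?B\<^sup>2) \<le> ennreal ((L2_norm M f * L2_norm M g)\<^sup>2)"
    by (simp add: ennreal_power ennreal_mult' power_mult_distrib)
  then have "?B\<^sup>2 \<le> (L2_norm M f * L2_norm M g)\<^sup>2"
    by (simp add: ennreal_le_iff)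
  then have "?B \<le> L2_norm M f * L2_norm M g"
    by (rule power2_le_imp_le) simp
  moreover have "cmod (L2_inner M f g) \<le> ?B"
    unfolding L2_inner_def
    by (rule order_trans[OF integral_norm_bound]) (simp add: norm_mult)
  ultimately show ?thesis by simp
qed

lemma L2_norm_add_power2:
  assumes f: "f \<in> L2_space M" and g: "g \<in> L2_space M"
  shows "(L2_norm M (\<lambda>x. f x + g x))\<^sup>2
    = (L2_norm M f)\<^sup>2 + 2 * Re (L2_inner M f g) + (L2_norm M g)\<^sup>2"
proof -
  have "complex_of_real ((L2_norm M (\<lambda>x. f x + g x))\<^sup>2)
      = L2_inner M f f + L2_inner M f g + (cnj (L2_inner M f g) + L2_inner M g g)"
    unfolding L2_inner_self[symmetric]
    by (simp add: L2_inner_add_left L2_inner_add_right L2_add f g L2_inner_commute[of M g f])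
  then have "Re (complex_of_real ((L2_norm M (\<lambda>x. f x + g x))\<^sup>2))
      = Re (L2_inner M f f + L2_inner M f g + (cnj (L2_inner M f g) + L2_inner M g g))"
    by (rule arg_cong)
  then show ?thesis by (simp add: L2_inner_self del: of_real_power)
qed

lemma L2_norm_triangle:
  assumes f: "f \<in> L2_space M" and g: "g \<in> L2_space M"
  shows "L2_norm M (\<lambda>x. f x + g x) \<le> L2_norm M f + L2_norm M g"
proof (rule power2_le_imp_le)
  have "Re (L2_inner M f g) \<le> L2_norm M f * L2_norm M g"
    using L2_Cauchy_Schwarz[OF f g] complex_Re_le_cmod[of "L2_inner M f g"] by linarith
  then show "(L2_norm M (\<lambda>x. f x + g x))\<^sup>2 \<le> (L2_norm M f + L2_norm M g)\<^sup>2"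
    unfolding L2_norm_add_power2[OF f g] by (simp add: power2_sum)
qed simp

lemma L2_norm_triangle_diff:
  assumes f: "f \<in> L2_space M" and g: "g \<in> L2_space M"
  shows "L2_norm M f \<le> L2_norm M (\<lambda>x. f x - g x) + L2_norm M g"
  using L2_norm_triangle[OF L2_diff[OF f g] g] by simp

lemma L2_norm_zero_iff:
  assumes f: "f \<in> L2_space M"
  shows "L2_norm M f = 0 \<longleftrightarrow> (AE x in M. f x = 0)"
  using integral_nonneg_eq_0_iff_AE[OF L2_square_integrable[OF f]] by (simp add: L2_norm_def)

text \<open>
  Completeness in the form that Neumann series call for. By Cauchy--Schwarz
  with weights \<open>q\<^sup>k\<close>, \<open>(\<Sum>k. \<bar>f\<^sub>k\<bar>)\<^sup>2\<close> is at most a constant times \<open>\<Sum>k. \<bar>f\<^sub>k\<bar>\<^sup>2 / q\<^sup>k\<close>, which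
  is integrable; this gives convergence almost everywhere and a dominating function at once.
\<close>

lemma L2_geometric_series:
  assumes f: "\<And>k. f k \<in> L2_space M" and q: "0 < q" "q < 1"
    and bd: "\<And>k. L2_norm M (f k) \<le> c * q ^ k"
  shows "\<exists>F\<in>L2_space M. (\<lambda>n. L2_norm M (\<lambda>x. F x - (\<Sum>k<n. f k x))) \<longlonglongrightarrow> 0"
proof -
  note [measurable] = L2_measurable[OF f]
  have c: "0 \<le> c" using order_trans[OF L2_norm_nonneg bd[of 0]] by simp
  define w where "w k x = (cmod (f k x))\<^sup>2 / q ^ k" for k x
  define G where "G x = (\<Sum>k. w k x)" for x
  have w0: "0 \<le> w k x" for k x using q by (simp add: w_def)
  have w_int: "integrable M (w k)" for k
    unfolding w_def using L2_square_integrable[OF f] by simp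
  have w_le: "(LINT x|M. w k x) \<le> c\<^sup>2 * q ^ k" for k
  proof -
    have "(LINT x|M. w k x) = (L2_norm M (f k))\<^sup>2 / q ^ k"
      by (simp add: w_def L2_norm_power2)
    also have "\<dots> \<le> (c * q ^ k)\<^sup>2 / q ^ k"
      using q by (intro divide_right_mono power_mono bd) auto
    also have "\<dots> = c\<^sup>2 * q ^ k" using q by (simp add: power2_eq_square)
    finally show ?thesis .
  qed
  have sum_int: "summable (\<lambda>k. LINT x|M. w k x)"
  proof (rule summable_comparison_test'[where N=0])
    show "summable (\<lambda>k. c\<^sup>2 * q ^ k)" using q by (intro summable_mult summable_geometric) auto
    show "norm (LINT x|M. w k x) \<le> c\<^sup>2 * q ^ k" for k
      using w_le[of k] Bochner_Integration.integral_nonneg[of M "w k"] w0 by simp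
  qed
  have "(\<integral>\<^sup>+x. (\<Sum>k. ennreal (w k x)) \<partial>M) = (\<Sum>k. \<integral>\<^sup>+x. ennreal (w k x) \<partial>M)"
    by (rule nn_integral_suminf) (use w_int in auto)
  also have "\<dots> = (\<Sum>k. ennreal (LINT x|M. w k x))"
    by (intro suminf_cong nn_integral_eq_integral w_int AE_I2 w0)
  also have "\<dots> = ennreal (\<Sum>k. LINT x|M. w k x)"
    by (rule suminf_ennreal2[OF _ sum_int]) (auto intro!: Bochner_Integration.integral_nonneg w0)
  finally have fin: "(\<integral>\<^sup>+x. (\<Sum>k. ennreal (w k x)) \<partial>M) < \<infinity>" by simp
  have "AE x in M. (\<Sum>k. ennreal (w k x)) \<noteq> \<infinity>"
    by (rule nn_integral_PInf_AE) (use fin w_int in auto)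
  then have w_summable: "AE x in M. summable (\<lambda>k. w k x)"
    by eventually_elim (auto intro!: summable_suminf_not_top w0)
  have G_int: "integrable M G"
    unfolding G_def
    by (rule integrable_suminf[OF w_int]) (use w_summable w0 sum_int in auto)
  have key: "(\<Sum>k\<in>I. cmod (f k x))\<^sup>2 \<le> (1 / (1 - q)) * G x"
    if I: "finite I" and s: "summable (\<lambda>k. w k x)" for I x
  proof -
    have "(\<Sum>k\<in>I. cmod (f k x)) = (\<Sum>k\<in>I. sqrt (q ^ k) * sqrt (w k x))"
      using q by (simp add: w_def real_sqrt_divide)
    also have "\<dots>\<^sup>2 \<le> (\<Sum>k\<in>I. (sqrt (q ^ k))\<^sup>2) * (\<Sum>k\<in>I. (sqrt (w k x))\<^sup>2)"
      by (rule Cauchy_Schwarz_ineq_sum)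
    also have "\<dots> = (\<Sum>k\<in>I. q ^ k) * (\<Sum>k\<in>I. w k x)"
      using q w0 by simp
    also have "\<dots> \<le> (1 / (1 - q)) * G x"
    proof (rule mult_mono)
      show "(\<Sum>k\<in>I. q ^ k) \<le> 1 / (1 - q)"
        using sum_le_suminf[OF summable_geometric[of q] I] suminf_geometric[of q] q by simp
      show "(\<Sum>k\<in>I. w k x) \<le> G x"
        unfolding G_def by (rule sum_le_suminf[OF s I]) (use w0 in auto)
      show "0 \<le> (\<Sum>k\<in>I. w k x)" by (rule sum_nonneg) (rule w0)
    qed (use q in auto)
    finally show ?thesis .
  qed
  have f_summable: "summable (\<lambda>k. f k x)" if s: "summable (\<lambda>k. w k x)" for x
  proof (rule summable_norm_cancel, rule summableI_nonneg_bounded)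
    show "(\<Sum>k<n. norm (f k x)) \<le> sqrt ((1 / (1 - q)) * G x)" for n
      by (rule real_le_rsqrt) (use key[OF _ s, of "{..<n}"] in simp)
  qed simp
  define F where "F x = (\<Sum>k. f k x)" for x
  have F_meas[measurable]: "F \<in> borel_measurable M" unfolding F_def by measurable
  have tail: "cmod (F x - (\<Sum>k<n. f k x)) ^ 2 \<le> (1 / (1 - q)) * G x"
    if s: "summable (\<lambda>k. w k x)" for n x
  proof -
    have l1: "(\<lambda>m. (\<Sum>k<m. f k x) - (\<Sum>k<n. f k x)) \<longlonglongrightarrow> F x - (\<Sum>k<n. f k x)"
      unfolding F_def by (intro tendsto_diff tendsto_const summable_LIMSEQ f_summable[OF s])
    have l2: "cmod ((\<Sum>k<m. f k x) - (\<Sum>k<n. f k x)) ^ 2 \<le> (1 / (1 - q)) * G x" if "n \<le> m" for m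
    proof -
      have "(\<Sum>k<m. f k x) - (\<Sum>k<n. f k x) = (\<Sum>k\<in>{n..<m}. f k x)"
        using sum_diff[of "{..<m}" "{..<n}" "\<lambda>k. f k x"] that
        by (simp add: lessThan_minus_lessThan)
      then have "cmod ((\<Sum>k<m. f k x) - (\<Sum>k<n. f k x)) ^ 2 \<le> (\<Sum>k\<in>{n..<m}. cmod (f k x)) ^ 2"
        by (auto intro!: power_mono norm_sum)
      also have "\<dots> \<le> (1 / (1 - q)) * G x" by (rule key[OF _ s]) simp
      finally show ?thesis .
    qed
    show ?thesis
      by (rule Lim_bounded[OF tendsto_power[OF tendsto_norm[OF l1]], of n]) (use l2 in auto)
  qed
  have F_L2: "F \<in> L2_space M"
  proof (rule L2_spaceI)
    show "integrable M (\<lambda>x. (cmod (F x))\<^sup>2)"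
    proof (rule Bochner_Integration.integrable_bound)
      show "integrable M (\<lambda>x. (1 / (1 - q)) * G x)" using G_int by simp
      show "AE x in M. norm ((cmod (F x))\<^sup>2) \<le> norm ((1 / (1 - q)) * G x)"
        using w_summable
      proof eventually_elim
        case (elim x)
        have "(cmod (F x))\<^sup>2 \<le> (1 / (1 - q)) * G x" using tail[OF elim, of 0] by simp
        then show ?case by (metis abs_ge_self abs_power2 order_trans real_norm_def)
      qed
    qed simp
  qed simp
  have "(\<lambda>n. LINT x|M. (cmod (F x - (\<Sum>k<n. f k x)))\<^sup>2) \<longlonglongrightarrow> (LINT x|M. 0)"
  proof (rule integral_dominated_convergence[where w="\<lambda>x. (1 / (1 - q)) * G x"])
    show "integrable M (\<lambda>x. (1 / (1 - q)) * G x)" using G_int by simp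
    show "AE x in M. (\<lambda>n. (cmod (F x - (\<Sum>k<n. f k x)))\<^sup>2) \<longlonglongrightarrow> 0"
      using w_summable
    proof eventually_elim
      case (elim x)
      have "(\<lambda>n. (cmod (F x - (\<Sum>k<n. f k x)))\<^sup>2) \<longlonglongrightarrow> (cmod (F x - F x))\<^sup>2"
        by (intro tendsto_intros) (simp add: F_def summable_LIMSEQ f_summable[OF elim])
      then show ?case by simp
    qed
    show "AE x in M. norm ((cmod (F x - (\<Sum>k<n. f k x)))\<^sup>2) \<le> (1 / (1 - q)) * G x" for n
      using w_summable by eventually_elim (use tail in auto)
  qed measurable
  then have "(\<lambda>n. sqrt (LINT x|M. (cmod (F x - (\<Sum>k<n. f k x)))\<^sup>2)) \<longlonglongrightarrow> sqrt 0"
    by (intro tendsto_real_sqrt) simp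
  then show ?thesis using F_L2 by (auto simp: L2_norm_def)
qed

section \<open>Spectra of symmetric operators\<close>

text \<open>
  An operator on functions that is a symmetric contraction of a closed subspace. Linearity holds
  exactly and not only almost everywhere, as it does for averaging operators; closedness is
  stated for sequences that are already known to converge in \<open>L\<^sup>2\<close>.
\<close>

locale L2_symmetric_operator =
  fixes M :: "'a measure" and H :: "('a \<Rightarrow> complex) set"
    and T :: "('a \<Rightarrow> complex) \<Rightarrow> 'a \<Rightarrow> complex"
  assumes H_L2: "H \<subseteq> L2_space M"
    and H_zero: "(\<lambda>x. 0) \<in> H"
    and H_add: "f \<in> H \<Longrightarrow> g \<in> H \<Longrightarrow> (\<lambda>x. f x + g x) \<in> H"
    and H_scale: "f \<in> H \<Longrightarrow> (\<lambda>x. c * f x) \<in> H"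
    and H_closed: "(\<And>n. F n \<in> H) \<Longrightarrow> f \<in> L2_space M
      \<Longrightarrow> (\<lambda>n. L2_norm M (\<lambda>x. f x - F n x)) \<longlonglongrightarrow> 0 \<Longrightarrow> f \<in> H"
    and T_H: "f \<in> H \<Longrightarrow> T f \<in> H"
    and T_add: "T (\<lambda>x. f x + g x) = (\<lambda>x. T f x + T g x)"
    and T_scale: "T (\<lambda>x. c * f x) = (\<lambda>x. c * T f x)"
    and T_contraction: "f \<in> H \<Longrightarrow> L2_norm M (T f) \<le> L2_norm M f"
    and T_symmetric: "f \<in> H \<Longrightarrow> g \<in> H \<Longrightarrow> L2_inner M (T f) g = L2_inner M f (T g)"
begin

lemma L2: "f \<in> H \<Longrightarrow> f \<in> L2_space M"
  using H_L2 by blast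

lemma H_diff: "f \<in> H \<Longrightarrow> g \<in> H \<Longrightarrow> (\<lambda>x. f x - g x) \<in> H"
  using H_add[of f "\<lambda>x. (-1) * g x"] H_scale[of g "-1"] by simp

lemma H_sum: "(\<And>i. i \<in> I \<Longrightarrow> f i \<in> H) \<Longrightarrow> (\<lambda>x. \<Sum>i\<in>I. f i x) \<in> H"
  by (induction I rule: infinite_finite_induct) (auto simp: H_zero intro: H_add)

lemma T_zero: "T (\<lambda>x. 0) = (\<lambda>x. 0)"
  using T_scale[of 0 "\<lambda>x. 0"] by simp

lemma T_diff: "T (\<lambda>x. f x - g x) = (\<lambda>x. T f x - T g x)"
  using T_add[of f "\<lambda>x. (-1) * g x"] T_scale[of "-1" g] by simp

lemma shift_in_H: "f \<in> H \<Longrightarrow> (\<lambda>x. T f x - z * f x) \<in> H"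
  by (intro H_diff T_H H_scale)

lemma shift_norm_le:
  assumes f: "f \<in> H"
  shows "L2_norm M (\<lambda>x. T f x - z * f x) \<le> (1 + cmod z) * L2_norm M f"
proof -
  have "L2_norm M (\<lambda>x. T f x - z * f x) \<le> L2_norm M (T f) + L2_norm M (\<lambda>x. - z * f x)"
    using L2_norm_triangle[OF L2[OF T_H[OF f]] L2_scale[OF L2[OF f], of "-z"]] by simp
  then show ?thesis
    using T_contraction[OF f] by (simp only: L2_norm_scale norm_minus_cancel) (simp add: ring_distribs)
qed

text \<open>
  If \<open>1 - \<kappa> (T - z)\<close> is a strict contraction, then \<open>(T - z) f = g\<close> is solved by the geometric
  series \<open>\<Sum>k. (1 - \<kappa> (T - z))\<^sup>k \<kappa> g\<close>, and uniquely so. The inverse is defined by choice of a solution,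
  so that it only sees the almost everywhere class of its argument. This allows an operator \<open>T\<^sub>0\<close>
  that agrees with \<open>T\<close> only almost everywhere and whose values need not even be measurable.
\<close>

lemma not_in_spectrum:
  assumes T0: "\<And>f. f \<in> H \<Longrightarrow> AE x in M. T0 f x = T f x"
    and q: "0 < q" "q < 1" and k: "\<kappa> \<noteq> 0"
    and contr: "\<And>f. f \<in> H \<Longrightarrow> L2_norm M (\<lambda>x. f x - \<kappa> * (T f x - z * f x)) \<le> q * L2_norm M f"
  shows "z \<notin> L2_spectrum M H T0"
proof -
  define A where "A f = (\<lambda>x. T f x - z * f x)" for f
  define K where "K f = (\<lambda>x. f x - \<kappa> * A f x)" for f
  have A_H: "A f \<in> H" if "f \<in> H" for f unfolding A_def by (rule shift_in_H[OF that])
  have K_H: "K f \<in> H" if "f \<in> H" for f unfolding K_def by (intro H_diff H_scale A_H that)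
  have K_le: "L2_norm M (K f) \<le> q * L2_norm M f" if "f \<in> H" for f
    using contr[OF that] by (simp add: K_def A_def)
  have A_diff: "A (\<lambda>x. f x - g x) = (\<lambda>x. A f x - A g x)" for f g
    by (simp add: A_def T_diff algebra_simps)
  have below: "L2_norm M f \<le> (cmod \<kappa> / (1 - q)) * L2_norm M (A f)" if f: "f \<in> H" for f
  proof -
    have "L2_norm M f \<le> L2_norm M (K f) + L2_norm M (\<lambda>x. \<kappa> * A f x)"
      using L2_norm_triangle[OF L2[OF K_H[OF f]] L2_scale[OF L2[OF A_H[OF f]], of \<kappa>]]
      by (simp add: K_def)
    then have "(1 - q) * L2_norm M f \<le> cmod \<kappa> * L2_norm M (A f)"
      using K_le[OF f] by (simp add: L2_norm_scale ring_distribs)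
    then show ?thesis using q by (simp add: field_simps)
  qed
  have inj: "AE x in M. f x = g x"
    if f: "f \<in> H" and g: "g \<in> H" and ae: "AE x in M. A f x = A g x" for f g
  proof -
    have "L2_norm M (A (\<lambda>x. f x - g x)) = 0"
      unfolding A_diff using ae by (subst L2_norm_zero_iff) (auto intro: L2 H_diff A_H f g)
    then have "L2_norm M (\<lambda>x. f x - g x) = 0"
      using below[OF H_diff[OF f g]] L2_norm_nonneg[of M "\<lambda>x. f x - g x"] by simp
    then show ?thesis
      using L2_norm_zero_iff[OF L2[OF H_diff[OF f g]]] by simp
  qed
  have surj: "\<exists>f\<in>H. AE x in M. A f x = g x" if g: "g \<in> H" for g
  proof -
    define f where "f n = (K ^^ n) (\<lambda>x. \<kappa> * g x)" for n
    have f_H: "f n \<in> H" for n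
      by (induction n) (auto simp: f_def intro: K_H H_scale g)
    have f_Suc: "f (Suc n) = K (f n)" for n by (simp add: f_def)
    have f_le: "L2_norm M (f n) \<le> L2_norm M (f 0) * q ^ n" for n
    proof (induction n)
      case (Suc n)
      have "L2_norm M (f (Suc n)) \<le> q * L2_norm M (f n)" unfolding f_Suc by (rule K_le[OF f_H])
      also have "\<dots> \<le> q * (L2_norm M (f 0) * q ^ n)" using Suc q by (intro mult_left_mono) auto
      finally show ?case by (simp add: mult_ac)
    qed simp
    define s where "s n = (\<lambda>x. \<Sum>k<n. f k x)" for n
    have s_H: "s n \<in> H" for n unfolding s_def by (rule H_sum[OF f_H])
    have "\<exists>F\<in>L2_space M. (\<lambda>n. L2_norm M (\<lambda>x. F x - (\<Sum>k<n. f k x))) \<longlonglongrightarrow> 0"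
      by (rule L2_geometric_series[OF L2[OF f_H] q f_le])
    then obtain F where F: "F \<in> L2_space M"
      and lim: "(\<lambda>n. L2_norm M (\<lambda>x. F x - s n x)) \<longlonglongrightarrow> 0"
      unfolding s_def by blast
    have F_H: "F \<in> H" by (rule H_closed[OF s_H F lim])
    have As: "\<kappa> * A (s n) x = \<kappa> * g x - f n x" for n x
    proof (induction n)
      case 0 then show ?case by (simp add: s_def A_def T_zero f_def)
    next
      case (Suc n)
      have "s (Suc n) = (\<lambda>x. s n x + f n x)" by (simp add: s_def)
      then have "A (s (Suc n)) = (\<lambda>x. A (s n) x + A (f n) x)"
        by (simp add: A_def T_add algebra_simps)
      then show ?case using Suc by (simp add: f_Suc K_def ring_distribs)
    qed
    have bound: "cmod \<kappa> * L2_norm M (\<lambda>x. A F x - g x)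
        \<le> cmod \<kappa> * ((1 + cmod z) * L2_norm M (\<lambda>x. F x - s n x)) + L2_norm M (f 0) * q ^ n" for n
    proof -
      have "(\<lambda>x. \<kappa> * (A F x - g x)) = (\<lambda>x. \<kappa> * A (\<lambda>x. F x - s n x) x + (-1) * f n x)"
        using As[of n] by (auto simp: A_diff algebra_simps fun_eq_iff)
      then have "cmod \<kappa> * L2_norm M (\<lambda>x. A F x - g x)
          = L2_norm M (\<lambda>x. \<kappa> * A (\<lambda>x. F x - s n x) x + (-1) * f n x)"
        by (simp only: L2_norm_scale[symmetric])
      also have "\<dots> \<le> L2_norm M (\<lambda>x. \<kappa> * A (\<lambda>x. F x - s n x) x) + L2_norm M (\<lambda>x. (-1) * f n x)"
        by (intro L2_norm_triangle L2 H_scale A_H H_diff F_H s_H f_H)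
      also have "\<dots> = cmod \<kappa> * L2_norm M (A (\<lambda>x. F x - s n x)) + L2_norm M (f n)"
        unfolding L2_norm_scale by simp
      also have "\<dots> \<le> cmod \<kappa> * ((1 + cmod z) * L2_norm M (\<lambda>x. F x - s n x)) + L2_norm M (f 0) * q ^ n"
        unfolding A_def by (intro add_mono mult_left_mono shift_norm_le H_diff F_H s_H f_le) simp
      finally show ?thesis .
    qed
    have "(\<lambda>n. cmod \<kappa> * ((1 + cmod z) * L2_norm M (\<lambda>x. F x - s n x)) + L2_norm M (f 0) * q ^ n)
        \<longlonglongrightarrow> cmod \<kappa> * ((1 + cmod z) * 0) + L2_norm M (f 0) * 0"
      using q by (intro tendsto_intros lim LIMSEQ_realpow_zero) auto
    then have "cmod \<kappa> * L2_norm M (\<lambda>x. A F x - g x) \<le> 0"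
      using bound by (intro tendsto_lowerbound[where F=sequentially]) auto
    then have "L2_norm M (\<lambda>x. A F x - g x) = 0"
      using k L2_norm_nonneg[of M "\<lambda>x. A F x - g x"]
      by (metis mult_le_0_iff norm_le_zero_iff order_antisym)
    then have "AE x in M. A F x = g x"
      by (subst (asm) L2_norm_zero_iff) (auto intro: L2 H_diff A_H F_H g)
    then show ?thesis using F_H by blast
  qed
  define S where "S g = (SOME f. f \<in> H \<and> (AE x in M. A f x = g x))" for g
  have S: "S g \<in> H \<and> (AE x in M. A (S g) x = g x)" if "\<exists>f\<in>H. AE x in M. A f x = g x" for g
    using someI_ex[OF that[unfolded Bex_def]] by (simp only: S_def)
  have "\<forall>f\<in>H. S f \<in> H \<and> L2_norm M (S f) \<le> (cmod \<kappa> / (1 - q)) * L2_norm M f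
      \<and> (AE x in M. T0 (S f) x - z * S f x = f x)
      \<and> (AE x in M. S (\<lambda>y. T0 f y - z * f y) x = f x)"
  proof
    fix f assume f: "f \<in> H"
    note Sf = S[OF surj[OF f]]
    have "AE x in M. A f x = T0 f x - z * f x"
      using T0[OF f] by eventually_elim (simp add: A_def)
    then have "\<exists>h\<in>H. AE x in M. A h x = T0 f x - z * f x" using f by blast
    note Sg = S[OF this]
    have "AE x in M. A (S (\<lambda>y. T0 f y - z * f y)) x = A f x"
      using Sg[THEN conjunct2] T0[OF f] by eventually_elim (simp add: A_def)
    then have "AE x in M. S (\<lambda>y. T0 f y - z * f y) x = f x"
      by (rule inj[OF Sg[THEN conjunct1] f])
    moreover have "L2_norm M (S f) \<le> (cmod \<kappa> / (1 - q)) * L2_norm M f"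
    proof -
      have "L2_norm M (A (S f)) = L2_norm M f"
        using Sf f by (intro L2_norm_cong L2 A_H L2_measurable) auto
      then show ?thesis using below[of "S f"] Sf by simp
    qed
    moreover have "AE x in M. T0 (S f) x - z * S f x = f x"
      using T0[OF Sf[THEN conjunct1]] Sf[THEN conjunct2] by eventually_elim (simp add: A_def)
    ultimately show "S f \<in> H \<and> L2_norm M (S f) \<le> (cmod \<kappa> / (1 - q)) * L2_norm M f
      \<and> (AE x in M. T0 (S f) x - z * S f x = f x)
      \<and> (AE x in M. S (\<lambda>y. T0 f y - z * f y) x = f x)" using Sf by simp
  qed
  then show ?thesis unfolding L2_spectrum_def mem_Collect_eq not_not by (intro exI)
qed

text \<open>
  \<open>T - a\<close> is symmetric for real \<open>a\<close>, so its quadratic form is real.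
\<close>

lemma inner_shift_real:
  assumes f: "f \<in> H"
  shows "Im (L2_inner M f (\<lambda>x. T f x - of_real a * f x)) = 0"
proof -
  have "L2_inner M f (T f) = cnj (L2_inner M f (T f))"
    using T_symmetric[OF f f] L2_inner_commute[of M "T f" f] by simp
  then have "Im (L2_inner M f (T f)) = 0" by (simp add: complex_eq_iff)
  moreover have "L2_inner M f (\<lambda>x. T f x - of_real a * f x)
      = L2_inner M f (T f) - of_real (a * (L2_norm M f)\<^sup>2)"
    by (simp add: L2_inner_diff_right L2 T_H H_scale f L2_inner_scale_right L2_inner_self)
  ultimately show ?thesis by (simp del: of_real_power of_real_mult)
qed

text \<open>
  For \<open>z = a + \<i>b\<close> with \<open>b \<noteq> 0\<close> and real \<open>s\<close>, \<open>1 - \<i>s (T - z) = (1 - s b) - \<i>s (T - a)\<close>, and the two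
  terms are orthogonal at every \<open>f\<close> because \<open>T - a\<close> is symmetric.
\<close>

theorem spectrum_in_interval:
  assumes T0: "\<And>f. f \<in> H \<Longrightarrow> AE x in M. T0 f x = T f x"
    and rho: "0 \<le> \<rho>" and bd: "\<And>f. f \<in> H \<Longrightarrow> L2_norm M (T f) \<le> \<rho> * L2_norm M f"
  shows "L2_spectrum M H T0 \<subseteq> complex_of_real ` {- \<rho>..\<rho>}"
proof
  fix z assume z: "z \<in> L2_spectrum M H T0"
  show "z \<in> complex_of_real ` {- \<rho>..\<rho>}"
  proof (cases "Im z = 0")
    case False
    \<comment> \<open>\<open>L\<close> bounds \<open>\<parallel>T - a\<parallel>\<^sup>2\<close>, and \<open>s\<close> minimises \<open>(1 - s b)\<^sup>2 + s\<^sup>2 L\<close>; the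
        minimum is \<open>L / (b\<^sup>2 + L)\<close>.\<close>
    define a b L s where "a = Re z" "b = Im z" "L = (1 + \<bar>a\<bar>)\<^sup>2" "s = b / (b\<^sup>2 + L)"
    note ab = this
    have zab: "z = of_real a + \<i> * of_real b" by (simp add: ab complex_eq_iff)
    have L: "0 < L" unfolding ab(3) using abs_ge_zero[of a] by (intro zero_less_power) linarith
    have bL: "0 < b\<^sup>2 + L" "0 < b\<^sup>2" using L False by (auto simp: ab(2) intro: add_nonneg_pos)
    define q where "q = sqrt (L / (b\<^sup>2 + L))"
    have "L / (b\<^sup>2 + L) < 1" using bL by simp
    moreover have "0 < L / (b\<^sup>2 + L)" using L bL by (intro divide_pos_pos)
    ultimately have q: "0 < q" "q < 1" unfolding q_def
      using real_sqrt_lt_1_iff real_sqrt_gt_0_iff by blast+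
    have qs: "(1 - s * b)\<^sup>2 + s\<^sup>2 * L = q\<^sup>2"
    proof -
      have "(1 - s * b)\<^sup>2 + s\<^sup>2 * L = 1 - 2 * s * b + s\<^sup>2 * (b\<^sup>2 + L)"
        by (simp add: power2_eq_square algebra_simps)
      also have "s\<^sup>2 * (b\<^sup>2 + L) = s * b" using bL by (simp add: ab(4) power2_eq_square)
      also have "1 - 2 * s * b + s * b = 1 - b\<^sup>2 / (b\<^sup>2 + L)" by (simp add: ab(4) power2_eq_square)
      also have "\<dots> = L / (b\<^sup>2 + L)" using bL by (simp add: field_simps)
      finally show ?thesis using L bL by (simp add: q_def)
    qed
    have "z \<notin> L2_spectrum M H T0"
    proof (rule not_in_spectrum[OF T0 q, of "\<i> * of_real s"])
      show "\<i> * of_real s \<noteq> 0"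
      proof -
        have "s \<noteq> 0" using bL unfolding ab(4) by auto
        then show ?thesis by simp
      qed
      fix f assume f: "f \<in> H"
      define g where "g = (\<lambda>x. T f x - of_real a * f x)"
      have g: "g \<in> H" unfolding g_def by (rule shift_in_H[OF f])
      have "L2_norm M (\<lambda>x. f x - \<i> * of_real s * (T f x - z * f x))
          = L2_norm M (\<lambda>x. of_real (1 - s * b) * f x + (- \<i> * of_real s) * g x)"
        by (rule arg_cong[where f="L2_norm M"]) (auto simp: zab g_def algebra_simps)
      also have "\<dots>\<^sup>2 = (1 - s * b)\<^sup>2 * (L2_norm M f)\<^sup>2
          + 2 * Re (of_real (1 - s * b) * (cnj (- \<i> * of_real s) * L2_inner M f g)) + s\<^sup>2 * (L2_norm M g)\<^sup>2"
        by (subst L2_norm_add_power2)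
          (auto intro!: L2 H_scale f g simp only: L2_norm_scale L2_inner_scale_left L2_inner_scale_right
            norm_of_real power_mult_distrib power2_abs norm_mult norm_minus_cancel norm_ii mult_1_left)
      also have "\<dots> = (1 - s * b)\<^sup>2 * (L2_norm M f)\<^sup>2 + s\<^sup>2 * (L2_norm M g)\<^sup>2"
        using inner_shift_real[OF f, of a] by (simp add: g_def)
      also have "\<dots> \<le> (1 - s * b)\<^sup>2 * (L2_norm M f)\<^sup>2 + s\<^sup>2 * (L * (L2_norm M f)\<^sup>2)"
      proof -
        have "(L2_norm M g)\<^sup>2 \<le> ((1 + \<bar>a\<bar>) * L2_norm M f)\<^sup>2"
          using shift_norm_le[OF f, of "of_real a"] by (intro power_mono) (auto simp: g_def)
        then show ?thesis by (intro add_left_mono mult_left_mono) (auto simp: ab(3) power_mult_distrib)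
      qed
      also have "\<dots> = ((1 - s * b)\<^sup>2 + s\<^sup>2 * L) * (L2_norm M f)\<^sup>2" by (simp only: ring_distribs mult.assoc)
      also have "\<dots> = (q * L2_norm M f)\<^sup>2" unfolding qs by (simp add: power_mult_distrib)
      finally show "L2_norm M (\<lambda>x. f x - \<i> * of_real s * (T f x - z * f x)) \<le> q * L2_norm M f"
        by (rule power2_le_imp_le) (use q in simp)
    qed
    then show ?thesis using z by simp
  next
    case True
    then have zr: "z = of_real (Re z)" by (simp add: complex_eq_iff)
    show ?thesis
    proof (rule ccontr)
      assume "z \<notin> complex_of_real ` {- \<rho>..\<rho>}"
      then have "Re z \<notin> {- \<rho>..\<rho>}" using zr by force
      then have "\<bar>Re z\<bar> > \<rho>" by auto
      then have big: "cmod z > \<rho>" using zr by (metis norm_of_real)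
      then have z0: "z \<noteq> 0" "cmod z > 0" using rho by auto
      \<comment> \<open>With \<open>\<kappa> = - 1 / z\<close> the contraction is \<open>T / z\<close>; the bound \<open>1/2\<close> keeps \<open>q\<close> positive
          when \<open>\<rho> = 0\<close>.\<close>
      define q where "q = max (\<rho> / cmod z) (1/2)"
      have "z \<notin> L2_spectrum M H T0"
      proof (rule not_in_spectrum[OF T0, of q "- 1 / z"])
        show "0 < q" "q < 1" using big z0 by (auto simp: q_def)
        show "- 1 / z \<noteq> 0" using z0 by simp
        fix f assume f: "f \<in> H"
        have "L2_norm M (\<lambda>x. f x - - 1 / z * (T f x - z * f x)) = L2_norm M (\<lambda>x. 1 / z * T f x)"
          using z0 by (intro arg_cong[where f="L2_norm M"] ext) (simp add: field_simps)
        also have "\<dots> = L2_norm M (T f) / cmod z" unfolding L2_norm_scale by (simp add: norm_divide)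
        also have "\<dots> \<le> (\<rho> * L2_norm M f) / cmod z" using z0 bd[OF f] by (intro divide_right_mono) auto
        also have "\<dots> = \<rho> / cmod z * L2_norm M f" by simp
        also have "\<dots> \<le> q * L2_norm M f" by (intro mult_right_mono) (auto simp: q_def)
        finally show "L2_norm M (\<lambda>x. f x - - 1 / z * (T f x - z * f x)) \<le> q * L2_norm M f" .
      qed
      then show False using z by simp
    qed
  qed
qed

text \<open>A bounded left inverse bounds \<open>T - z\<close> from below.\<close>

lemma spectrum_bounded_below:
  assumes "z \<notin> L2_spectrum M H T"
  obtains C where "0 < C" "\<And>f. f \<in> H \<Longrightarrow> L2_norm M f \<le> C * L2_norm M (\<lambda>x. T f x - z * f x)"
proof -
  obtain S C where S_all: "\<forall>f\<in>H. S f \<in> H \<and> L2_norm M (S f) \<le> C * L2_norm M f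
      \<and> (AE x in M. T (S f) x - z * S f x = f x)
      \<and> (AE x in M. S (\<lambda>y. T f y - z * f y) x = f x)"
    using assms unfolding L2_spectrum_def mem_Collect_eq not_not by (elim exE)
  have S: "S f \<in> H" "L2_norm M (S f) \<le> C * L2_norm M f"
    "AE x in M. S (\<lambda>y. T f y - z * f y) x = f x" if "f \<in> H" for f
    using bspec[OF S_all that] by simp_all
  have "L2_norm M f \<le> max C 1 * L2_norm M (\<lambda>x. T f x - z * f x)" if f: "f \<in> H" for f
  proof -
    have "L2_norm M f = L2_norm M (S (\<lambda>y. T f y - z * f y))"
      using S(3)[OF f] by (intro L2_norm_cong L2 f L2_measurable S(1) shift_in_H) auto
    also have "\<dots> \<le> C * L2_norm M (\<lambda>x. T f x - z * f x)" by (rule S(2)[OF shift_in_H[OF f]])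
    also have "\<dots> \<le> max C 1 * L2_norm M (\<lambda>x. T f x - z * f x)" by (intro mult_right_mono) auto
    finally show ?thesis .
  qed
  then show ?thesis using that[of "max C 1"] by auto
qed

text \<open>
  The norm \<open>N\<close> of \<open>T\<close> or its negative is in the spectrum, because
  \<open>\<parallel>T\<^sup>2f - N\<^sup>2f\<parallel>\<^sup>2 \<le> N\<^sup>2 (N\<^sup>2\<parallel>f\<parallel>\<^sup>2 - \<parallel>T f\<parallel>\<^sup>2)\<close> shows that \<open>(T - N)(T + N)\<close> is not bounded below.
\<close>

theorem Sup_spectrum_le_iff:
  assumes nontrivial: "f0 \<in> H" "L2_norm M f0 \<noteq> 0"
  shows "0 \<le> (SUP z\<in>L2_spectrum M H T. cmod z)"
    and "0 \<le> r \<Longrightarrow> (SUP z\<in>L2_spectrum M H T. cmod z) \<le> r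
      \<longleftrightarrow> (\<forall>f\<in>H. L2_norm M (T f) \<le> r * L2_norm M f)"
proof -
  define B where "B = {r. 0 \<le> r \<and> (\<forall>f\<in>H. L2_norm M (T f) \<le> r * L2_norm M f)}"
  have B1: "1 \<in> B" unfolding B_def using T_contraction by simp
  have Bb: "bdd_below B" by (auto simp: B_def intro: bdd_belowI)
  define N where "N = Inf B"
  have B_ne: "B \<noteq> {}" using B1 by blast
  have N0: "0 \<le> N" unfolding N_def by (rule cInf_greatest[OF B_ne]) (simp add: B_def)
  have NB: "L2_norm M (T f) \<le> N * L2_norm M f" if f: "f \<in> H" for f
  proof (cases "L2_norm M f = 0")
    case True then show ?thesis using T_contraction[OF f] by simp
  next
    case False
    then have pos: "0 < L2_norm M f" using L2_norm_nonneg[of M f] by linarith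
    have "L2_norm M (T f) / L2_norm M f \<le> N"
      unfolding N_def by (rule cInf_greatest[OF B_ne]) (use f pos in \<open>simp add: B_def pos_divide_le_eq\<close>)
    then show ?thesis using pos by (simp add: field_simps)
  qed
  have N_le: "N \<le> r" if "0 \<le> r" "\<forall>f\<in>H. L2_norm M (T f) \<le> r * L2_norm M f" for r
    unfolding N_def by (rule cInf_lower[OF _ Bb]) (use that in \<open>auto simp: B_def\<close>)
  have "of_real N \<in> L2_spectrum M H T \<or> - of_real N \<in> L2_spectrum M H T"
  proof (rule ccontr)
    assume neg: "\<not> ?thesis"
    then obtain C1 where C1: "0 < C1"
        "\<And>f. f \<in> H \<Longrightarrow> L2_norm M f \<le> C1 * L2_norm M (\<lambda>x. T f x - of_real N * f x)"
      using spectrum_bounded_below[of "of_real N"] by blast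
    obtain C2 where C2: "0 < C2"
        "\<And>f. f \<in> H \<Longrightarrow> L2_norm M f \<le> C2 * L2_norm M (\<lambda>x. T f x - (- of_real N) * f x)"
      using spectrum_bounded_below[of "- of_real N"] neg by blast
    define C where "C = C1 * C2"
    have C0: "0 < C" using C1 C2 by (simp add: C_def)
    have main: "(L2_norm M f)\<^sup>2 \<le> C\<^sup>2 * (N\<^sup>2 * (N\<^sup>2 * (L2_norm M f)\<^sup>2 - (L2_norm M (T f))\<^sup>2))"
      if f: "f \<in> H" for f
    proof -
      let ?g = "\<lambda>x. T f x - of_real N * f x"
      let ?h = "\<lambda>x. T (T f) x + (- of_real (N\<^sup>2)) * f x"
      have "T ?g = (\<lambda>x. T (T f) x - of_real N * T f x)"
        by (simp add: T_diff T_scale)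
      then have hg: "(\<lambda>x. T ?g x - (- of_real N) * ?g x) = ?h"
        by (simp add: algebra_simps power2_eq_square)
      have "L2_norm M f \<le> C1 * (C2 * L2_norm M ?h)"
        using order_trans[OF C1(2)[OF f] mult_left_mono[OF C2(2)[OF shift_in_H[OF f]]]] C1(1)
        unfolding hg by simp
      then have "(L2_norm M f)\<^sup>2 \<le> (C * L2_norm M ?h)\<^sup>2"
        by (intro power_mono) (auto simp: C_def mult.assoc)
      also have "\<dots> = C\<^sup>2 * (L2_norm M ?h)\<^sup>2" by (simp add: power_mult_distrib)
      also have "(L2_norm M ?h)\<^sup>2 = (L2_norm M (T (T f)))\<^sup>2
          + 2 * Re (cnj (- of_real (N\<^sup>2)) * L2_inner M (T (T f)) f)
          + (N\<^sup>2 * L2_norm M f)\<^sup>2"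
        by (subst L2_norm_add_power2)
          (auto intro!: L2 T_H H_scale f simp only: L2_norm_scale L2_inner_scale_right
             norm_minus_cancel norm_of_real abs_power2)
      also have "L2_inner M (T (T f)) f = of_real ((L2_norm M (T f))\<^sup>2)"
        using T_symmetric[OF T_H[OF f] f] by (simp only: L2_inner_self)
      also have "2 * Re (cnj (- of_real (N\<^sup>2)) * of_real ((L2_norm M (T f))\<^sup>2))
          = - 2 * N\<^sup>2 * (L2_norm M (T f))\<^sup>2"
        by (simp del: of_real_power)
      also have "(L2_norm M (T (T f)))\<^sup>2 + - 2 * N\<^sup>2 * (L2_norm M (T f))\<^sup>2 + (N\<^sup>2 * L2_norm M f)\<^sup>2
          \<le> N\<^sup>2 * (N\<^sup>2 * (L2_norm M f)\<^sup>2 - (L2_norm M (T f))\<^sup>2)"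
      proof -
        have "(L2_norm M (T (T f)))\<^sup>2 \<le> (N * L2_norm M (T f))\<^sup>2"
          by (intro power_mono NB T_H f) simp
        then show ?thesis by (simp add: power_mult_distrib algebra_simps power2_eq_square)
      qed
      finally show ?thesis using C0 by (simp add: mult_left_mono)
    qed
    have f0: "0 < (L2_norm M f0)\<^sup>2" using nontrivial by simp
    have N_pos: "0 < N"
    proof (rule ccontr)
      assume "\<not> 0 < N" then have "N = 0" using N0 by simp
      then show False using main[OF nontrivial(1)] f0 by simp
    qed
    \<comment> \<open>Rearranged, \<open>main\<close> says that \<open>\<parallel>T\<parallel>\<^sup>2\<close> is at most \<open>t < N\<^sup>2\<close>, although \<open>N\<close> is the least bound.\<close>
    define t where "t = N\<^sup>2 - 1 / (C\<^sup>2 * N\<^sup>2)"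
    have t_bd: "(L2_norm M (T f))\<^sup>2 \<le> t * (L2_norm M f)\<^sup>2" if f: "f \<in> H" for f
    proof -
      have "(L2_norm M f)\<^sup>2 \<le> (C\<^sup>2 * N\<^sup>2) * (N\<^sup>2 * (L2_norm M f)\<^sup>2 - (L2_norm M (T f))\<^sup>2)"
        using main[OF f] by (simp add: mult.assoc)
      then have "(L2_norm M f)\<^sup>2 / (C\<^sup>2 * N\<^sup>2) \<le> N\<^sup>2 * (L2_norm M f)\<^sup>2 - (L2_norm M (T f))\<^sup>2"
        using C0 N_pos by (subst pos_divide_le_eq) (auto simp: mult.commute)
      then show ?thesis by (simp add: t_def left_diff_distrib)
    qed
    have t0: "0 \<le> t"
      using order_trans[OF zero_le_power2 t_bd[OF nontrivial(1)]] f0 by (simp add: zero_le_mult_iff)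
    have "N \<le> sqrt t"
    proof (rule N_le)
      show "\<forall>f\<in>H. L2_norm M (T f) \<le> sqrt t * L2_norm M f"
      proof
        fix f assume f: "f \<in> H"
        show "L2_norm M (T f) \<le> sqrt t * L2_norm M f"
          by (rule power2_le_imp_le) (use t_bd[OF f] t0 in \<open>simp_all add: power_mult_distrib\<close>)
      qed
    qed (use t0 in simp)
    then have "N\<^sup>2 \<le> (sqrt t)\<^sup>2" using N0 by (rule power_mono)
    then have "N\<^sup>2 \<le> t" using t0 by simp
    moreover have "0 < 1 / (C\<^sup>2 * N\<^sup>2)" using C0 N_pos by simp
    ultimately show False unfolding t_def by linarith
  qed
  moreover have "cmod (of_real N) = N" "cmod (- of_real N) = N" using N0 by simp_all
  ultimately obtain z where z: "z \<in> L2_spectrum M H T" "cmod z = N" by blast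
  have le: "cmod z \<le> N" if "z \<in> L2_spectrum M H T" for z
    using subsetD[OF spectrum_in_interval[OF _ N0 NB] that] by auto
  have SUP_eq: "(SUP z\<in>L2_spectrum M H T. cmod z) = N"
    by (rule cSup_eq_maximum) (use z le in auto)
  show "0 \<le> (SUP z\<in>L2_spectrum M H T. cmod z)" using N0 by (simp only: SUP_eq)
  show "(SUP z\<in>L2_spectrum M H T. cmod z) \<le> r \<longleftrightarrow> (\<forall>f\<in>H. L2_norm M (T f) \<le> r * L2_norm M f)"
    if r: "0 \<le> r"
    unfolding SUP_eq
  proof
    assume Nr: "N \<le> r"
    show "\<forall>f\<in>H. L2_norm M (T f) \<le> r * L2_norm M f"
      by (intro ballI order_trans[OF NB mult_right_mono[OF Nr L2_norm_nonneg]])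
  qed (rule N_le[OF r])
qed

end

text \<open>
  The ratios of consecutive terms of a log-convex sequence increase, so the sequence grows at
  least geometrically with its first ratio.
\<close>

lemma log_convex_growth:
  fixes b :: "nat \<Rightarrow> real"
  assumes nonneg: "\<And>k. 0 \<le> b k" and convex: "\<And>k. (b (Suc k))\<^sup>2 \<le> b k * b (Suc (Suc k))"
    and bound: "\<And>k. b k \<le> C * \<rho> ^ k" and rho: "0 \<le> \<rho>"
  shows "b 1 \<le> \<rho> * b 0"
proof (cases "b 0 = 0")
  case True
  then show ?thesis using convex[of 0] by simp
next
  case False
  then have b0: "0 < b 0" using nonneg[of 0] by simp
  \<comment> \<open>Monotonicity of the ratios, multiplied out because \<open>b\<close> may vanish.\<close>
  have step: "b k * b 1 \<le> b (Suc k) * b 0" for k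
  proof (induction k)
    case (Suc k)
    show ?case
    proof (cases "b (Suc k) = 0")
      case True then show ?thesis using nonneg b0 by simp
    next
      case False
      then have p1: "0 < b (Suc k)" using nonneg[of "Suc k"] by simp
      then have "0 < b k * b (Suc (Suc k))" using convex[of k] by (meson less_le_trans zero_less_power)
      then have pk: "0 < b k" using nonneg[of k] by (simp add: zero_less_mult_iff)
      have "b k * (b (Suc k) * b 1) \<le> b (Suc k) * (b (Suc k) * b 0)"
        using mult_left_mono[OF Suc, of "b (Suc k)"] p1 by (simp add: mult_ac)
      also have "\<dots> \<le> (b k * b (Suc (Suc k))) * b 0"
        using mult_right_mono[OF convex[of k], of "b 0"] b0 by (simp add: power2_eq_square mult_ac)
      finally have "b k * (b (Suc k) * b 1) \<le> b k * (b (Suc (Suc k)) * b 0)" by (simp add: mult_ac)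
      then show ?thesis using pk by simp
    qed
  qed simp
  define x where "x = b 1 / b 0"
  have x0: "0 \<le> x" using nonneg b0 by (simp add: x_def)
  have grow: "b 0 * x ^ k \<le> b k" for k
  proof (induction k)
    case (Suc k)
    have "b 0 * x ^ Suc k \<le> b k * x" using mult_right_mono[OF Suc x0] by (simp add: mult_ac)
    also have "\<dots> \<le> b (Suc k)" using step[of k] b0 by (simp add: x_def field_simps)
    finally show ?case .
  qed simp
  have "x \<le> \<rho>"
  proof (rule ccontr)
    assume "\<not> x \<le> \<rho>"
    then have gt: "\<rho> < x" by simp
    have "\<rho> \<noteq> 0"
    proof
      assume "\<rho> = 0"
      then have "b 1 \<le> 0" using bound[of 1] by simp
      then show False using gt \<open>\<rho> = 0\<close> b0 by (simp add: x_def zero_less_divide_iff)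
    qed
    then have rp: "0 < \<rho>" using rho by simp
    obtain n where n: "C / b 0 < (x / \<rho>) ^ n"
      using real_arch_pow[of "x / \<rho>"] gt rp by auto
    then have "C * \<rho> ^ n < b 0 * x ^ n" using b0 rp by (simp add: field_simps power_divide)
    then show False using grow[of n] bound[of n] by linarith
  qed
  then show ?thesis using b0 by (simp add: x_def field_simps)
qed

text \<open>
  The norms \<open>\<parallel>T\<^sup>k f\<parallel>\<close> are log-convex in \<open>k\<close>, so their exponential growth rate is at least the
  first ratio \<open>\<parallel>T f\<parallel> / \<parallel>f\<parallel>\<close>. Hence decay of the correlations \<open>\<langle>T\<^sup>k f, f\<rangle>\<close>, with no control of the
  constant, already bounds \<open>T\<close> at \<open>f\<close>.
\<close>

lemma (in L2_symmetric_operator) norm_le_if_correlations_decay: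
  assumes f: "f \<in> H" and rho: "0 \<le> \<rho>"
    and decay: "\<And>k. cmod (L2_inner M ((T ^^ k) f) f) \<le> C * \<rho> ^ k"
  shows "L2_norm M (T f) \<le> \<rho> * L2_norm M f"
proof -
  have TH: "(T ^^ k) f \<in> H" for k by (induction k) (auto intro: T_H f)
  have move: "L2_inner M ((T ^^ (k + l)) f) g = L2_inner M ((T ^^ k) f) ((T ^^ l) g)" if "g \<in> H" for k l g
    using that
  proof (induction l arbitrary: g)
    case (Suc l)
    have "L2_inner M ((T ^^ (k + Suc l)) f) g = L2_inner M (T ((T ^^ (k + l)) f)) g" by simp
    also have "\<dots> = L2_inner M ((T ^^ (k + l)) f) (T g)" by (rule T_symmetric[OF TH Suc.prems])
    also have "\<dots> = L2_inner M ((T ^^ k) f) ((T ^^ Suc l) g)"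
      by (simp add: Suc.IH[OF T_H[OF Suc.prems]] funpow_swap1)
    finally show ?case .
  qed simp
  \<comment> \<open>Log-convexity of \<open>b\<close> is the Cauchy--Schwarz inequality for \<open>T\<^sup>k f\<close> and \<open>T\<^sup>k\<^sup>+\<^sup>2 f\<close>.\<close>
  define b where "b k = L2_norm M ((T ^^ k) f)" for k
  have "(b (Suc k))\<^sup>2 \<le> b k * b (Suc (Suc k))" for k
  proof -
    have "complex_of_real ((b (Suc k))\<^sup>2) = L2_inner M ((T ^^ Suc k) f) ((T ^^ Suc k) f)"
      by (simp add: b_def L2_inner_self)
    also have "\<dots> = L2_inner M ((T ^^ k) f) ((T ^^ Suc (Suc k)) f)"
      using T_symmetric[OF TH[of k] TH[of "Suc k"]] by simp
    finally have "(b (Suc k))\<^sup>2 = cmod (L2_inner M ((T ^^ k) f) ((T ^^ Suc (Suc k)) f))"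
      by (metis abs_power2 norm_of_real)
    also have "\<dots> \<le> b k * b (Suc (Suc k))"
      unfolding b_def by (intro L2_Cauchy_Schwarz L2 TH)
    finally show ?thesis .
  qed
  \<comment> \<open>\<open>(b k)\<^sup>2\<close> is the correlation of order \<open>2 k\<close>.\<close>
  moreover have "b k \<le> sqrt \<bar>C\<bar> * \<rho> ^ k" for k
  proof (rule power2_le_imp_le)
    have "complex_of_real ((b k)\<^sup>2) = L2_inner M ((T ^^ (k + k)) f) f"
      unfolding move[OF f] b_def L2_inner_self ..
    then have "(b k)\<^sup>2 = cmod (L2_inner M ((T ^^ (k + k)) f) f)"
      by (metis abs_power2 norm_of_real)
    also have "\<dots> \<le> C * \<rho> ^ (k + k)" by (rule decay)
    also have "\<dots> \<le> \<bar>C\<bar> * \<rho> ^ (k + k)" using rho by (intro mult_right_mono) auto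
    also have "\<dots> = (sqrt \<bar>C\<bar> * \<rho> ^ k)\<^sup>2" by (simp add: power_mult_distrib power_add power2_eq_square)
    finally show "(b k)\<^sup>2 \<le> (sqrt \<bar>C\<bar> * \<rho> ^ k)\<^sup>2" .
  qed (use rho in simp)
  ultimately show ?thesis
    using log_convex_growth[of b "sqrt \<bar>C\<bar>" \<rho>] rho by (simp add: b_def)
qed

section \<open>Averaging over neighbours in a reversible measure\<close>

text \<open>
  The simple random walk on a graph and the one on a graphing are treated at once: a point
  \<open>x\<close> has finitely many neighbours \<open>y x i\<close>, indexed with multiplicity by \<open>i \<in> N x\<close>.
\<close>

definition avg :: "('a \<Rightarrow> 'i set) \<Rightarrow> ('a \<Rightarrow> 'i \<Rightarrow> 'a) \<Rightarrow> ('a \<Rightarrow> complex) \<Rightarrow> 'a \<Rightarrow> complex" where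
  "avg N y f x = (\<Sum>i\<in>N x. f (y x i)) / of_nat (card (N x))"

lemma avg_add: "avg N y (\<lambda>x. f x + g x) = (\<lambda>x. avg N y f x + avg N y g x)"
  and avg_scale: "avg N y (\<lambda>x. c * f x) = (\<lambda>x. c * avg N y f x)"
  by (simp_all add: fun_eq_iff avg_def sum.distrib add_divide_distrib sum_distrib_left)

text \<open>
  Statements that are linear in \<open>f\<close> reduce to the four nonnegative parts of \<open>f\<close>, for which
  Lebesgue integrals need no integrability.
\<close>

lemma L2_parts_induct:
  assumes f: "f \<in> L2_space M"
    and nonneg: "\<And>u. u \<in> borel_measurable M \<Longrightarrow> (\<And>x. 0 \<le> u x) \<Longrightarrow>
      (\<lambda>x. complex_of_real (u x)) \<in> L2_space M \<Longrightarrow> Q (\<lambda>x. complex_of_real (u x))"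
    and lin: "\<And>f g c. f \<in> L2_space M \<Longrightarrow> g \<in> L2_space M \<Longrightarrow> Q f \<Longrightarrow> Q g \<Longrightarrow> Q (\<lambda>x. f x + c * g x)"
  shows "Q f"
proof -
  have [measurable]: "f \<in> borel_measurable M" by (rule L2_measurable[OF f])
  have part: "(\<lambda>x. complex_of_real (max 0 (h x))) \<in> L2_space M"
    if [measurable]: "h \<in> borel_measurable M" and h: "\<And>x. \<bar>h x\<bar> \<le> cmod (f x)" for h
  proof (rule L2_spaceI)
    show "integrable M (\<lambda>x. (cmod (complex_of_real (max 0 (h x))))\<^sup>2)"
    proof (rule Bochner_Integration.integrable_bound[OF L2_square_integrable[OF f]])
      show "AE x in M. norm ((cmod (complex_of_real (max 0 (h x))))\<^sup>2) \<le> norm ((cmod (f x))\<^sup>2)"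
      proof (rule AE_I2)
        fix x
        have "\<bar>max 0 (h x)\<bar> \<le> cmod (f x)" using h[of x] by (auto simp: max_def)
        then show "norm ((cmod (complex_of_real (max 0 (h x))))\<^sup>2) \<le> norm ((cmod (f x))\<^sup>2)"
          unfolding norm_of_real real_norm_def abs_power2 by (rule power_mono) simp
      qed
    qed measurable
  qed measurable
  define p where "p h x = complex_of_real (max 0 (h x))" for h and x :: 'a
  have p: "p h \<in> L2_space M \<and> Q (p h)"
    if "h \<in> borel_measurable M" "\<And>x. \<bar>h x\<bar> \<le> cmod (f x)" for h
    unfolding p_def using part[OF that] that(1) by (auto intro!: nonneg)
  have 1: "p (\<lambda>x. Re (f x)) \<in> L2_space M \<and> Q (p (\<lambda>x. Re (f x)))"
    by (rule p) (auto simp: abs_Re_le_cmod)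
  have 2: "p (\<lambda>x. - Re (f x)) \<in> L2_space M \<and> Q (p (\<lambda>x. - Re (f x)))"
    by (rule p) (auto simp: abs_Re_le_cmod)
  have 3: "p (\<lambda>x. Im (f x)) \<in> L2_space M \<and> Q (p (\<lambda>x. Im (f x)))"
    by (rule p) (auto simp: abs_Im_le_cmod)
  have 4: "p (\<lambda>x. - Im (f x)) \<in> L2_space M \<and> Q (p (\<lambda>x. - Im (f x)))"
    by (rule p) (auto simp: abs_Im_le_cmod)
  have "Q (\<lambda>x. (p (\<lambda>x. Re (f x)) x + (-1) * p (\<lambda>x. - Re (f x)) x)
      + \<i> * (p (\<lambda>x. Im (f x)) x + (-1) * p (\<lambda>x. - Im (f x)) x))"
    using 1 2 3 4 by (intro lin L2_add L2_scale) auto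
  also have "(\<lambda>x. (p (\<lambda>x. Re (f x)) x + (-1) * p (\<lambda>x. - Re (f x)) x)
      + \<i> * (p (\<lambda>x. Im (f x)) x + (-1) * p (\<lambda>x. - Im (f x)) x)) = f"
    by (auto simp: p_def complex_eq_iff max_def)
  finally show ?thesis .
qed

locale finite_walk =
  fixes M :: "'a measure" and N :: "'a \<Rightarrow> 'i set" and y :: "'a \<Rightarrow> 'i \<Rightarrow> 'a"
  assumes N_finite: "x \<in> space M \<Longrightarrow> finite (N x)"
    and N_nonempty: "x \<in> space M \<Longrightarrow> N x \<noteq> {}"
    and step: "x \<in> space M \<Longrightarrow> i \<in> N x \<Longrightarrow> y x i \<in> space M"
begin

text \<open>
  The law of one step of the walk, as a kernel. Kernels make integrals over the neighbours
  measurable and turn reversibility into an equality of measures.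
\<close>

definition W :: "'a \<Rightarrow> 'a measure" where
  "W x = distr (uniform_count_measure (N x)) M (y x)"

lemma sets_W[simp, measurable_cong]: "sets (W x) = sets M"
  by (simp add: W_def)

lemma space_W[simp]: "space (W x) = space M"
  by (simp add: W_def)

lemma y_measurable: "x \<in> space M \<Longrightarrow> y x \<in> measurable (uniform_count_measure (N x)) M"
  using step by (simp add: uniform_count_measure_def)

lemma prob_space_W: "x \<in> space M \<Longrightarrow> prob_space (W x)"
  unfolding W_def
  by (intro prob_space.prob_space_distr prob_space_uniform_count_measure N_finite N_nonempty y_measurable)

lemma emeasure_W:
  assumes x: "x \<in> space M" and A: "A \<in> sets M"
  shows "emeasure (W x) A = ennreal (real (card {i \<in> N x. y x i \<in> A}) / real (card (N x)))"
proof -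
  have "emeasure (W x) A = emeasure (uniform_count_measure (N x)) (y x -` A \<inter> N x)"
    unfolding W_def by (subst emeasure_distr[OF y_measurable[OF x] A]) (simp add: space_uniform_count_measure)
  also have "\<dots> = ennreal (real (card (y x -` A \<inter> N x)) / real (card (N x)))"
    by (simp add: emeasure_uniform_count_measure N_finite[OF x] divide_ennreal ennreal_of_nat_eq_real_of_nat)
  also have "y x -` A \<inter> N x = {i \<in> N x. y x i \<in> A}" by auto
  finally show ?thesis .
qed

lemma W_kernelI:
  assumes "\<And>A. A \<in> sets M \<Longrightarrow>
    (\<lambda>x. real (card {i \<in> N x. y x i \<in> A}) / real (card (N x))) \<in> borel_measurable M"
  shows "W \<in> measurable M (subprob_algebra M)"
proof (rule measurable_subprob_algebra)
  show "subprob_space (W x)" if "x \<in> space M" for x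
    by (rule prob_space_imp_subprob_space[OF prob_space_W[OF that]])
  fix A assume A: "A \<in> sets M"
  have "(\<lambda>x. ennreal (real (card {i \<in> N x. y x i \<in> A}) / real (card (N x)))) \<in> borel_measurable M"
    using assms[OF A] by measurable
  then show "(\<lambda>x. emeasure (W x) A) \<in> borel_measurable M"
    by (rule measurable_cong[THEN iffD1, rotated]) (simp add: emeasure_W A)
qed simp

text \<open>
  For fixed \<open>A\<close> both sides of the reversibility condition are finite measures in \<open>B\<close>. So it
  extends from a \<open>\<pi>\<close>-system first in one argument and then in the other.
\<close>

lemma reversible_generated:
  assumes fin: "finite_measure M" and W[measurable]: "W \<in> measurable M (subprob_algebra M)"
    and sets: "sets M = sigma_sets (space M) \<G>" and pi: "Int_stable \<G>" "\<G> \<subseteq> Pow (space M)"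
    and top: "space M \<in> \<G>"
    and rev: "\<And>A B. A \<in> \<G> \<Longrightarrow> B \<in> \<G> \<Longrightarrow>
      (\<integral>\<^sup>+x. indicator A x * emeasure (W x) B \<partial>M) = (\<integral>\<^sup>+x. indicator B x * emeasure (W x) A \<partial>M)"
    and A: "A \<in> sets M" and B: "B \<in> sets M"
  shows "(\<integral>\<^sup>+x. indicator A x * emeasure (W x) B \<partial>M) = (\<integral>\<^sup>+x. indicator B x * emeasure (W x) A \<partial>M)"
proof (cases "space M = {}")
  case True then show ?thesis by (simp add: nn_integral_empty)
next
  case False
  interpret finite_measure M by fact
  have \<G>_sets: "A \<in> sets M" if "A \<in> \<G>" for A unfolding sets using that by (rule sigma_sets.Basic)
  have extend: "(\<integral>\<^sup>+x. indicator A x * emeasure (W x) B \<partial>M) = (\<integral>\<^sup>+x. indicator B x * emeasure (W x) A \<partial>M)"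
    if A[measurable]: "A \<in> sets M" and B: "B \<in> sets M" and
      gen: "\<And>B. B \<in> \<G> \<Longrightarrow>
      (\<integral>\<^sup>+x. indicator A x * emeasure (W x) B \<partial>M) = (\<integral>\<^sup>+x. indicator B x * emeasure (W x) A \<partial>M)" for A B
  proof -
    let ?M1 = "bind (density M (indicator A)) W" and ?M2 = "density M (\<lambda>x. emeasure (W x) A)"
    have ne: "space (density M (indicator A)) \<noteq> {}" using False by simp
    have W': "W \<in> measurable (density M (indicator A)) (subprob_algebra M)" by measurable
    have s1: "sets ?M1 = sets M" using sets_bind[OF _ ne, of W M] by simp
    have e1: "emeasure ?M1 B = (\<integral>\<^sup>+x. indicator A x * emeasure (W x) B \<partial>M)" if [measurable]: "B \<in> sets M" for B
      unfolding emeasure_bind[OF ne W' that] by (subst nn_integral_density) measurable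
    have e2: "emeasure ?M2 B = (\<integral>\<^sup>+x. indicator B x * emeasure (W x) A \<partial>M)" if [measurable]: "B \<in> sets M" for B
      by (subst emeasure_density) (measurable, simp add: mult.commute)
    have "?M1 = ?M2"
    proof (rule measure_eqI_generator_eq[OF pi, where A="\<lambda>_. space M"])
      fix X assume "X \<in> \<G>"
      then show "emeasure ?M1 X = emeasure ?M2 X" by (simp only: e1 e2 \<G>_sets gen)
    next
      fix i :: nat
      have "emeasure ?M1 (space M) \<le> (\<integral>\<^sup>+x. 1 \<partial>M)"
        unfolding e1[OF sets.top]
        using prob_space.emeasure_space_1[OF prob_space_W] by (intro nn_integral_mono) (auto split: split_indicator)
      also have "\<dots> < \<infinity>" by (simp add: emeasure_eq_measure)
      finally show "emeasure ?M1 (space M) \<noteq> \<infinity>" by simp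
    qed (use s1 sets top in auto)
    then have "emeasure ?M1 B = emeasure ?M2 B" by simp
    then show ?thesis by (simp only: e1[OF B] e2[OF B])
  qed
  have step: "(\<integral>\<^sup>+x. indicator A x * emeasure (W x) B \<partial>M) = (\<integral>\<^sup>+x. indicator B x * emeasure (W x) A \<partial>M)"
    if "A \<in> \<G>" "B \<in> sets M" for A B
    by (rule extend[OF \<G>_sets[OF that(1)] that(2) rev[OF that(1)]])
  show ?thesis by (rule extend[OF A B]) (rule step[symmetric, OF _ A])
qed

text \<open>The densities are the values \<open>W x A\<close> of a kernel, whose measurability can be checked on a \<open>\<pi>\<close>-system.\<close>

lemma count_measurable_generated:
  assumes sets: "sets M = sigma_sets (space M) \<G>" and pi: "Int_stable \<G>" "\<G> \<subseteq> Pow (space M)"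
    and top: "space M \<in> \<G>"
    and meas: "\<And>A. A \<in> \<G> \<Longrightarrow> (\<lambda>x. real (card {i \<in> N x. y x i \<in> A})) \<in> borel_measurable M"
    and A: "A \<in> sets M"
  shows "(\<lambda>x. real (card {i \<in> N x. y x i \<in> A}) / real (card (N x))) \<in> borel_measurable M"
proof -
  have card_N: "(\<lambda>x. real (card (N x))) \<in> borel_measurable M"
  proof (rule measurable_cong[THEN iffD1, OF _ meas[OF top]])
    fix x assume x: "x \<in> space M"
    have "{i \<in> N x. y x i \<in> space M} = N x" using step[OF x] by blast
    then show "real (card {i \<in> N x. y x i \<in> space M}) = real (card (N x))" by simp
  qed
  have gen: "(\<lambda>x. emeasure (W x) B) \<in> borel_measurable M" if B: "B \<in> \<G>" for B
  proof -
    have "B \<in> sets M" unfolding sets using B by (rule sigma_sets.Basic)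
    then have eq: "ennreal (real (card {i \<in> N x. y x i \<in> B}) / real (card (N x))) = emeasure (W x) B"
      if "x \<in> space M" for x by (simp add: emeasure_W that)
    have "(\<lambda>x. ennreal (real (card {i \<in> N x. y x i \<in> B}) / real (card (N x)))) \<in> borel_measurable M"
      using meas[OF B] card_N by measurable
    then show ?thesis by (rule measurable_cong[THEN iffD1, rotated]) (rule eq)
  qed
  have W: "W \<in> measurable M (subprob_algebra M)"
    by (rule measurable_subprob_algebra_generated[OF sets pi])
      (auto intro: gen top prob_space_imp_subprob_space prob_space_W)
  have "(\<lambda>x. enn2real (emeasure (W x) A)) \<in> borel_measurable M"
    using measurable_compose[OF W measurable_emeasure_subprob_algebra[OF A]] by measurable
  then show ?thesis by (rule measurable_cong[THEN iffD1, rotated]) (simp add: emeasure_W A)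
qed

end

text \<open>
  Both conditions are about the density of the set \<open>B\<close> among the neighbours of \<open>x\<close>: it is
  measurable, and the flow of the walk from \<open>A\<close> to \<open>B\<close> equals the flow from \<open>B\<close> to \<open>A\<close>.
\<close>

locale reversible_walk = finite_walk +
  assumes count_measurable:
      "A \<in> sets M \<Longrightarrow> (\<lambda>x. real (card {i \<in> N x. y x i \<in> A}) / real (card (N x))) \<in> borel_measurable M"
    and reversible: "A \<in> sets M \<Longrightarrow> B \<in> sets M \<Longrightarrow>
      (\<integral>\<^sup>+x. indicator A x * ennreal (real (card {i \<in> N x. y x i \<in> B}) / real (card (N x))) \<partial>M)
    = (\<integral>\<^sup>+x. indicator B x * ennreal (real (card {i \<in> N x. y x i \<in> A}) / real (card (N x))) \<partial>M)"
begin

lemma W_kernel[measurable]: "W \<in> measurable M (subprob_algebra M)"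
  by (rule W_kernelI[OF count_measurable])

lemma integral_W:
  assumes x: "x \<in> space M" and f: "f \<in> borel_measurable M"
  shows "(LINT z|W x. f z) = avg N y f x"
proof -
  have "(LINT z|W x. f z) = (LINT i|uniform_count_measure (N x). f (y x i))"
    unfolding W_def by (rule integral_distr[OF y_measurable[OF x] f])
  also have "\<dots> = (\<Sum>i\<in>N x. (1 / real (card (N x))) *\<^sub>R f (y x i))"
    unfolding uniform_count_measure_def
    by (subst lebesgue_integral_point_measure_finite) (auto simp: N_finite[OF x])
  also have "\<dots> = avg N y f x"
    by (simp add: avg_def scaleR_conv_of_real sum_divide_distrib)
  finally show ?thesis .
qed

lemma nn_integral_W:
  assumes x: "x \<in> space M" and f: "f \<in> borel_measurable M"
  shows "(\<integral>\<^sup>+z. f z \<partial>W x) = (\<Sum>i\<in>N x. ennreal (1 / real (card (N x))) * f (y x i))"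
  unfolding W_def uniform_count_measure_def
  using y_measurable[OF x] f
  by (subst nn_integral_distr)
    (auto simp: uniform_count_measure_def nn_integral_point_measure_finite N_finite[OF x])

lemma avg_measurable[measurable]:
  assumes f[measurable]: "f \<in> borel_measurable M" shows "avg N y f \<in> borel_measurable M"
proof -
  have "(\<lambda>x. LINT z|W x. f z) \<in> borel_measurable M" by measurable
  then show ?thesis by (rule measurable_cong[THEN iffD1, rotated]) (simp add: integral_W f)
qed

text \<open>
  Reversibility on sets says that two measures agree, which gives the identity for a set and a
  function; read the other way round this is again an equality of measures.
\<close>

lemma nn_reversible:
  assumes f[measurable]: "f \<in> borel_measurable M" and g[measurable]: "g \<in> borel_measurable M"
  shows "(\<integral>\<^sup>+x. g x * (\<integral>\<^sup>+z. f z \<partial>W x) \<partial>M) = (\<integral>\<^sup>+x. f x * (\<integral>\<^sup>+z. g z \<partial>W x) \<partial>M)"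
proof (cases "space M = {}")
  case True then show ?thesis by (simp add: nn_integral_empty)
next
  case False
  have via_measures: "(\<integral>\<^sup>+x. h x * (\<integral>\<^sup>+z. k z \<partial>W x) \<partial>M) = (\<integral>\<^sup>+x. k x * (\<integral>\<^sup>+z. h z \<partial>W x) \<partial>M)"
    if h[measurable]: "h \<in> borel_measurable M" and k[measurable]: "k \<in> borel_measurable M"
      and sets_eq: "\<And>B. B \<in> sets M \<Longrightarrow> (\<integral>\<^sup>+x. h x * emeasure (W x) B \<partial>M)
        = (\<integral>\<^sup>+x. indicator B x * (\<integral>\<^sup>+z. h z \<partial>W x) \<partial>M)" for h k :: "'a \<Rightarrow> ennreal"
  proof -
    have ne: "space (density M h) \<noteq> {}" using False by simp
    have W': "W \<in> measurable (density M h) (subprob_algebra M)" by measurable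
    have "bind (density M h) W = density M (\<lambda>x. \<integral>\<^sup>+z. h z \<partial>W x)"
    proof (rule measure_eqI)
      show "sets (bind (density M h) W) = sets (density M (\<lambda>x. \<integral>\<^sup>+z. h z \<partial>W x))"
        using sets_bind[OF _ ne, of W M] by simp
      fix B assume "B \<in> sets (bind (density M h) W)"
      then have B[measurable]: "B \<in> sets M" using sets_bind[OF _ ne, of W M] by simp
      have "emeasure (bind (density M h) W) B = (\<integral>\<^sup>+x. emeasure (W x) B \<partial>density M h)"
        by (rule emeasure_bind[OF ne W' B])
      also have "\<dots> = (\<integral>\<^sup>+x. h x * emeasure (W x) B \<partial>M)"
        by (subst nn_integral_density) measurable
      also have "\<dots> = (\<integral>\<^sup>+x. (\<integral>\<^sup>+z. h z \<partial>W x) * indicator B x \<partial>M)"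
        using sets_eq[OF B] by (simp add: mult.commute)
      also have "\<dots> = emeasure (density M (\<lambda>x. \<integral>\<^sup>+z. h z \<partial>W x)) B"
        by (subst emeasure_density) (use B in measurable)
      finally show "emeasure (bind (density M h) W) B = emeasure (density M (\<lambda>x. \<integral>\<^sup>+z. h z \<partial>W x)) B" .
    qed
    then have "(\<integral>\<^sup>+x. k x \<partial>bind (density M h) W) = (\<integral>\<^sup>+x. k x \<partial>density M (\<lambda>x. \<integral>\<^sup>+z. h z \<partial>W x))"
      by simp
    then show ?thesis
      unfolding nn_integral_bind[OF k W']
      by (subst (asm) (1 2) nn_integral_density) (measurable, simp add: mult.commute)
  qed
  have ind: "(\<integral>\<^sup>+x. indicator A x * (\<integral>\<^sup>+z. k z \<partial>W x) \<partial>M) = (\<integral>\<^sup>+x. k x * emeasure (W x) A \<partial>M)"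
    if A[measurable]: "A \<in> sets M" and k: "k \<in> borel_measurable M" for A k
  proof -
    have "(\<integral>\<^sup>+x. indicator A x * (\<integral>\<^sup>+z. k z \<partial>W x) \<partial>M)
        = (\<integral>\<^sup>+x. k x * (\<integral>\<^sup>+z. indicator A z \<partial>W x) \<partial>M)"
    proof (rule via_measures[OF _ k])
      fix B assume B: "B \<in> sets M"
      have "(\<integral>\<^sup>+x. indicator A x * emeasure (W x) B \<partial>M) = (\<integral>\<^sup>+x. indicator B x * emeasure (W x) A \<partial>M)"
        using reversible[OF A B] by (simp add: emeasure_W A B cong: nn_integral_cong)
      then show "(\<integral>\<^sup>+x. indicator A x * emeasure (W x) B \<partial>M)
          = (\<integral>\<^sup>+x. indicator B x * (\<integral>\<^sup>+z. indicator A z \<partial>W x) \<partial>M)" using A by simp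
    qed measurable
    then show ?thesis using A by simp
  qed
  show ?thesis
    by (rule via_measures[OF g f]) (simp add: ind g)
qed

text \<open>Reversibility against the constant 1.\<close>

lemma nn_stationary:
  assumes f: "f \<in> borel_measurable M"
  shows "(\<integral>\<^sup>+x. (\<integral>\<^sup>+z. f z \<partial>W x) \<partial>M) = (\<integral>\<^sup>+x. f x \<partial>M)"
proof -
  have "(\<integral>\<^sup>+x. (\<integral>\<^sup>+z. f z \<partial>W x) \<partial>M) = (\<integral>\<^sup>+x. f x * (\<integral>\<^sup>+z. 1 \<partial>W x) \<partial>M)"
    using nn_reversible[OF f, of "\<lambda>_. 1"] by simp
  also have "\<dots> = (\<integral>\<^sup>+x. f x \<partial>M)"
    using prob_space.emeasure_space_1[OF prob_space_W] by (intro nn_integral_cong) simp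
  finally show ?thesis .
qed

text \<open>By stationarity, the points from which one step may lead into a null set form a null set.\<close>

lemma AE_neighbours:
  assumes ae: "AE x in M. P x"
  shows "AE x in M. \<forall>i\<in>N x. P (y x i)"
proof -
  obtain B where B: "{x \<in> space M. \<not> P x} \<subseteq> B" "emeasure M B = 0" and [measurable]: "B \<in> sets M"
    using ae by (auto elim!: AE_E)
  have "(\<integral>\<^sup>+x. emeasure (W x) B \<partial>M) = 0"
    using nn_stationary[of "indicator B"] B by simp
  then have "AE x in M. emeasure (W x) B = 0"
    by (subst (asm) nn_integral_0_iff_AE) auto
  then show ?thesis
  proof (rule AE_mp, intro AE_I2 impI ballI)
    fix x i assume x: "x \<in> space M" and 0: "emeasure (W x) B = 0" and i: "i \<in> N x"
    have "card (N x) > 0" using N_finite[OF x] i card_gt_0_iff by blast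
    then have "card {i \<in> N x. y x i \<in> B} = 0"
      using 0 by (simp add: emeasure_W x ennreal_eq_0_iff divide_le_0_iff del: card_eq_0_iff)
    then have "y x i \<notin> B" using N_finite[OF x] i by auto
    then show "P (y x i)" using B(1) step[OF x i] by blast
  qed
qed

lemma avg_cong_AE:
  assumes "AE x in M. f x = g x"
  shows "AE x in M. avg N y f x = avg N y g x"
  using AE_neighbours[OF assms] by eventually_elim (auto simp: avg_def intro!: sum.cong)

lemma avg_square_le:
  assumes x: "x \<in> space M" and f[measurable]: "f \<in> borel_measurable M"
  shows "ennreal ((cmod (avg N y f x))\<^sup>2) \<le> (\<integral>\<^sup>+z. ennreal ((cmod (f z))\<^sup>2) \<partial>W x)"
proof -
  define n where "n = real (card (N x))"
  have n: "0 < n" using N_finite[OF x] N_nonempty[OF x] by (simp add: n_def card_gt_0_iff)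
  have "(cmod (\<Sum>i\<in>N x. f (y x i)))\<^sup>2 \<le> (\<Sum>i\<in>N x. cmod (f (y x i)))\<^sup>2"
    by (intro power_mono norm_sum) simp
  also have "\<dots> \<le> (\<Sum>i\<in>N x. (cmod (f (y x i)))\<^sup>2) * n"
    unfolding n_def by (rule sum_squared_le_sum_of_squares)
  finally have "(cmod (avg N y f x))\<^sup>2 \<le> (\<Sum>i\<in>N x. (cmod (f (y x i)))\<^sup>2) / n"
    using n by (simp add: avg_def norm_divide power_divide n_def[symmetric] pos_divide_le_eq power2_eq_square[of n])
  then have "ennreal ((cmod (avg N y f x))\<^sup>2) \<le> ennreal (\<Sum>i\<in>N x. 1 / n * (cmod (f (y x i)))\<^sup>2)"
    by (intro ennreal_leI) (simp add: sum_divide_distrib)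
  also have "\<dots> = (\<Sum>i\<in>N x. ennreal (1 / n * (cmod (f (y x i)))\<^sup>2))"
    using n by (intro sum_ennreal[symmetric]) simp
  also have "\<dots> = (\<Sum>i\<in>N x. ennreal (1 / n) * ennreal ((cmod (f (y x i)))\<^sup>2))"
    using n by (intro sum.cong refl ennreal_mult) auto
  also have "\<dots> = (\<integral>\<^sup>+z. ennreal ((cmod (f z))\<^sup>2) \<partial>W x)"
    unfolding n_def by (rule nn_integral_W[OF x, symmetric]) measurable
  finally show ?thesis .
qed

lemma avg_nn_norm_le:
  assumes f[measurable]: "f \<in> borel_measurable M"
  shows "(\<integral>\<^sup>+x. ennreal ((cmod (avg N y f x))\<^sup>2) \<partial>M) \<le> (\<integral>\<^sup>+x. ennreal ((cmod (f x))\<^sup>2) \<partial>M)"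
proof -
  have "(\<integral>\<^sup>+x. ennreal ((cmod (avg N y f x))\<^sup>2) \<partial>M) \<le> (\<integral>\<^sup>+x. (\<integral>\<^sup>+z. ennreal ((cmod (f z))\<^sup>2) \<partial>W x) \<partial>M)"
    by (intro nn_integral_mono avg_square_le f)
  also have "\<dots> = (\<integral>\<^sup>+x. ennreal ((cmod (f x))\<^sup>2) \<partial>M)" by (rule nn_stationary) measurable
  finally show ?thesis .
qed

lemma avg_L2:
  assumes f: "f \<in> L2_space M" shows "avg N y f \<in> L2_space M"
proof (rule L2_spaceI)
  note [measurable] = L2_measurable[OF f]
  show "avg N y f \<in> borel_measurable M" by measurable
  have "(\<integral>\<^sup>+x. ennreal ((cmod (avg N y f x))\<^sup>2) \<partial>M) \<le> (\<integral>\<^sup>+x. ennreal ((cmod (f x))\<^sup>2) \<partial>M)"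
    by (rule avg_nn_norm_le) measurable
  also have "\<dots> < \<infinity>"
    using L2_square_integrable[OF f] by (simp add: integrable_iff_bounded)
  finally show "integrable M (\<lambda>x. (cmod (avg N y f x))\<^sup>2)"
    by (simp add: integrable_iff_bounded)
qed

lemma avg_contraction:
  assumes f: "f \<in> L2_space M" shows "L2_norm M (avg N y f) \<le> L2_norm M f"
proof -
  have "ennreal (LINT x|M. (cmod (avg N y f x))\<^sup>2) \<le> ennreal (LINT x|M. (cmod (f x))\<^sup>2)"
    using avg_nn_norm_le[OF L2_measurable[OF f]]
      nn_integral_eq_integral[OF L2_square_integrable[OF avg_L2[OF f]]]
      nn_integral_eq_integral[OF L2_square_integrable[OF f]] by simp
  then show ?thesis
    by (simp add: L2_norm_def ennreal_le_iff)
qed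

text \<open>
  Both sides are sesquilinear, so nonnegative functions suffice. For these the inner products
  are nonnegative integrals, to which reversibility applies.
\<close>

lemma avg_symmetric:
  assumes f: "f \<in> L2_space M" and g: "g \<in> L2_space M"
  shows "L2_inner M (avg N y f) g = L2_inner M f (avg N y g)"
proof -
  define sym where "sym f g \<longleftrightarrow> L2_inner M (avg N y f) g = L2_inner M f (avg N y g)" for f g
  have sym_commute: "sym f g \<longleftrightarrow> sym g f" for f g
    unfolding sym_def by (metis L2_inner_commute)
  have sym_lin: "sym (\<lambda>x. f1 x + c * f2 x) g"
    if "f1 \<in> L2_space M" "f2 \<in> L2_space M" "sym f1 g" "sym f2 g" "g \<in> L2_space M" for f1 f2 c g
    using that unfolding sym_def avg_add avg_scale
    by (simp add: L2_inner_add_left L2_inner_scale_left L2_scale avg_L2)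
  have nonneg: "sym (\<lambda>x. complex_of_real (u x)) (\<lambda>x. complex_of_real (v x))"
    if u: "u \<in> borel_measurable M" "\<And>x. 0 \<le> u x" and v: "v \<in> borel_measurable M" "\<And>x. 0 \<le> v x" for u v
  proof -
    note [measurable] = u(1) v(1)
    have half: "L2_inner M (avg N y (\<lambda>x. complex_of_real (u x))) (\<lambda>x. complex_of_real (v x))
        = of_real (enn2real (\<integral>\<^sup>+x. ennreal (v x) * (\<integral>\<^sup>+z. ennreal (u z) \<partial>W x) \<partial>M))"
      if [measurable]: "u \<in> borel_measurable M" and u: "\<And>x. 0 \<le> u x" and
        [measurable]: "v \<in> borel_measurable M" and v: "\<And>x. 0 \<le> v x" for u v
    proof -
      define a where "a x = (\<Sum>i\<in>N x. 1 / real (card (N x)) * u (y x i))" for x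
      have a: "avg N y (\<lambda>x. complex_of_real (u x)) = (\<lambda>x. of_real (a x))"
        by (simp add: fun_eq_iff avg_def a_def sum_divide_distrib)
      have "(\<lambda>x. complex_of_real (a x)) \<in> borel_measurable M"
        unfolding a[symmetric] by measurable
      then have [measurable]: "a \<in> borel_measurable M"
        by (drule_tac measurable_compose[OF _ borel_measurable_Re]) simp
      have a0: "0 \<le> a x" for x unfolding a_def by (intro sum_nonneg) (simp add: u)
      have "L2_inner M (avg N y (\<lambda>x. complex_of_real (u x))) (\<lambda>x. complex_of_real (v x))
          = of_real (LINT x|M. a x * v x)"
        unfolding a L2_inner_def by (simp only: complex_cnj_complex_of_real of_real_mult[symmetric] integral_complex_of_real)
      also have "(LINT x|M. a x * v x) = enn2real (\<integral>\<^sup>+x. ennreal (a x * v x) \<partial>M)"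
        by (rule integral_eq_nn_integral) (auto simp: a0 v)
      also have "(\<integral>\<^sup>+x. ennreal (a x * v x) \<partial>M)
          = (\<integral>\<^sup>+x. ennreal (v x) * (\<integral>\<^sup>+z. ennreal (u z) \<partial>W x) \<partial>M)"
      proof (rule nn_integral_cong)
        fix x assume x: "x \<in> space M"
        have "(\<integral>\<^sup>+z. ennreal (u z) \<partial>W x) = (\<Sum>i\<in>N x. ennreal (1 / real (card (N x)) * u (y x i)))"
          unfolding nn_integral_W[OF x measurable_compose[OF that(1) measurable_ennreal]]
          by (intro sum.cong refl ennreal_mult[symmetric]) (auto simp: u)
        also have "\<dots> = ennreal (a x)" unfolding a_def by (rule sum_ennreal) (simp add: u)
        finally show "ennreal (a x * v x) = ennreal (v x) * (\<integral>\<^sup>+z. ennreal (u z) \<partial>W x)"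
          by (simp add: ennreal_mult a0 v mult.commute)
      qed
      finally show ?thesis .
    qed
    have "(\<integral>\<^sup>+x. ennreal (v x) * (\<integral>\<^sup>+z. ennreal (u z) \<partial>W x) \<partial>M)
        = (\<integral>\<^sup>+x. ennreal (u x) * (\<integral>\<^sup>+z. ennreal (v z) \<partial>W x) \<partial>M)"
      by (rule nn_reversible) measurable
    then have "L2_inner M (avg N y (\<lambda>x. complex_of_real (u x))) (\<lambda>x. complex_of_real (v x))
        = L2_inner M (avg N y (\<lambda>x. complex_of_real (v x))) (\<lambda>x. complex_of_real (u x))"
      by (simp add: half u v)
    also have "\<dots> = cnj (L2_inner M (avg N y (\<lambda>x. complex_of_real (v x))) (\<lambda>x. complex_of_real (u x)))"
      by (simp add: half u v)
    also have "\<dots> = L2_inner M (\<lambda>x. complex_of_real (u x)) (avg N y (\<lambda>x. complex_of_real (v x)))"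
      by (rule L2_inner_commute[symmetric])
    finally show ?thesis unfolding sym_def .
  qed
  have step1: "sym f (\<lambda>x. complex_of_real (v x))"
    if f: "f \<in> L2_space M" and v: "v \<in> borel_measurable M" "\<And>x. 0 \<le> v x"
      "(\<lambda>x. complex_of_real (v x)) \<in> L2_space M" for f v
    using f by (rule L2_parts_induct) (auto intro!: nonneg sym_lin v)
  have "sym g f"
    using g by (rule L2_parts_induct) (auto intro!: sym_lin sym_commute[THEN iffD1, OF step1] f)
  then show ?thesis using sym_commute sym_def by blast
qed

lemma avg_symmetric_operator:
  assumes "H \<subseteq> L2_space M" "(\<lambda>x. 0) \<in> H"
    and "\<And>f g. f \<in> H \<Longrightarrow> g \<in> H \<Longrightarrow> (\<lambda>x. f x + g x) \<in> H" "\<And>f c. f \<in> H \<Longrightarrow> (\<lambda>x. c * f x) \<in> H"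
    and "\<And>F f. (\<And>n. F n \<in> H) \<Longrightarrow> f \<in> L2_space M
      \<Longrightarrow> (\<lambda>n. L2_norm M (\<lambda>x. f x - F n x)) \<longlonglongrightarrow> 0 \<Longrightarrow> f \<in> H"
    and "\<And>f. f \<in> H \<Longrightarrow> avg N y f \<in> H"
  shows "L2_symmetric_operator M H (avg N y)"
proof
  fix F f assume "\<And>n. F n \<in> H" "f \<in> L2_space M" "(\<lambda>n. L2_norm M (\<lambda>x. f x - F n x)) \<longlonglongrightarrow> 0"
  then show "f \<in> H" by (rule assms(5))
qed (use assms(1-4,6) in \<open>auto simp: avg_add avg_scale intro!: avg_symmetric avg_contraction\<close>)

end

section \<open>Balls in graphs and their isomorphisms\<close>

abbreviation bverts :: "graph \<Rightarrow> nat \<Rightarrow> nat \<Rightarrow> nat set" where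
  "bverts G p n \<equiv> verts (graph_ball G p n)"

definition ball_iso :: "(nat \<Rightarrow> nat) \<Rightarrow> nat \<Rightarrow> graph \<Rightarrow> nat \<Rightarrow> graph \<Rightarrow> nat \<Rightarrow> bool" where
  "ball_iso \<phi> n G p H q \<longleftrightarrow> graph_iso \<phi> (graph_ball G p n) (graph_ball H q n) \<and> \<phi> p = q"

lemma mem_bverts: "v \<in> bverts G p n \<longleftrightarrow> v \<in> verts G \<and> (\<exists>k\<le>n. (p, v) \<in> edges G ^^ k)"
  by (simp add: graph_ball_def Let_def)

lemma edges_graph_ball: "edges (graph_ball G p n) = edges G \<inter> bverts G p n \<times> bverts G p n"
  by (simp add: graph_ball_def Let_def)

lemma bverts_subset: "bverts G p n \<subseteq> verts G"
  by (auto simp: mem_bverts)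

lemma simple_graph_edge:
  "simple_graph G \<Longrightarrow> (u, v) \<in> edges G \<Longrightarrow> u \<in> verts G \<and> v \<in> verts G \<and> (v, u) \<in> edges G"
  by (auto simp: simple_graph_def sym_def)

lemma relpow_sym:
  assumes "simple_graph G" shows "(p, v) \<in> edges G ^^ k \<Longrightarrow> (v, p) \<in> edges G ^^ k"
proof (induction k arbitrary: v)
  case (Suc k)
  then obtain w where "(p, w) \<in> edges G ^^ k" "(w, v) \<in> edges G" by auto
  then show ?case using Suc.IH[of w] simple_graph_edge[OF assms, of w v] by (meson relpow_Suc_I2)
qed simp

lemma bverts_self: "p \<in> verts G \<Longrightarrow> p \<in> bverts G p n"
  by (auto simp: mem_bverts intro: exI[of _ 0])

lemma bverts_0: "p \<in> verts G \<Longrightarrow> bverts G p 0 = {p}"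
  by (auto simp: mem_bverts)

lemma bverts_mono: "m \<le> n \<Longrightarrow> bverts G p m \<subseteq> bverts G p n"
  unfolding mem_bverts subset_iff by (meson le_trans)

lemma bverts_trans: "v \<in> bverts G p m \<Longrightarrow> w \<in> bverts G v n \<Longrightarrow> w \<in> bverts G p (m + n)"
  by (auto simp: mem_bverts) (metis add_mono relpow_trans)

lemma bverts_sym: "simple_graph G \<Longrightarrow> v \<in> verts G \<Longrightarrow> w \<in> bverts G v n \<Longrightarrow> v \<in> bverts G w n"
  by (auto simp: mem_bverts dest: relpow_sym)

lemma neighbour_in_bverts: "simple_graph G \<Longrightarrow> (v, w) \<in> edges G \<Longrightarrow> w \<in> bverts G v (Suc 0)"
  unfolding mem_bverts using simple_graph_edge[of G v w] by (auto intro!: exI[of _ "Suc 0"])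

lemma bverts_edge:
  "simple_graph G \<Longrightarrow> v \<in> bverts G p m \<Longrightarrow> (v, w) \<in> edges G \<Longrightarrow> w \<in> bverts G p (Suc m)"
  using bverts_trans[of v G p m w "Suc 0"] neighbour_in_bverts[of G v w] by simp

lemma bverts_Suc_subset:
  assumes "simple_graph G"
  shows "bverts G p (Suc n) \<subseteq> bverts G p n \<union> (\<Union>v\<in>bverts G p n. edges G `` {v})"
proof
  fix w assume "w \<in> bverts G p (Suc n)"
  then obtain k where w: "w \<in> verts G" and k: "k \<le> Suc n" "(p, w) \<in> edges G ^^ k"
    by (auto simp: mem_bverts)
  show "w \<in> bverts G p n \<union> (\<Union>v\<in>bverts G p n. edges G `` {v})"
  proof (cases "k \<le> n")
    case True then show ?thesis using w k by (auto simp: mem_bverts)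
  next
    case False
    then have "k = Suc n" using k by simp
    then obtain v where v: "(p, v) \<in> edges G ^^ n" "(v, w) \<in> edges G" using k by auto
    then have "v \<in> bverts G p n" using simple_graph_edge[OF assms v(2)] by (auto simp: mem_bverts)
    then show ?thesis using v by auto
  qed
qed

lemma bounded_graphD:
  assumes "bounded_graph D G"
  shows "simple_graph G"
    and "u \<in> verts G \<Longrightarrow> v \<in> verts G \<Longrightarrow> (u, v) \<in> (edges G)\<^sup>*"
    and "u \<in> verts G \<Longrightarrow> edges G `` {u} \<noteq> {}"
    and "u \<in> verts G \<Longrightarrow> finite (edges G `` {u})"
    and "u \<in> verts G \<Longrightarrow> deg (edges G) u \<le> D"
  using assms by (auto simp: bounded_graph_def)

lemma bounded_graph_deg_pos: "bounded_graph D G \<Longrightarrow> u \<in> verts G \<Longrightarrow> 0 < deg (edges G) u"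
  using bounded_graphD(3,4)[of D G u] by (simp add: deg_def card_gt_0_iff)

text \<open>That the bound is the same for all graphs makes the constant in the decay of correlations deterministic.\<close>

lemma card_bverts_le:
  assumes G: "bounded_graph D G" and p: "p \<in> verts G"
  shows "finite (bverts G p n) \<and> card (bverts G p n) \<le> Suc D ^ n"
proof (induction n)
  case 0 then show ?case by (simp add: bverts_0[OF p])
next
  case (Suc n)
  let ?U = "\<Union>v\<in>bverts G p n. edges G `` {v}"
  have fU: "finite ?U" using Suc bounded_graphD(4)[OF G] bverts_subset[of G p n] by auto
  have "card ?U \<le> (\<Sum>v\<in>bverts G p n. card (edges G `` {v}))" using Suc by (intro card_UN_le) auto
  also have "\<dots> \<le> (\<Sum>v\<in>bverts G p n. D)"
    using bounded_graphD(5)[OF G] bverts_subset[of G p n] by (intro sum_mono) (auto simp: deg_def)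
  finally have cU: "card ?U \<le> card (bverts G p n) * D" by simp
  have sub: "bverts G p (Suc n) \<subseteq> bverts G p n \<union> ?U"
    by (rule bverts_Suc_subset[OF bounded_graphD(1)[OF G]])
  have "card (bverts G p (Suc n)) \<le> card (bverts G p n \<union> ?U)"
    using sub fU Suc by (intro card_mono) auto
  also have "\<dots> \<le> card (bverts G p n) + card ?U" by (rule card_Un_le)
  also have "\<dots> \<le> card (bverts G p n) * Suc D" using cU by simp
  also have "\<dots> \<le> Suc D ^ n * Suc D" using Suc by (intro mult_right_mono) auto
  finally have "card (bverts G p (Suc n)) \<le> Suc D ^ Suc n" by (simp add: mult.commute)
  then show ?case using finite_subset[OF sub] fU Suc by auto
qed

lemmas finite_bverts = card_bverts_le[THEN conjunct1]

lemma connected_bverts: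
  assumes G: "bounded_graph D G" and "p \<in> verts G" "v \<in> verts G"
  obtains n where "v \<in> bverts G p n"
proof -
  obtain n where "(p, v) \<in> edges G ^^ n"
    using rtrancl_imp_relpow[OF bounded_graphD(2)[OF assms]] by blast
  then have "v \<in> bverts G p n" using assms(3) by (auto simp: mem_bverts)
  then show ?thesis by (rule that)
qed

subsection \<open>Isomorphisms\<close>

lemma graph_iso_sym:
  assumes "graph_iso \<phi> G H" shows "graph_iso (inv_into (verts G) \<phi>) H G"
proof -
  have b: "bij_betw \<phi> (verts G) (verts H)" using assms by (simp add: graph_iso_def)
  have "(u, v) \<in> edges H \<longleftrightarrow> (inv_into (verts G) \<phi> u, inv_into (verts G) \<phi> v) \<in> edges G"
    if "u \<in> verts H" "v \<in> verts H" for u v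
  proof -
    have "inv_into (verts G) \<phi> u \<in> verts G" "inv_into (verts G) \<phi> v \<in> verts G"
      using bij_betwE[OF bij_betw_inv_into[OF b]] that by blast+
    then show ?thesis
      using assms bij_betw_inv_into_right[OF b that(1)] bij_betw_inv_into_right[OF b that(2)]
      by (simp add: graph_iso_def)
  qed
  then show ?thesis using bij_betw_inv_into[OF b] by (simp add: graph_iso_def)
qed

lemma graph_iso_trans:
  assumes "graph_iso \<phi> G H" "graph_iso \<psi> H K" shows "graph_iso (\<psi> \<circ> \<phi>) G K"
  using assms bij_betwE[of \<phi> "verts G" "verts H"] unfolding graph_iso_def
  by (auto intro: bij_betw_trans)

lemma graph_iso_id: "graph_iso id G G" "graph_iso (\<lambda>x. x) G G"
  by (auto simp: graph_iso_def bij_betw_def inj_on_def)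

lemma ball_iso_bij: "ball_iso \<phi> n G p H q \<Longrightarrow> bij_betw \<phi> (bverts G p n) (bverts H q n)"
  by (simp add: ball_iso_def graph_iso_def)

lemma ball_iso_id: "ball_iso (\<lambda>x. x) n G p G p"
  by (simp add: ball_iso_def graph_iso_id)

lemma ball_iso_sym:
  assumes "ball_iso \<phi> n G p H q" "p \<in> verts G"
  shows "ball_iso (inv_into (bverts G p n) \<phi>) n H q G p"
  using assms graph_iso_sym[of \<phi> "graph_ball G p n" "graph_ball H q n"] bverts_self[of p G n]
    bij_betw_inv_into_left[OF ball_iso_bij[OF assms(1)]]
  by (auto simp: ball_iso_def)

lemma ball_iso_trans:
  "ball_iso \<phi> n G p H q \<Longrightarrow> ball_iso \<psi> n H q K r \<Longrightarrow> ball_iso (\<psi> \<circ> \<phi>) n G p K r"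
  by (auto simp: ball_iso_def intro: graph_iso_trans)

lemma ball_iso_edge:
  assumes "ball_iso \<phi> N G p H q" "u \<in> bverts G p N" "v \<in> bverts G p N"
  shows "(u, v) \<in> edges G \<longleftrightarrow> (\<phi> u, \<phi> v) \<in> edges H"
proof -
  have "\<phi> u \<in> bverts H q N" "\<phi> v \<in> bverts H q N"
    using bij_betwE[OF ball_iso_bij[OF assms(1)]] assms(2,3) by auto
  then show ?thesis
    using assms by (auto simp: ball_iso_def graph_iso_def edges_graph_ball)
qed

lemma ball_iso_path:
  assumes G: "simple_graph G" and iso: "ball_iso \<phi> N G p H q" and v: "v \<in> bverts G p m"
  shows "(v, w) \<in> edges G ^^ k \<Longrightarrow> m + k \<le> N
    \<Longrightarrow> w \<in> bverts G p (m + k) \<and> (\<phi> v, \<phi> w) \<in> edges H ^^ k"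
proof (induction k arbitrary: w)
  case 0 then show ?case using v by simp
next
  case (Suc k)
  then obtain u where u: "(v, u) \<in> edges G ^^ k" "(u, w) \<in> edges G" by auto
  have IH: "u \<in> bverts G p (m + k)" "(\<phi> v, \<phi> u) \<in> edges H ^^ k" using Suc.IH[OF u(1)] Suc.prems by auto
  have w: "w \<in> bverts G p (m + Suc k)" using bverts_edge[OF G IH(1) u(2)] by simp
  have "u \<in> bverts G p N" "w \<in> bverts G p N"
    using IH(1) w Suc.prems bverts_mono[of "m + k" N G p] bverts_mono[of "m + Suc k" N G p] by auto
  then have "(\<phi> u, \<phi> w) \<in> edges H" using ball_iso_edge[OF iso] u(2) by blast
  then show ?case using IH(2) w by auto
qed

text \<open>
  An isomorphism between balls of radius \<open>N\<close> knows the balls of radius \<open>n\<close> around the points at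
  distance at most \<open>N - n\<close> from the root, because a path of length at most \<open>n\<close> from such a point
  stays inside. Everything that is finitely determined is transported along this lemma.
\<close>

lemma ball_iso_at:
  assumes G: "simple_graph G" and H: "simple_graph H" and p: "p \<in> verts G"
    and iso: "ball_iso \<phi> N G p H q" and v: "v \<in> bverts G p m" and le: "m + n \<le> N"
  shows "ball_iso \<phi> n G v H (\<phi> v)"
proof -
  let ?\<psi> = "inv_into (bverts G p N) \<phi>"
  note bij = ball_iso_bij[OF iso]
  have iso': "ball_iso ?\<psi> N H q G p" by (rule ball_iso_sym[OF iso p])
  have q: "q = \<phi> p" using iso by (simp add: ball_iso_def)
  have vN: "v \<in> bverts G p N" using v le bverts_mono[of m N G p] by auto
  have sub: "bverts G v n \<subseteq> bverts G p N"
    using bverts_trans[OF v] bverts_mono[OF le, of G p] by blast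
  have \<phi>v: "\<phi> v \<in> bverts H q m"
  proof -
    obtain k where k: "k \<le> m" "(p, v) \<in> edges G ^^ k" using v by (auto simp: mem_bverts)
    have "(\<phi> p, \<phi> v) \<in> edges H ^^ k"
      using ball_iso_path[OF G iso bverts_self[OF p, of 0] k(2)] k(1) le by simp
    moreover have "\<phi> v \<in> verts H" using bij_betwE[OF bij] vN bverts_subset by blast
    ultimately show ?thesis using k q by (auto simp: mem_bverts)
  qed
  have \<psi>\<phi>v: "?\<psi> (\<phi> v) = v" by (rule bij_betw_inv_into_left[OF bij vN])
  have "\<phi> ` bverts G v n = bverts H (\<phi> v) n"
  proof (intro set_eqI iffI)
    fix w' assume "w' \<in> \<phi> ` bverts G v n"
    then obtain w where w: "w' = \<phi> w" "w \<in> bverts G v n" by blast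
    then obtain k where k: "k \<le> n" "(v, w) \<in> edges G ^^ k" by (auto simp: mem_bverts)
    have "(\<phi> v, \<phi> w) \<in> edges H ^^ k" using ball_iso_path[OF G iso v k(2)] k(1) le by simp
    moreover have "\<phi> w \<in> verts H" using bij_betwE[OF bij] w(2) sub bverts_subset by blast
    ultimately show "w' \<in> bverts H (\<phi> v) n" using k w by (auto simp: mem_bverts)
  next
    fix w' assume w': "w' \<in> bverts H (\<phi> v) n"
    then obtain k where k: "k \<le> n" "(\<phi> v, w') \<in> edges H ^^ k" by (auto simp: mem_bverts)
    have path: "(v, ?\<psi> w') \<in> edges G ^^ k"
      using ball_iso_path[OF H iso' \<phi>v k(2)] k(1) le \<psi>\<phi>v by simp
    have w'N: "w' \<in> bverts H q N"
      using bverts_trans[OF \<phi>v w'] bverts_mono[OF le, of H q] by blast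
    then have "?\<psi> w' \<in> verts G" using bij_betwE[OF bij_betw_inv_into[OF bij]] bverts_subset by blast
    then have "?\<psi> w' \<in> bverts G v n" using path k by (auto simp: mem_bverts)
    then show "w' \<in> \<phi> ` bverts G v n"
      using bij_betw_inv_into_right[OF bij w'N] by (metis image_eqI)
  qed
  moreover have "inj_on \<phi> (bverts G v n)"
    using bij sub by (meson bij_betw_def inj_on_subset)
  ultimately have b: "bij_betw \<phi> (bverts G v n) (bverts H (\<phi> v) n)" by (simp add: bij_betw_def)
  have "(u, w) \<in> edges (graph_ball G v n) \<longleftrightarrow> (\<phi> u, \<phi> w) \<in> edges (graph_ball H (\<phi> v) n)"
    if "u \<in> bverts G v n" "w \<in> bverts G v n" for u w
  proof -
    have "\<phi> u \<in> bverts H (\<phi> v) n" "\<phi> w \<in> bverts H (\<phi> v) n" using bij_betwE[OF b] that by auto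
    then show ?thesis
      using ball_iso_edge[OF iso, of u w] that sub by (auto simp: edges_graph_ball)
  qed
  then show ?thesis using b by (simp add: ball_iso_def graph_iso_def)
qed

lemma ball_iso_mono:
  assumes "simple_graph G" "simple_graph H" "p \<in> verts G" "ball_iso \<phi> N G p H q" "n \<le> N"
  shows "ball_iso \<phi> n G p H q"
proof -
  have "\<phi> p = q" using assms(4) by (simp add: ball_iso_def)
  then show ?thesis
    using ball_iso_at[OF assms(1-4) bverts_self[OF assms(3), of 0], of n] assms(5) by simp
qed

lemma graph_iso_path:
  assumes iso: "graph_iso \<phi> G H" and G: "simple_graph G" and v: "v \<in> verts G"
  shows "(v, w) \<in> edges G ^^ k \<Longrightarrow> (\<phi> v, \<phi> w) \<in> edges H ^^ k"
proof (induction k arbitrary: w)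
  case (Suc k)
  then obtain u where u: "(v, u) \<in> edges G ^^ k" "(u, w) \<in> edges G" by auto
  then have "(\<phi> u, \<phi> w) \<in> edges H"
    using iso simple_graph_edge[OF G u(2)] by (auto simp: graph_iso_def)
  then show ?case using Suc.IH[OF u(1)] by auto
qed simp

lemma graph_iso_ball:
  assumes iso: "graph_iso \<phi> G H" and G: "simple_graph G" and H: "simple_graph H" and p: "p \<in> verts G"
  shows "ball_iso \<phi> n G p H (\<phi> p)"
proof -
  have bij: "bij_betw \<phi> (verts G) (verts H)" using iso by (simp add: graph_iso_def)
  have sub: "\<phi> ` bverts G p n \<subseteq> bverts H (\<phi> p) n"
  proof
    fix w' assume "w' \<in> \<phi> ` bverts G p n"
    then obtain w k where w: "w' = \<phi> w" "w \<in> verts G" "k \<le> n" "(p, w) \<in> edges G ^^ k"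
      by (auto simp: mem_bverts)
    then show "w' \<in> bverts H (\<phi> p) n"
      using graph_iso_path[OF iso G p w(4)] bij_betwE[OF bij] by (auto simp: mem_bverts)
  qed
  have "w \<in> \<phi> ` bverts G p n" if w: "w \<in> bverts H (\<phi> p) n" for w
  proof -
    let ?\<psi> = "inv_into (verts G) \<phi>"
    have wH: "w \<in> verts H" using w bverts_subset by blast
    have "\<phi> p \<in> verts H" using bij_betwE[OF bij] p by blast
    moreover obtain k where k: "k \<le> n" "(\<phi> p, w) \<in> edges H ^^ k" using w by (auto simp: mem_bverts)
    ultimately have "(?\<psi> (\<phi> p), ?\<psi> w) \<in> edges G ^^ k"
      using graph_iso_path[OF graph_iso_sym[OF iso] H] by blast
    then have "?\<psi> w \<in> bverts G (?\<psi> (\<phi> p)) n"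
      using k(1) wH bij_betwE[OF bij_betw_inv_into[OF bij]] by (auto simp: mem_bverts)
    then have "?\<psi> w \<in> bverts G p n" using bij_betw_inv_into_left[OF bij p] by simp
    then show ?thesis using bij_betw_inv_into_right[OF bij wH] by (metis image_eqI)
  qed
  then have img: "\<phi> ` bverts G p n = bverts H (\<phi> p) n" using sub by blast
  have "inj_on \<phi> (bverts G p n)" using bij bverts_subset by (meson bij_betw_def inj_on_subset)
  moreover have "(u, w) \<in> edges (graph_ball G p n) \<longleftrightarrow> (\<phi> u, \<phi> w) \<in> edges (graph_ball H (\<phi> p) n)"
    if "u \<in> bverts G p n" "w \<in> bverts G p n" for u w
    using that iso bverts_subset[of G p n] img by (auto simp: edges_graph_ball graph_iso_def)
  ultimately show ?thesis using img by (simp add: ball_iso_def graph_iso_def bij_betw_def)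
qed

lemma ball_iso_neighbours:
  assumes G: "simple_graph G" and H: "simple_graph H" and p: "p \<in> verts G"
    and iso: "ball_iso \<phi> N G p H q" and v: "v \<in> bverts G p m" and le: "Suc m \<le> N"
  shows "bij_betw \<phi> (edges G `` {v}) (edges H `` {\<phi> v})"
    and "deg (edges H) (\<phi> v) = deg (edges G) v"
proof -
  have vG: "v \<in> verts G" using v bverts_subset by blast
  have iso1: "ball_iso \<phi> 1 G v H (\<phi> v)" using ball_iso_at[OF G H p iso v] le by simp
  note bij = ball_iso_bij[OF iso1]
  have subG: "edges G `` {v} \<subseteq> bverts G v 1" using neighbour_in_bverts[OF G] by auto
  have subH: "edges H `` {\<phi> v} \<subseteq> bverts H (\<phi> v) 1" using neighbour_in_bverts[OF H] by auto
  have v1: "v \<in> bverts G v 1" by (rule bverts_self[OF vG])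
  have "\<phi> ` (edges G `` {v}) = edges H `` {\<phi> v}"
  proof (intro set_eqI iffI)
    fix w assume "w \<in> \<phi> ` (edges G `` {v})"
    then obtain u where u: "w = \<phi> u" "(v, u) \<in> edges G" by blast
    then have "u \<in> bverts G v 1" using subG by blast
    then show "w \<in> edges H `` {\<phi> v}" using ball_iso_edge[OF iso1 v1, of u] u by simp
  next
    fix w assume w: "w \<in> edges H `` {\<phi> v}"
    then have "w \<in> \<phi> ` bverts G v 1" using subH bij by (auto simp: bij_betw_def)
    then obtain u where u: "u \<in> bverts G v 1" "w = \<phi> u" by blast
    then have "u \<in> edges G `` {v}" using ball_iso_edge[OF iso1 v1 u(1)] w by simp
    then show "w \<in> \<phi> ` (edges G `` {v})" using u by blast
  qed
  moreover have "inj_on \<phi> (edges G `` {v})" using bij subG by (meson bij_betw_def inj_on_subset)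
  ultimately show "bij_betw \<phi> (edges G `` {v}) (edges H `` {\<phi> v})" by (simp add: bij_betw_def)
  then show "deg (edges H) (\<phi> v) = deg (edges G) v"
    unfolding deg_def by (rule bij_betw_same_card[symmetric])
qed

lemma bounded_graph_iso:
  assumes iso: "graph_iso \<phi> G H" and H: "simple_graph H" and G: "bounded_graph D G"
  shows "bounded_graph D H"
proof -
  note sG = bounded_graphD(1)[OF G]
  have bij: "bij_betw \<phi> (verts G) (verts H)" using iso by (simp add: graph_iso_def)
  have "(u', v') \<in> (edges H)\<^sup>*" if uv: "u' \<in> verts H" "v' \<in> verts H" for u' v'
  proof -
    obtain u v where u: "u \<in> verts G" "v \<in> verts G" "u' = \<phi> u" "v' = \<phi> v"
      using uv bij by (metis bij_betw_def image_iff)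
    then show ?thesis
      using bounded_graphD(2)[OF G u(1,2)] graph_iso_path[OF iso sG u(1)]
      by (metis rtrancl_imp_relpow relpow_imp_rtrancl)
  qed
  moreover have "edges H `` {u'} \<noteq> {} \<and> finite (edges H `` {u'}) \<and> deg (edges H) u' \<le> D"
    if u': "u' \<in> verts H" for u'
  proof -
    obtain u where u: "u \<in> verts G" "u' = \<phi> u" using u' bij by (metis bij_betw_def image_iff)
    have iso1: "ball_iso \<phi> 1 G u H (\<phi> u)" by (rule graph_iso_ball[OF iso sG H u(1)])
    note n = ball_iso_neighbours[OF sG H u(1) iso1 bverts_self[OF u(1), of 0], simplified]
    show ?thesis
      using n bounded_graphD(3-5)[OF G u(1)] u(2) bij_betw_finite[OF n(1)]
      by (auto simp: bij_betw_def)
  qed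
  ultimately show ?thesis using H by (simp add: bounded_graph_def)
qed

section \<open>Local functions are measurable\<close>

lemma class_eqI:
  assumes "sym r" "trans r" "(x, y) \<in> r"
  shows "r `` {x} = r `` {y}"
proof (intro set_eqI iffI)
  fix z assume "z \<in> r `` {x}"
  then show "z \<in> r `` {y}" using transD[OF assms(2) symD[OF assms(1,3)]] by simp
next
  fix z assume "z \<in> r `` {y}"
  then show "z \<in> r `` {x}" using transD[OF assms(2,3)] by simp
qed

lemma class_rep:
  assumes "(x, x) \<in> r" shows "(x, rep (r `` {x})) \<in> r"
  using someI[of "\<lambda>z. z \<in> r `` {x}" x] assms by (simp add: rep_def)

lemma sym_rooted_iso: "sym rooted_iso"
proof (rule symI)
  fix x y assume "(x, y) \<in> rooted_iso"
  then obtain G p H q \<phi> where xy: "x = (G, p)" "y = (H, q)" and *: "simple_graph G" "p \<in> verts G"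
    "simple_graph H" "q \<in> verts H" "graph_iso \<phi> G H" "\<phi> p = q"
    by (auto simp: rooted_iso_def)
  have "inv_into (verts G) \<phi> q = p"
    using * by (auto simp: graph_iso_def bij_betw_def)
  then show "(y, x) \<in> rooted_iso"
    using * graph_iso_sym[OF *(5)] by (auto simp: rooted_iso_def xy)
qed

lemma trans_rooted_iso: "trans rooted_iso"
proof (rule transI)
  fix x y z assume "(x, y) \<in> rooted_iso" "(y, z) \<in> rooted_iso"
  then obtain G p H q K r \<phi> \<psi> where xyz: "x = (G, p)" "y = (H, q)" "z = (K, r)" and
    *: "simple_graph G" "p \<in> verts G" "simple_graph K" "r \<in> verts K"
    "graph_iso \<phi> G H" "\<phi> p = q" "graph_iso \<psi> H K" "\<psi> q = r"
    by (auto simp: rooted_iso_def)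
  have "(\<psi> \<circ> \<phi>) p = r" using * by simp
  then show "(x, z) \<in> rooted_iso"
    using * graph_iso_trans[OF *(5,7)] unfolding xyz rooted_iso_def by blast
qed

lemma rooted_refl: "x \<in> rooted D \<Longrightarrow> (x, x) \<in> rooted_iso"
  using graph_iso_id(1) by (fastforce simp: rooted_def rooted_iso_def bounded_graph_def intro: exI[of _ id])

lemma rooted_iso_ball_iso:
  assumes "((G, p), (H, q)) \<in> rooted_iso"
  obtains \<phi> where "graph_iso \<phi> G H" "\<phi> p = q" "\<And>n. ball_iso \<phi> n G p H q"
proof -
  obtain \<phi> where *: "simple_graph G" "simple_graph H" "p \<in> verts G" "graph_iso \<phi> G H" "\<phi> p = q"
    using assms by (auto simp: rooted_iso_def)
  then show ?thesis using that[of \<phi>] graph_iso_ball[OF *(4,1,2,3)] by simp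
qed

lemma rooted_iso_rooted:
  assumes "(x, y) \<in> rooted_iso" "x \<in> rooted D" shows "y \<in> rooted D"
proof -
  obtain G p H q \<phi> where *: "x = (G, p)" "y = (H, q)" "graph_iso \<phi> G H" "simple_graph H" "q \<in> verts H"
    using assms(1) by (auto simp: rooted_iso_def)
  then show ?thesis using bounded_graph_iso[OF *(3,4)] assms(2) by (simp add: rooted_def)
qed

lemma rclass_eqI: "(x, y) \<in> rooted_iso \<Longrightarrow> rclass x = rclass y"
  unfolding rclass_def by (rule class_eqI[OF sym_rooted_iso trans_rooted_iso])

lemma rclass_eqD: "rclass x = rclass y \<Longrightarrow> x \<in> rooted D \<Longrightarrow> (x, y) \<in> rooted_iso"
  using rooted_refl[of x D] symD[OF sym_rooted_iso, of y x] unfolding rclass_def by blast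

lemma rooted_nbhd_subset: "rooted_nbhd D x n \<subseteq> rooted D // rooted_iso"
  by (cases x) (auto simp: rooted_nbhd_def rclass_def quotient_def)

lemma sets_rooted_space:
    "sets (rooted_space D) = sigma_sets (rooted D // rooted_iso) {rooted_nbhd D x n |x n. x \<in> rooted D}"
  and space_rooted_space: "space (rooted_space D) = rooted D // rooted_iso"
proof -
  have "{rooted_nbhd D x n |x n. x \<in> rooted D} \<subseteq> Pow (rooted D // rooted_iso)"
    using rooted_nbhd_subset by blast
  then show "sets (rooted_space D) = sigma_sets (rooted D // rooted_iso) {rooted_nbhd D x n |x n. x \<in> rooted D}"
    and "space (rooted_space D) = rooted D // rooted_iso"
    unfolding rooted_space_def by (rule sets_measure_of, rule space_measure_of)
qed

lemma rclass_in_space: "x \<in> rooted D \<Longrightarrow> rclass x \<in> space (rooted_space D)"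
  by (auto simp: space_rooted_space rclass_def quotient_def)

lemma rep_rclass:
  assumes "x \<in> rooted D" shows "(x, rep (rclass x)) \<in> rooted_iso"
  unfolding rclass_def by (rule class_rep[OF rooted_refl[OF assms]])

lemma rooted_space_cases:
  assumes "X \<in> space (rooted_space D)"
  obtains G p where "rep X = (G, p)" "(G, p) \<in> rooted D" "X = rclass (G, p)"
proof -
  obtain x where x: "x \<in> rooted D" "X = rclass x"
    using assms by (auto simp: space_rooted_space rclass_def quotient_def)
  obtain G p where r: "rep X = (G, p)" by fastforce
  have iso: "(x, (G, p)) \<in> rooted_iso" using rep_rclass[OF x(1)] unfolding x(2)[symmetric] r .
  show ?thesis
    by (rule that[OF r rooted_iso_rooted[OF iso x(1)]]) (simp only: x(2) rclass_eqI[OF iso])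
qed

lemma mem_rooted_nbhd:
  "X \<in> rooted_nbhd D (G, p) n
    \<longleftrightarrow> (\<exists>H q \<phi>. (H, q) \<in> rooted D \<and> X = rclass (H, q) \<and> ball_iso \<phi> n G p H q)"
  unfolding rooted_nbhd_def ball_iso_def split mem_Collect_eq by blast

lemma countable_finite_graphs:
  "countable {x :: graph \<times> nat. finite (fst (fst x)) \<and> finite (snd (fst x))}"
proof (rule countable_subset)
  show "{x :: graph \<times> nat. finite (fst (fst x)) \<and> finite (snd (fst x))}
      \<subseteq> (Collect finite \<times> Collect finite) \<times> UNIV" by auto
  show "countable (((Collect finite :: nat set set) \<times> (Collect finite :: (nat \<times> nat) set set)) \<times> (UNIV :: nat set))"
    by (intro countable_SIGMA countable_Collect_finite) auto
qed

lemma finite_graph_ball: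
  "bounded_graph D G \<Longrightarrow> p \<in> verts G \<Longrightarrow> finite (fst (graph_ball G p n)) \<and> finite (snd (graph_ball G p n))"
  by (auto simp: edges_graph_ball finite_bverts intro: finite_subset[where B="bverts G p n \<times> bverts G p n"])

lemma countable_rooted_nbhds: "countable {rooted_nbhd D x n |x. x \<in> rooted D}"
proof (rule countable_subset)
  define F where "F = (\<lambda>(B, p). {rclass (H, q) |H q. (H, q) \<in> rooted D
     \<and> (\<exists>\<phi>. graph_iso \<phi> B (graph_ball H q n) \<and> \<phi> p = q)})"
  let ?C = "{x :: graph \<times> nat. finite (fst (fst x)) \<and> finite (snd (fst x))}"
  show "{rooted_nbhd D x n |x. x \<in> rooted D} \<subseteq> F ` ?C"
  proof safe
    fix G p assume "(G, p) \<in> rooted D"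
    then have "(graph_ball G p n, p) \<in> ?C"
      using finite_graph_ball[of D G p n] by (simp add: rooted_def)
    moreover have "rooted_nbhd D (G, p) n = F (graph_ball G p n, p)"
      by (simp add: rooted_nbhd_def F_def)
    ultimately show "rooted_nbhd D (G, p) n \<in> F ` ?C"
      by (rule image_eqI[rotated])
  qed
  show "countable (F ` ?C)"
    by (intro countable_image countable_finite_graphs)
qed

text \<open>There are only countably many balls, so every function of the ball is measurable.\<close>

lemma rooted_local_measurable:
  fixes h :: "graph \<Rightarrow> nat \<Rightarrow> 'b"
  assumes local: "\<And>G p H q \<phi>. (G, p) \<in> rooted D \<Longrightarrow> (H, q) \<in> rooted D
    \<Longrightarrow> ball_iso \<phi> n G p H q \<Longrightarrow> h G p = h H q"
    and T: "space T = UNIV"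
  shows "(\<lambda>X. case rep X of (G, p) \<Rightarrow> h G p) \<in> measurable (rooted_space D) T"
proof (rule measurableI)
  fix A assume "A \<in> sets T"
  let ?S = "{rooted_nbhd D (G, p) n |G p. (G, p) \<in> rooted D \<and> h G p \<in> A}"
  have "(\<lambda>X. case rep X of (G, p) \<Rightarrow> h G p) -` A \<inter> space (rooted_space D) = \<Union>?S"
  proof (intro set_eqI iffI)
    fix X assume X: "X \<in> (\<lambda>X. case rep X of (G, p) \<Rightarrow> h G p) -` A \<inter> space (rooted_space D)"
    then obtain G p where G: "rep X = (G, p)" "(G, p) \<in> rooted D" "X = rclass (G, p)"
      using rooted_space_cases by blast
    have "X \<in> rooted_nbhd D (G, p) n" unfolding mem_rooted_nbhd using G(2,3) ball_iso_id by blast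
    moreover have "h G p \<in> A" using X G(1) by simp
    ultimately show "X \<in> \<Union>?S" using G(2) by blast
  next
    fix X assume "X \<in> \<Union>?S"
    then obtain G p where G: "(G, p) \<in> rooted D" "h G p \<in> A" "X \<in> rooted_nbhd D (G, p) n" by blast
    then obtain H q \<phi> where H: "(H, q) \<in> rooted D" "X = rclass (H, q)" "ball_iso \<phi> n G p H q"
      unfolding mem_rooted_nbhd by blast
    obtain K r where K: "rep X = (K, r)" by fastforce
    then have iso: "((H, q), (K, r)) \<in> rooted_iso"
      using rep_rclass[OF H(1)] unfolding H(2)[symmetric] by simp
    obtain \<psi> where "graph_iso \<psi> H K" "\<psi> q = r" and \<psi>: "\<And>n. ball_iso \<psi> n H q K r"
      using rooted_iso_ball_iso[OF iso] by metis
    have "h H q = h K r" by (rule local[OF H(1) rooted_iso_rooted[OF iso H(1)] \<psi>])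
    moreover have "h G p = h H q" by (rule local[OF G(1) H(1,3)])
    ultimately show "X \<in> (\<lambda>X. case rep X of (G, p) \<Rightarrow> h G p) -` A \<inter> space (rooted_space D)"
      using G(2) K H rclass_in_space by auto
  qed
  moreover have "countable ?S"
    by (rule countable_subset[OF _ countable_rooted_nbhds[of D n]]) blast
  moreover have "?S \<subseteq> sets (rooted_space D)" unfolding sets_rooted_space
    by (intro subsetI sigma_sets.Basic) blast
  ultimately show "(\<lambda>X. case rep X of (G, p) \<Rightarrow> h G p) -` A \<inter> space (rooted_space D) \<in> sets (rooted_space D)"
    by (simp only: sets.countable_Union)
qed (simp add: T)

subsection \<open>Doubly rooted graphs\<close>

lemma sym_birooted_iso: "sym birooted_iso"
proof (rule symI)
  fix x y assume "(x, y) \<in> birooted_iso"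
  then obtain G p p' H q q' \<phi> where xy: "x = (G, p, p')" "y = (H, q, q')" and *: "simple_graph G" "p \<in> verts G"
    "p' \<in> verts G" "simple_graph H" "q \<in> verts H" "q' \<in> verts H" "graph_iso \<phi> G H" "\<phi> p = q" "\<phi> p' = q'"
    by (auto simp: birooted_iso_def)
  have "inv_into (verts G) \<phi> q = p" "inv_into (verts G) \<phi> q' = p'"
    using * by (auto simp: graph_iso_def bij_betw_def)
  then show "(y, x) \<in> birooted_iso"
    using * graph_iso_sym[OF *(7)] by (auto simp: birooted_iso_def xy)
qed

lemma trans_birooted_iso: "trans birooted_iso"
proof (rule transI)
  fix x y z assume "(x, y) \<in> birooted_iso" "(y, z) \<in> birooted_iso"
  then obtain G p p' H q q' K r r' \<phi> \<psi> where xyz: "x = (G, p, p')" "y = (H, q, q')" "z = (K, r, r')" and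
    *: "simple_graph G" "p \<in> verts G" "p' \<in> verts G" "simple_graph K" "r \<in> verts K" "r' \<in> verts K"
    "graph_iso \<phi> G H" "\<phi> p = q" "\<phi> p' = q'" "graph_iso \<psi> H K" "\<psi> q = r" "\<psi> q' = r'"
    by (auto simp: birooted_iso_def)
  have "(\<psi> \<circ> \<phi>) p = r" "(\<psi> \<circ> \<phi>) p' = r'" using * by simp_all
  then show "(x, z) \<in> birooted_iso"
    using * graph_iso_trans[OF *(7,10)] unfolding xyz birooted_iso_def by blast
qed

lemma birooted_refl: "x \<in> birooted D \<Longrightarrow> (x, x) \<in> birooted_iso"
  using graph_iso_id(1) by (fastforce simp: birooted_def birooted_iso_def bounded_graph_def intro: exI[of _ id])

lemma birooted_iso_ball_iso:
  assumes "((G, p, p'), (H, q, q')) \<in> birooted_iso"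
  obtains \<phi> where "\<And>n. ball_iso \<phi> n G p H q" "\<phi> p' = q'"
proof -
  obtain \<phi> where *: "simple_graph G" "simple_graph H" "p \<in> verts G" "graph_iso \<phi> G H" "\<phi> p = q"
    "\<phi> p' = q'" using assms by (auto simp: birooted_iso_def)
  then show ?thesis using that[of \<phi>] graph_iso_ball[OF *(4,1,2,3)] by simp
qed

lemma birooted_iso_birooted:
  assumes "(x, y) \<in> birooted_iso" "x \<in> birooted D" shows "y \<in> birooted D"
proof -
  obtain G p p' H q q' \<phi> where *: "x = (G, p, p')" "y = (H, q, q')" "graph_iso \<phi> G H"
    "simple_graph H" "q \<in> verts H" "q' \<in> verts H"
    using assms(1) by (auto simp: birooted_iso_def)
  then show ?thesis using bounded_graph_iso[OF *(3,4)] assms(2) by (simp add: birooted_def)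
qed

lemma birooted_nbhd_subset: "birooted_nbhd D x n \<subseteq> birooted D // birooted_iso"
  by (cases x) (auto simp: birooted_nbhd_def bclass_def quotient_def)

lemma sets_birooted_space:
    "sets (birooted_space D) = sigma_sets (birooted D // birooted_iso)
      {birooted_nbhd D (G, p, p') n |G p p' n. (G, p, p') \<in> birooted D \<and> p' \<in> verts (graph_ball G p n)}"
  and space_birooted_space: "space (birooted_space D) = birooted D // birooted_iso"
proof -
  have "{birooted_nbhd D (G, p, p') n |G p p' n. (G, p, p') \<in> birooted D \<and> p' \<in> verts (graph_ball G p n)}
      \<subseteq> Pow (birooted D // birooted_iso)" using birooted_nbhd_subset by blast
  then show "sets (birooted_space D) = sigma_sets (birooted D // birooted_iso)
      {birooted_nbhd D (G, p, p') n |G p p' n. (G, p, p') \<in> birooted D \<and> p' \<in> verts (graph_ball G p n)}"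
    and "space (birooted_space D) = birooted D // birooted_iso"
    unfolding birooted_space_def by (rule sets_measure_of, rule space_measure_of)
qed

lemma mem_birooted_nbhd:
  "X \<in> birooted_nbhd D (G, p, p') n \<longleftrightarrow> (\<exists>H q q' \<phi>. (H, q, q') \<in> birooted D
    \<and> X = bclass (H, q, q') \<and> ball_iso \<phi> n G p H q \<and> \<phi> p' = q')"
  unfolding birooted_nbhd_def ball_iso_def split mem_Collect_eq by blast

lemma rep_bclass:
  assumes "x \<in> birooted D" shows "(x, rep (bclass x)) \<in> birooted_iso"
  unfolding bclass_def by (rule class_rep[OF birooted_refl[OF assms]])

lemma birooted_space_cases:
  assumes "X \<in> space (birooted_space D)"
  obtains G p p' where "rep X = (G, p, p')" "(G, p, p') \<in> birooted D" "X = bclass (G, p, p')"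
proof -
  obtain x where x: "x \<in> birooted D" "X = bclass x"
    using assms by (auto simp: space_birooted_space bclass_def quotient_def)
  obtain G p p' where r: "rep X = (G, p, p')" by (metis prod_cases3)
  have iso: "(x, (G, p, p')) \<in> birooted_iso" using rep_bclass[OF x(1)] unfolding x(2)[symmetric] r .
  then have "bclass x = bclass (G, p, p')"
    unfolding bclass_def by (rule class_eqI[OF sym_birooted_iso trans_birooted_iso])
  then show ?thesis
    by (intro that[OF r birooted_iso_birooted[OF iso x(1)]]) (simp only: x(2))
qed

lemma countable_birooted_nbhds: "countable {birooted_nbhd D x n |x. x \<in> birooted D}"
proof (rule countable_subset)
  define F where "F = (\<lambda>((B, p), p'). {bclass (H, q, q') |H q q'. (H, q, q') \<in> birooted D
     \<and> (\<exists>\<phi>. graph_iso \<phi> B (graph_ball H q n) \<and> \<phi> p = q \<and> \<phi> p' = q')})"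
  let ?C = "{x :: graph \<times> nat. finite (fst (fst x)) \<and> finite (snd (fst x))} \<times> (UNIV :: nat set)"
  show "{birooted_nbhd D x n |x. x \<in> birooted D} \<subseteq> F ` ?C"
  proof safe
    fix G p p' assume "(G, p, p') \<in> birooted D"
    then have "((graph_ball G p n, p), p') \<in> ?C"
      using finite_graph_ball[of D G p n] by (simp add: birooted_def)
    moreover have "birooted_nbhd D (G, p, p') n = F ((graph_ball G p n, p), p')"
      by (simp add: birooted_nbhd_def F_def)
    ultimately show "birooted_nbhd D (G, p, p') n \<in> F ` ?C"
      by (rule image_eqI[rotated])
  qed
  show "countable (F ` ?C)"
    by (intro countable_image countable_SIGMA countable_finite_graphs) auto
qed

text \<open>
  As for one root, but the \<open>\<sigma>\<close>-algebra has generators only for radii whose ball contains the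
  second root. So \<open>h\<close> must vanish when the second root is outside the ball; sets that contain
  the value 0 are handled by their complements.
\<close>

lemma birooted_local_measurable:
  fixes h :: "graph \<Rightarrow> nat \<Rightarrow> nat \<Rightarrow> real"
  assumes local: "\<And>G p p' H q q' \<phi>. (G, p, p') \<in> birooted D \<Longrightarrow> (H, q, q') \<in> birooted D
      \<Longrightarrow> ball_iso \<phi> n G p H q \<Longrightarrow> p' \<in> bverts G p n \<Longrightarrow> \<phi> p' = q' \<Longrightarrow> h G p p' = h H q q'"
    and supp: "\<And>G p p'. (G, p, p') \<in> birooted D \<Longrightarrow> p' \<notin> bverts G p n \<Longrightarrow> h G p p' = 0"
  shows "(\<lambda>X. case rep X of (G, p, p') \<Rightarrow> h G p p') \<in> borel_measurable (birooted_space D)"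
proof -
  let ?h = "\<lambda>X. case rep X of (G, p, p') \<Rightarrow> h G p p'"
  let ?M = "birooted_space D"
  have without_0: "?h -` A \<inter> space ?M \<in> sets ?M" if A: "0 \<notin> A" for A
  proof -
    let ?S = "{birooted_nbhd D (G, p, p') n |G p p'. (G, p, p') \<in> birooted D \<and> h G p p' \<in> A}"
    have "?h -` A \<inter> space ?M = \<Union>?S"
    proof (intro set_eqI iffI)
      fix X assume X: "X \<in> ?h -` A \<inter> space ?M"
      then obtain G p p' where G: "rep X = (G, p, p')" "(G, p, p') \<in> birooted D" "X = bclass (G, p, p')"
        using birooted_space_cases by blast
      have "X \<in> birooted_nbhd D (G, p, p') n"
        unfolding mem_birooted_nbhd using G(2,3) ball_iso_id by blast
      moreover have "h G p p' \<in> A" using X G(1) by simp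
      ultimately show "X \<in> \<Union>?S" using G(2) by blast
    next
      fix X assume "X \<in> \<Union>?S"
      then obtain G p p' where G: "(G, p, p') \<in> birooted D" "h G p p' \<in> A"
        "X \<in> birooted_nbhd D (G, p, p') n" by blast
      then obtain H q q' \<phi> where H: "(H, q, q') \<in> birooted D" "X = bclass (H, q, q')"
        "ball_iso \<phi> n G p H q" "\<phi> p' = q'" unfolding mem_birooted_nbhd by blast
      have p': "p' \<in> bverts G p n" using supp[OF G(1)] G(2) A by metis
      have q': "q' \<in> bverts H q n" using bij_betwE[OF ball_iso_bij[OF H(3)]] p' H(4) by blast
      have hG: "h G p p' = h H q q'" by (rule local[OF G(1) H(1,3) p' H(4)])
      obtain K r r' where K: "rep X = (K, r, r')" by (metis prod_cases3)
      then have iso: "((H, q, q'), (K, r, r')) \<in> birooted_iso"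
        using rep_bclass[OF H(1)] unfolding H(2)[symmetric] by simp
      obtain \<psi> where \<psi>: "\<And>n. ball_iso \<psi> n H q K r" "\<psi> q' = r'"
        using birooted_iso_ball_iso[OF iso] by metis
      have "h H q q' = h K r r'"
        by (rule local[OF H(1) birooted_iso_birooted[OF iso H(1)] \<psi>(1) q' \<psi>(2)])
      then show "X \<in> ?h -` A \<inter> space ?M"
        using G(2) hG K birooted_nbhd_subset[of D "(G, p, p')" n] G(3) by (auto simp: space_birooted_space)
    qed
    moreover have "countable ?S"
      by (rule countable_subset[OF _ countable_birooted_nbhds[of D n]]) blast
    moreover have "?S \<subseteq> sets ?M"
    proof
      fix U assume "U \<in> ?S"
      then obtain G p p' where G: "(G, p, p') \<in> birooted D" "h G p p' \<in> A" "U = birooted_nbhd D (G, p, p') n"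
        by blast
      have "p' \<in> bverts G p n" using supp[OF G(1)] G(2) A by metis
      then show "U \<in> sets ?M" unfolding sets_birooted_space using G by (intro sigma_sets.Basic) blast
    qed
    ultimately show ?thesis by (simp only: sets.countable_Union)
  qed
  show ?thesis
  proof (rule measurableI)
    fix A :: "real set" assume "A \<in> sets borel"
    show "?h -` A \<inter> space ?M \<in> sets ?M"
    proof (cases "0 \<in> A")
      case True
      have "?h -` A \<inter> space ?M = space ?M - (?h -` (- A) \<inter> space ?M)" by auto
      then show ?thesis using without_0[of "- A"] True by simp
    qed (rule without_0)
  qed simp
qed

section \<open>The space of labelled graphs\<close>

lemma sym_labelled_iso: "sym labelled_iso"
proof (rule symI)
  fix x y assume "(x, y) \<in> labelled_iso"
  then obtain G \<xi> p H \<eta> q \<phi> where xy: "x = (G, \<xi>, p)" "y = (H, \<eta>, q)" and *: "simple_graph G" "p \<in> verts G"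
    "\<xi> \<in> verts G \<rightarrow>\<^sub>E {0..1}" "simple_graph H" "q \<in> verts H" "\<eta> \<in> verts H \<rightarrow>\<^sub>E {0..1}"
    "graph_iso \<phi> G H" "\<phi> p = q" "\<forall>v\<in>verts G. \<eta> (\<phi> v) = \<xi> v"
    by (auto simp: labelled_iso_def)
  let ?\<psi> = "inv_into (verts G) \<phi>"
  have b: "bij_betw \<phi> (verts G) (verts H)" using *(7) by (simp add: graph_iso_def)
  have 1: "?\<psi> q = p" using bij_betw_inv_into_left[OF b *(2)] *(8) by simp
  have 2: "\<xi> (?\<psi> w) = \<eta> w" if w: "w \<in> verts H" for w
  proof -
    have "?\<psi> w \<in> verts G" using bij_betwE[OF bij_betw_inv_into[OF b]] w by blast
    then have "\<eta> (\<phi> (?\<psi> w)) = \<xi> (?\<psi> w)" using *(9) by blast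
    then show ?thesis using bij_betw_inv_into_right[OF b w] by simp
  qed
  show "(y, x) \<in> labelled_iso"
    unfolding xy labelled_iso_def mem_Collect_eq split
    by (intro conjI exI[of _ ?\<psi>] ballI graph_iso_sym * 1 2)
qed

lemma trans_labelled_iso: "trans labelled_iso"
proof (rule transI)
  fix x y z assume xy: "(x, y) \<in> labelled_iso" and yz: "(y, z) \<in> labelled_iso"
  obtain G \<xi> p where x: "x = (G, \<xi>, p)" by (metis prod_cases3)
  obtain H \<eta> q where y: "y = (H, \<eta>, q)" by (metis prod_cases3)
  obtain K \<zeta> r where z: "z = (K, \<zeta>, r)" by (metis prod_cases3)
  obtain \<phi> where *: "simple_graph G" "p \<in> verts G" "\<xi> \<in> verts G \<rightarrow>\<^sub>E {0..1}"
    "graph_iso \<phi> G H" "\<phi> p = q" "\<forall>v\<in>verts G. \<eta> (\<phi> v) = \<xi> v"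
    using xy unfolding x y labelled_iso_def mem_Collect_eq split by blast
  obtain \<psi> where **: "simple_graph K" "r \<in> verts K" "\<zeta> \<in> verts K \<rightarrow>\<^sub>E {0..1}"
    "graph_iso \<psi> H K" "\<psi> q = r" "\<forall>v\<in>verts H. \<zeta> (\<psi> v) = \<eta> v"
    using yz unfolding y z labelled_iso_def mem_Collect_eq split by blast
  have b: "bij_betw \<phi> (verts G) (verts H)" using *(4) by (simp add: graph_iso_def)
  have "(\<psi> \<circ> \<phi>) p = r" using *(5) **(5) by simp
  moreover have "\<forall>v\<in>verts G. \<zeta> ((\<psi> \<circ> \<phi>) v) = \<xi> v"
    using *(6) **(6) bij_betwE[OF b] by simp
  ultimately show "(x, z) \<in> labelled_iso"
    unfolding x z labelled_iso_def mem_Collect_eq split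
    by (intro conjI exI[of _ "\<psi> \<circ> \<phi>"] graph_iso_trans[OF *(4) **(4)] * **)
qed

lemma labelled_refl: "x \<in> labelled D \<Longrightarrow> (x, x) \<in> labelled_iso"
  using graph_iso_id(1)
  by (fastforce simp: labelled_def labelled_iso_def bounded_graph_def intro: exI[of _ id])

lemma labelled_iso_ball_iso:
  assumes "((G, \<xi>, p), (H, \<eta>, q)) \<in> labelled_iso"
  obtains \<phi> where "graph_iso \<phi> G H" "\<phi> p = q" "\<And>n. ball_iso \<phi> n G p H q" "\<And>v. v \<in> verts G \<Longrightarrow> \<eta> (\<phi> v) = \<xi> v"
proof -
  obtain \<phi> where *: "simple_graph G" "simple_graph H" "p \<in> verts G" "graph_iso \<phi> G H" "\<phi> p = q"
    "\<forall>v\<in>verts G. \<eta> (\<phi> v) = \<xi> v"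
    using assms by (auto simp: labelled_iso_def)
  show ?thesis
  proof (rule that[OF *(4,5)])
    show "ball_iso \<phi> n G p H q" for n using graph_iso_ball[OF *(4,1,2,3), of n] *(5) by simp
  qed (use *(6) in blast)
qed

lemma labelled_iso_labelled:
  assumes "(x, y) \<in> labelled_iso" "x \<in> labelled D" shows "y \<in> labelled D"
proof -
  obtain G \<xi> p H \<eta> q \<phi> where *: "x = (G, \<xi>, p)" "y = (H, \<eta>, q)" "graph_iso \<phi> G H" "simple_graph H" "q \<in> verts H"
    "\<eta> \<in> verts H \<rightarrow>\<^sub>E {0..1}"
    using assms(1) by (auto simp: labelled_iso_def)
  then show ?thesis using bounded_graph_iso[OF *(3,4)] assms(2) by (simp add: labelled_def)
qed

lemma labelledD:
  assumes "(G, \<xi>, p) \<in> labelled D"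
  shows "bounded_graph D G" "simple_graph G" "p \<in> verts G" "\<xi> \<in> verts G \<rightarrow>\<^sub>E {0..1}"
  using assms bounded_graphD(1)[of D G] by (simp_all add: labelled_def)

lemma lclass_eqI: "(x, y) \<in> labelled_iso \<Longrightarrow> lclass x = lclass y"
  unfolding lclass_def by (rule class_eqI[OF sym_labelled_iso trans_labelled_iso])

lemma lclass_eqD: "lclass x = lclass y \<Longrightarrow> x \<in> labelled D \<Longrightarrow> (x, y) \<in> labelled_iso"
  using labelled_refl[of x D] symD[OF sym_labelled_iso, of y x] unfolding lclass_def by blast

lemma rep_lclass:
  assumes "x \<in> labelled D" shows "(x, rep (lclass x)) \<in> labelled_iso"
  unfolding lclass_def by (rule class_rep[OF labelled_refl[OF assms]])

lemma labelled_nbhd_subset: "labelled_nbhd D x n \<epsilon> \<subseteq> labelled D // labelled_iso"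
  by (cases x) (auto simp: labelled_nbhd_def lclass_def quotient_def)

lemma sets_labelled_space:
    "sets (labelled_space D) = sigma_sets (labelled D // labelled_iso)
      {labelled_nbhd D x n \<epsilon> |x n \<epsilon>. x \<in> labelled D \<and> 0 < \<epsilon>}"
  and space_labelled_space: "space (labelled_space D) = labelled D // labelled_iso"
proof -
  have "{labelled_nbhd D x n \<epsilon> |x n \<epsilon>. x \<in> labelled D \<and> 0 < \<epsilon>} \<subseteq> Pow (labelled D // labelled_iso)"
    using labelled_nbhd_subset by blast
  then show "sets (labelled_space D) = sigma_sets (labelled D // labelled_iso)
      {labelled_nbhd D x n \<epsilon> |x n \<epsilon>. x \<in> labelled D \<and> 0 < \<epsilon>}"
    and "space (labelled_space D) = labelled D // labelled_iso"
    unfolding labelled_space_def by (rule sets_measure_of, rule space_measure_of)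
qed

lemma lclass_in_space: "x \<in> labelled D \<Longrightarrow> lclass x \<in> space (labelled_space D)"
  by (auto simp: space_labelled_space lclass_def quotient_def)

lemma labelled_space_cases:
  assumes "X \<in> space (labelled_space D)"
  obtains G \<xi> p where "rep X = (G, \<xi>, p)" "(G, \<xi>, p) \<in> labelled D" "X = lclass (G, \<xi>, p)"
proof -
  obtain x where x: "x \<in> labelled D" "X = lclass x"
    using assms by (auto simp: space_labelled_space lclass_def quotient_def)
  obtain G \<xi> p where r: "rep X = (G, \<xi>, p)" by (metis prod_cases3)
  have iso: "(x, (G, \<xi>, p)) \<in> labelled_iso" using rep_lclass[OF x(1)] unfolding x(2)[symmetric] r .
  show ?thesis
    by (rule that[OF r labelled_iso_labelled[OF iso x(1)]]) (simp only: x(2) lclass_eqI[OF iso])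
qed

lemma mem_labelled_nbhd:
  "X \<in> labelled_nbhd D (G, \<xi>, p) n \<epsilon> \<longleftrightarrow> (\<exists>H \<eta> q \<phi>. (H, \<eta>, q) \<in> labelled D \<and> X = lclass (H, \<eta>, q)
    \<and> ball_iso \<phi> n G p H q \<and> (\<forall>v\<in>bverts G p n. \<bar>\<eta> (\<phi> v) - \<xi> v\<bar> < \<epsilon>))"
  unfolding labelled_nbhd_def ball_iso_def split mem_Collect_eq by blast

lemma lclass_mem_nbhd:
  assumes K: "(K, \<zeta>, r) \<in> labelled D"
  shows "lclass (K, \<zeta>, r) \<in> labelled_nbhd D (G, \<xi>, p) n \<epsilon>
    \<longleftrightarrow> (\<exists>\<phi>. ball_iso \<phi> n G p K r \<and> (\<forall>v\<in>bverts G p n. \<bar>\<zeta> (\<phi> v) - \<xi> v\<bar> < \<epsilon>))"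
proof
  assume "lclass (K, \<zeta>, r) \<in> labelled_nbhd D (G, \<xi>, p) n \<epsilon>"
  then obtain H \<eta> q \<phi> where H: "(H, \<eta>, q) \<in> labelled D" "lclass (K, \<zeta>, r) = lclass (H, \<eta>, q)"
    "ball_iso \<phi> n G p H q" "\<forall>v\<in>bverts G p n. \<bar>\<eta> (\<phi> v) - \<xi> v\<bar> < \<epsilon>"
    unfolding mem_labelled_nbhd by blast
  obtain \<psi> where \<psi>: "ball_iso \<psi> n H q K r" "\<And>v. v \<in> verts H \<Longrightarrow> \<zeta> (\<psi> v) = \<eta> v"
    using labelled_iso_ball_iso[OF lclass_eqD[OF H(2)[symmetric] H(1)]] by metis
  have "\<zeta> ((\<psi> \<circ> \<phi>) v) = \<eta> (\<phi> v)" if "v \<in> bverts G p n" for v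
    using \<psi>(2)[of "\<phi> v"] bij_betwE[OF ball_iso_bij[OF H(3)]] that bverts_subset[of H q n] by auto
  then show "\<exists>\<phi>. ball_iso \<phi> n G p K r \<and> (\<forall>v\<in>bverts G p n. \<bar>\<zeta> (\<phi> v) - \<xi> v\<bar> < \<epsilon>)"
    using ball_iso_trans[OF H(3) \<psi>(1)] H(4) by (intro exI[of _ "\<psi> \<circ> \<phi>"]) simp
qed (use K mem_labelled_nbhd in blast)

lemma labelled_nbhd_sets: "x \<in> labelled D \<Longrightarrow> 0 < \<epsilon> \<Longrightarrow> labelled_nbhd D x n \<epsilon> \<in> sets (labelled_space D)"
  unfolding sets_labelled_space by (rule sigma_sets.Basic) blast

lemma labelled_nbhd_mono:
  assumes x: "(G, \<xi>, p) \<in> labelled D" and n: "n \<le> n'" and e: "\<epsilon>' \<le> \<epsilon>"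
  shows "labelled_nbhd D (G, \<xi>, p) n' \<epsilon>' \<subseteq> labelled_nbhd D (G, \<xi>, p) n \<epsilon>"
proof
  fix X assume "X \<in> labelled_nbhd D (G, \<xi>, p) n' \<epsilon>'"
  then obtain H \<eta> q \<phi> where H: "(H, \<eta>, q) \<in> labelled D" "X = lclass (H, \<eta>, q)"
    "ball_iso \<phi> n' G p H q" "\<forall>v\<in>bverts G p n'. \<bar>\<eta> (\<phi> v) - \<xi> v\<bar> < \<epsilon>'"
    unfolding mem_labelled_nbhd by blast
  have "ball_iso \<phi> n G p H q"
    by (rule ball_iso_mono[OF labelledD(2)[OF x] labelledD(2)[OF H(1)] labelledD(3)[OF x] H(3) n])
  moreover have "\<bar>\<eta> (\<phi> v) - \<xi> v\<bar> < \<epsilon>" if "v \<in> bverts G p n" for v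
    using bspec[OF H(4) subsetD[OF bverts_mono[OF n] that]] e by linarith
  ultimately show "X \<in> labelled_nbhd D (G, \<xi>, p) n \<epsilon>"
    unfolding mem_labelled_nbhd using H(1,2) by blast
qed

subsection \<open>Open sets\<close>

text \<open>
  The local topology. It serves to prove measurability: preimages of basic neighbourhoods are
  easily seen to be open, but are not basic neighbourhoods themselves.
\<close>

definition labelled_open :: "nat \<Rightarrow> lgraph set set set" where
  "labelled_open D = {A. A \<subseteq> space (labelled_space D) \<and> (\<forall>G \<xi> p. (G, \<xi>, p) \<in> labelled D
     \<longrightarrow> lclass (G, \<xi>, p) \<in> A \<longrightarrow> (\<exists>n \<delta>. 0 < \<delta> \<and> labelled_nbhd D (G, \<xi>, p) n \<delta> \<subseteq> A))}"

lemma labelled_openD: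
  assumes "A \<in> labelled_open D" "(G, \<xi>, p) \<in> labelled D" "lclass (G, \<xi>, p) \<in> A"
  obtains n \<delta> where "0 < \<delta>" "labelled_nbhd D (G, \<xi>, p) n \<delta> \<subseteq> A"
  using assms unfolding labelled_open_def by blast

lemma labelled_openI:
  assumes "A \<subseteq> space (labelled_space D)"
    and "\<And>G \<xi> p. (G, \<xi>, p) \<in> labelled D \<Longrightarrow> lclass (G, \<xi>, p) \<in> A
      \<Longrightarrow> \<exists>n \<delta>. 0 < \<delta> \<and> labelled_nbhd D (G, \<xi>, p) n \<delta> \<subseteq> A"
  shows "A \<in> labelled_open D"
  using assms unfolding labelled_open_def by blast

text \<open>
  Rounding the labels down to multiples of \<open>1 / m\<close> leaves only countably many neighbourhoods of a
  given radius, and these form a base.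
\<close>

definition grid :: "nat \<Rightarrow> graph \<Rightarrow> (nat \<Rightarrow> real) \<Rightarrow> nat \<Rightarrow> real" where
  "grid m G \<xi> = (\<lambda>v\<in>verts G. of_int \<lfloor>real m * \<xi> v\<rfloor> / real m)"

lemma grid_labelled:
  assumes "(G, \<xi>, p) \<in> labelled D" "0 < m" shows "(G, grid m G \<xi>, p) \<in> labelled D"
proof -
  have "of_int \<lfloor>real m * \<xi> v\<rfloor> / real m \<in> {0..1}" if "v \<in> verts G" for v
  proof -
    have xi: "0 \<le> \<xi> v" "\<xi> v \<le> 1" using labelledD(4)[OF assms(1)] that by (auto simp: PiE_iff)
    have "of_int \<lfloor>real m * \<xi> v\<rfloor> \<le> real m * \<xi> v" by simp
    also have "\<dots> \<le> real m" using mult_left_mono[OF xi(2), of "real m"] by simp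
    finally have "of_int \<lfloor>real m * \<xi> v\<rfloor> / real m \<le> 1" using assms(2) by simp
    moreover have "0 \<le> \<lfloor>real m * \<xi> v\<rfloor>" using xi by simp
    ultimately show ?thesis by simp
  qed
  then show ?thesis using assms(1) by (simp add: labelled_def grid_def)
qed

lemma grid_close:
  assumes "0 < m" "v \<in> verts G" shows "\<bar>\<xi> v - grid m G \<xi> v\<bar> < 1 / real m"
proof -
  have "of_int \<lfloor>real m * \<xi> v\<rfloor> \<le> real m * \<xi> v" "real m * \<xi> v < of_int \<lfloor>real m * \<xi> v\<rfloor> + 1"
    by simp_all
  then have "of_int \<lfloor>real m * \<xi> v\<rfloor> / real m \<le> \<xi> v" "\<xi> v < (of_int \<lfloor>real m * \<xi> v\<rfloor> + 1) / real m"
    using assms(1) by (simp_all add: pos_divide_le_eq pos_less_divide_eq mult.commute)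
  then show ?thesis using assms by (simp add: grid_def add_divide_distrib abs_real_def)
qed

lemma countable_grid_nbhds:
  "countable {labelled_nbhd D (G, grid m G \<xi>, p) n \<epsilon> |G \<xi> p. (G, \<xi>, p) \<in> labelled D}"
proof (rule countable_subset)
  define F where "F = (\<lambda>((B, p), J :: (nat \<times> int) set). {lclass (H, \<eta>, q) |H \<eta> q. (H, \<eta>, q) \<in> labelled D
     \<and> (\<exists>\<phi>. graph_iso \<phi> B (graph_ball H q n) \<and> \<phi> p = q
          \<and> (\<forall>va\<in>J. \<bar>\<eta> (\<phi> (fst va)) - of_int (snd va) / real m\<bar> < \<epsilon>))})"
  let ?C = "{x :: graph \<times> nat. finite (fst (fst x)) \<and> finite (snd (fst x))} \<times> (Collect finite :: (nat \<times> int) set set)"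
  show "{labelled_nbhd D (G, grid m G \<xi>, p) n \<epsilon> |G \<xi> p. (G, \<xi>, p) \<in> labelled D} \<subseteq> F ` ?C"
  proof
    fix U assume "U \<in> {labelled_nbhd D (G, grid m G \<xi>, p) n \<epsilon> |G \<xi> p. (G, \<xi>, p) \<in> labelled D}"
    then obtain G \<xi> p where U: "U = labelled_nbhd D (G, grid m G \<xi>, p) n \<epsilon>" "(G, \<xi>, p) \<in> labelled D" by blast
    define J where "J = (\<lambda>v. (v, \<lfloor>real m * \<xi> v\<rfloor>)) ` bverts G p n"
    have "((graph_ball G p n, p), J) \<in> ?C"
      using finite_graph_ball[OF labelledD(1,3)[OF U(2)], of n] by (simp add: J_def)
    moreover have "(\<forall>va\<in>J. \<bar>\<eta> (\<phi> (fst va)) - of_int (snd va) / real m\<bar> < \<epsilon>)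
        \<longleftrightarrow> (\<forall>v\<in>bverts G p n. \<bar>\<eta> (\<phi> v) - grid m G \<xi> v\<bar> < \<epsilon>)" for \<eta> :: "nat \<Rightarrow> real" and \<phi>
      using bverts_subset[of G p n] by (auto simp: J_def grid_def subset_iff)
    then have "U = F ((graph_ball G p n, p), J)"
      unfolding U(1) labelled_nbhd_def F_def split by simp
    ultimately show "U \<in> F ` ?C" by (rule image_eqI[rotated])
  qed
  show "countable (F ` ?C)"
    by (intro countable_image countable_SIGMA countable_finite_graphs countable_Collect_finite)
qed

lemma labelled_open_sets:
  assumes A: "A \<in> labelled_open D" shows "A \<in> sets (labelled_space D)"
proof -
  define \<B> where "\<B> = (\<Union>m n. {labelled_nbhd D (G, grid (Suc m) G \<xi>, p) n (1 / real (Suc m)) |G \<xi> p.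
    (G, \<xi>, p) \<in> labelled D})"
  have cB: "countable \<B>" unfolding \<B>_def by (intro countable_UN countableI_type countable_grid_nbhds)
  have sB: "\<B> \<subseteq> sets (labelled_space D)"
  proof
    fix U assume "U \<in> \<B>"
    then obtain m n G \<xi> p where U: "U = labelled_nbhd D (G, grid (Suc m) G \<xi>, p) n (1 / real (Suc m))"
      "(G, \<xi>, p) \<in> labelled D" unfolding \<B>_def by blast
    show "U \<in> sets (labelled_space D)"
      unfolding U(1) by (intro labelled_nbhd_sets grid_labelled[OF U(2)]) simp_all
  qed
  \<comment> \<open>The radius and the rounding error of the labels are both \<open>1 / (m + 1)\<close>; their sum has to stay
      below \<open>\<delta>\<close>.\<close>
  have eq: "A = \<Union>{U \<in> \<B>. U \<subseteq> A}"
  proof (intro set_eqI iffI)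
    fix X assume X: "X \<in> A"
    then have "X \<in> space (labelled_space D)" using A unfolding labelled_open_def by blast
    then obtain G \<xi> p where G: "(G, \<xi>, p) \<in> labelled D" "X = lclass (G, \<xi>, p)"
      by (rule labelled_space_cases)
    obtain n \<delta> where nd: "0 < \<delta>" "labelled_nbhd D (G, \<xi>, p) n \<delta> \<subseteq> A"
      by (rule labelled_openD[OF A G(1) X[unfolded G(2)]])
    obtain m where "1 / real (Suc m) < \<delta> / 2"
      using reals_Archimedean[of "\<delta> / 2"] nd(1) by (auto simp: inverse_eq_divide)
    then have m: "2 * (1 / real (Suc m)) < \<delta>" by linarith
    let ?U = "labelled_nbhd D (G, grid (Suc m) G \<xi>, p) n (1 / real (Suc m))"
    have close: "\<bar>\<xi> v - grid (Suc m) G \<xi> v\<bar> < 1 / real (Suc m)" if "v \<in> bverts G p n" for v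
      using grid_close[of "Suc m" v G \<xi>] that bverts_subset[of G p n] by auto
    have "X \<in> ?U"
      unfolding G(2) lclass_mem_nbhd[OF G(1)] using ball_iso_id close by blast
    moreover have "?U \<subseteq> labelled_nbhd D (G, \<xi>, p) n \<delta>"
    proof
      fix Y assume "Y \<in> ?U"
      then obtain H \<eta> q \<phi> where H: "(H, \<eta>, q) \<in> labelled D" "Y = lclass (H, \<eta>, q)"
        "ball_iso \<phi> n G p H q" "\<forall>v\<in>bverts G p n. \<bar>\<eta> (\<phi> v) - grid (Suc m) G \<xi> v\<bar> < 1 / real (Suc m)"
        unfolding mem_labelled_nbhd by blast
      have "\<bar>\<eta> (\<phi> v) - \<xi> v\<bar> < \<delta>" if v: "v \<in> bverts G p n" for v
        using bspec[OF H(4) v] close[OF v] m by linarith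
      then show "Y \<in> labelled_nbhd D (G, \<xi>, p) n \<delta>"
        unfolding mem_labelled_nbhd using H(1,2,3) by blast
    qed
    moreover have "?U \<in> \<B>" unfolding \<B>_def using G(1) by blast
    ultimately show "X \<in> \<Union>{U \<in> \<B>. U \<subseteq> A}" using nd(2) by blast
  qed blast
  have c: "countable {U \<in> \<B>. U \<subseteq> A}" by (rule countable_subset[OF _ cB]) blast
  have s: "{U \<in> \<B>. U \<subseteq> A} \<subseteq> sets (labelled_space D)" using sB by blast
  show ?thesis by (subst eq) (rule sets.countable_Union[OF c s])
qed

text \<open>
  The strict inequalities hold at finitely many vertices, which leaves a margin.
\<close>

lemma labelled_nbhd_open:
  assumes x: "(G, \<xi>, p) \<in> labelled D"
  shows "labelled_nbhd D (G, \<xi>, p) n \<epsilon> \<in> labelled_open D"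
proof (rule labelled_openI)
  show "labelled_nbhd D (G, \<xi>, p) n \<epsilon> \<subseteq> space (labelled_space D)"
    unfolding space_labelled_space by (rule labelled_nbhd_subset)
  fix K \<zeta> r assume K: "(K, \<zeta>, r) \<in> labelled D" and "lclass (K, \<zeta>, r) \<in> labelled_nbhd D (G, \<xi>, p) n \<epsilon>"
  then obtain \<phi> where \<phi>: "ball_iso \<phi> n G p K r" "\<forall>v\<in>bverts G p n. \<bar>\<zeta> (\<phi> v) - \<xi> v\<bar> < \<epsilon>"
    unfolding lclass_mem_nbhd[OF K] by blast
  let ?S = "(\<lambda>v. \<bar>\<zeta> (\<phi> v) - \<xi> v\<bar>) ` bverts G p n"
  have fin: "finite ?S" "?S \<noteq> {}"
    using finite_bverts[OF labelledD(1,3)[OF x], of n] bverts_self[OF labelledD(3)[OF x], of n] by auto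
  define \<delta> where "\<delta> = \<epsilon> - Max ?S"
  have "0 < \<delta>" unfolding \<delta>_def using Max_in[OF fin] \<phi>(2) by auto
  moreover have "labelled_nbhd D (K, \<zeta>, r) n \<delta> \<subseteq> labelled_nbhd D (G, \<xi>, p) n \<epsilon>"
  proof
    fix Y assume "Y \<in> labelled_nbhd D (K, \<zeta>, r) n \<delta>"
    then obtain H \<eta> q \<psi> where H: "(H, \<eta>, q) \<in> labelled D" "Y = lclass (H, \<eta>, q)"
      "ball_iso \<psi> n K r H q" "\<forall>v\<in>bverts K r n. \<bar>\<eta> (\<psi> v) - \<zeta> v\<bar> < \<delta>"
      unfolding mem_labelled_nbhd by blast
    have "\<bar>\<eta> ((\<psi> \<circ> \<phi>) v) - \<xi> v\<bar> < \<epsilon>" if v: "v \<in> bverts G p n" for v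
    proof -
      have "\<phi> v \<in> bverts K r n" using bij_betwE[OF ball_iso_bij[OF \<phi>(1)]] v by blast
      then have "\<bar>\<eta> (\<psi> (\<phi> v)) - \<zeta> (\<phi> v)\<bar> < \<delta>" using H(4) by blast
      moreover have "\<bar>\<zeta> (\<phi> v) - \<xi> v\<bar> \<le> Max ?S" using fin v by (intro Max_ge) auto
      ultimately show ?thesis unfolding \<delta>_def o_def by linarith
    qed
    then show "Y \<in> labelled_nbhd D (G, \<xi>, p) n \<epsilon>"
      unfolding mem_labelled_nbhd using H(1,2) ball_iso_trans[OF \<phi>(1) H(3)] by blast
  qed
  ultimately show "\<exists>n' \<delta>. 0 < \<delta> \<and> labelled_nbhd D (K, \<zeta>, r) n' \<delta> \<subseteq> labelled_nbhd D (G, \<xi>, p) n \<epsilon>" by blast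
qed

lemma space_labelled_open: "space (labelled_space D) \<in> labelled_open D"
proof (rule labelled_openI)
  fix G \<xi> p assume "(G, \<xi>, p) \<in> labelled D"
  show "\<exists>n \<delta>. 0 < \<delta> \<and> labelled_nbhd D (G, \<xi>, p) n \<delta> \<subseteq> space (labelled_space D)"
    unfolding space_labelled_space using labelled_nbhd_subset by (intro exI[of _ 0] exI[of _ 1]) simp
qed simp

lemma labelled_open_Int:
  assumes A: "A \<in> labelled_open D" and B: "B \<in> labelled_open D"
  shows "A \<inter> B \<in> labelled_open D"
proof (rule labelled_openI)
  show "A \<inter> B \<subseteq> space (labelled_space D)" using A unfolding labelled_open_def by blast
  fix G \<xi> p assume G: "(G, \<xi>, p) \<in> labelled D" "lclass (G, \<xi>, p) \<in> A \<inter> B"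
  obtain n \<delta> where 1: "0 < \<delta>" "labelled_nbhd D (G, \<xi>, p) n \<delta> \<subseteq> A"
    using labelled_openD[OF A G(1)] G(2) by blast
  obtain n' \<delta>' where 2: "0 < \<delta>'" "labelled_nbhd D (G, \<xi>, p) n' \<delta>' \<subseteq> B"
    using labelled_openD[OF B G(1)] G(2) by blast
  have "labelled_nbhd D (G, \<xi>, p) (max n n') (min \<delta> \<delta>') \<subseteq> A \<inter> B"
    using labelled_nbhd_mono[OF G(1), of n "max n n'" "min \<delta> \<delta>'" \<delta>]
      labelled_nbhd_mono[OF G(1), of n' "max n n'" "min \<delta> \<delta>'" \<delta>'] 1(2) 2(2) by auto
  moreover have "0 < min \<delta> \<delta>'" using 1(1) 2(1) by simp
  ultimately show "\<exists>n \<delta>. 0 < \<delta> \<and> labelled_nbhd D (G, \<xi>, p) n \<delta> \<subseteq> A \<inter> B" by blast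
qed

lemma labelled_open_subset: "labelled_open D \<subseteq> Pow (space (labelled_space D))"
  unfolding labelled_open_def by blast

lemma sets_labelled_space_open:
  "sets (labelled_space D) = sigma_sets (space (labelled_space D)) (labelled_open D)"
proof (rule antisym)
  show "sets (labelled_space D) \<subseteq> sigma_sets (space (labelled_space D)) (labelled_open D)"
    unfolding sets_labelled_space space_labelled_space
  proof (rule sigma_sets_mono', rule subsetI)
    fix U assume "U \<in> {labelled_nbhd D x n \<epsilon> |x n \<epsilon>. x \<in> labelled D \<and> 0 < \<epsilon>}"
    then obtain x n \<epsilon> where "U = labelled_nbhd D x n \<epsilon>" "x \<in> labelled D" by blast
    then show "U \<in> labelled_open D" using labelled_nbhd_open by (metis prod_cases3)
  qed
  show "sigma_sets (space (labelled_space D)) (labelled_open D) \<subseteq> sets (labelled_space D)"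
    using labelled_open_sets by (intro sets.sigma_sets_subset) blast
qed

subsection \<open>Local sets\<close>

text \<open>
  Events that are determined by the ball of radius \<open>n\<close> with its exact labels. They form a
  generating \<open>\<pi>\<close>-system, and their probability given the graph depends only on the ball without
  labels.
\<close>

definition local_sets :: "nat \<Rightarrow> nat \<Rightarrow> lgraph set set set" where
  "local_sets D n = {A \<in> sets (labelled_space D). \<forall>G \<xi> p H \<eta> q \<phi>. (G, \<xi>, p) \<in> labelled D
     \<longrightarrow> (H, \<eta>, q) \<in> labelled D \<longrightarrow> ball_iso \<phi> n G p H q \<longrightarrow> (\<forall>v\<in>bverts G p n. \<eta> (\<phi> v) = \<xi> v)
     \<longrightarrow> (lclass (G, \<xi>, p) \<in> A \<longleftrightarrow> lclass (H, \<eta>, q) \<in> A)}"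

lemma local_sets_measurable: "A \<in> local_sets D n \<Longrightarrow> A \<in> sets (labelled_space D)"
  by (simp add: local_sets_def)

lemma local_setsD:
  assumes "A \<in> local_sets D n" "(G, \<xi>, p) \<in> labelled D" "(H, \<eta>, q) \<in> labelled D" "ball_iso \<phi> n G p H q"
    "\<And>v. v \<in> bverts G p n \<Longrightarrow> \<eta> (\<phi> v) = \<xi> v"
  shows "lclass (G, \<xi>, p) \<in> A \<longleftrightarrow> lclass (H, \<eta>, q) \<in> A"
  using assms unfolding local_sets_def by blast

lemma local_setsI:
  assumes "A \<in> sets (labelled_space D)"
    and "\<And>G \<xi> p H \<eta> q \<phi>. (G, \<xi>, p) \<in> labelled D \<Longrightarrow> (H, \<eta>, q) \<in> labelled D \<Longrightarrow> ball_iso \<phi> n G p H q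
      \<Longrightarrow> (\<And>v. v \<in> bverts G p n \<Longrightarrow> \<eta> (\<phi> v) = \<xi> v) \<Longrightarrow> lclass (G, \<xi>, p) \<in> A \<longleftrightarrow> lclass (H, \<eta>, q) \<in> A"
  shows "A \<in> local_sets D n"
  unfolding local_sets_def mem_Collect_eq by (intro conjI allI impI assms) blast+

lemma local_sets_mono:
  assumes "n \<le> N" shows "local_sets D n \<subseteq> local_sets D N"
proof
  fix A assume A: "A \<in> local_sets D n"
  show "A \<in> local_sets D N"
  proof (rule local_setsI[OF local_sets_measurable[OF A]])
    fix G \<xi> p H \<eta> q \<phi>
    assume G: "(G, \<xi>, p) \<in> labelled D" and H: "(H, \<eta>, q) \<in> labelled D" and iso: "ball_iso \<phi> N G p H q"
      and lab: "\<And>v. v \<in> bverts G p N \<Longrightarrow> \<eta> (\<phi> v) = \<xi> v"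
    have "ball_iso \<phi> n G p H q"
      by (rule ball_iso_mono[OF labelledD(2)[OF G] labelledD(2)[OF H] labelledD(3)[OF G] iso assms])
    then show "lclass (G, \<xi>, p) \<in> A \<longleftrightarrow> lclass (H, \<eta>, q) \<in> A"
      using local_setsD[OF A G H] lab subsetD[OF bverts_mono[OF assms]] by blast
  qed
qed

lemma labelled_nbhd_local:
  assumes x: "(K, \<zeta>, r) \<in> labelled D" and e: "0 < \<epsilon>"
  shows "labelled_nbhd D (K, \<zeta>, r) n \<epsilon> \<in> local_sets D n"
proof (rule local_setsI[OF labelled_nbhd_sets[OF x e]])
  fix G \<xi> p H \<eta> q \<phi>
  assume G: "(G, \<xi>, p) \<in> labelled D" and H: "(H, \<eta>, q) \<in> labelled D" and iso: "ball_iso \<phi> n G p H q"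
    and lab: "\<And>v. v \<in> bverts G p n \<Longrightarrow> \<eta> (\<phi> v) = \<xi> v"
  have half: "\<exists>\<omega>. ball_iso \<omega> n K r H q \<and> (\<forall>v\<in>bverts K r n. \<bar>\<eta> (\<omega> v) - \<zeta> v\<bar> < \<epsilon>)"
    if iso: "ball_iso \<phi> n G p H q" and lab: "\<And>v. v \<in> bverts G p n \<Longrightarrow> \<eta> (\<phi> v) = \<xi> v"
      and ex: "\<exists>\<omega>. ball_iso \<omega> n K r G p \<and> (\<forall>v\<in>bverts K r n. \<bar>\<xi> (\<omega> v) - \<zeta> v\<bar> < \<epsilon>)"
    for G H p q \<phi> and \<xi> \<eta> :: "nat \<Rightarrow> real"
  proof -
    obtain \<omega> where \<omega>: "ball_iso \<omega> n K r G p" "\<forall>v\<in>bverts K r n. \<bar>\<xi> (\<omega> v) - \<zeta> v\<bar> < \<epsilon>" using ex by blast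
    have "\<eta> ((\<phi> \<circ> \<omega>) v) = \<xi> (\<omega> v)" if "v \<in> bverts K r n" for v
      using lab bij_betwE[OF ball_iso_bij[OF \<omega>(1)]] that by simp
    then show ?thesis using ball_iso_trans[OF \<omega>(1) iso] \<omega>(2) by (intro exI[of _ "\<phi> \<circ> \<omega>"]) simp
  qed
  note p = labelledD(3)[OF G]
  note bij = ball_iso_bij[OF iso]
  have lab': "\<xi> (inv_into (bverts G p n) \<phi> w) = \<eta> w" if w: "w \<in> bverts H q n" for w
    using lab[OF bij_betw_apply[OF bij_betw_inv_into[OF bij] w]] bij_betw_inv_into_right[OF bij w] by simp
  show "lclass (G, \<xi>, p) \<in> labelled_nbhd D (K, \<zeta>, r) n \<epsilon> \<longleftrightarrow> lclass (H, \<eta>, q) \<in> labelled_nbhd D (K, \<zeta>, r) n \<epsilon>"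
    unfolding lclass_mem_nbhd[OF G] lclass_mem_nbhd[OF H]
  proof
    assume ex: "\<exists>\<omega>. ball_iso \<omega> n K r G p \<and> (\<forall>v\<in>bverts K r n. \<bar>\<xi> (\<omega> v) - \<zeta> v\<bar> < \<epsilon>)"
    show "\<exists>\<omega>. ball_iso \<omega> n K r H q \<and> (\<forall>v\<in>bverts K r n. \<bar>\<eta> (\<omega> v) - \<zeta> v\<bar> < \<epsilon>)"
      by (rule half[of \<phi> G p H q \<eta> \<xi>, OF iso _ ex]) (rule lab)
  next
    assume ex: "\<exists>\<omega>. ball_iso \<omega> n K r H q \<and> (\<forall>v\<in>bverts K r n. \<bar>\<eta> (\<omega> v) - \<zeta> v\<bar> < \<epsilon>)"
    show "\<exists>\<omega>. ball_iso \<omega> n K r G p \<and> (\<forall>v\<in>bverts K r n. \<bar>\<xi> (\<omega> v) - \<zeta> v\<bar> < \<epsilon>)"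
      by (rule half[of "inv_into (bverts G p n) \<phi>" H q G p \<xi> \<eta>, OF ball_iso_sym[OF iso p] _ ex])
        (rule lab')
  qed
qed

lemma local_sets_Int: "A \<in> local_sets D n \<Longrightarrow> B \<in> local_sets D n \<Longrightarrow> A \<inter> B \<in> local_sets D n"
  unfolding local_sets_def mem_Collect_eq Int_iff by (intro conjI sets.Int) blast+

lemma local_sets_Int_stable: "Int_stable (\<Union>n. local_sets D n)"
proof (rule Int_stableI)
  fix A B assume "A \<in> (\<Union>n. local_sets D n)" "B \<in> (\<Union>n. local_sets D n)"
  then obtain m n where "A \<in> local_sets D m" "B \<in> local_sets D n" by blast
  then have "A \<in> local_sets D (max m n)" "B \<in> local_sets D (max m n)"
    using local_sets_mono[of m "max m n" D] local_sets_mono[of n "max m n" D] by auto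
  then show "A \<inter> B \<in> (\<Union>n. local_sets D n)" using local_sets_Int by blast
qed

lemma space_local_sets: "space (labelled_space D) \<in> local_sets D n"
  by (rule local_setsI) (simp_all add: lclass_in_space)

lemma local_sets_subset: "(\<Union>n. local_sets D n) \<subseteq> Pow (space (labelled_space D))"
  using local_sets_measurable sets.sets_into_space by blast

lemma sets_labelled_space_local:
  "sets (labelled_space D) = sigma_sets (space (labelled_space D)) (\<Union>n. local_sets D n)"
proof (rule antisym)
  show "sets (labelled_space D) \<subseteq> sigma_sets (space (labelled_space D)) (\<Union>n. local_sets D n)"
    unfolding sets_labelled_space space_labelled_space
  proof (rule sigma_sets_mono', rule subsetI)
    fix U assume "U \<in> {labelled_nbhd D x n \<epsilon> |x n \<epsilon>. x \<in> labelled D \<and> 0 < \<epsilon>}"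
    then obtain x n \<epsilon> where U: "U = labelled_nbhd D x n \<epsilon>" "x \<in> labelled D" "0 < \<epsilon>" by blast
    obtain K \<zeta> r where "x = (K, \<zeta>, r)" by (metis prod_cases3)
    then have "U \<in> local_sets D n" using labelled_nbhd_local U by simp
    then show "U \<in> (\<Union>n. local_sets D n)" by blast
  qed
  show "sigma_sets (space (labelled_space D)) (\<Union>n. local_sets D n) \<subseteq> sets (labelled_space D)"
    using local_sets_measurable by (intro sets.sigma_sets_subset) blast
qed

subsection \<open>The walk on the space of labelled graphs\<close>

text \<open>
  Neighbours are vertices of the chosen representative, not classes, so that two neighbours with
  isomorphic labelled graphs still count twice.
\<close>

definition nbrs :: "lgraph set \<Rightarrow> nat set" where
  "nbrs X = (case rep X of (G, \<xi>, p) \<Rightarrow> edges G `` {p})"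

definition move_root :: "lgraph set \<Rightarrow> nat \<Rightarrow> lgraph set" where
  "move_root X p' = (case rep X of (G, \<xi>, p) \<Rightarrow> lclass (G, \<xi>, p'))"

lemma labelled_move: "(G, \<xi>, p) \<in> labelled D \<Longrightarrow> p' \<in> verts G \<Longrightarrow> (G, \<xi>, p') \<in> labelled D"
  by (simp add: labelled_def)

lemma neighbour_verts: "(G, \<xi>, p) \<in> labelled D \<Longrightarrow> p' \<in> edges G `` {p} \<Longrightarrow> p' \<in> verts G"
  using simple_graph_edge labelledD(2) by blast

lemma nbrs_finite_walk: "finite_walk (labelled_space D) nbrs move_root"
proof
  fix X assume "X \<in> space (labelled_space D)"
  then obtain G \<xi> p where G: "rep X = (G, \<xi>, p)" "(G, \<xi>, p) \<in> labelled D" by (rule labelled_space_cases)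
  show "finite (nbrs X)" "nbrs X \<noteq> {}"
    unfolding nbrs_def G(1) using bounded_graphD(3,4)[OF labelledD(1)[OF G(2)] labelledD(3)[OF G(2)]] by auto
  show "move_root X i \<in> space (labelled_space D)" if "i \<in> nbrs X" for i
  proof -
    have "i \<in> verts G" using neighbour_verts[OF G(2)] that unfolding nbrs_def G(1) by simp
    then show ?thesis unfolding move_root_def G(1) split by (intro lclass_in_space labelled_move[OF G(2)])
  qed
qed

text \<open>
  The choice of the representative does not matter up to a bijection of the neighbours.
\<close>

lemma nbrs_lclass:
  assumes x: "(G, \<xi>, p) \<in> labelled D"
  obtains \<phi> where "bij_betw \<phi> (edges G `` {p}) (nbrs (lclass (G, \<xi>, p)))"
    "\<And>p'. p' \<in> edges G `` {p} \<Longrightarrow> move_root (lclass (G, \<xi>, p)) (\<phi> p') = lclass (G, \<xi>, p')"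
proof -
  obtain H \<eta> q where H: "rep (lclass (G, \<xi>, p)) = (H, \<eta>, q)" by (metis prod_cases3)
  have iso: "((G, \<xi>, p), (H, \<eta>, q)) \<in> labelled_iso" using rep_lclass[OF x] unfolding H .
  have xH: "(H, \<eta>, q) \<in> labelled D" by (rule labelled_iso_labelled[OF iso x])
  obtain \<phi> where \<phi>: "graph_iso \<phi> G H" "\<phi> p = q" "\<And>n. ball_iso \<phi> n G p H q" "\<And>v. v \<in> verts G \<Longrightarrow> \<eta> (\<phi> v) = \<xi> v"
    using labelled_iso_ball_iso[OF iso] by metis
  show ?thesis
  proof (rule that)
    show "bij_betw \<phi> (edges G `` {p}) (nbrs (lclass (G, \<xi>, p)))"
      using ball_iso_neighbours(1)[OF labelledD(2)[OF x] labelledD(2)[OF xH] labelledD(3)[OF x] \<phi>(3)[of 1]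
          bverts_self[OF labelledD(3)[OF x], of 0]] \<phi>(2)
      unfolding nbrs_def H by simp
    fix p' assume "p' \<in> edges G `` {p}"
    then have p': "p' \<in> verts G" by (rule neighbour_verts[OF x])
    then have "\<phi> p' \<in> verts H" using \<phi>(1) unfolding graph_iso_def by (auto dest: bij_betwE)
    then have "((G, \<xi>, p'), (H, \<eta>, \<phi> p')) \<in> labelled_iso"
      using \<phi>(1,4) p' labelledD[OF x] labelledD[OF xH] unfolding labelled_iso_def by blast
    then show "move_root (lclass (G, \<xi>, p)) (\<phi> p') = lclass (G, \<xi>, p')"
      unfolding move_root_def H split by (rule lclass_eqI[symmetric])
  qed
qed

lemma card_nbrs_lclass:
  assumes "(G, \<xi>, p) \<in> labelled D" shows "card (nbrs (lclass (G, \<xi>, p))) = deg (edges G) p"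
  by (rule nbrs_lclass[OF assms]) (simp add: deg_def bij_betw_same_card[symmetric])

lemma sum_nbrs_lclass:
  assumes "(G, \<xi>, p) \<in> labelled D"
  shows "(\<Sum>i\<in>nbrs (lclass (G, \<xi>, p)). f (move_root (lclass (G, \<xi>, p)) i))
    = (\<Sum>p'\<in>edges G `` {p}. f (lclass (G, \<xi>, p')))"
proof (rule nbrs_lclass[OF assms])
  fix \<phi> assume b: "bij_betw \<phi> (edges G `` {p}) (nbrs (lclass (G, \<xi>, p)))"
    and m: "\<And>p'. p' \<in> edges G `` {p} \<Longrightarrow> move_root (lclass (G, \<xi>, p)) (\<phi> p') = lclass (G, \<xi>, p')"
  show ?thesis unfolding sum.reindex_bij_betw[OF b, symmetric] by (intro sum.cong refl) (simp only: m)
qed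

lemma count_nbrs_lclass:
  assumes x: "(G, \<xi>, p) \<in> labelled D"
  shows "card {i \<in> nbrs (lclass (G, \<xi>, p)). move_root (lclass (G, \<xi>, p)) i \<in> A}
    = card {p' \<in> edges G `` {p}. lclass (G, \<xi>, p') \<in> A}"
proof -
  interpret finite_walk "labelled_space D" nbrs move_root by (rule nbrs_finite_walk)
  have "(\<Sum>i\<in>nbrs (lclass (G, \<xi>, p)). if move_root (lclass (G, \<xi>, p)) i \<in> A then 1 else 0 :: nat)
      = (\<Sum>p'\<in>edges G `` {p}. if lclass (G, \<xi>, p') \<in> A then 1 else 0)"
    by (rule sum_nbrs_lclass[OF x])
  then show ?thesis
    using N_finite[OF lclass_in_space[OF x]] bounded_graphD(4)[OF labelledD(1)[OF x] labelledD(3)[OF x]]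
    by (simp add: sum.If_cases Int_def conj_commute)
qed

text \<open>
  If \<open>k\<close> neighbours of the root lie in an open set, then so do the corresponding neighbours in
  every labelled graph that agrees sufficiently far and closely.
\<close>

lemma open_neighbour_count:
  assumes A: "A \<in> labelled_open D"
  shows "{X \<in> space (labelled_space D). k \<le> card {i \<in> nbrs X. move_root X i \<in> A}} \<in> labelled_open D"
    (is "?U \<in> _")
proof (rule labelled_openI)
  fix G \<xi> p assume x: "(G, \<xi>, p) \<in> labelled D" and "lclass (G, \<xi>, p) \<in> ?U"
  define S where "S = {p' \<in> edges G `` {p}. lclass (G, \<xi>, p') \<in> A}"
  have k: "k \<le> card S"
    using \<open>lclass (G, \<xi>, p) \<in> ?U\<close> by (simp add: S_def count_nbrs_lclass[OF x])
  have fS: "finite S"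
    by (rule finite_subset[OF _ bounded_graphD(4)[OF labelledD(1)[OF x] labelledD(3)[OF x]]])
      (auto simp: S_def)
  have S: "(G, \<xi>, p') \<in> labelled D" "p' \<in> bverts G p (Suc 0)" "lclass (G, \<xi>, p') \<in> A" "(p, p') \<in> edges G"
    if "p' \<in> S" for p'
    using that labelled_move[OF x neighbour_verts[OF x]] neighbour_in_bverts[OF labelledD(2)[OF x]]
    unfolding S_def by blast+
  have "\<forall>p'\<in>S. \<exists>n \<delta>. 0 < \<delta> \<and> labelled_nbhd D (G, \<xi>, p') n \<delta> \<subseteq> A"
    using A S(1,3) unfolding labelled_open_def by blast
  then obtain n \<delta> where nd: "\<And>p'. p' \<in> S \<Longrightarrow> 0 < \<delta> p' \<and> labelled_nbhd D (G, \<xi>, p') (n p') (\<delta> p') \<subseteq> A"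
    by metis
  define N where "N = Max (insert 0 (n ` S))"
  define d where "d = Min (insert 1 (\<delta> ` S))"
  have N: "n p' \<le> N" if "p' \<in> S" for p' unfolding N_def using fS that by (intro Max_ge) auto
  have d: "d \<le> \<delta> p'" if "p' \<in> S" for p' unfolding d_def using fS that by (intro Min_le) auto
  have d0: "0 < d" unfolding d_def using fS nd by (subst Min_gr_iff) auto
  have "labelled_nbhd D (G, \<xi>, p) (Suc N) d \<subseteq> ?U"
  proof
    fix Y assume "Y \<in> labelled_nbhd D (G, \<xi>, p) (Suc N) d"
    then obtain H \<eta> q \<phi> where H: "(H, \<eta>, q) \<in> labelled D" "Y = lclass (H, \<eta>, q)"
      "ball_iso \<phi> (Suc N) G p H q" "\<forall>v\<in>bverts G p (Suc N). \<bar>\<eta> (\<phi> v) - \<xi> v\<bar> < d"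
      unfolding mem_labelled_nbhd by blast
    note GH = labelledD(2)[OF x] labelledD(2)[OF H(1)] labelledD(3)[OF x]
    have nb: "bij_betw \<phi> (edges G `` {p}) (edges H `` {q})"
      using ball_iso_neighbours(1)[OF GH H(3) bverts_self[OF GH(3), of 0]] H(3)
      by (simp add: ball_iso_def)
    have img: "\<phi> p' \<in> {q' \<in> edges H `` {q}. lclass (H, \<eta>, q') \<in> A}" if p': "p' \<in> S" for p'
    proof -
      have e: "\<phi> p' \<in> edges H `` {q}" using bij_betwE[OF nb] S(4)[OF p'] by blast
      have iso: "ball_iso \<phi> N G p' H (\<phi> p')"
        by (rule ball_iso_at[OF GH H(3) S(2)[OF p']]) simp
      have sub: "bverts G p' N \<subseteq> bverts G p (Suc N)"
        using bverts_trans[OF S(2)[OF p'], of _ N] by auto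
      have "lclass (H, \<eta>, \<phi> p') \<in> labelled_nbhd D (G, \<xi>, p') N d"
        unfolding mem_labelled_nbhd
        using labelled_move[OF H(1) neighbour_verts[OF H(1) e]] iso H(4) sub by blast
      then have "lclass (H, \<eta>, \<phi> p') \<in> A"
        using labelled_nbhd_mono[OF S(1)[OF p'] N[OF p'] d[OF p']] nd[OF p'] by blast
      then show ?thesis using e by simp
    qed
    have "inj_on \<phi> S" using nb S_def unfolding bij_betw_def by (auto elim: inj_on_subset)
    then have "card S = card (\<phi> ` S)" by (rule card_image[symmetric])
    also have "\<dots> \<le> card {q' \<in> edges H `` {q}. lclass (H, \<eta>, q') \<in> A}"
      by (rule card_mono[OF finite_subset[OF _ bounded_graphD(4)[OF labelledD(1)[OF H(1)] labelledD(3)[OF H(1)]]]])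
        (use img in auto)
    finally show "Y \<in> ?U"
      using k lclass_in_space[OF H(1)] unfolding H(2) by (simp add: count_nbrs_lclass[OF H(1)])
  qed
  then show "\<exists>n \<delta>. 0 < \<delta> \<and> labelled_nbhd D (G, \<xi>, p) n \<delta> \<subseteq> ?U" using d0 by blast
qed blast

lemma open_neighbour_count_measurable:
  assumes B: "B \<in> labelled_open D"
  shows "(\<lambda>X. card {i \<in> nbrs X. move_root X i \<in> B}) \<in> measurable (labelled_space D) (count_space UNIV)"
proof (rule measurable_count_space_eq2_countable[THEN iffD2], intro conjI ballI)
  fix k :: nat
  let ?c = "\<lambda>X. card {i \<in> nbrs X. move_root X i \<in> B}"
  have "?c -` {k} \<inter> space (labelled_space D)
      = {X \<in> space (labelled_space D). k \<le> ?c X} - {X \<in> space (labelled_space D). Suc k \<le> ?c X}" by auto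
  then show "?c -` {k} \<inter> space (labelled_space D) \<in> sets (labelled_space D)"
    using labelled_open_sets[OF open_neighbour_count[OF B, of k]]
      labelled_open_sets[OF open_neighbour_count[OF B, of "Suc k"]] by (simp only: sets.Diff)
qed simp_all

lemma card_nbrs_measurable: "(\<lambda>X. card (nbrs X)) \<in> measurable (labelled_space D) (count_space UNIV)"
proof (rule measurable_cong[THEN iffD1, OF _ open_neighbour_count_measurable[OF space_labelled_open]])
  fix X assume X: "X \<in> space (labelled_space D)"
  have "{i \<in> nbrs X. move_root X i \<in> space (labelled_space D)} = nbrs X"
    using finite_walk.step[OF nbrs_finite_walk X] by blast
  then show "card {i \<in> nbrs X. move_root X i \<in> space (labelled_space D)} = card (nbrs X)" by simp
qed

lemma nbrs_count_measurable:
  assumes "A \<in> sets (labelled_space D)"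
  shows "(\<lambda>X. real (card {i \<in> nbrs X. move_root X i \<in> A}) / real (card (nbrs X)))
    \<in> borel_measurable (labelled_space D)"
proof -
  interpret finite_walk "labelled_space D" nbrs move_root by (rule nbrs_finite_walk)
  show ?thesis
  proof (rule count_measurable_generated[OF sets_labelled_space_open _ labelled_open_subset
        space_labelled_open _ assms])
    show "Int_stable (labelled_open D)" by (intro Int_stableI labelled_open_Int)
    fix B assume B: "B \<in> labelled_open D"
    show "(\<lambda>X. real (card {i \<in> nbrs X. move_root X i \<in> B})) \<in> borel_measurable (labelled_space D)"
      using open_neighbour_count_measurable[OF B] by measurable
  qed
qed

section \<open>Independent labels\<close>

abbreviation unif :: "real measure" where
  "unif \<equiv> restrict_space lborel {0..1}"

definition label_measure :: "graph \<Rightarrow> (nat \<Rightarrow> real) measure" where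
  "label_measure G = PiM (verts G) (\<lambda>_. unif)"

lemma space_unif: "space unif = {0..1}"
  by (simp add: space_restrict_space)

lemma prob_space_unif: "prob_space unif"
  by (rule prob_spaceI) (simp add: space_unif emeasure_restrict_space)

lemma space_label_measure: "space (label_measure G) = verts G \<rightarrow>\<^sub>E {0..1}"
  by (simp add: label_measure_def space_PiM space_unif)

lemma prob_space_label_measure: "prob_space (label_measure G)"
  unfolding label_measure_def by (intro prob_space_PiM prob_space_unif)

lemma label_component_measurable:
  assumes "v \<in> I" shows "(\<lambda>\<xi>. \<xi> v) \<in> borel_measurable (PiM I (\<lambda>_. unif))"
  by (rule measurable_compose[OF measurable_component_singleton[OF assms] measurable_restrict_space1]) simp

lemma labelled_iff: "(G, \<xi>, p) \<in> labelled D \<longleftrightarrow> (G, p) \<in> rooted D \<and> \<xi> \<in> space (label_measure G)"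
  by (auto simp: labelled_def rooted_def space_label_measure)

lemma ball_iso_cong:
  assumes "ball_iso \<phi> n G p H q" "p \<in> verts G" "\<And>v. v \<in> bverts G p n \<Longrightarrow> \<psi> v = \<phi> v"
  shows "ball_iso \<psi> n G p H q"
proof -
  have "bij_betw \<psi> (bverts G p n) (bverts H q n)"
    using ball_iso_bij[OF assms(1)] bij_betw_cong[of "bverts G p n" \<psi> \<phi>] assms(3) by blast
  then show ?thesis
    using assms bverts_self[OF assms(2), of n] by (simp add: ball_iso_def graph_iso_def)
qed

text \<open>
  A basic neighbourhood pulls back to the labellings of \<open>G\<close> that are close to the given labels
  along one of the finitely many isomorphisms between the balls.
\<close>

lemma lclass_measurable:
  assumes x: "(G, p) \<in> rooted D"
  shows "(\<lambda>\<xi>. lclass (G, \<xi>, p)) \<in> measurable (label_measure G) (labelled_space D)"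
proof (rule measurable_sigma_sets[OF sets_labelled_space])
  show "{labelled_nbhd D x n \<epsilon> |x n \<epsilon>. x \<in> labelled D \<and> 0 < \<epsilon>} \<subseteq> Pow (labelled D // labelled_iso)"
    using labelled_nbhd_subset by blast
  show "(\<lambda>\<xi>. lclass (G, \<xi>, p)) \<in> space (label_measure G) \<rightarrow> labelled D // labelled_iso"
    using lclass_in_space x unfolding space_labelled_space[symmetric] by (auto simp: labelled_iff)
  fix U assume "U \<in> {labelled_nbhd D x n \<epsilon> |x n \<epsilon>. x \<in> labelled D \<and> 0 < \<epsilon>}"
  then obtain y n \<epsilon> where y: "y \<in> labelled D" "U = labelled_nbhd D y n \<epsilon>" by blast
  obtain H \<eta> q where H: "y = (H, \<eta>, q)" by (metis prod_cases3)
  note yH = y(1)[unfolded H]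
  have fH: "finite (bverts H q n)" by (rule finite_bverts[OF labelledD(1,3)[OF yH]])
  have G: "bounded_graph D G" "p \<in> verts G" using x by (auto simp: rooted_def)
  have fG: "finite (bverts G p n)" by (rule finite_bverts[OF G])
  define \<Phi> where "\<Phi> = {\<phi> \<in> bverts H q n \<rightarrow>\<^sub>E bverts G p n. ball_iso \<phi> n H q G p}"
  have fPhi: "finite \<Phi>" unfolding \<Phi>_def using fH fG by (simp add: finite_PiE)
  have "(\<lambda>\<xi>. lclass (G, \<xi>, p)) -` U \<inter> space (label_measure G)
      = (\<Union>\<phi>\<in>\<Phi>. {\<xi> \<in> space (label_measure G). \<forall>v\<in>bverts H q n. \<bar>\<xi> (\<phi> v) - \<eta> v\<bar> < \<epsilon>})" (is "?L = ?R")
  proof (intro set_eqI iffI)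
    fix \<xi> assume \<xi>: "\<xi> \<in> ?L"
    then have L: "(G, \<xi>, p) \<in> labelled D" using x by (simp add: labelled_iff)
    obtain \<phi> where \<phi>: "ball_iso \<phi> n H q G p" "\<forall>v\<in>bverts H q n. \<bar>\<xi> (\<phi> v) - \<eta> v\<bar> < \<epsilon>"
      using \<xi> unfolding y(2) H vimage_def Int_iff mem_Collect_eq lclass_mem_nbhd[OF L] by blast
    let ?\<psi> = "restrict \<phi> (bverts H q n)"
    have "ball_iso ?\<psi> n H q G p" by (rule ball_iso_cong[OF \<phi>(1) labelledD(3)[OF yH]]) simp
    moreover have "?\<psi> \<in> bverts H q n \<rightarrow>\<^sub>E bverts G p n"
      using bij_betwE[OF ball_iso_bij[OF \<phi>(1)]] by auto
    ultimately have "?\<psi> \<in> \<Phi>" unfolding \<Phi>_def by blast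
    moreover have "\<xi> \<in> {\<xi> \<in> space (label_measure G). \<forall>v\<in>bverts H q n. \<bar>\<xi> (?\<psi> v) - \<eta> v\<bar> < \<epsilon>}"
      using \<xi> \<phi>(2) by simp
    ultimately show "\<xi> \<in> ?R" by blast
  next
    fix \<xi> assume "\<xi> \<in> ?R"
    then obtain \<phi> where \<phi>: "\<phi> \<in> \<Phi>" "\<xi> \<in> space (label_measure G)" "\<forall>v\<in>bverts H q n. \<bar>\<xi> (\<phi> v) - \<eta> v\<bar> < \<epsilon>"
      by blast
    then have L: "(G, \<xi>, p) \<in> labelled D" using x by (simp add: labelled_iff)
    have "lclass (G, \<xi>, p) \<in> U"
      unfolding y(2) H lclass_mem_nbhd[OF L] using \<phi> unfolding \<Phi>_def by blast
    then show "\<xi> \<in> ?L" using \<phi>(2) by simp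
  qed
  also have "\<dots> \<in> sets (label_measure G)"
  proof (rule sets.finite_UN[OF fPhi])
    fix \<phi> assume "\<phi> \<in> \<Phi>"
    then have \<phi>: "\<phi> v \<in> verts G" if "v \<in> bverts H q n" for v
      using that bverts_subset[of G p n] unfolding \<Phi>_def by auto
    have [measurable]: "(\<lambda>\<xi>. \<xi> (\<phi> v)) \<in> borel_measurable (label_measure G)" if "v \<in> bverts H q n" for v
      unfolding label_measure_def by (rule label_component_measurable[OF \<phi>[OF that]])
    have "{\<xi> \<in> space (label_measure G). \<bar>\<xi> (\<phi> v) - \<eta> v\<bar> < \<epsilon>} \<in> sets (label_measure G)"
      if "v \<in> bverts H q n" for v using that by measurable
    then show "{\<xi> \<in> space (label_measure G). \<forall>v\<in>bverts H q n. \<bar>\<xi> (\<phi> v) - \<eta> v\<bar> < \<epsilon>} \<in> sets (label_measure G)"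
      using fH by (intro sets.sets_Collect_finite_All) auto
  qed
  finally show "(\<lambda>\<xi>. lclass (G, \<xi>, p)) -` U \<inter> space (label_measure G) \<in> sets (label_measure G)" .
qed

text \<open>
  Events on two graphs that correspond to each other through the labels of matched vertices
  have the same probability: both are pulled back from one event in the product over the matched
  vertices.
\<close>

lemma emeasure_label_transfer:
  assumes B: "B \<subseteq> verts G" and \<phi>: "inj_on \<phi> B" "\<phi> ` B \<subseteq> verts H"
    and EG: "E \<in> sets (label_measure G)" and EH: "E' \<in> sets (label_measure H)"
    and eq: "\<And>\<xi> \<eta>. \<xi> \<in> space (label_measure G) \<Longrightarrow> \<eta> \<in> space (label_measure H)
      \<Longrightarrow> (\<And>v. v \<in> B \<Longrightarrow> \<eta> (\<phi> v) = \<xi> v) \<Longrightarrow> \<xi> \<in> E \<longleftrightarrow> \<eta> \<in> E'"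
  shows "emeasure (label_measure G) E = emeasure (label_measure H) E'"
proof -
  let ?P = "PiM B (\<lambda>_. unif)"
  define ext where "ext \<zeta> = (\<lambda>v\<in>verts G. if v \<in> B then \<zeta> v else 0)" for \<zeta> :: "nat \<Rightarrow> real"
  have ext_meas: "ext \<in> measurable ?P (label_measure G)"
    unfolding ext_def label_measure_def
  proof (rule measurable_restrict)
    fix v
    show "(\<lambda>\<zeta>. if v \<in> B then \<zeta> v else 0) \<in> measurable ?P unif"
      using measurable_component_singleton[of v B "\<lambda>_. unif"]
      by (cases "v \<in> B") (simp_all add: space_unif)
  qed
  define F where "F = ext -` E \<inter> space ?P"
  have F: "F \<in> sets ?P" unfolding F_def by (rule measurable_sets[OF ext_meas EG])
  have pull: "emeasure (label_measure K) {\<eta> \<in> space (label_measure K). (\<lambda>v\<in>B. \<eta> (f v)) \<in> F} = emeasure ?P F"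
    if f: "inj_on f B" "f \<in> B \<rightarrow> verts K" for K f
  proof -
    have m: "(\<lambda>\<eta>. \<lambda>v\<in>B. \<eta> (f v)) \<in> measurable (label_measure K) ?P"
      unfolding label_measure_def using f(2)
      by (intro measurable_restrict measurable_component_singleton) auto
    have "distr (label_measure K) ?P (\<lambda>\<eta>. \<lambda>v\<in>B. \<eta> (f v)) = ?P"
      unfolding label_measure_def by (rule distr_PiM_reindex[OF prob_space_unif f])
    then have "emeasure ?P F = emeasure (distr (label_measure K) ?P (\<lambda>\<eta>. \<lambda>v\<in>B. \<eta> (f v))) F" by simp
    also have "\<dots> = emeasure (label_measure K) ((\<lambda>\<eta>. \<lambda>v\<in>B. \<eta> (f v)) -` F \<inter> space (label_measure K))"
      by (rule emeasure_distr[OF m F])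
    also have "(\<lambda>\<eta>. \<lambda>v\<in>B. \<eta> (f v)) -` F \<inter> space (label_measure K)
        = {\<eta> \<in> space (label_measure K). (\<lambda>v\<in>B. \<eta> (f v)) \<in> F}" by auto
    finally show ?thesis by simp
  qed
  have inP: "(\<lambda>v\<in>B. \<eta> (f v)) \<in> space ?P" if "\<eta> \<in> space (label_measure K)" "f \<in> B \<rightarrow> verts K" for K f \<eta>
    using that by (auto simp: space_label_measure space_PiM space_unif PiE_iff)
  have ext_space: "ext \<zeta> \<in> space (label_measure G)" if "\<zeta> \<in> space ?P" for \<zeta>
    by (rule measurable_space[OF ext_meas that])
  have \<phi>': "\<phi> \<in> B \<rightarrow> verts H" using \<phi>(2) by blast
  have H_iff: "\<eta> \<in> E' \<longleftrightarrow> (\<lambda>v\<in>B. \<eta> (\<phi> v)) \<in> F" if \<eta>: "\<eta> \<in> space (label_measure H)" for \<eta>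
  proof -
    note s = inP[OF \<eta> \<phi>']
    have "ext (\<lambda>v\<in>B. \<eta> (\<phi> v)) \<in> E \<longleftrightarrow> \<eta> \<in> E'"
      by (rule eq[OF ext_space[OF s] \<eta>]) (use B in \<open>auto simp: ext_def\<close>)
    then show ?thesis using s by (simp add: F_def)
  qed
  have G_iff: "\<xi> \<in> E \<longleftrightarrow> (\<lambda>v\<in>B. \<xi> v) \<in> F" if \<xi>: "\<xi> \<in> space (label_measure G)" for \<xi>
  proof -
    define \<eta> where "\<eta> = (\<lambda>w\<in>verts H. if w \<in> \<phi> ` B then \<xi> (inv_into B \<phi> w) else 0)"
    have \<eta>_eq: "\<eta> (\<phi> v) = \<xi> v" if "v \<in> B" for v
      using that \<phi> by (auto simp: \<eta>_def inv_into_f_f)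
    have "\<eta> \<in> space (label_measure H)"
    proof -
      have "\<xi> (inv_into B \<phi> w) \<in> {0..1}" if "w \<in> \<phi> ` B" for w
        using inv_into_into[OF that] B \<xi> by (auto simp: space_label_measure PiE_iff)
      then show ?thesis by (auto simp: \<eta>_def space_label_measure)
    qed
    then have 1: "\<xi> \<in> E \<longleftrightarrow> \<eta> \<in> E'" by (rule eq[OF \<xi> _ \<eta>_eq])
    have "(\<lambda>v\<in>B. \<eta> (\<phi> v)) = (\<lambda>v\<in>B. \<xi> v)" by (rule restrict_ext) (rule \<eta>_eq)
    then show ?thesis using 1 H_iff[OF \<open>\<eta> \<in> space (label_measure H)\<close>] by simp
  qed
  have E_eq: "E = {\<xi> \<in> space (label_measure G). (\<lambda>v\<in>B. \<xi> v) \<in> F}"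
    using G_iff sets.sets_into_space[OF EG] by blast
  have E'_eq: "E' = {\<eta> \<in> space (label_measure H). (\<lambda>v\<in>B. \<eta> (\<phi> v)) \<in> F}"
    using H_iff sets.sets_into_space[OF EH] by blast
  have "emeasure (label_measure G) E = emeasure ?P F"
    by (subst E_eq) (rule pull, use B in auto)
  also have "\<dots> = emeasure (label_measure H) E'"
    by (subst E'_eq) (rule pull[OF \<phi>(1) \<phi>', symmetric])
  finally show ?thesis .
qed

text \<open>
  The two labels have a product law without atoms in the first factor.
\<close>

lemma AE_labels_distinct:
  assumes uv: "u \<in> verts G" "v \<in> verts G" "u \<noteq> v"
  shows "AE \<xi> in label_measure G. \<xi> u \<noteq> \<xi> v"
proof -
  interpret product_sigma_finite "\<lambda>_::nat. unif"
    by (intro product_sigma_finite.intro prob_space_imp_sigma_finite prob_space_unif)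
  let ?P = "PiM {u, v} (\<lambda>_. unif)"
  let ?E = "\<lambda>M. {\<xi> \<in> space M. \<xi> u = \<xi> v}"
  have E: "?E ?P \<in> sets ?P"
    using label_component_measurable[of u "{u, v}"] label_component_measurable[of v "{u, v}"] by measurable
  have point: "emeasure unif {a} = 0" for a :: real
  proof (cases "a \<in> {0..1}")
    case True then show ?thesis by (subst emeasure_restrict_space) auto
  next
    case False
    then have "{a} \<notin> sets unif" using sets.sets_into_space[of "{a}" unif] by (auto simp: space_unif)
    then show ?thesis by (rule emeasure_notin_sets)
  qed
  have "emeasure ?P (?E ?P) = (\<integral>\<^sup>+\<xi>. indicator (?E ?P) \<xi> \<partial>?P)" using E by simp
  also have "\<dots> = (\<integral>\<^sup>+\<xi>. (\<integral>\<^sup>+a. indicator (?E ?P) (\<xi>(u := a)) \<partial>unif) \<partial>PiM {v} (\<lambda>_. unif))"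
    using E uv by (intro product_nn_integral_insert) auto
  also have "\<dots> = (\<integral>\<^sup>+\<xi>. 0 \<partial>PiM {v} (\<lambda>_. unif))"
  proof (rule nn_integral_cong)
    fix \<xi> :: "nat \<Rightarrow> real" assume \<xi>: "\<xi> \<in> space (PiM {v} (\<lambda>_. unif))"
    then have "\<xi> v \<in> {0..1}" by (auto simp: space_PiM space_unif)
    then have m: "{\<xi> v} \<in> sets unif" by (subst sets_restrict_space_iff) auto
    have "(\<integral>\<^sup>+a. indicator (?E ?P) (\<xi>(u := a)) \<partial>unif) \<le> (\<integral>\<^sup>+a. indicator {\<xi> v} a \<partial>unif)"
      using uv(3) by (intro nn_integral_mono) (auto split: split_indicator)
    also have "\<dots> = 0" using m point by simp
    finally show "(\<integral>\<^sup>+a. indicator (?E ?P) (\<xi>(u := a)) \<partial>unif) = 0" by simp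
  qed
  finally have 0: "emeasure ?P (?E ?P) = 0" by simp
  have m: "(\<lambda>\<eta>. \<lambda>w\<in>{u, v}. \<eta> w) \<in> measurable (label_measure G) ?P"
    unfolding label_measure_def using uv by (intro measurable_restrict measurable_component_singleton) auto
  have d: "distr (label_measure G) ?P (\<lambda>\<eta>. \<lambda>w\<in>{u, v}. \<eta> w) = ?P"
    unfolding label_measure_def
    using distr_PiM_reindex[OF prob_space_unif, where K="verts G" and f="\<lambda>w. w" and I="{u, v}"] uv by simp
  have "{\<zeta> \<in> space ?P. \<zeta> u \<noteq> \<zeta> v} = space ?P - ?E ?P" by auto
  then have E': "{\<zeta> \<in> space ?P. \<zeta> u \<noteq> \<zeta> v} \<in> sets ?P" using E by (simp only: sets.compl_sets)
  have "AE \<zeta> in ?P. \<zeta> u \<noteq> \<zeta> v"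
    by (rule AE_I[OF _ 0 E]) auto
  then have "AE \<zeta> in distr (label_measure G) ?P (\<lambda>\<eta>. \<lambda>w\<in>{u, v}. \<eta> w). \<zeta> u \<noteq> \<zeta> v" by (simp only: d)
  then have "AE \<eta> in label_measure G. (\<lambda>w\<in>{u, v}. \<eta> w) u \<noteq> (\<lambda>w\<in>{u, v}. \<eta> w) v"
    by (simp only: AE_distr_iff[OF m E'])
  then show ?thesis by simp
qed

section \<open>The label kernel\<close>

definition label_kernel :: "nat \<Rightarrow> graph \<Rightarrow> nat \<Rightarrow> lgraph set measure" where
  "label_kernel D G p = distr (label_measure G) (labelled_space D) (\<lambda>\<xi>. lclass (G, \<xi>, p))"

lemma sets_label_kernel[simp]: "sets (label_kernel D G p) = sets (labelled_space D)"
  and space_label_kernel[simp]: "space (label_kernel D G p) = space (labelled_space D)"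
  by (simp_all add: label_kernel_def)

lemma event_measurable:
  assumes "(G, p) \<in> rooted D" "A \<in> sets (labelled_space D)"
  shows "{\<xi> \<in> space (label_measure G). lclass (G, \<xi>, p) \<in> A} \<in> sets (label_measure G)"
  using measurable_sets[OF lclass_measurable[OF assms(1)] assms(2)] by (simp add: vimage_def Int_def conj_commute)

lemma emeasure_label_kernel:
  assumes "(G, p) \<in> rooted D" "A \<in> sets (labelled_space D)"
  shows "emeasure (label_kernel D G p) A = emeasure (label_measure G) {\<xi> \<in> space (label_measure G). lclass (G, \<xi>, p) \<in> A}"
  unfolding label_kernel_def emeasure_distr[OF lclass_measurable[OF assms(1)] assms(2)]
  by (rule arg_cong[where f="emeasure (label_measure G)"]) auto

lemma prob_space_label_kernel: "(G, p) \<in> rooted D \<Longrightarrow> prob_space (label_kernel D G p)"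
  unfolding label_kernel_def
  by (rule prob_space.prob_space_distr[OF prob_space_label_measure lclass_measurable])

lemma nn_integral_label_kernel:
  "(G, p) \<in> rooted D \<Longrightarrow> f \<in> borel_measurable (labelled_space D)
    \<Longrightarrow> (\<integral>\<^sup>+x. f x \<partial>label_kernel D G p) = (\<integral>\<^sup>+\<xi>. f (lclass (G, \<xi>, p)) \<partial>label_measure G)"
  unfolding label_kernel_def by (subst nn_integral_distr[OF lclass_measurable]) simp_all

lemma rootedD:
  assumes "(G, p) \<in> rooted D" shows "bounded_graph D G" "simple_graph G" "p \<in> verts G"
  using assms bounded_graphD(1)[of D G] by (simp_all add: rooted_def)

text \<open>
  The key to measurability in the graph: on events determined by balls of radius \<open>n\<close> the kernel
  is a function of the ball, and these events generate.
\<close>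

lemma label_kernel_local:
  assumes A: "A \<in> local_sets D n" and G: "(G, p) \<in> rooted D" and H: "(H, q) \<in> rooted D"
    and iso: "ball_iso \<phi> n G p H q"
  shows "emeasure (label_kernel D G p) A = emeasure (label_kernel D H q) A"
  unfolding emeasure_label_kernel[OF G local_sets_measurable[OF A]]
    emeasure_label_kernel[OF H local_sets_measurable[OF A]]
proof (rule emeasure_label_transfer[of "bverts G p n" G \<phi>])
  show "inj_on \<phi> (bverts G p n)" "\<phi> ` bverts G p n \<subseteq> verts H"
    using ball_iso_bij[OF iso] bverts_subset[of H q n] by (auto simp: bij_betw_def)
  fix \<xi> \<eta> assume *: "\<xi> \<in> space (label_measure G)" "\<eta> \<in> space (label_measure H)"
    and lab: "\<And>v. v \<in> bverts G p n \<Longrightarrow> \<eta> (\<phi> v) = \<xi> v"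
  have "lclass (G, \<xi>, p) \<in> A \<longleftrightarrow> lclass (H, \<eta>, q) \<in> A"
    by (rule local_setsD[OF A _ _ iso]) (use * G H in \<open>simp_all add: labelled_iff lab\<close>)
  then show "\<xi> \<in> {\<xi> \<in> space (label_measure G). lclass (G, \<xi>, p) \<in> A}
      \<longleftrightarrow> \<eta> \<in> {\<xi> \<in> space (label_measure H). lclass (H, \<xi>, q) \<in> A}" using * by simp
qed (use bverts_subset event_measurable[OF G local_sets_measurable[OF A]]
    event_measurable[OF H local_sets_measurable[OF A]] in simp_all)

lemma label_kernel_iso:
  assumes iso: "((G, p), (H, q)) \<in> rooted_iso" and G: "(G, p) \<in> rooted D"
  shows "label_kernel D G p = label_kernel D H q"
proof (rule measure_eqI)
  fix A assume "A \<in> sets (label_kernel D G p)"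
  then have A: "A \<in> sets (labelled_space D)" by simp
  have H: "(H, q) \<in> rooted D" by (rule rooted_iso_rooted[OF iso G])
  obtain \<phi> where \<phi>: "graph_iso \<phi> G H" "\<phi> p = q" using rooted_iso_ball_iso[OF iso] by metis
  have b: "bij_betw \<phi> (verts G) (verts H)" using \<phi>(1) by (simp add: graph_iso_def)
  show "emeasure (label_kernel D G p) A = emeasure (label_kernel D H q) A"
    unfolding emeasure_label_kernel[OF G A] emeasure_label_kernel[OF H A]
  proof (rule emeasure_label_transfer[of "verts G" G \<phi>])
    show "inj_on \<phi> (verts G)" "\<phi> ` verts G \<subseteq> verts H" using b by (simp_all add: bij_betw_def)
    fix \<xi> \<eta> assume *: "\<xi> \<in> space (label_measure G)" "\<eta> \<in> space (label_measure H)"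
      and lab: "\<And>v. v \<in> verts G \<Longrightarrow> \<eta> (\<phi> v) = \<xi> v"
    have "((G, \<xi>, p), (H, \<eta>, q)) \<in> labelled_iso"
      unfolding labelled_iso_def mem_Collect_eq split
      using rootedD[OF G] rootedD[OF H] * \<phi> lab by (auto simp: space_label_measure)
    then have "lclass (G, \<xi>, p) = lclass (H, \<eta>, q)" by (rule lclass_eqI)
    then show "\<xi> \<in> {\<xi> \<in> space (label_measure G). lclass (G, \<xi>, p) \<in> A}
        \<longleftrightarrow> \<eta> \<in> {\<xi> \<in> space (label_measure H). lclass (H, \<xi>, q) \<in> A}" using * by simp
  qed (use event_measurable[OF G A] event_measurable[OF H A] in simp_all)
qed simp

definition class_kernel :: "nat \<Rightarrow> rgraph set \<Rightarrow> lgraph set measure" where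
  "class_kernel D X = (case rep X of (G, p) \<Rightarrow> label_kernel D G p)"

lemma class_kernel_rclass: "(G, p) \<in> rooted D \<Longrightarrow> class_kernel D (rclass (G, p)) = label_kernel D G p"
  using rep_rclass[of "(G, p)" D] label_kernel_iso[of G p _ _ D]
  by (cases "rep (rclass (G, p))") (simp add: class_kernel_def)

lemma class_kernel_measurable: "class_kernel D \<in> measurable (rooted_space D) (subprob_algebra (labelled_space D))"
proof (rule measurable_subprob_algebra_generated[OF sets_labelled_space_local local_sets_Int_stable local_sets_subset])
  fix X assume "X \<in> space (rooted_space D)"
  then obtain G p where X: "rep X = (G, p)" "(G, p) \<in> rooted D" by (rule rooted_space_cases)
  show "subprob_space (class_kernel D X)" "sets (class_kernel D X) = sets (labelled_space D)"
    unfolding class_kernel_def X split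
    by (rule prob_space_imp_subprob_space[OF prob_space_label_kernel[OF X(2)]]) simp
next
  have *: "(\<lambda>X. emeasure (class_kernel D X) A) \<in> borel_measurable (rooted_space D)"
    if A: "A \<in> local_sets D n" for A n
  proof -
    have "(\<lambda>X. case rep X of (G, p) \<Rightarrow> emeasure (label_kernel D G p) A) \<in> borel_measurable (rooted_space D)"
      by (rule rooted_local_measurable[where n=n]) (auto intro: label_kernel_local[OF A])
    then show ?thesis by (simp add: class_kernel_def case_prod_beta)
  qed
  show "(\<lambda>X. emeasure (class_kernel D X) (space (labelled_space D))) \<in> borel_measurable (rooted_space D)"
    by (rule *[OF space_local_sets])
  fix A assume "A \<in> (\<Union>n. local_sets D n)"
  then show "(\<lambda>X. emeasure (class_kernel D X) A) \<in> borel_measurable (rooted_space D)" using * by blast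
qed

lemma bernoulli_measure_eq: "bernoulli_measure D \<nu> = bind \<nu> (class_kernel D)"
proof -
  have "class_kernel D = (\<lambda>X. case rep X of (G, p) \<Rightarrow> distr (PiM (verts G) (\<lambda>_. unif)) (labelled_space D)
      (\<lambda>\<xi>. lclass (G, \<xi>, p)))"
    by (simp add: fun_eq_iff class_kernel_def label_kernel_def label_measure_def)
  then show ?thesis by (simp only: bernoulli_measure_def)
qed

section \<open>Mass transport with labels\<close>

text \<open>
  The transport used in the mass transport principle.
\<close>

definition joint :: "lgraph set set \<Rightarrow> lgraph set set \<Rightarrow> graph \<Rightarrow> nat \<Rightarrow> nat \<Rightarrow> real" where
  "joint A B G p p' = measure (label_measure G)
     {\<xi> \<in> space (label_measure G). lclass (G, \<xi>, p) \<in> A \<and> lclass (G, \<xi>, p') \<in> B}"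

lemma joint_commute: "joint A B G p p' = joint B A G p' p"
  unfolding joint_def by (simp add: conj_commute)

lemma rooted_move: "(G, p) \<in> rooted D \<Longrightarrow> p' \<in> verts G \<Longrightarrow> (G, p') \<in> rooted D"
  by (simp add: rooted_def)

lemma joint_event_measurable:
  assumes "(G, p) \<in> rooted D" "p' \<in> verts G" "A \<in> sets (labelled_space D)" "B \<in> sets (labelled_space D)"
  shows "{\<xi> \<in> space (label_measure G). lclass (G, \<xi>, p) \<in> A \<and> lclass (G, \<xi>, p') \<in> B} \<in> sets (label_measure G)"
proof -
  have "{\<xi> \<in> space (label_measure G). lclass (G, \<xi>, p) \<in> A \<and> lclass (G, \<xi>, p') \<in> B}
      = {\<xi> \<in> space (label_measure G). lclass (G, \<xi>, p) \<in> A} \<inter> {\<xi> \<in> space (label_measure G). lclass (G, \<xi>, p') \<in> B}"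
    by auto
  then show ?thesis
    using event_measurable[OF assms(1,3)] event_measurable[OF rooted_move[OF assms(1,2)] assms(4)] by simp
qed

text \<open>
  The balls of radius \<open>n\<close> around \<open>p\<close> and its neighbour lie in the ball of radius \<open>n + 1\<close> around
  \<open>p\<close>.
\<close>

lemma joint_local:
  assumes A: "A \<in> local_sets D n" and B: "B \<in> local_sets D n"
    and G: "(G, p) \<in> rooted D" and H: "(H, q) \<in> rooted D"
    and iso: "ball_iso \<phi> (Suc n) G p H q" and p': "p' \<in> bverts G p 1"
  shows "joint A B G p p' = joint A B H q (\<phi> p')"
proof -
  note GH = rootedD(2)[OF G] rootedD(2)[OF H] rootedD(3)[OF G]
  have iso1: "ball_iso \<phi> n G p H q" by (rule ball_iso_mono[OF GH iso]) simp
  have iso2: "ball_iso \<phi> n G p' H (\<phi> p')" by (rule ball_iso_at[OF GH iso p']) simp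
  have sub1: "bverts G p n \<subseteq> bverts G p (Suc n)" by (rule bverts_mono) simp
  have sub2: "bverts G p' n \<subseteq> bverts G p (Suc n)" using bverts_trans[OF p', of _ n] by auto
  have "p' \<in> bverts G p (Suc n)" using p' bverts_mono[of 1 "Suc n" G p] by auto
  then have q': "\<phi> p' \<in> verts H" and p'': "p' \<in> verts G"
    using bij_betwE[OF ball_iso_bij[OF iso]] bverts_subset by blast+
  have "emeasure (label_measure G) {\<xi> \<in> space (label_measure G). lclass (G, \<xi>, p) \<in> A \<and> lclass (G, \<xi>, p') \<in> B}
      = emeasure (label_measure H) {\<xi> \<in> space (label_measure H). lclass (H, \<xi>, q) \<in> A \<and> lclass (H, \<xi>, \<phi> p') \<in> B}"
  proof (rule emeasure_label_transfer[of "bverts G p (Suc n)" G \<phi>])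
    show "inj_on \<phi> (bverts G p (Suc n))" "\<phi> ` bverts G p (Suc n) \<subseteq> verts H"
      using ball_iso_bij[OF iso] bverts_subset[of H q "Suc n"] by (auto simp: bij_betw_def)
    fix \<xi> \<eta> assume *: "\<xi> \<in> space (label_measure G)" "\<eta> \<in> space (label_measure H)"
      and lab: "\<And>v. v \<in> bverts G p (Suc n) \<Longrightarrow> \<eta> (\<phi> v) = \<xi> v"
    have "lclass (G, \<xi>, p) \<in> A \<longleftrightarrow> lclass (H, \<eta>, q) \<in> A"
      by (rule local_setsD[OF A _ _ iso1]) (use * G H lab[OF subsetD[OF sub1]] in \<open>simp_all add: labelled_iff\<close>)
    moreover have "lclass (G, \<xi>, p') \<in> B \<longleftrightarrow> lclass (H, \<eta>, \<phi> p') \<in> B"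
      by (rule local_setsD[OF B _ _ iso2])
        (use * rooted_move[OF G p''] rooted_move[OF H q'] lab[OF subsetD[OF sub2]] in \<open>simp_all add: labelled_iff\<close>)
    ultimately show "\<xi> \<in> {\<xi> \<in> space (label_measure G). lclass (G, \<xi>, p) \<in> A \<and> lclass (G, \<xi>, p') \<in> B}
        \<longleftrightarrow> \<eta> \<in> {\<xi> \<in> space (label_measure H). lclass (H, \<xi>, q) \<in> A \<and> lclass (H, \<xi>, \<phi> p') \<in> B}" using * by simp
  qed (use bverts_subset joint_event_measurable[OF G p'' local_sets_measurable[OF A] local_sets_measurable[OF B]]
      joint_event_measurable[OF H q' local_sets_measurable[OF A] local_sets_measurable[OF B]] in simp_all)
  then show ?thesis by (simp add: joint_def measure_def)
qed

text \<open>
  The mass sent from \<open>p\<close> to a neighbour \<open>p'\<close> is the probability that the labels put \<open>p\<close> into \<open>A\<close>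
  and \<open>p'\<close> into \<open>B\<close>. For local \<open>A\<close> and \<open>B\<close> this is a local function of the doubly rooted graph, hence
  an admissible transport.
\<close>

lemma labelled_mass_transport:
  assumes u: "unimodular_random_graph D \<nu>" and A: "A \<in> local_sets D n" and B: "B \<in> local_sets D n"
  shows "(\<integral>\<^sup>+X. (case rep X of (G, p) \<Rightarrow> \<Sum>p'\<in>edges G `` {p}. ennreal (joint A B G p p')) \<partial>\<nu>)
    = (\<integral>\<^sup>+X. (case rep X of (G, p) \<Rightarrow> \<Sum>p'\<in>edges G `` {p}. ennreal (joint B A G p p')) \<partial>\<nu>)"
proof -
  \<comment> \<open>The mass \<open>w\<close> vanishes unless the roots are adjacent, so the sums over all vertices in the mass
      transport principle become sums over neighbours.\<close>
  define w where "w G p p' = (if (p, p') \<in> edges G then joint A B G p p' else 0)" for G p p'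
  define f where "f Y = (case rep Y of (G, p, p') \<Rightarrow> w G p p')" for Y
  have w_local: "w G p p' = w H q q'"
    if G: "(G, p, p') \<in> birooted D" and H: "(H, q, q') \<in> birooted D" and iso: "ball_iso \<phi> (Suc n) G p H q"
      and p': "p' \<in> bverts G p (Suc n)" and q': "\<phi> p' = q'" for G p p' H q q' \<phi>
  proof -
    have GH: "(G, p) \<in> rooted D" "(H, q) \<in> rooted D" using G H by (simp_all add: birooted_def rooted_def)
    have pq: "\<phi> p = q" using iso by (simp add: ball_iso_def)
    have "(p, p') \<in> edges G \<longleftrightarrow> (q, q') \<in> edges H"
      using ball_iso_edge[OF iso bverts_self[OF rootedD(3)[OF GH(1)]] p'] pq q' by simp
    moreover have "joint A B G p p' = joint A B H q q'" if "(p, p') \<in> edges G"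
      using joint_local[OF A B GH iso] neighbour_in_bverts[OF rootedD(2)[OF GH(1)] that] q' by simp
    ultimately show ?thesis by (simp add: w_def)
  qed
  have f_meas: "f \<in> borel_measurable (birooted_space D)"
    unfolding f_def
  proof (rule birooted_local_measurable[where n="Suc n"])
    fix G p p' assume G: "(G, p, p') \<in> birooted D" "p' \<notin> bverts G p (Suc n)"
    then have sG: "simple_graph G" using bounded_graphD(1)[of D G] by (simp add: birooted_def)
    have "(p, p') \<notin> edges G"
      using neighbour_in_bverts[OF sG, of p p'] bverts_mono[of "Suc 0" "Suc n" G p] G(2) by auto
    then show "w G p p' = 0" by (simp add: w_def)
  qed (rule w_local)
  have f_bclass: "f (bclass (G, p, p')) = w G p p'" if G: "(G, p, p') \<in> birooted D" for G p p'
  proof -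
    obtain H q q' where H: "rep (bclass (G, p, p')) = (H, q, q')" by (metis prod_cases3)
    have iso: "((G, p, p'), (H, q, q')) \<in> birooted_iso" using rep_bclass[OF G] unfolding H .
    have H': "(H, q, q') \<in> birooted D" by (rule birooted_iso_birooted[OF iso G])
    obtain \<phi> where \<phi>: "\<And>n. ball_iso \<phi> n G p H q" "\<phi> p' = q'" using birooted_iso_ball_iso[OF iso] by metis
    have sGH: "simple_graph G" "simple_graph H" "p \<in> verts G" "p' \<in> verts G"
      using G H' bounded_graphD(1)[of D G] bounded_graphD(1)[of D H] by (simp_all add: birooted_def)
    have "w G p p' = w H q q'"
    proof (cases "p' \<in> bverts G p (Suc n)")
      case True then show ?thesis by (rule w_local[OF G H' \<phi>(1) _ \<phi>(2)])
    next
      case False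
      have q': "q' \<notin> bverts H q (Suc n)"
      proof
        assume q'': "q' \<in> bverts H q (Suc n)"
        obtain m where m: "p' \<in> bverts G p m"
          using connected_bverts[of D G p p'] G by (auto simp: birooted_def)
        have bij: "bij_betw \<phi> (bverts G p (max m (Suc n))) (bverts H q (max m (Suc n)))"
          by (rule ball_iso_bij[OF \<phi>(1)])
        have p'm: "p' \<in> bverts G p (max m (Suc n))" using m bverts_mono[of m "max m (Suc n)" G p] by auto
        obtain v where v: "v \<in> bverts G p (Suc n)" "\<phi> v = q'"
          using q'' ball_iso_bij[OF \<phi>(1), of "Suc n"] by (metis bij_betw_def imageE)
        have "v \<in> bverts G p (max m (Suc n))" using v bverts_mono[of "Suc n" "max m (Suc n)" G p] by auto
        then have "v = p'" using bij p'm v(2) \<phi>(2) unfolding bij_betw_def inj_on_def by blast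
        then show False using v False by simp
      qed
      have "(p, p') \<notin> edges G"
        using neighbour_in_bverts[OF sGH(1), of p p'] bverts_mono[of "Suc 0" "Suc n" G p] False by auto
      moreover have "(q, q') \<notin> edges H"
        using neighbour_in_bverts[OF sGH(2), of q q'] bverts_mono[of "Suc 0" "Suc n" H q] q' by auto
      ultimately show ?thesis by (simp add: w_def)
    qed
    then show ?thesis unfolding f_def H by simp
  qed
  have sets: "sets \<nu> = sets (rooted_space D)" using u by (simp add: unimodular_random_graph_def)
  have "\<forall>x\<in>space (birooted_space D). 0 \<le> f x"
    by (auto simp: f_def w_def joint_def split: prod.split)
  then have mtp: "(\<integral>\<^sup>+X. (case rep X of (G, p) \<Rightarrow>
            \<integral>\<^sup>+p'. ennreal (f (bclass (G, p', p))) \<partial>count_space (verts G)) \<partial>\<nu>)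
      = (\<integral>\<^sup>+X. (case rep X of (G, p) \<Rightarrow>
            \<integral>\<^sup>+p'. ennreal (f (bclass (G, p, p'))) \<partial>count_space (verts G)) \<partial>\<nu>)"
    using u f_meas unfolding unimodular_random_graph_def by blast
  have collapse: "(\<integral>\<^sup>+p'. ennreal (g p') \<partial>count_space (verts G)) = (\<Sum>p'\<in>edges G `` {p}. ennreal (h p'))"
    if G: "(G, p) \<in> rooted D" and gh: "\<And>p'. p' \<in> verts G \<Longrightarrow> g p' = (if (p, p') \<in> edges G then h p' else 0)"
    for G p and g h :: "nat \<Rightarrow> real"
  proof -
    have sub: "edges G `` {p} \<subseteq> verts G" using simple_graph_edge[OF rootedD(2)[OF G]] by blast
    have "(\<integral>\<^sup>+p'. ennreal (g p') \<partial>count_space (verts G)) = (\<Sum>p'\<in>edges G `` {p}. ennreal (g p'))"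
      by (rule nn_integral_count_space'[OF bounded_graphD(4)[OF rootedD(1,3)[OF G]] _ sub]) (simp add: gh)
    also have "\<dots> = (\<Sum>p'\<in>edges G `` {p}. ennreal (h p'))"
      by (rule sum.cong[OF refl]) (use sub gh in auto)
    finally show ?thesis .
  qed
  have bi: "(G, p, p') \<in> birooted D \<and> (G, p', p) \<in> birooted D" if "(G, p) \<in> rooted D" "p' \<in> verts G" for G p p'
    using that by (simp add: rooted_def birooted_def)
  have "(\<integral>\<^sup>+X. (case rep X of (G, p) \<Rightarrow> \<Sum>p'\<in>edges G `` {p}. ennreal (joint A B G p p')) \<partial>\<nu>)
      = (\<integral>\<^sup>+X. (case rep X of (G, p) \<Rightarrow>
            \<integral>\<^sup>+p'. ennreal (f (bclass (G, p, p'))) \<partial>count_space (verts G)) \<partial>\<nu>)"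
  proof (rule nn_integral_cong)
    fix X assume "X \<in> space \<nu>"
    then have "X \<in> space (rooted_space D)" using sets_eq_imp_space_eq[OF sets] by simp
    then obtain G p where X: "rep X = (G, p)" "(G, p) \<in> rooted D" by (rule rooted_space_cases)
    show "(case rep X of (G, p) \<Rightarrow> \<Sum>p'\<in>edges G `` {p}. ennreal (joint A B G p p'))
        = (case rep X of (G, p) \<Rightarrow> \<integral>\<^sup>+p'. ennreal (f (bclass (G, p, p'))) \<partial>count_space (verts G))"
      unfolding X split
      by (rule collapse[OF X(2), symmetric]) (use bi[OF X(2)] f_bclass in \<open>simp add: w_def\<close>)
  qed
  also have "\<dots> = (\<integral>\<^sup>+X. (case rep X of (G, p) \<Rightarrow>
            \<integral>\<^sup>+p'. ennreal (f (bclass (G, p', p))) \<partial>count_space (verts G)) \<partial>\<nu>)"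
    by (rule mtp[symmetric])
  also have "\<dots> = (\<integral>\<^sup>+X. (case rep X of (G, p) \<Rightarrow> \<Sum>p'\<in>edges G `` {p}. ennreal (joint B A G p p')) \<partial>\<nu>)"
  proof (rule nn_integral_cong)
    fix X assume "X \<in> space \<nu>"
    then have "X \<in> space (rooted_space D)" using sets_eq_imp_space_eq[OF sets] by simp
    then obtain G p where X: "rep X = (G, p)" "(G, p) \<in> rooted D" by (rule rooted_space_cases)
    have sym: "(p', p) \<in> edges G \<longleftrightarrow> (p, p') \<in> edges G" for p'
      using simple_graph_edge[OF rootedD(2)[OF X(2)]] by blast
    show "(case rep X of (G, p) \<Rightarrow> \<integral>\<^sup>+p'. ennreal (f (bclass (G, p', p))) \<partial>count_space (verts G))
        = (case rep X of (G, p) \<Rightarrow> \<Sum>p'\<in>edges G `` {p}. ennreal (joint B A G p p'))"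
      unfolding X split
      by (rule collapse[OF X(2)])
        (use bi[OF X(2)] f_bclass joint_commute[of A B G _ p] sym in \<open>simp add: w_def\<close>)
  qed
  finally show ?thesis .
qed

section \<open>The Bernoulli graphing\<close>

subsection \<open>Graphs with distinct labels\<close>

definition distinct_nbrs :: "nat \<Rightarrow> lgraph set set" where
  "distinct_nbrs D = {lclass (G, \<xi>, p) |G \<xi> p. (G, \<xi>, p) \<in> labelled D \<and> inj_on \<xi> (bverts G p 1)}"

lemma lclass_distinct_nbrs:
  assumes x: "(G, \<xi>, p) \<in> labelled D"
  shows "lclass (G, \<xi>, p) \<in> distinct_nbrs D \<longleftrightarrow> inj_on \<xi> (bverts G p 1)"
proof
  assume "lclass (G, \<xi>, p) \<in> distinct_nbrs D"
  then obtain H \<eta> q where H: "lclass (G, \<xi>, p) = lclass (H, \<eta>, q)" "(H, \<eta>, q) \<in> labelled D" "inj_on \<eta> (bverts H q 1)"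
    unfolding distinct_nbrs_def by blast
  obtain \<phi> where \<phi>: "\<And>n. ball_iso \<phi> n G p H q" "\<And>v. v \<in> verts G \<Longrightarrow> \<eta> (\<phi> v) = \<xi> v"
    using labelled_iso_ball_iso[OF lclass_eqD[OF H(1) x]] by metis
  note b = ball_iso_bij[OF \<phi>(1), of 1]
  show "inj_on \<xi> (bverts G p 1)"
  proof (rule inj_onI)
    fix u v assume uv: "u \<in> bverts G p 1" "v \<in> bverts G p 1" "\<xi> u = \<xi> v"
    then have "\<eta> (\<phi> u) = \<eta> (\<phi> v)" using \<phi>(2)[OF subsetD[OF bverts_subset uv(1)]] \<phi>(2)[OF subsetD[OF bverts_subset uv(2)]] by simp
    then have "\<phi> u = \<phi> v" using inj_onD[OF H(3)] bij_betwE[OF b] uv(1,2) by blast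
    then show "u = v" using b uv(1,2) unfolding bij_betw_def inj_on_def by blast
  qed
qed (use x in \<open>unfold distinct_nbrs_def, blast\<close>)

text \<open>
  Half of the smallest gap between the finitely many labels is a radius that keeps them
  distinct.
\<close>

lemma distinct_nbrs_open: "distinct_nbrs D \<in> labelled_open D"
proof (rule labelled_openI)
  show "distinct_nbrs D \<subseteq> space (labelled_space D)"
    unfolding distinct_nbrs_def using lclass_in_space by blast
  fix G \<xi> p assume x: "(G, \<xi>, p) \<in> labelled D" and "lclass (G, \<xi>, p) \<in> distinct_nbrs D"
  then have inj: "inj_on \<xi> (bverts G p 1)" by (simp only: lclass_distinct_nbrs[OF x])
  let ?B = "bverts G p 1"
  have fB: "finite ?B" by (rule finite_bverts[OF labelledD(1,3)[OF x]])
  define gaps where "gaps = (\<lambda>(u, v). \<bar>\<xi> u - \<xi> v\<bar>) ` {(u, v). u \<in> ?B \<and> v \<in> ?B \<and> u \<noteq> v}"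
  have fg: "finite gaps" unfolding gaps_def
    by (rule finite_imageI, rule finite_subset[of _ "?B \<times> ?B"]) (use fB in auto)
  have pos: "0 < g" if "g \<in> gaps" for g
    using that inj unfolding gaps_def inj_on_def by auto
  define \<delta> where "\<delta> = Min (insert 1 gaps) / 2"
  have \<delta>0: "0 < \<delta>" unfolding \<delta>_def using fg pos by (simp add: Min_gr_iff)
  have gap: "2 * \<delta> \<le> \<bar>\<xi> u - \<xi> v\<bar>" if "u \<in> ?B" "v \<in> ?B" "u \<noteq> v" for u v
  proof -
    have "\<bar>\<xi> u - \<xi> v\<bar> \<in> gaps" unfolding gaps_def using that by force
    then show ?thesis unfolding \<delta>_def using fg by simp
  qed
  have "labelled_nbhd D (G, \<xi>, p) 1 \<delta> \<subseteq> distinct_nbrs D"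
  proof
    fix Y assume "Y \<in> labelled_nbhd D (G, \<xi>, p) 1 \<delta>"
    then obtain H \<eta> q \<phi> where H: "(H, \<eta>, q) \<in> labelled D" "Y = lclass (H, \<eta>, q)"
      "ball_iso \<phi> 1 G p H q" "\<forall>v\<in>bverts G p 1. \<bar>\<eta> (\<phi> v) - \<xi> v\<bar> < \<delta>"
      unfolding mem_labelled_nbhd by blast
    have "inj_on \<eta> (bverts H q 1)"
    proof (rule inj_onI)
      fix u' v' assume *: "u' \<in> bverts H q 1" "v' \<in> bverts H q 1" "\<eta> u' = \<eta> v'"
      obtain u v where uv: "u \<in> ?B" "v \<in> ?B" "u' = \<phi> u" "v' = \<phi> v"
        using *(1,2) ball_iso_bij[OF H(3)] unfolding bij_betw_def by blast
      have "\<eta> (\<phi> u) = \<eta> (\<phi> v)" using *(3) uv(3,4) by simp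
      then have "\<bar>\<xi> u - \<xi> v\<bar> < 2 * \<delta>"
        using bspec[OF H(4) uv(1)] bspec[OF H(4) uv(2)] by linarith
      then have "u = v" using gap[OF uv(1,2)] by linarith
      then show "u' = v'" using uv by simp
    qed
    then show "Y \<in> distinct_nbrs D" unfolding H(2) by (simp only: lclass_distinct_nbrs[OF H(1)])
  qed
  then show "\<exists>n \<delta>. 0 < \<delta> \<and> labelled_nbhd D (G, \<xi>, p) n \<delta> \<subseteq> distinct_nbrs D" using \<delta>0 by blast
qed

lemma AE_label_kernel_distinct:
  assumes G: "(G, p) \<in> rooted D"
  shows "AE X in label_kernel D G p. X \<in> distinct_nbrs D"
proof -
  have fB: "finite (bverts G p 1)" by (rule finite_bverts[OF rootedD(1,3)[OF G]])
  have "AE \<xi> in label_measure G. \<forall>u\<in>bverts G p 1. \<forall>v\<in>bverts G p 1. u \<noteq> v \<longrightarrow> \<xi> u \<noteq> \<xi> v"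
  proof (intro AE_finite_allI fB)
    fix u v assume "u \<in> bverts G p 1" "v \<in> bverts G p 1"
    then have uv: "u \<in> verts G" "v \<in> verts G" using bverts_subset[of G p 1] by auto
    show "AE \<xi> in label_measure G. u \<noteq> v \<longrightarrow> \<xi> u \<noteq> \<xi> v"
      using AE_labels_distinct[OF uv] by (cases "u = v") auto
  qed
  moreover have "AE \<xi> in label_measure G. (G, \<xi>, p) \<in> labelled D"
    by (rule AE_I2) (simp add: labelled_iff G)
  ultimately have "AE \<xi> in label_measure G. lclass (G, \<xi>, p) \<in> distinct_nbrs D"
  proof eventually_elim
    case (elim \<xi>)
    then have "inj_on \<xi> (bverts G p 1)" unfolding inj_on_def by blast
    then show ?case using lclass_distinct_nbrs[OF elim(2)] by blast
  qed
  moreover have "{X \<in> space (labelled_space D). X \<in> distinct_nbrs D} \<in> sets (labelled_space D)"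
    using labelled_open_sets[OF distinct_nbrs_open] by measurable
  ultimately show ?thesis
    unfolding label_kernel_def by (subst AE_distr_iff[OF lclass_measurable[OF G]]) auto
qed

text \<open>When the labels of the neighbours are distinct, no two neighbours are identified in the graphing.\<close>

lemma bernoulli_graph_nbrs:
  assumes X: "X \<in> distinct_nbrs D"
  shows "bernoulli_graph D `` {X} = move_root X ` nbrs X" and "inj_on (move_root X) (nbrs X)"
proof -
  obtain G \<xi> p where x: "(G, \<xi>, p) \<in> labelled D" "X = lclass (G, \<xi>, p)" "inj_on \<xi> (bverts G p 1)"
    using X unfolding distinct_nbrs_def by blast
  obtain \<phi> where \<phi>: "bij_betw \<phi> (edges G `` {p}) (nbrs X)"
    "\<And>p'. p' \<in> edges G `` {p} \<Longrightarrow> move_root X (\<phi> p') = lclass (G, \<xi>, p')"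
    using nbrs_lclass[OF x(1)] x(2) by metis
  have img: "move_root X ` nbrs X = (\<lambda>p'. lclass (G, \<xi>, p')) ` (edges G `` {p})"
  proof -
    have "move_root X ` nbrs X = (\<lambda>p'. move_root X (\<phi> p')) ` (edges G `` {p})"
      using \<phi>(1) unfolding bij_betw_def by (auto simp: image_image[symmetric])
    also have "\<dots> = (\<lambda>p'. lclass (G, \<xi>, p')) ` (edges G `` {p})" by (rule image_cong) (simp_all only: \<phi>(2))
    finally show ?thesis .
  qed
  have "bernoulli_graph D `` {X} = (\<lambda>p'. lclass (G, \<xi>, p')) ` (edges G `` {p})"
  proof (intro set_eqI iffI)
    fix Y assume "Y \<in> (\<lambda>p'. lclass (G, \<xi>, p')) ` (edges G `` {p})"
    then show "Y \<in> bernoulli_graph D `` {X}"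
      using x(1) unfolding bernoulli_graph_def x(2) by blast
  next
    fix Y assume "Y \<in> bernoulli_graph D `` {X}"
    then obtain H \<eta> q q' where H: "X = lclass (H, \<eta>, q)" "Y = lclass (H, \<eta>, q')" "(H, \<eta>, q) \<in> labelled D"
      "(q, q') \<in> edges H" unfolding bernoulli_graph_def by blast
    obtain \<psi> where \<psi>: "bij_betw \<psi> (edges H `` {q}) (nbrs X)"
      "\<And>p'. p' \<in> edges H `` {q} \<Longrightarrow> move_root X (\<psi> p') = lclass (H, \<eta>, p')"
      using nbrs_lclass[OF H(3)] H(1) by metis
    have q': "q' \<in> edges H `` {q}" using H(4) by simp
    then have "\<psi> q' \<in> nbrs X" using bij_betwE[OF \<psi>(1)] by blast
    then show "Y \<in> (\<lambda>p'. lclass (G, \<xi>, p')) ` (edges G `` {p})"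
      unfolding img[symmetric] H(2) \<psi>(2)[OF q', symmetric] by (rule imageI)
  qed
  then show "bernoulli_graph D `` {X} = move_root X ` nbrs X" using img by (simp only:)
  show "inj_on (move_root X) (nbrs X)"
  proof (rule inj_onI)
    fix i j assume ij: "i \<in> nbrs X" "j \<in> nbrs X" "move_root X i = move_root X j"
    obtain u v where uv: "u \<in> edges G `` {p}" "v \<in> edges G `` {p}" "i = \<phi> u" "j = \<phi> v"
      using ij(1,2) \<phi>(1) unfolding bij_betw_def by blast
    have "lclass (G, \<xi>, u) = lclass (G, \<xi>, v)" using ij(3) \<phi>(2)[OF uv(1)] \<phi>(2)[OF uv(2)] uv(3,4) by simp
    moreover have "(G, \<xi>, u) \<in> labelled D" by (rule labelled_move[OF x(1) neighbour_verts[OF x(1) uv(1)]])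
    ultimately have "((G, \<xi>, u), (G, \<xi>, v)) \<in> labelled_iso" by (rule lclass_eqD)
    then have "\<xi> u = \<xi> v" unfolding labelled_iso_def mem_Collect_eq split by metis
    moreover have "u \<in> bverts G p 1" "v \<in> bverts G p 1"
      using neighbour_in_bverts[OF labelledD(2)[OF x(1)]] uv(1,2) by auto
    ultimately show "i = j" using inj_onD[OF x(3)] uv(3,4) by blast
  qed
qed

lemma deg_bernoulli_graph: "X \<in> distinct_nbrs D \<Longrightarrow> deg (bernoulli_graph D) X = card (nbrs X)"
  by (simp add: deg_def bernoulli_graph_nbrs card_image)

lemma markov_op_bernoulli_graph:
  "X \<in> distinct_nbrs D \<Longrightarrow> markov_op (bernoulli_graph D) f X = avg nbrs move_root f X"
  by (simp add: markov_op_def avg_def deg_bernoulli_graph)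
    (simp add: bernoulli_graph_nbrs sum.reindex)

subsection \<open>The measure of the graphing\<close>

locale unimodular_graph =
  fixes D :: nat and \<nu> :: "rgraph set measure"
  assumes unimodular: "unimodular_random_graph D \<nu>"
begin

abbreviation (input) "L \<equiv> labelled_space D"
abbreviation (input) "\<mu> \<equiv> bernoulli_measure D \<nu>"

lemma sets_nu[measurable_cong]: "sets \<nu> = sets (rooted_space D)"
  and prob_space_nu: "prob_space \<nu>"
  using unimodular by (simp_all add: unimodular_random_graph_def)

lemma space_nu: "space \<nu> = space (rooted_space D)"
  by (rule sets_eq_imp_space_eq[OF sets_nu])

lemma nu_cases:
  assumes "X \<in> space \<nu>"
  obtains G p where "rep X = (G, p)" "(G, p) \<in> rooted D" "X = rclass (G, p)"
  using rooted_space_cases assms unfolding space_nu by metis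

lemma kernel[measurable]: "class_kernel D \<in> measurable \<nu> (subprob_algebra L)"
  using class_kernel_measurable[of D] measurable_cong_sets[OF sets_nu refl] by blast

lemma sets_mu[measurable_cong]: "sets \<mu> = sets L"
  unfolding bernoulli_measure_eq
  by (rule sets_bind[OF _ prob_space.not_empty[OF prob_space_nu]]) (erule nu_cases, simp add: class_kernel_def)

lemma space_mu: "space \<mu> = space L"
  by (rule sets_eq_imp_space_eq[OF sets_mu])

lemma prob_space_mu: "prob_space \<mu>"
  unfolding bernoulli_measure_eq
proof (rule prob_space.prob_space_bind[OF prob_space_nu _ kernel])
  show "AE X in \<nu>. prob_space (class_kernel D X)"
    by (rule AE_I2, erule nu_cases) (simp add: class_kernel_def prob_space_label_kernel)
qed

lemma nn_integral_mu:
  assumes f: "f \<in> borel_measurable L"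
  shows "(\<integral>\<^sup>+x. f x \<partial>\<mu>) = (\<integral>\<^sup>+X. (case rep X of (G, p) \<Rightarrow> \<integral>\<^sup>+\<xi>. f (lclass (G, \<xi>, p)) \<partial>label_measure G) \<partial>\<nu>)"
  unfolding bernoulli_measure_eq nn_integral_bind[OF f kernel]
proof (rule nn_integral_cong)
  fix X assume "X \<in> space \<nu>"
  then obtain G p where "rep X = (G, p)" "(G, p) \<in> rooted D" by (rule nu_cases)
  then show "(\<integral>\<^sup>+x. f x \<partial>class_kernel D X) = (case rep X of (G, p) \<Rightarrow> \<integral>\<^sup>+\<xi>. f (lclass (G, \<xi>, p)) \<partial>label_measure G)"
    by (simp add: class_kernel_def nn_integral_label_kernel[OF _ f])
qed

lemma distinct_nbrs_sets: "distinct_nbrs D \<in> sets L"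
  by (rule labelled_open_sets[OF distinct_nbrs_open])

lemma AE_mu_distinct: "AE X in \<mu>. X \<in> distinct_nbrs D"
  unfolding bernoulli_measure_eq
proof (subst AE_bind[OF kernel])
  show "Measurable.pred L (\<lambda>X. X \<in> distinct_nbrs D)" using distinct_nbrs_sets by measurable
  show "AE X in \<nu>. AE y in class_kernel D X. y \<in> distinct_nbrs D"
  proof (rule AE_I2)
    fix X assume "X \<in> space \<nu>"
    then obtain G p where X: "rep X = (G, p)" "(G, p) \<in> rooted D" by (rule nu_cases)
    show "AE y in class_kernel D X. y \<in> distinct_nbrs D"
      unfolding class_kernel_def X split by (rule AE_label_kernel_distinct[OF X(2)])
  qed
qed

lemma card_nbrs_bounds:
  assumes "X \<in> space L" shows "1 \<le> card (nbrs X)" "card (nbrs X) \<le> D"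
proof -
  obtain G \<xi> p where x: "(G, \<xi>, p) \<in> labelled D" "X = lclass (G, \<xi>, p)"
    using assms by (rule labelled_space_cases)
  show "1 \<le> card (nbrs X)" "card (nbrs X) \<le> D"
    unfolding x(2) card_nbrs_lclass[OF x(1)]
    using bounded_graph_deg_pos[OF labelledD(1,3)[OF x(1)]] bounded_graphD(5)[OF labelledD(1,3)[OF x(1)]] by simp_all
qed

lemma real_card_nbrs_measurable[measurable]: "(\<lambda>X. real (card (nbrs X))) \<in> borel_measurable L"
  using card_nbrs_measurable[of D] by measurable

definition mean_deg :: real where
  "mean_deg = (LINT X|\<mu>. real (card (nbrs X)))"

lemma mean_deg_ge_1: "1 \<le> mean_deg"
proof -
  interpret prob_space \<mu> by (rule prob_space_mu)
  have "integrable \<mu> (\<lambda>X. real (card (nbrs X)))"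
    by (rule integrable_const_bound[where B="real D"])
      (use card_nbrs_bounds(2) space_mu in \<open>auto intro!: AE_I2\<close>)
  then have "(LINT X|\<mu>. 1) \<le> mean_deg"
    unfolding mean_deg_def using card_nbrs_bounds(1) space_mu
    by (intro integral_mono) (auto simp: Suc_le_eq)
  then show ?thesis using prob_space by simp
qed

lemma AE_deg: "AE X in \<mu>. deg (bernoulli_graph D) X = card (nbrs X)"
  using AE_mu_distinct by eventually_elim (rule deg_bernoulli_graph)

end

text \<open>
  The degree in the graphing is compared with the degree in the graph, which is Borel, only almost
  everywhere. If the former were not Borel, its integral would be zero by convention, and so would
  be the measure \<open>mu_star\<close>.
\<close>

locale measurable_degree = unimodular_graph +
  assumes deg_measurable: "(\<lambda>X. real (deg (bernoulli_graph D) X)) \<in> borel_measurable (bernoulli_measure D \<nu>)"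
begin

abbreviation (input) "\<mu>s \<equiv> mu_star D \<nu>"

lemma mu_star_eq: "\<mu>s = density \<mu> (\<lambda>X. ennreal (real (card (nbrs X)) / mean_deg))"
proof -
  have c: "(LINT X|\<mu>. real (deg (bernoulli_graph D) X)) = mean_deg"
    unfolding mean_deg_def using AE_deg deg_measurable by (intro integral_cong_AE) auto
  show ?thesis
    unfolding mu_star_def degree_biased_def c
    using deg_measurable AE_deg by (intro density_cong) (auto elim: AE_mp)
qed

lemma sets_mu_star[measurable_cong, simp]: "sets \<mu>s = sets L"
  and space_mu_star[simp]: "space \<mu>s = space L"
  unfolding mu_star_eq by (simp_all add: sets_mu space_mu)

lemma AE_mu_starI:
  assumes "AE X in \<mu>. P X" shows "AE X in \<mu>s. P X"
  unfolding mu_star_eq by (subst AE_density) (use assms in auto)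

lemma nn_integral_mu_star:
  assumes f[measurable]: "f \<in> borel_measurable L"
  shows "(\<integral>\<^sup>+X. f X \<partial>\<mu>s) = ennreal (1 / mean_deg) * (\<integral>\<^sup>+X. of_nat (card (nbrs X)) * f X \<partial>\<mu>)"
proof -
  have [measurable]: "(\<lambda>X. of_nat (card (nbrs X)) :: ennreal) \<in> borel_measurable L"
    using card_nbrs_measurable[of D] by measurable
  have "(\<integral>\<^sup>+X. f X \<partial>\<mu>s) = (\<integral>\<^sup>+X. ennreal (real (card (nbrs X)) / mean_deg) * f X \<partial>\<mu>)"
    unfolding mu_star_eq by (rule nn_integral_density) measurable
  also have "\<dots> = (\<integral>\<^sup>+X. ennreal (1 / mean_deg) * (of_nat (card (nbrs X)) * f X) \<partial>\<mu>)"
  proof (rule nn_integral_cong)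
    fix X
    have "ennreal (real (card (nbrs X)) / mean_deg) = ennreal (1 / mean_deg) * ennreal (real (card (nbrs X)))"
      using mean_deg_ge_1 by (simp add: ennreal_mult[symmetric])
    then show "ennreal (real (card (nbrs X)) / mean_deg) * f X
        = ennreal (1 / mean_deg) * (of_nat (card (nbrs X)) * f X)"
      by (simp add: mult.assoc ennreal_of_nat_eq_real_of_nat)
  qed
  also have "\<dots> = ennreal (1 / mean_deg) * (\<integral>\<^sup>+X. of_nat (card (nbrs X)) * f X \<partial>\<mu>)"
    by (rule nn_integral_cmult) measurable
  finally show ?thesis .
qed

lemma prob_space_mu_star: "prob_space \<mu>s"
proof (rule prob_spaceI)
  interpret prob_space \<mu> by (rule prob_space_mu)
  have int: "integrable \<mu> (\<lambda>X. real (card (nbrs X)))"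
    by (rule integrable_const_bound[where B="real D"])
      (use card_nbrs_bounds(2) space_mu in \<open>auto intro!: AE_I2\<close>)
  have "emeasure \<mu>s (space \<mu>s) = ennreal (1 / mean_deg) * (\<integral>\<^sup>+X. of_nat (card (nbrs X)) * 1 \<partial>\<mu>)"
    using nn_integral_mu_star[of "\<lambda>_. 1"] by simp
  also have "(\<integral>\<^sup>+X. of_nat (card (nbrs X)) * 1 \<partial>\<mu>) = ennreal mean_deg"
    unfolding mean_deg_def using nn_integral_eq_integral[OF int] by (simp add: ennreal_of_nat_eq_real_of_nat)
  also have "ennreal (1 / mean_deg) * ennreal mean_deg = 1"
    using mean_deg_ge_1 by (subst ennreal_mult[symmetric]) auto
  finally show "emeasure \<mu>s (space \<mu>s) = 1" .
qed

text \<open>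
  The degree in the density of \<open>mu_star\<close> cancels the normalisation of the walk, so the flow from
  \<open>A\<close> to \<open>B\<close> is the expected number of neighbours in \<open>B\<close> of a root in \<open>A\<close>. Taking the
  expectation over the labels first gives the mass sent out by the root.
\<close>

lemma reversible_local:
  assumes A: "A \<in> local_sets D n" and B: "B \<in> local_sets D n"
  shows "(\<integral>\<^sup>+X. indicator A X * ennreal (real (card {i \<in> nbrs X. move_root X i \<in> B}) / real (card (nbrs X))) \<partial>\<mu>s)
    = ennreal (1 / mean_deg) * (\<integral>\<^sup>+X. (case rep X of (G, p) \<Rightarrow> \<Sum>p'\<in>edges G `` {p}. ennreal (joint A B G p p')) \<partial>\<nu>)"
proof -
  have [measurable]: "A \<in> sets L" "B \<in> sets L" using A B local_sets_measurable by blast+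
  note [measurable] = nbrs_count_measurable[OF \<open>B \<in> sets L\<close>]
  have [measurable]: "(\<lambda>X. of_nat (card (nbrs X)) :: ennreal) \<in> borel_measurable L"
    using card_nbrs_measurable[of D] by measurable
  have "(\<integral>\<^sup>+X. indicator A X * ennreal (real (card {i \<in> nbrs X. move_root X i \<in> B}) / real (card (nbrs X))) \<partial>\<mu>s)
      = ennreal (1 / mean_deg) * (\<integral>\<^sup>+X. of_nat (card (nbrs X)) *
          (indicator A X * ennreal (real (card {i \<in> nbrs X. move_root X i \<in> B}) / real (card (nbrs X)))) \<partial>\<mu>)"
    by (rule nn_integral_mu_star) measurable
  also have "(\<integral>\<^sup>+X. of_nat (card (nbrs X)) *
          (indicator A X * ennreal (real (card {i \<in> nbrs X. move_root X i \<in> B}) / real (card (nbrs X)))) \<partial>\<mu>)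
      = (\<integral>\<^sup>+X. (case rep X of (G, p) \<Rightarrow> \<integral>\<^sup>+\<xi>. of_nat (card (nbrs (lclass (G, \<xi>, p)))) *
          (indicator A (lclass (G, \<xi>, p)) * ennreal (real (card {i \<in> nbrs (lclass (G, \<xi>, p)).
              move_root (lclass (G, \<xi>, p)) i \<in> B}) / real (card (nbrs (lclass (G, \<xi>, p)))))) \<partial>label_measure G) \<partial>\<nu>)"
    by (rule nn_integral_mu) measurable
  also have "\<dots> = (\<integral>\<^sup>+X. (case rep X of (G, p) \<Rightarrow> \<Sum>p'\<in>edges G `` {p}. ennreal (joint A B G p p')) \<partial>\<nu>)"
  proof (rule nn_integral_cong)
    fix X assume "X \<in> space \<nu>"
    then obtain G p where X: "rep X = (G, p)" "(G, p) \<in> rooted D" by (rule nu_cases)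
    interpret prob_space "label_measure G" by (rule prob_space_label_measure)
    have fin: "finite (edges G `` {p})" by (rule bounded_graphD(4)[OF rootedD(1,3)[OF X(2)]])
    let ?E = "\<lambda>p'. {\<xi> \<in> space (label_measure G). lclass (G, \<xi>, p) \<in> A \<and> lclass (G, \<xi>, p') \<in> B}"
    have E: "?E p' \<in> sets (label_measure G)" if "p' \<in> edges G `` {p}" for p'
      using joint_event_measurable[OF X(2) _ \<open>A \<in> sets L\<close> \<open>B \<in> sets L\<close>]
        simple_graph_edge[OF rootedD(2)[OF X(2)], of p p'] that by blast
    have "(\<integral>\<^sup>+\<xi>. of_nat (card (nbrs (lclass (G, \<xi>, p)))) *
          (indicator A (lclass (G, \<xi>, p)) * ennreal (real (card {i \<in> nbrs (lclass (G, \<xi>, p)).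
              move_root (lclass (G, \<xi>, p)) i \<in> B}) / real (card (nbrs (lclass (G, \<xi>, p)))))) \<partial>label_measure G)
        = (\<integral>\<^sup>+\<xi>. (\<Sum>p'\<in>edges G `` {p}. indicator (?E p') \<xi>) \<partial>label_measure G)"
    proof (rule nn_integral_cong)
      fix \<xi> assume \<xi>: "\<xi> \<in> space (label_measure G)"
      then have x: "(G, \<xi>, p) \<in> labelled D" using X(2) by (simp add: labelled_iff)
      have d: "0 < deg (edges G) p" by (rule bounded_graph_deg_pos[OF rootedD(1,3)[OF X(2)]])
      have cancel: "of_nat m * ennreal (real k / real m) = of_nat k" if "0 < m" for k m :: nat
        using that by (simp add: ennreal_of_nat_eq_real_of_nat ennreal_mult[symmetric])
      have "(\<Sum>p'\<in>edges G `` {p}. indicator (?E p') \<xi> :: ennreal)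
          = (\<Sum>p'\<in>edges G `` {p}. indicator A (lclass (G, \<xi>, p)) * (if lclass (G, \<xi>, p') \<in> B then 1 else 0))"
        using \<xi> by (intro sum.cong refl) (auto split: split_indicator)
      also have "\<dots> = indicator A (lclass (G, \<xi>, p)) * of_nat (card {p' \<in> edges G `` {p}. lclass (G, \<xi>, p') \<in> B})"
        using fin by (simp add: sum_distrib_left[symmetric] sum.If_cases Int_def conj_commute)
      also have "\<dots> = of_nat (deg (edges G) p) * (indicator A (lclass (G, \<xi>, p)) *
          ennreal (real (card {p' \<in> edges G `` {p}. lclass (G, \<xi>, p') \<in> B}) / real (deg (edges G) p)))"
        by (simp only: mult.left_commute[of "of_nat _"] cancel[OF d])
      finally show "of_nat (card (nbrs (lclass (G, \<xi>, p)))) *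
          (indicator A (lclass (G, \<xi>, p)) * ennreal (real (card {i \<in> nbrs (lclass (G, \<xi>, p)).
              move_root (lclass (G, \<xi>, p)) i \<in> B}) / real (card (nbrs (lclass (G, \<xi>, p))))))
          = (\<Sum>p'\<in>edges G `` {p}. indicator (?E p') \<xi>)"
        unfolding card_nbrs_lclass[OF x] count_nbrs_lclass[OF x] by simp
    qed
    also have "\<dots> = (\<Sum>p'\<in>edges G `` {p}. emeasure (label_measure G) (?E p'))"
      using E by (subst nn_integral_sum) auto
    also have "\<dots> = (\<Sum>p'\<in>edges G `` {p}. ennreal (joint A B G p p'))"
      unfolding joint_def by (simp add: emeasure_eq_measure)
    finally show "(case rep X of (G, p) \<Rightarrow> \<integral>\<^sup>+\<xi>. of_nat (card (nbrs (lclass (G, \<xi>, p)))) *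
          (indicator A (lclass (G, \<xi>, p)) * ennreal (real (card {i \<in> nbrs (lclass (G, \<xi>, p)).
              move_root (lclass (G, \<xi>, p)) i \<in> B}) / real (card (nbrs (lclass (G, \<xi>, p)))))) \<partial>label_measure G)
        = (case rep X of (G, p) \<Rightarrow> \<Sum>p'\<in>edges G `` {p}. ennreal (joint A B G p p'))"
      unfolding X split .
  qed
  finally show ?thesis .
qed

sublocale walk: finite_walk \<mu>s nbrs move_root
  using nbrs_finite_walk[of D] by (simp add: finite_walk_def)

sublocale reversible_walk \<mu>s nbrs move_root
proof
  fix A assume A: "A \<in> sets \<mu>s"
  show count: "(\<lambda>X. real (card {i \<in> nbrs X. move_root X i \<in> A}) / real (card (nbrs X))) \<in> borel_measurable \<mu>s"
    unfolding measurable_cong_sets[OF sets_mu_star refl] by (rule nbrs_count_measurable) (use A in simp)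
next
  fix A B assume A: "A \<in> sets \<mu>s" and B: "B \<in> sets \<mu>s"
  have W_count: "(\<integral>\<^sup>+X. indicator A X * emeasure (walk.W X) B \<partial>\<mu>s)
      = (\<integral>\<^sup>+X. indicator A X * ennreal (real (card {i \<in> nbrs X. move_root X i \<in> B}) / real (card (nbrs X))) \<partial>\<mu>s)"
    if "B \<in> sets \<mu>s" for A B
    by (rule nn_integral_cong) (simp only: walk.emeasure_W[OF _ that])
  have W: "walk.W \<in> measurable \<mu>s (subprob_algebra \<mu>s)"
    by (rule walk.W_kernelI, unfold measurable_cong_sets[OF sets_mu_star refl])
      (rule nbrs_count_measurable, simp)
  have fin: "finite_measure \<mu>s" using prob_space_mu_star by (rule prob_space.finite_measure)
  have sets: "sets \<mu>s = sigma_sets (space \<mu>s) (\<Union>n. local_sets D n)"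
    using sets_labelled_space_local[of D] by simp
  have sub: "(\<Union>n. local_sets D n) \<subseteq> Pow (space \<mu>s)" using local_sets_subset[of D] by simp
  have top: "space \<mu>s \<in> (\<Union>n. local_sets D n)" using space_local_sets[of D 0] by auto
  have "(\<integral>\<^sup>+x. indicator A x * emeasure (walk.W x) B \<partial>\<mu>s) = (\<integral>\<^sup>+x. indicator B x * emeasure (walk.W x) A \<partial>\<mu>s)"
  proof (rule walk.reversible_generated[OF fin W sets local_sets_Int_stable sub top _ A B])
    fix A B assume "A \<in> (\<Union>n. local_sets D n)" "B \<in> (\<Union>n. local_sets D n)"
    then obtain m n where "A \<in> local_sets D m" "B \<in> local_sets D n" by blast
    then have AB: "A \<in> local_sets D (max m n)" "B \<in> local_sets D (max m n)"
      using local_sets_mono[of m "max m n" D] local_sets_mono[of n "max m n" D] by auto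
    have s: "A \<in> sets \<mu>s" "B \<in> sets \<mu>s" using local_sets_measurable[OF AB(1)] local_sets_measurable[OF AB(2)] by simp_all
    show "(\<integral>\<^sup>+x. indicator A x * emeasure (walk.W x) B \<partial>\<mu>s) = (\<integral>\<^sup>+x. indicator B x * emeasure (walk.W x) A \<partial>\<mu>s)"
      unfolding W_count[OF s(1)] W_count[OF s(2)] reversible_local[OF AB] reversible_local[OF AB(2,1)]
        labelled_mass_transport[OF unimodular AB] ..
  qed
  then show "(\<integral>\<^sup>+X. indicator A X * ennreal (real (card {i \<in> nbrs X. move_root X i \<in> B}) / real (card (nbrs X))) \<partial>\<mu>s)
      = (\<integral>\<^sup>+X. indicator B X * ennreal (real (card {i \<in> nbrs X. move_root X i \<in> A}) / real (card (nbrs X))) \<partial>\<mu>s)"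
    unfolding W_count[OF A] W_count[OF B] .
qed

lemma AE_markov_op: "AE X in \<mu>s. markov_op (bernoulli_graph D) f X = avg nbrs move_root f X"
proof (rule AE_mu_starI)
  show "AE X in \<mu>. markov_op (bernoulli_graph D) f X = avg nbrs move_root f X"
    using AE_mu_distinct by eventually_elim (rule markov_op_bernoulli_graph)
qed

end

section \<open>The spectral radius of a graph\<close>

lemma sets_deg_measure: "sets (deg_measure G) = Pow (verts G)"
  and space_deg_measure: "space (deg_measure G) = verts G"
  by (simp_all add: deg_measure_def sets_point_measure space_point_measure)

lemma deg_measure_measurable[simp]: "f \<in> borel_measurable (deg_measure G)"
  by (simp add: deg_measure_def)

lemma nn_integral_deg_measure:
  "(\<integral>\<^sup>+u. f u \<partial>deg_measure G) = (\<integral>\<^sup>+u. of_nat (deg (edges G) u) * f u \<partial>count_space (verts G))"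
  unfolding deg_measure_def point_measure_def
  by (subst nn_integral_density) (auto simp: ennreal_of_nat_eq_real_of_nat)

abbreviation (input) graph_nbrs :: "graph \<Rightarrow> nat \<Rightarrow> nat set" where
  "graph_nbrs G x \<equiv> edges G `` {x}"

lemma avg_graph: "avg (graph_nbrs G) (\<lambda>x i. i) = markov_op (edges G)"
  by (simp add: fun_eq_iff avg_def markov_op_def deg_def)

text \<open>
  With the measure \<open>deg\<close>, the flow from \<open>A\<close> to \<open>B\<close> is the number of edges from \<open>A\<close> to \<open>B\<close>.
\<close>

lemma graph_reversible_walk:
  assumes G: "bounded_graph D G"
  shows "reversible_walk (deg_measure G) (graph_nbrs G) (\<lambda>x i. i)"
proof
  fix x assume x: "x \<in> space (deg_measure G)"
  show "finite (graph_nbrs G x)" "graph_nbrs G x \<noteq> {}"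
    using bounded_graphD(3,4)[OF G] x unfolding space_deg_measure by simp_all
  show "i \<in> space (deg_measure G)" if "i \<in> graph_nbrs G x" for i
    using simple_graph_edge[OF bounded_graphD(1)[OF G]] that unfolding space_deg_measure by blast
next
  show "(\<lambda>x. real (card {i \<in> graph_nbrs G x. i \<in> A}) / real (card (graph_nbrs G x))) \<in> borel_measurable (deg_measure G)"
    for A by simp
next
  fix A B assume "A \<in> sets (deg_measure G)" "B \<in> sets (deg_measure G)"
  then have AB: "A \<subseteq> verts G" "B \<subseteq> verts G" by (simp_all add: sets_deg_measure)
  note sG = bounded_graphD(1)[OF G]
  have half: "(\<integral>\<^sup>+x. indicator A x * ennreal (real (card {i \<in> graph_nbrs G x. i \<in> B}) / real (card (graph_nbrs G x))) \<partial>deg_measure G)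
      = (\<integral>\<^sup>+x. (\<integral>\<^sup>+y. indicator (edges G \<inter> A \<times> B) (x, y) \<partial>count_space UNIV) \<partial>count_space UNIV)"
    if A: "A \<subseteq> verts G" for A B
  proof -
    have "(\<integral>\<^sup>+x. indicator A x * ennreal (real (card {i \<in> graph_nbrs G x. i \<in> B}) / real (card (graph_nbrs G x))) \<partial>deg_measure G)
        = (\<integral>\<^sup>+x. of_nat (deg (edges G) x) * (indicator A x * ennreal (real (card {i \<in> graph_nbrs G x. i \<in> B}) / real (card (graph_nbrs G x)))) \<partial>count_space (verts G))"
      by (rule nn_integral_deg_measure)
    also have "\<dots> = (\<integral>\<^sup>+x. (\<integral>\<^sup>+y. indicator (edges G \<inter> A \<times> B) (x, y) \<partial>count_space UNIV) \<partial>count_space (verts G))"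
    proof (rule nn_integral_cong)
      fix x assume "x \<in> space (count_space (verts G))"
      then have x: "x \<in> verts G" by simp
      have d: "0 < card (graph_nbrs G x)" using bounded_graph_deg_pos[OF G x] by (simp add: deg_def)
      have fin: "finite {i \<in> graph_nbrs G x. i \<in> B}"
        by (rule finite_subset[OF _ bounded_graphD(4)[OF G x]]) blast
      have "(\<integral>\<^sup>+y. indicator (edges G \<inter> A \<times> B) (x, y) \<partial>count_space UNIV)
          = (\<integral>\<^sup>+y. indicator A x * indicator {i \<in> graph_nbrs G x. i \<in> B} y \<partial>count_space UNIV)"
        by (intro nn_integral_cong) (auto split: split_indicator)
      also have "\<dots> = indicator A x * of_nat (card {i \<in> graph_nbrs G x. i \<in> B})"
        using fin by (subst nn_integral_cmult) (auto simp: emeasure_count_space_finite)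
      also have "of_nat (card {i \<in> graph_nbrs G x. i \<in> B})
          = of_nat (card (graph_nbrs G x)) * ennreal (real (card {i \<in> graph_nbrs G x. i \<in> B}) / real (card (graph_nbrs G x)))"
        using d by (simp add: ennreal_of_nat_eq_real_of_nat ennreal_mult[symmetric])
      finally show "of_nat (deg (edges G) x) * (indicator A x * ennreal (real (card {i \<in> graph_nbrs G x. i \<in> B}) / real (card (graph_nbrs G x))))
          = (\<integral>\<^sup>+y. indicator (edges G \<inter> A \<times> B) (x, y) \<partial>count_space UNIV)"
        unfolding deg_def by (simp only: mult.left_commute)
    qed
    also have "\<dots> = (\<integral>\<^sup>+x. (\<integral>\<^sup>+y. indicator (edges G \<inter> A \<times> B) (x, y) \<partial>count_space UNIV) * indicator (verts G) x \<partial>count_space UNIV)"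
      by (rule nn_integral_count_space_indicator) simp
    also have "\<dots> = (\<integral>\<^sup>+x. (\<integral>\<^sup>+y. indicator (edges G \<inter> A \<times> B) (x, y) \<partial>count_space UNIV) \<partial>count_space UNIV)"
    proof (rule nn_integral_cong)
      fix x
      show "(\<integral>\<^sup>+y. indicator (edges G \<inter> A \<times> B) (x, y) \<partial>count_space UNIV) * indicator (verts G) x
          = (\<integral>\<^sup>+y. indicator (edges G \<inter> A \<times> B) (x, y) \<partial>count_space UNIV)"
      proof (cases "x \<in> verts G")
        case False
        then have "indicator (edges G \<inter> A \<times> B) (x, y) = (0 :: ennreal)" for y using A by (auto split: split_indicator)
        then show ?thesis by simp
      qed simp
    qed
    finally show ?thesis .
  qed
  have swap: "indicator (edges G \<inter> A \<times> B) (x, y) = (indicator (edges G \<inter> B \<times> A) (y, x) :: ennreal)" for x y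
    using simple_graph_edge[OF sG] by (auto split: split_indicator)
  show "(\<integral>\<^sup>+x. indicator A x * ennreal (real (card {i \<in> graph_nbrs G x. i \<in> B}) / real (card (graph_nbrs G x))) \<partial>deg_measure G)
      = (\<integral>\<^sup>+x. indicator B x * ennreal (real (card {i \<in> graph_nbrs G x. i \<in> A}) / real (card (graph_nbrs G x))) \<partial>deg_measure G)"
    unfolding half[OF AB(1)] half[OF AB(2)] swap
    using nn_integral_fst_count_space[of "indicator (edges G \<inter> B \<times> A) :: _ \<Rightarrow> ennreal"]
      nn_integral_snd_count_space[of "indicator (edges G \<inter> B \<times> A) :: _ \<Rightarrow> ennreal"]
    by (simp only:)
qed

lemma graph_symmetric_operator:
  assumes G: "bounded_graph D G"
  shows "L2_symmetric_operator (deg_measure G) (L2_space (deg_measure G)) (markov_op (edges G))"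
proof -
  interpret reversible_walk "deg_measure G" "graph_nbrs G" "\<lambda>x i. i" by (rule graph_reversible_walk[OF G])
  show ?thesis
    using avg_symmetric_operator[OF subset_refl L2_zero L2_add L2_scale _ avg_L2] unfolding avg_graph by blast
qed

lemma finite_support_L2:
  fixes f :: "nat \<Rightarrow> complex"
  assumes S: "finite S" "S \<subseteq> verts G" and supp: "\<And>u. u \<in> verts G \<Longrightarrow> u \<notin> S \<Longrightarrow> f u = 0"
  shows "f \<in> L2_space (deg_measure G)"
    and "(L2_norm (deg_measure G) f)\<^sup>2 = (\<Sum>u\<in>S. real (deg (edges G) u) * (cmod (f u))\<^sup>2)"
proof -
  have "(\<integral>\<^sup>+u. ennreal ((cmod (f u))\<^sup>2) \<partial>deg_measure G)
      = (\<integral>\<^sup>+u. of_nat (deg (edges G) u) * ennreal ((cmod (f u))\<^sup>2) \<partial>count_space (verts G))"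
    by (rule nn_integral_deg_measure)
  also have "\<dots> = (\<Sum>u\<in>S. of_nat (deg (edges G) u) * ennreal ((cmod (f u))\<^sup>2))"
    by (rule nn_integral_count_space'[OF S(1) _ S(2)]) (simp add: supp)
  also have "\<dots> = (\<Sum>u\<in>S. ennreal (real (deg (edges G) u) * (cmod (f u))\<^sup>2))"
    by (simp add: ennreal_of_nat_eq_real_of_nat ennreal_mult)
  also have "\<dots> = ennreal (\<Sum>u\<in>S. real (deg (edges G) u) * (cmod (f u))\<^sup>2)"
    by (rule sum_ennreal) simp
  finally have nn: "(\<integral>\<^sup>+u. ennreal ((cmod (f u))\<^sup>2) \<partial>deg_measure G)
      = ennreal (\<Sum>u\<in>S. real (deg (edges G) u) * (cmod (f u))\<^sup>2)" .
  show "f \<in> L2_space (deg_measure G)"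
    by (rule L2_spaceI) (simp_all add: integrable_iff_bounded nn)
  show "(L2_norm (deg_measure G) f)\<^sup>2 = (\<Sum>u\<in>S. real (deg (edges G) u) * (cmod (f u))\<^sup>2)"
    unfolding L2_norm_power2 by (subst integral_eq_nn_integral) (simp_all add: nn sum_nonneg)
qed

lemma L2_pointwise_le:
  assumes p: "p \<in> verts G" and h: "h \<in> L2_space (deg_measure G)"
  shows "real (deg (edges G) p) * (cmod (h p))\<^sup>2 \<le> (L2_norm (deg_measure G) h)\<^sup>2"
proof -
  let ?g = "\<lambda>u. if u = p then h u else 0"
  have g: "?g \<in> L2_space (deg_measure G)"
    by (rule finite_support_L2(1)[of "{p}"]) (use p in auto)
  have g2: "(L2_norm (deg_measure G) ?g)\<^sup>2 = (\<Sum>u\<in>{p}. real (deg (edges G) u) * (cmod (?g u))\<^sup>2)"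
    by (rule finite_support_L2(2)) (use p in auto)
  have "(L2_norm (deg_measure G) ?g)\<^sup>2 \<le> (L2_norm (deg_measure G) h)\<^sup>2"
    unfolding L2_norm_power2
    by (rule integral_mono[OF L2_square_integrable[OF g] L2_square_integrable[OF h]]) simp
  then show ?thesis unfolding g2 by simp
qed

definition markov_norm_le :: "graph \<Rightarrow> real \<Rightarrow> bool" where
  "markov_norm_le G r \<longleftrightarrow> (\<forall>f\<in>L2_space (deg_measure G).
     L2_norm (deg_measure G) (markov_op (edges G) f) \<le> r * L2_norm (deg_measure G) f)"

lemma spectral_radius_le_iff:
  assumes X: "rep X = (G, p)" "(G, p) \<in> rooted D"
  shows "0 \<le> spectral_radius X" and "0 \<le> r \<Longrightarrow> spectral_radius X \<le> r \<longleftrightarrow> markov_norm_le G r"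
proof -
  interpret L2_symmetric_operator "deg_measure G" "L2_space (deg_measure G)" "markov_op (edges G)"
    by (rule graph_symmetric_operator[OF rootedD(1)[OF X(2)]])
  note p = rootedD(3)[OF X(2)]
  let ?f = "\<lambda>u. if u = p then 1 else 0 :: complex"
  have f: "?f \<in> L2_space (deg_measure G)"
    by (rule finite_support_L2(1)[of "{p}"]) (use p in auto)
  have f2: "(L2_norm (deg_measure G) ?f)\<^sup>2 = (\<Sum>u\<in>{p}. real (deg (edges G) u) * (cmod (?f u))\<^sup>2)"
    by (rule finite_support_L2(2)) (use p in auto)
  have "L2_norm (deg_measure G) ?f \<noteq> 0"
    using f2 bounded_graph_deg_pos[OF rootedD(1)[OF X(2)] p] by auto
  note S = Sup_spectrum_le_iff[OF f this]
  show "0 \<le> spectral_radius X" unfolding spectral_radius_def X(1) split by (rule S(1))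
  show "spectral_radius X \<le> r \<longleftrightarrow> markov_norm_le G r" if "0 \<le> r"
    unfolding spectral_radius_def X(1) split markov_norm_le_def by (rule S(2)[OF that])
qed

text \<open>
  By density of finitely supported functions, the norm is at most \<open>r\<close> if and only if this holds
  for all functions supported in a ball around \<open>p\<close>, which is a condition on a slightly larger ball.
\<close>

definition ball_norm_le :: "nat \<Rightarrow> real \<Rightarrow> graph \<Rightarrow> nat \<Rightarrow> bool" where
  "ball_norm_le n r G p \<longleftrightarrow> (\<forall>f :: nat \<Rightarrow> complex. (\<forall>u. u \<notin> bverts G p n \<longrightarrow> f u = 0) \<longrightarrow>
     (\<Sum>u\<in>bverts G p (Suc n). real (deg (edges G) u) * (cmod (markov_op (edges G) f u))\<^sup>2)
       \<le> r\<^sup>2 * (\<Sum>u\<in>bverts G p n. real (deg (edges G) u) * (cmod (f u))\<^sup>2))"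

lemma markov_op_support:
  assumes G: "bounded_graph D G" and p: "p \<in> verts G"
    and supp: "\<And>u. u \<notin> bverts G p n \<Longrightarrow> f u = 0" and u: "u \<in> verts G" "u \<notin> bverts G p (Suc n)"
  shows "markov_op (edges G) f u = 0"
proof -
  have "f v = 0" if v: "(u, v) \<in> edges G" for v
  proof (rule supp, rule notI)
    assume "v \<in> bverts G p n"
    moreover have "(v, u) \<in> edges G" using simple_graph_edge[OF bounded_graphD(1)[OF G] v] by blast
    ultimately have "u \<in> bverts G p (Suc n)" by (rule bverts_edge[OF bounded_graphD(1)[OF G]])
    then show False using u(2) by blast
  qed
  then show ?thesis by (simp add: markov_op_def)
qed

lemma markov_norm_le_iff_balls:
  assumes G: "bounded_graph D G" and p: "p \<in> verts G" and r: "0 \<le> r"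
  shows "markov_norm_le G r \<longleftrightarrow> (\<forall>n. ball_norm_le n r G p)"
proof -
  let ?M = "deg_measure G" and ?T = "markov_op (edges G)"
  interpret L2_symmetric_operator ?M "L2_space ?M" ?T by (rule graph_symmetric_operator[OF G])
  have sq: "ball_norm_le n r G p \<longleftrightarrow> (\<forall>f. (\<forall>u. u \<notin> bverts G p n \<longrightarrow> f u = 0) \<longrightarrow>
      (L2_norm ?M (?T f))\<^sup>2 \<le> (r * L2_norm ?M f)\<^sup>2)" for n
  proof -
    have "(L2_norm ?M (?T f))\<^sup>2 = (\<Sum>u\<in>bverts G p (Suc n). real (deg (edges G) u) * (cmod (?T f u))\<^sup>2)
        \<and> (L2_norm ?M f)\<^sup>2 = (\<Sum>u\<in>bverts G p n. real (deg (edges G) u) * (cmod (f u))\<^sup>2)"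
      if f: "\<forall>u. u \<notin> bverts G p n \<longrightarrow> f u = 0" for f
    proof
      show "(L2_norm ?M (?T f))\<^sup>2 = (\<Sum>u\<in>bverts G p (Suc n). real (deg (edges G) u) * (cmod (?T f u))\<^sup>2)"
      proof (rule finite_support_L2(2)[OF finite_bverts[OF G p] bverts_subset])
        show "?T f u = 0" if "u \<in> verts G" "u \<notin> bverts G p (Suc n)" for u
          by (rule markov_op_support[OF G p _ that]) (use f in blast)
      qed
      show "(L2_norm ?M f)\<^sup>2 = (\<Sum>u\<in>bverts G p n. real (deg (edges G) u) * (cmod (f u))\<^sup>2)"
        by (rule finite_support_L2(2)[OF finite_bverts[OF G p] bverts_subset]) (use f in blast)
    qed
    then show ?thesis unfolding ball_norm_le_def power_mult_distrib by simp
  qed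
  show ?thesis
  proof
    assume NB: "markov_norm_le G r"
    show "\<forall>n. ball_norm_le n r G p"
      unfolding sq
    proof (intro allI impI power_mono L2_norm_nonneg)
      fix n and f :: "nat \<Rightarrow> complex" assume "\<forall>u. u \<notin> bverts G p n \<longrightarrow> f u = 0"
      then have "f \<in> L2_space ?M"
        by (intro finite_support_L2(1)[OF finite_bverts[OF G p] bverts_subset]) blast
      then show "L2_norm ?M (?T f) \<le> r * L2_norm ?M f" using NB unfolding markov_norm_le_def by blast
    qed
  next
    assume LB: "\<forall>n. ball_norm_le n r G p"
    show "markov_norm_le G r"
      unfolding markov_norm_le_def
    proof
      fix f assume f: "f \<in> L2_space ?M"
      define g where "g n u = (if u \<in> bverts G p n then f u else 0)" for n u
      have g: "g n \<in> L2_space ?M" for n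
        by (rule finite_support_L2(1)[OF finite_bverts[OF G p, of n] bverts_subset]) (simp add: g_def)
      have Tg: "L2_norm ?M (?T (g n)) \<le> r * L2_norm ?M (g n)" for n
      proof (rule power2_le_imp_le)
        show "(L2_norm ?M (?T (g n)))\<^sup>2 \<le> (r * L2_norm ?M (g n))\<^sup>2"
          using LB[unfolded sq, rule_format, of n "g n"] by (simp add: g_def)
      qed (use r in simp)
      have "(\<lambda>n. LINT u|?M. (cmod (f u - g n u))\<^sup>2) \<longlonglongrightarrow> (LINT u|?M. 0)"
      proof (rule integral_dominated_convergence[where w="\<lambda>u. (cmod (f u))\<^sup>2"])
        show "AE u in ?M. (\<lambda>n. (cmod (f u - g n u))\<^sup>2) \<longlonglongrightarrow> 0"
        proof (rule AE_I2)
          fix u assume "u \<in> space ?M"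
          then obtain m where m: "u \<in> bverts G p m"
            using connected_bverts[OF G p] unfolding space_deg_measure by metis
          have "\<forall>\<^sub>F n in sequentially. (cmod (f u - g n u))\<^sup>2 = 0"
            unfolding eventually_sequentially
            using bverts_mono[of m _ G p] m by (intro exI[of _ m]) (auto simp: g_def)
          then show "(\<lambda>n. (cmod (f u - g n u))\<^sup>2) \<longlonglongrightarrow> 0" by (rule tendsto_eventually)
        qed
        show "AE u in ?M. norm ((cmod (f u - g n u))\<^sup>2) \<le> (cmod (f u))\<^sup>2" for n
          by (rule AE_I2) (simp add: g_def)
      qed (use L2_square_integrable[OF f] in simp_all)
      then have "(\<lambda>n. sqrt (LINT u|?M. (cmod (f u - g n u))\<^sup>2)) \<longlonglongrightarrow> sqrt 0"
        by (intro tendsto_real_sqrt) simp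
      then have lim: "(\<lambda>n. L2_norm ?M (\<lambda>u. f u - g n u)) \<longlonglongrightarrow> 0" by (simp add: L2_norm_def)
      have bound: "L2_norm ?M (?T f) \<le> r * L2_norm ?M f + (r + 1) * L2_norm ?M (\<lambda>u. f u - g n u)" for n
      proof -
        have "L2_norm ?M (?T f) \<le> L2_norm ?M (\<lambda>u. ?T f u - ?T (g n) u) + L2_norm ?M (?T (g n))"
          by (rule L2_norm_triangle_diff[OF T_H[OF f] T_H[OF g]])
        also have "L2_norm ?M (\<lambda>u. ?T f u - ?T (g n) u) \<le> L2_norm ?M (\<lambda>u. f u - g n u)"
          using T_contraction[OF L2_diff[OF f g]] by (simp only: T_diff)
        also have "L2_norm ?M (?T (g n)) \<le> r * (L2_norm ?M f + L2_norm ?M (\<lambda>u. f u - g n u))"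
        proof (rule order_trans[OF Tg mult_left_mono[OF _ r]])
          show "L2_norm ?M (g n) \<le> L2_norm ?M f + L2_norm ?M (\<lambda>u. f u - g n u)"
            using L2_norm_triangle_diff[OF g f, of n] L2_norm_minus_commute[of ?M "g n" f] by simp
        qed
        finally show ?thesis by (simp add: algebra_simps)
      qed
      have "(\<lambda>n. r * L2_norm ?M f + (r + 1) * L2_norm ?M (\<lambda>u. f u - g n u)) \<longlonglongrightarrow> r * L2_norm ?M f + (r + 1) * 0"
        by (intro tendsto_intros lim)
      then show "L2_norm ?M (?T f) \<le> r * L2_norm ?M f"
        using bound by (intro tendsto_lowerbound[where F=sequentially]) auto
    qed
  qed
qed

text \<open>
  The value of the Markov operator at distance \<open>n + 1\<close> involves the degrees there, hence
  vertices at distance \<open>n + 2\<close>.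
\<close>

lemma ball_norm_le_local:
  assumes G: "(G, p) \<in> rooted D" and H: "(H, q) \<in> rooted D" and iso: "ball_iso \<phi> (n + 2) G p H q"
    and LB: "ball_norm_le n r H q"
  shows "ball_norm_le n r G p"
  unfolding ball_norm_le_def
proof (intro allI impI)
  fix f :: "nat \<Rightarrow> complex" assume f: "\<forall>u. u \<notin> bverts G p n \<longrightarrow> f u = 0"
  note GH = rootedD(2)[OF G] rootedD(2)[OF H] rootedD(3)[OF G]
  note bij2 = ball_iso_bij[OF iso]
  have bij1: "bij_betw \<phi> (bverts G p (Suc n)) (bverts H q (Suc n))"
    by (rule ball_iso_bij[OF ball_iso_mono[OF GH iso]]) simp
  have bij0: "bij_betw \<phi> (bverts G p n) (bverts H q n)"
    by (rule ball_iso_bij[OF ball_iso_mono[OF GH iso]]) simp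
  have sub02: "bverts G p n \<subseteq> bverts G p (n + 2)" by (rule bverts_mono) simp
  define g where "g w = (if w \<in> bverts H q n then f (inv_into (bverts G p n) \<phi> w) else 0)" for w
  have g\<phi>: "g (\<phi> u) = f u" if u: "u \<in> bverts G p (n + 2)" for u
  proof (cases "u \<in> bverts G p n")
    case True
    then have "\<phi> u \<in> bverts H q n" by (rule bij_betw_apply[OF bij0])
    then show ?thesis unfolding g_def bij_betw_inv_into_left[OF bij0 True] by (rule if_P)
  next
    case False
    have "\<phi> u \<notin> bverts H q n"
    proof
      assume "\<phi> u \<in> bverts H q n"
      then have "\<phi> u \<in> \<phi> ` bverts G p n" using bij0 by (simp only: bij_betw_def)
      then obtain v where v: "v \<in> bverts G p n" "\<phi> u = \<phi> v" by (rule imageE)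
      then have "v = u"
        using inj_onD[OF bij_betw_imp_inj_on[OF bij2] v(2) u subsetD[OF sub02 v(1)]] by simp
      then show False using v False by blast
    qed
    then show ?thesis using f False by (simp add: g_def)
  qed
  have deg_eq: "deg (edges H) (\<phi> u) = deg (edges G) u"
    and nb: "bij_betw \<phi> (edges G `` {u}) (edges H `` {\<phi> u})" if u: "u \<in> bverts G p (Suc n)" for u
    using ball_iso_neighbours[OF GH iso u] by simp_all
  have T_eq: "markov_op (edges H) g (\<phi> u) = markov_op (edges G) f u" if u: "u \<in> bverts G p (Suc n)" for u
  proof -
    have "(\<Sum>w\<in>edges H `` {\<phi> u}. g w) = (\<Sum>v\<in>edges G `` {u}. g (\<phi> v))"
      by (rule sum.reindex_bij_betw[OF nb[OF u], symmetric])
    also have "\<dots> = (\<Sum>v\<in>edges G `` {u}. f v)"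
      using bverts_edge[OF GH(1) u] by (intro sum.cong refl g\<phi>) simp
    finally show ?thesis by (simp add: markov_op_def deg_eq[OF u])
  qed
  have "(\<Sum>u\<in>bverts G p (Suc n). real (deg (edges G) u) * (cmod (markov_op (edges G) f u))\<^sup>2)
      = (\<Sum>u\<in>bverts G p (Suc n). real (deg (edges H) (\<phi> u)) * (cmod (markov_op (edges H) g (\<phi> u)))\<^sup>2)"
    by (intro sum.cong refl) (simp only: deg_eq T_eq)
  also have "\<dots> = (\<Sum>u\<in>bverts H q (Suc n). real (deg (edges H) u) * (cmod (markov_op (edges H) g u))\<^sup>2)"
    by (rule sum.reindex_bij_betw[OF bij1])
  also have "\<dots> \<le> r\<^sup>2 * (\<Sum>u\<in>bverts H q n. real (deg (edges H) u) * (cmod (g u))\<^sup>2)"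
    by (rule LB[unfolded ball_norm_le_def, THEN spec, THEN mp]) (simp add: g_def)
  also have "(\<Sum>u\<in>bverts H q n. real (deg (edges H) u) * (cmod (g u))\<^sup>2)
      = (\<Sum>u\<in>bverts G p n. real (deg (edges H) (\<phi> u)) * (cmod (g (\<phi> u)))\<^sup>2)"
    by (rule sum.reindex_bij_betw[OF bij0, symmetric])
  also have "\<dots> = (\<Sum>u\<in>bverts G p n. real (deg (edges G) u) * (cmod (f u))\<^sup>2)"
    using bverts_mono[of n "Suc n" G p] sub02
    by (intro sum.cong refl) (simp add: deg_eq g\<phi> subset_iff)
  finally show "(\<Sum>u\<in>bverts G p (Suc n). real (deg (edges G) u) * (cmod (markov_op (edges G) f u))\<^sup>2)
      \<le> r\<^sup>2 * (\<Sum>u\<in>bverts G p n. real (deg (edges G) u) * (cmod (f u))\<^sup>2)" .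
qed

lemma ball_norm_le_local_iff:
  assumes "(G, p) \<in> rooted D" "(H, q) \<in> rooted D" "ball_iso \<phi> (n + 2) G p H q"
  shows "ball_norm_le n r G p \<longleftrightarrow> ball_norm_le n r H q"
  using ball_norm_le_local[OF assms] ball_norm_le_local[OF assms(2,1) ball_iso_sym[OF assms(3) rootedD(3)[OF assms(1)]]]
  by blast

lemma markov_norm_le_iso:
  assumes iso: "((G, p), (H, q)) \<in> rooted_iso" and G: "(G, p) \<in> rooted D" and r: "0 \<le> r"
  shows "markov_norm_le G r \<longleftrightarrow> markov_norm_le H r"
proof -
  have H: "(H, q) \<in> rooted D" by (rule rooted_iso_rooted[OF iso G])
  obtain \<phi> where "\<And>n. ball_iso \<phi> n G p H q" using rooted_iso_ball_iso[OF iso] by metis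
  then show ?thesis
    unfolding markov_norm_le_iff_balls[OF rootedD(1,3)[OF G] r] markov_norm_le_iff_balls[OF rootedD(1,3)[OF H] r]
    using ball_norm_le_local_iff[OF G H] by blast
qed

lemma markov_norm_le_sets:
  assumes r: "0 \<le> r"
  shows "{X \<in> space (rooted_space D). markov_norm_le (fst (rep X)) r} \<in> sets (rooted_space D)"
proof -
  have loc: "(\<lambda>X. case rep X of (G, p) \<Rightarrow> ball_norm_le n r G p) \<in> measurable (rooted_space D) (count_space UNIV)" for n
    by (rule rooted_local_measurable[where n="n + 2"]) (auto simp: ball_norm_le_local_iff)
  have "{X \<in> space (rooted_space D). \<forall>n. (case rep X of (G, p) \<Rightarrow> ball_norm_le n r G p)} \<in> sets (rooted_space D)"
    using loc by measurable
  also have "{X \<in> space (rooted_space D). \<forall>n. (case rep X of (G, p) \<Rightarrow> ball_norm_le n r G p)}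
      = {X \<in> space (rooted_space D). markov_norm_le (fst (rep X)) r}"
  proof (intro Collect_cong conj_cong refl)
    fix X assume "X \<in> space (rooted_space D)"
    then obtain G p where X: "rep X = (G, p)" "(G, p) \<in> rooted D" by (rule rooted_space_cases)
    show "(\<forall>n. (case rep X of (G, p) \<Rightarrow> ball_norm_le n r G p)) \<longleftrightarrow> markov_norm_le (fst (rep X)) r"
      unfolding X split fst_conv markov_norm_le_iff_balls[OF rootedD(1,3)[OF X(2)] r] by (rule refl)
  qed
  finally show ?thesis .
qed

text \<open>
  The condition only speaks of the graph, but it is evaluated at representatives of two classes;
  these are isomorphic as graphs.
\<close>

lemma markov_norm_le_rerooting_invariant:
  assumes r: "0 \<le> r"
  shows "rerooting_invariant D {X \<in> space (rooted_space D). markov_norm_le (fst (rep X)) r}"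
  unfolding rerooting_invariant_def
proof (intro allI impI)
  fix G p p' assume G: "(G, p) \<in> rooted D" and p': "p' \<in> verts G"
    and "rclass (G, p) \<in> {X \<in> space (rooted_space D). markov_norm_le (fst (rep X)) r}"
  moreover have *: "markov_norm_le (fst (rep (rclass (G, p)))) r \<longleftrightarrow> markov_norm_le G r"
    if G: "(G, p) \<in> rooted D" for p
  proof -
    obtain H q where H: "rep (rclass (G, p)) = (H, q)" by fastforce
    show ?thesis using rep_rclass[OF G] unfolding H fst_conv by (rule markov_norm_le_iso[OF _ G r, symmetric])
  qed
  ultimately show "rclass (G, p') \<in> {X \<in> space (rooted_space D). markov_norm_le (fst (rep X)) r}"
    using *[OF rooted_move[OF G p']] *[OF G] rclass_in_space[OF rooted_move[OF G p']] by simp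
qed

text \<open>
  The events \<open>spectral_radius X \<le> r\<close> are Borel and rerooting invariant, so each has
  probability 0 or 1, and the spectral radius equals the threshold.
\<close>

lemma spectral_radius_constant:
  assumes u: "unimodular_random_graph D \<nu>" and erg: "ergodic_random_graph D \<nu>"
  obtains \<rho> where "0 \<le> \<rho>" "AE X in \<nu>. spectral_radius X = \<rho>"
proof -
  interpret unimodular_graph D \<nu> by (rule unimodular_graph.intro[OF u])
  interpret prob_space \<nu> by (rule prob_space_nu)
  define U where "U r = {X \<in> space \<nu>. spectral_radius X \<le> r}" for r
  have nonneg: "0 \<le> spectral_radius X" if "X \<in> space \<nu>" for X
    using that by (rule nu_cases) (rule spectral_radius_le_iff(1))
  have U_eq: "U r = {X \<in> space (rooted_space D). markov_norm_le (fst (rep X)) r}" if r: "0 \<le> r" for r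
    unfolding U_def space_nu
  proof (intro Collect_cong conj_cong refl)
    fix X assume "X \<in> space (rooted_space D)"
    then obtain G p where X: "rep X = (G, p)" "(G, p) \<in> rooted D" by (rule rooted_space_cases)
    show "spectral_radius X \<le> r \<longleftrightarrow> markov_norm_le (fst (rep X)) r"
      using spectral_radius_le_iff(2)[OF X r] X(1) by simp
  qed
  have U_sets: "U r \<in> sets \<nu>" if "0 \<le> r" for r
    unfolding U_eq[OF that] sets_nu by (rule markov_norm_le_sets[OF that])
  have zero_one: "prob (U r) = 0 \<or> prob (U r) = 1" if "0 \<le> r" for r
    using erg markov_norm_le_sets[OF that, of D] markov_norm_le_rerooting_invariant[OF that, of D]
    unfolding ergodic_random_graph_def U_eq[OF that] by blast
  have U1: "U 1 = space \<nu>"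
  proof -
    have "spectral_radius X \<le> 1" if "X \<in> space \<nu>" for X
    proof -
      from that obtain G p where X: "rep X = (G, p)" "(G, p) \<in> rooted D" by (rule nu_cases)
      interpret op: L2_symmetric_operator "deg_measure G" "L2_space (deg_measure G)" "markov_op (edges G)"
        by (rule graph_symmetric_operator[OF rootedD(1)[OF X(2)]])
      show ?thesis
        using spectral_radius_le_iff(2)[OF X, of 1] op.T_contraction by (simp add: markov_norm_le_def)
    qed
    then show ?thesis by (auto simp: U_def)
  qed
  \<comment> \<open>The threshold is the infimum of \<open>R\<close>; it is approached from both sides along \<open>\<rho> \<plusminus> 1 / (k + 1)\<close>.\<close>
  define R where "R = {r. 0 \<le> r \<and> prob (U r) = 1}"
  have R1: "1 \<in> R" by (simp add: R_def U1 prob_space)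
  have Rb: "bdd_below R" by (auto simp: R_def intro: bdd_belowI)
  define \<rho> where "\<rho> = Inf R"
  have R_ne: "R \<noteq> {}" using R1 by blast
  have \<rho>0: "0 \<le> \<rho>" unfolding \<rho>_def by (rule cInf_greatest[OF R_ne]) (simp add: R_def)
  have mono: "U r \<subseteq> U s" if "r \<le> s" for r s using that by (auto simp: U_def)
  have above: "AE X in \<nu>. spectral_radius X \<le> \<rho> + 1 / real (Suc k)" for k
  proof -
    obtain r where r: "r \<in> R" "r < \<rho> + 1 / real (Suc k)"
      using cInf_lessD[OF R_ne, of "\<rho> + 1 / real (Suc k)"] unfolding \<rho>_def[symmetric] by auto
    have "AE X in \<nu>. X \<in> U r" using r(1) U_sets by (intro AE_prob_1) (simp add: R_def)
    then show ?thesis by eventually_elim (use r(2) in \<open>auto simp: U_def\<close>)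
  qed
  have below: "AE X in \<nu>. \<rho> - 1 / real (Suc k) \<le> spectral_radius X" for k
  proof (cases "0 \<le> \<rho> - 1 / real (Suc k)")
    case True
    have "\<rho> - 1 / real (Suc k) \<notin> R"
    proof
      assume "\<rho> - 1 / real (Suc k) \<in> R"
      then have "\<rho> \<le> \<rho> - 1 / real (Suc k)" unfolding \<rho>_def by (rule cInf_lower[OF _ Rb])
      then show False by simp
    qed
    then have "prob (U (\<rho> - 1 / real (Suc k))) = 0" using zero_one[OF True] True by (auto simp: R_def)
    then have "AE X in \<nu>. X \<notin> U (\<rho> - 1 / real (Suc k))"
      using U_sets[OF True] by (intro AE_not_in) (simp add: null_sets_def emeasure_eq_measure)
    moreover have "AE X in \<nu>. X \<in> space \<nu>" by simp
    ultimately show ?thesis by eventually_elim (auto simp: U_def)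
  next
    case False
    then show ?thesis using nonneg by (intro AE_I2) (meson le_less_linear less_imp_le order_trans)
  qed
  have "AE X in \<nu>. \<forall>k. spectral_radius X \<le> \<rho> + 1 / real (Suc k)"
    using above by (simp add: AE_all_countable)
  moreover have "AE X in \<nu>. \<forall>k. \<rho> - 1 / real (Suc k) \<le> spectral_radius X"
    using below by (simp add: AE_all_countable)
  ultimately have "AE X in \<nu>. spectral_radius X = \<rho>"
  proof eventually_elim
    case (elim X)
    have l: "(\<lambda>k. 1 / real (Suc k)) \<longlonglongrightarrow> 0"
      using LIMSEQ_inverse_real_of_nat by (simp only: inverse_eq_divide)
    note lim = tendsto_add[OF tendsto_const[of \<rho>] l] tendsto_diff[OF tendsto_const[of \<rho>] l]
    have "spectral_radius X \<le> \<rho> + 0"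
      by (rule LIMSEQ_le_const[OF lim(1)]) (use elim in blast)
    moreover have "\<rho> - 0 \<le> spectral_radius X"
      by (rule LIMSEQ_le_const2[OF lim(2)]) (use elim in blast)
    ultimately show ?case by simp
  qed
  then show ?thesis by (rule that[OF \<rho>0])
qed

subsection \<open>Powers of the Markov operator\<close>

lemma markov_op_cong:
  assumes "\<And>q. (p, q) \<in> E \<Longrightarrow> f q = g q" shows "markov_op E f p = markov_op E g p"
proof -
  have "(\<Sum>q\<in>E `` {p}. f q) = (\<Sum>q\<in>E `` {p}. g q)" by (intro sum.cong refl assms) simp
  then show ?thesis by (simp only: markov_op_def)
qed

lemma markov_pow_cong:
  assumes G: "bounded_graph D G"
  shows "p \<in> verts G \<Longrightarrow> (\<And>v. v \<in> bverts G p k \<Longrightarrow> f v = g v)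
    \<Longrightarrow> (markov_op (edges G) ^^ k) f p = (markov_op (edges G) ^^ k) g p"
proof (induction k arbitrary: p)
  case 0 then show ?case by (simp add: bverts_self)
next
  case (Suc k)
  note sG = bounded_graphD(1)[OF G]
  have "(markov_op (edges G) ^^ k) f q = (markov_op (edges G) ^^ k) g q" if q: "(p, q) \<in> edges G" for q
  proof (rule Suc.IH)
    show "q \<in> verts G" using simple_graph_edge[OF sG q] by blast
    fix v assume "v \<in> bverts G q k"
    then have "v \<in> bverts G p (Suc k)"
      using bverts_trans[OF neighbour_in_bverts[OF sG q], of v k] by simp
    then show "f v = g v" by (rule Suc.prems(2))
  qed
  then show ?case unfolding funpow.simps o_apply by (rule markov_op_cong)
qed

lemma markov_pow_sum:
  "(markov_op E ^^ k) (\<lambda>x. \<Sum>v\<in>B. c v * h v x) = (\<lambda>x. \<Sum>v\<in>B. c v * (markov_op E ^^ k) (h v) x)"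
proof (induction k)
  case (Suc k)
  have "markov_op E (\<lambda>x. \<Sum>v\<in>B. c v * h v x) = (\<lambda>x. \<Sum>v\<in>B. c v * markov_op E (h v) x)" for h
    by (rule ext) (simp add: markov_op_def sum.swap[of _ B] sum_divide_distrib sum_distrib_left)
  then show ?case using Suc by simp
qed simp

definition point_mass :: "nat \<Rightarrow> nat \<Rightarrow> complex" where
  "point_mass v u = (if u = v then 1 else 0)"

text \<open>
  Expansion of a function into point masses. The coefficient of \<open>F v\<close> is the probability that
  the walk from \<open>p\<close> is at \<open>v\<close> after \<open>k\<close> steps.
\<close>

lemma markov_pow_eq_sum:
  assumes G: "bounded_graph D G" and p: "p \<in> verts G"
  shows "(markov_op (edges G) ^^ k) F p
    = (\<Sum>v\<in>bverts G p k. F v * (markov_op (edges G) ^^ k) (point_mass v) p)"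
proof -
  have "(markov_op (edges G) ^^ k) F p
      = (markov_op (edges G) ^^ k) (\<lambda>x. \<Sum>v\<in>bverts G p k. F v * point_mass v x) p"
  proof (rule markov_pow_cong[OF G p])
    fix v assume "v \<in> bverts G p k"
    then show "F v = (\<Sum>w\<in>bverts G p k. F w * point_mass w v)"
      using finite_bverts[OF G p, of k] by (simp add: point_mass_def if_distrib[of "(*) _"] cong: if_cong)
  qed
  then show ?thesis unfolding markov_pow_sum .
qed

text \<open>
  Evaluation at \<open>p\<close> is bounded by the norm since \<open>deg p \<ge> 1\<close>, and the point mass has norm
  \<open>sqrt (deg v)\<close>.
\<close>

lemma markov_pow_point_mass_le:
  assumes G: "bounded_graph D G" and p: "p \<in> verts G" and v: "v \<in> verts G"
    and nb: "markov_norm_le G \<rho>" and \<rho>: "0 \<le> \<rho>"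
  shows "cmod ((markov_op (edges G) ^^ k) (point_mass v) p) \<le> sqrt (real D) * \<rho> ^ k"
proof -
  let ?M = "deg_measure G" and ?T = "markov_op (edges G)"
  interpret L2_symmetric_operator ?M "L2_space ?M" ?T by (rule graph_symmetric_operator[OF G])
  have pm: "point_mass v \<in> L2_space ?M"
    by (rule finite_support_L2(1)[of "{v}"]) (use v in \<open>auto simp: point_mass_def\<close>)
  have pm2: "(L2_norm ?M (point_mass v))\<^sup>2 = (\<Sum>u\<in>{v}. real (deg (edges G) u) * (cmod (point_mass v u))\<^sup>2)"
    by (rule finite_support_L2(2)) (use v in \<open>auto simp: point_mass_def\<close>)
  have L: "(?T ^^ k) (point_mass v) \<in> L2_space ?M" for k
    by (induction k) (auto intro: T_H pm)
  have nrm: "L2_norm ?M ((?T ^^ k) (point_mass v)) \<le> \<rho> ^ k * L2_norm ?M (point_mass v)" for k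
  proof (induction k)
    case (Suc k)
    have "L2_norm ?M ((?T ^^ Suc k) (point_mass v)) \<le> \<rho> * L2_norm ?M ((?T ^^ k) (point_mass v))"
      using nb L[of k] unfolding markov_norm_le_def by simp
    also have "\<dots> \<le> \<rho> * (\<rho> ^ k * L2_norm ?M (point_mass v))" by (rule mult_left_mono[OF Suc \<rho>])
    finally show ?case by (simp add: mult_ac)
  qed simp
  let ?c = "cmod ((?T ^^ k) (point_mass v) p)"
  have "?c\<^sup>2 \<le> real (deg (edges G) p) * ?c\<^sup>2"
    using bounded_graph_deg_pos[OF G p] by (simp add: mult_le_cancel_right1 Suc_le_eq)
  also have "\<dots> \<le> (L2_norm ?M ((?T ^^ k) (point_mass v)))\<^sup>2" by (rule L2_pointwise_le[OF p L])
  also have "\<dots> \<le> (\<rho> ^ k * L2_norm ?M (point_mass v))\<^sup>2" by (intro power_mono nrm) simp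
  also have "\<dots> = (\<rho> ^ k)\<^sup>2 * real (deg (edges G) v)"
    unfolding power_mult_distrib pm2 by (simp add: point_mass_def)
  also have "\<dots> \<le> (\<rho> ^ k)\<^sup>2 * real D"
    using bounded_graphD(5)[OF G v] by (intro mult_left_mono) auto
  also have "\<dots> = (sqrt (real D) * \<rho> ^ k)\<^sup>2" by (simp add: power_mult_distrib)
  finally show ?thesis by (rule power2_le_imp_le) (use \<rho> in simp)
qed

section \<open>Structured functions\<close>

lemma forget_lclass:
  assumes x: "(G, \<xi>, p) \<in> labelled D"
  shows "forget_labels (lclass (G, \<xi>, p)) = rclass (G, p)"
proof -
  obtain H \<eta> q where H: "rep (lclass (G, \<xi>, p)) = (H, \<eta>, q)" by (metis prod_cases3)
  have iso: "((G, \<xi>, p), (H, \<eta>, q)) \<in> labelled_iso" using rep_lclass[OF x] unfolding H .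
  obtain \<phi> where "graph_iso \<phi> G H" "\<phi> p = q" using labelled_iso_ball_iso[OF iso] by metis
  then have "((G, p), (H, q)) \<in> rooted_iso"
    using labelledD(2,3)[OF x] labelledD(2,3)[OF labelled_iso_labelled[OF iso x]]
    unfolding rooted_iso_def by blast
  then show ?thesis unfolding forget_labels_def H split by (rule rclass_eqI[symmetric])
qed

lemma rclass_mem_nbhd:
  assumes K: "(K, r) \<in> rooted D"
  shows "rclass (K, r) \<in> rooted_nbhd D (G, p) n \<longleftrightarrow> (\<exists>\<phi>. ball_iso \<phi> n G p K r)"
proof
  assume "rclass (K, r) \<in> rooted_nbhd D (G, p) n"
  then obtain H q \<phi> where H: "(H, q) \<in> rooted D" "rclass (K, r) = rclass (H, q)" "ball_iso \<phi> n G p H q"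
    unfolding mem_rooted_nbhd by blast
  obtain \<psi> where "ball_iso \<psi> n H q K r"
    using rooted_iso_ball_iso[OF rclass_eqD[OF H(2)[symmetric] H(1)]] by metis
  then show "\<exists>\<phi>. ball_iso \<phi> n G p K r" using ball_iso_trans[OF H(3)] by blast
qed (use K mem_rooted_nbhd in blast)

lemma labelled_rooted: "(G, \<xi>, p) \<in> labelled D \<Longrightarrow> (G, p) \<in> rooted D"
  by (simp add: labelled_iff)

lemma forget_measurable: "forget_labels \<in> measurable (labelled_space D) (rooted_space D)"
proof (rule measurable_sigma_sets[OF sets_rooted_space])
  show "{rooted_nbhd D x n |x n. x \<in> rooted D} \<subseteq> Pow (rooted D // rooted_iso)"
    using rooted_nbhd_subset by blast
  show "forget_labels \<in> space (labelled_space D) \<rightarrow> rooted D // rooted_iso"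
    unfolding space_rooted_space[symmetric]
  proof
    fix X assume "X \<in> space (labelled_space D)"
    then obtain G \<xi> p where x: "(G, \<xi>, p) \<in> labelled D" "X = lclass (G, \<xi>, p)" by (rule labelled_space_cases)
    show "forget_labels X \<in> space (rooted_space D)"
      unfolding x(2) forget_lclass[OF x(1)] by (rule rclass_in_space[OF labelled_rooted[OF x(1)]])
  qed
  fix U assume "U \<in> {rooted_nbhd D x n |x n. x \<in> rooted D}"
  then obtain K r n where U: "U = rooted_nbhd D (K, r) n" by force
  have "forget_labels -` U \<inter> space (labelled_space D) \<in> labelled_open D"
  proof (rule labelled_openI)
    fix G \<xi> p assume x: "(G, \<xi>, p) \<in> labelled D" and "lclass (G, \<xi>, p) \<in> forget_labels -` U \<inter> space (labelled_space D)"
    then obtain \<phi> where \<phi>: "ball_iso \<phi> n K r G p"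
      using forget_lclass[OF x] rclass_mem_nbhd[OF labelled_rooted[OF x]] unfolding U by auto
    have "labelled_nbhd D (G, \<xi>, p) n 1 \<subseteq> forget_labels -` U \<inter> space (labelled_space D)"
    proof
      fix Y assume "Y \<in> labelled_nbhd D (G, \<xi>, p) n 1"
      then obtain H \<eta> q \<psi> where H: "(H, \<eta>, q) \<in> labelled D" "Y = lclass (H, \<eta>, q)" "ball_iso \<psi> n G p H q"
        unfolding mem_labelled_nbhd by blast
      have "rclass (H, q) \<in> U"
        unfolding U rclass_mem_nbhd[OF labelled_rooted[OF H(1)]] using ball_iso_trans[OF \<phi> H(3)] by blast
      then show "Y \<in> forget_labels -` U \<inter> space (labelled_space D)"
        using lclass_in_space[OF H(1)] forget_lclass[OF H(1)] unfolding H(2) by simp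
    qed
    then show "\<exists>n \<delta>. 0 < \<delta> \<and> labelled_nbhd D (G, \<xi>, p) n \<delta> \<subseteq> forget_labels -` U \<inter> space (labelled_space D)"
      by (intro exI[of _ n] exI[of _ 1]) simp
  qed simp
  then show "forget_labels -` U \<inter> space (labelled_space D) \<in> sets (labelled_space D)" by (rule labelled_open_sets)
qed

lemma integral_label_kernel:
  fixes u :: "lgraph set \<Rightarrow> complex"
  assumes "(G, p) \<in> rooted D" "u \<in> borel_measurable (labelled_space D)"
  shows "(LINT Y|label_kernel D G p. u Y) = (LINT \<xi>|label_measure G. u (lclass (G, \<xi>, p)))"
  unfolding label_kernel_def by (rule integral_distr[OF lclass_measurable[OF assms(1)] assms(2)])

text \<open>
  The expectation over the labels, a function of the rooted graph. Composed with \<open>forget_labels\<close>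
  it is the conditional expectation given the graph.
\<close>

definition label_mean :: "nat \<Rightarrow> (lgraph set \<Rightarrow> complex) \<Rightarrow> rgraph set \<Rightarrow> complex" where
  "label_mean D u X = (LINT Y|class_kernel D X. u Y)"

lemma label_mean_measurable:
  "u \<in> borel_measurable (labelled_space D) \<Longrightarrow> label_mean D u \<in> borel_measurable (rooted_space D)"
  unfolding label_mean_def[abs_def]
  by (rule measurable_compose[OF class_kernel_measurable integral_measurable_subprob_algebra])

definition given_graph :: "nat \<Rightarrow> (lgraph set \<Rightarrow> complex) \<Rightarrow> lgraph set \<Rightarrow> complex" where
  "given_graph D u Y = label_mean D u (forget_labels Y)"

lemma given_graph_lclass:
  assumes x: "(G, \<xi>, p) \<in> labelled D" and u: "u \<in> borel_measurable (labelled_space D)"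
  shows "given_graph D u (lclass (G, \<xi>, p)) = (LINT \<xi>'|label_measure G. u (lclass (G, \<xi>', p)))"
  unfolding given_graph_def forget_lclass[OF x] label_mean_def class_kernel_rclass[OF labelled_rooted[OF x]]
  by (rule integral_label_kernel[OF labelled_rooted[OF x] u])

lemma given_graph_measurable:
  "u \<in> borel_measurable (labelled_space D) \<Longrightarrow> given_graph D u \<in> borel_measurable (labelled_space D)"
  unfolding given_graph_def[abs_def] by (rule measurable_compose[OF forget_measurable label_mean_measurable])

lemma (in prob_space) norm_integral_le:
  fixes h :: "'a \<Rightarrow> complex"
  assumes "AE x in M. cmod (h x) \<le> C" "0 \<le> C" shows "cmod (LINT x|M. h x) \<le> C"
proof (cases "integrable M h")
  case True
  have "cmod (LINT x|M. h x) \<le> (LINT x|M. cmod (h x))" by (rule integral_norm_bound)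
  also have "\<dots> \<le> (LINT x|M. C)" using True assms(1) by (intro integral_mono_AE) auto
  finally show ?thesis by (simp add: prob_space)
qed (simp add: not_integrable_integral_eq assms(2))

lemma given_graph_bounded:
  assumes u: "u \<in> borel_measurable (labelled_space D)" and b: "\<And>Y. Y \<in> space (labelled_space D) \<Longrightarrow> cmod (u Y) \<le> c"
    and Y: "Y \<in> space (labelled_space D)"
  shows "cmod (given_graph D u Y) \<le> c"
proof -
  obtain G \<xi> p where x: "(G, \<xi>, p) \<in> labelled D" "Y = lclass (G, \<xi>, p)" using Y by (rule labelled_space_cases)
  interpret prob_space "label_measure G" by (rule prob_space_label_measure)
  have c: "0 \<le> c" using order_trans[OF norm_ge_zero b[OF Y]] .
  show ?thesis
    unfolding x(2) given_graph_lclass[OF x(1) u]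
  proof (rule norm_integral_le[OF AE_I2 c])
    fix \<xi>' assume "\<xi>' \<in> space (label_measure G)"
    then show "cmod (u (lclass (G, \<xi>', p))) \<le> c"
      using labelled_rooted[OF x(1)] by (intro b lclass_in_space) (simp add: labelled_iff)
  qed
qed

lemma root_deg_measurable: "(\<lambda>X. root_deg X) \<in> measurable (rooted_space D) (count_space UNIV)"
  unfolding root_deg_def
proof (rule rooted_local_measurable[where n=1])
  fix G p H q \<phi> assume G: "(G, p) \<in> rooted D" and H: "(H, q) \<in> rooted D" and iso: "ball_iso \<phi> 1 G p H q"
  have "deg (edges H) (\<phi> p) = deg (edges G) p"
    by (rule ball_iso_neighbours(2)[OF rootedD(2)[OF G] rootedD(2)[OF H] rootedD(3)[OF G] iso
      bverts_self[OF rootedD(3)[OF G], of 0]]) simp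
  then show "deg (edges G) p = deg (edges H) q" using iso by (simp add: ball_iso_def)
qed simp

context unimodular_graph
begin

lemma integral_bernoulli_measure:
  assumes u: "u \<in> borel_measurable L" and b: "\<And>Y. Y \<in> space L \<Longrightarrow> cmod (u Y) \<le> c"
  shows "(LINT Y|\<mu>. u Y) = (LINT X|\<nu>. LINT Y|class_kernel D X. u Y)"
proof -
  interpret \<nu>: prob_space \<nu> by (rule prob_space_nu)
  interpret \<mu>: prob_space \<mu> by (rule prob_space_mu)
  note [measurable] = u
  have pk: "prob_space (class_kernel D X) \<and> sets (class_kernel D X) = sets L" if "X \<in> space \<nu>" for X
    using that by (rule nu_cases) (simp add: class_kernel_def prob_space_label_kernel)
  have iK: "integrable (class_kernel D X) u" if X: "X \<in> space \<nu>" for X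
  proof -
    interpret prob_space "class_kernel D X" using pk[OF X] by blast
    show ?thesis
      by (rule integrable_const_bound[where B=c], rule AE_I2)
        (use pk[OF X] b sets_eq_imp_space_eq[of "class_kernel D X" L] measurable_cong_sets[of "class_kernel D X" L borel borel] in auto)
  qed
  have imu: "integrable \<mu> u"
    by (rule \<mu>.integrable_const_bound[where B=c]) (use b space_mu in \<open>auto intro!: AE_I2\<close>)
  have real_bind: "(LINT Y|\<mu>. h Y) = (LINT X|\<nu>. LINT Y|class_kernel D X. h Y)"
    if h: "h \<in> borel_measurable L" "\<And>Y. Y \<in> space L \<Longrightarrow> \<bar>h Y\<bar> \<le> c" for h :: "lgraph set \<Rightarrow> real"
    unfolding bernoulli_measure_eq
  proof (rule integral_bind[OF h kernel \<nu>.finite_measure_axioms, where B'=1])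
    show "AE X in \<nu>. emeasure (class_kernel D X) (space (class_kernel D X)) \<le> ennreal 1"
      by (rule AE_I2) (use pk prob_space.emeasure_space_1 in force)
  qed
  have inner_meas: "(\<lambda>X. LINT Y|class_kernel D X. u Y) \<in> borel_measurable \<nu>"
    by (rule measurable_compose[OF kernel integral_measurable_subprob_algebra[OF u]])
  have inner_bound: "AE X in \<nu>. cmod (LINT Y|class_kernel D X. u Y) \<le> \<bar>c\<bar>"
  proof (rule AE_I2)
    fix X assume X: "X \<in> space \<nu>"
    interpret prob_space "class_kernel D X" using pk[OF X] by blast
    have "space (class_kernel D X) = space L" using pk[OF X] by (intro sets_eq_imp_space_eq) blast
    then show "cmod (LINT Y|class_kernel D X. u Y) \<le> \<bar>c\<bar>"
      using b by (intro norm_integral_le AE_I2) force+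
  qed
  have inner_int: "integrable \<nu> (\<lambda>X. LINT Y|class_kernel D X. u Y)"
    by (rule \<nu>.integrable_const_bound[OF inner_bound inner_meas])
  have "Re (LINT Y|\<mu>. u Y) = (LINT Y|\<mu>. Re (u Y))" using imu by simp
  also have "\<dots> = (LINT X|\<nu>. LINT Y|class_kernel D X. Re (u Y))"
    by (rule real_bind) (use b in \<open>auto intro: order_trans[OF abs_Re_le_cmod]\<close>)
  also have "\<dots> = (LINT X|\<nu>. Re (LINT Y|class_kernel D X. u Y))"
    by (rule Bochner_Integration.integral_cong[OF refl]) (simp add: iK)
  also have "\<dots> = Re (LINT X|\<nu>. LINT Y|class_kernel D X. u Y)" using inner_int by simp
  finally have re: "Re (LINT Y|\<mu>. u Y) = Re (LINT X|\<nu>. LINT Y|class_kernel D X. u Y)" .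
  have "Im (LINT Y|\<mu>. u Y) = (LINT Y|\<mu>. Im (u Y))" using imu by simp
  also have "\<dots> = (LINT X|\<nu>. LINT Y|class_kernel D X. Im (u Y))"
    by (rule real_bind) (use b in \<open>auto intro: order_trans[OF abs_Im_le_cmod]\<close>)
  also have "\<dots> = (LINT X|\<nu>. Im (LINT Y|class_kernel D X. u Y))"
    by (rule Bochner_Integration.integral_cong[OF refl]) (simp add: iK)
  also have "\<dots> = Im (LINT X|\<nu>. LINT Y|class_kernel D X. u Y)" using inner_int by simp
  finally show ?thesis using re by (simp add: complex_eq_iff)
qed

lemma mean_deg_root_deg: "(LINT X|\<nu>. real (root_deg X)) = mean_deg"
proof -
  have [measurable]: "(\<lambda>X. real (root_deg X)) \<in> borel_measurable (rooted_space D)"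
    using root_deg_measurable[of D] by measurable
  have "mean_deg = enn2real (\<integral>\<^sup>+X. ennreal (real (card (nbrs X))) \<partial>\<mu>)"
    unfolding mean_deg_def by (rule integral_eq_nn_integral) auto
  also have "(\<integral>\<^sup>+X. ennreal (real (card (nbrs X))) \<partial>\<mu>) = (\<integral>\<^sup>+X. ennreal (real (root_deg X)) \<partial>\<nu>)"
  proof (subst nn_integral_mu)
    show "(\<integral>\<^sup>+X. (case rep X of (G, p) \<Rightarrow> \<integral>\<^sup>+\<xi>. ennreal (real (card (nbrs (lclass (G, \<xi>, p))))) \<partial>label_measure G) \<partial>\<nu>)
        = (\<integral>\<^sup>+X. ennreal (real (root_deg X)) \<partial>\<nu>)"
    proof (rule nn_integral_cong)
      fix X assume "X \<in> space \<nu>"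
      then obtain G p where X: "rep X = (G, p)" "(G, p) \<in> rooted D" by (rule nu_cases)
      interpret prob_space "label_measure G" by (rule prob_space_label_measure)
      have "(\<integral>\<^sup>+\<xi>. ennreal (real (card (nbrs (lclass (G, \<xi>, p))))) \<partial>label_measure G)
          = (\<integral>\<^sup>+\<xi>. ennreal (real (deg (edges G) p)) \<partial>label_measure G)"
        by (rule nn_integral_cong) (use X(2) card_nbrs_lclass in \<open>simp add: labelled_iff\<close>)
      then show "(case rep X of (G, p) \<Rightarrow> \<integral>\<^sup>+\<xi>. ennreal (real (card (nbrs (lclass (G, \<xi>, p))))) \<partial>label_measure G)
          = ennreal (real (root_deg X))" by (simp add: X(1) root_deg_def emeasure_space_1)
    qed
  qed simp
  also have "enn2real (\<integral>\<^sup>+X. ennreal (real (root_deg X)) \<partial>\<nu>) = (LINT X|\<nu>. real (root_deg X))"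
    by (rule integral_eq_nn_integral[symmetric]) auto
  finally show ?thesis by simp
qed

lemma sets_nu_star: "sets (nu_star \<nu>) = sets (rooted_space D)"
  by (simp add: nu_star_def degree_biased_def sets_nu)

end

context measurable_degree
begin

lemma integral_mu_star:
  assumes F: "F \<in> borel_measurable L" "\<And>Y. Y \<in> space L \<Longrightarrow> cmod (F Y) \<le> c"
  shows "(LINT Y|\<mu>s. F Y) = of_real (1 / mean_deg) * (LINT X|\<nu>. of_nat (root_deg X) * label_mean D F X)"
proof -
  note [measurable] = F(1)
  have [measurable]: "(\<lambda>X. of_nat (card (nbrs X)) :: complex) \<in> borel_measurable L"
    using card_nbrs_measurable[of D] by measurable
  let ?H = "\<lambda>Y. of_nat (card (nbrs Y)) * F Y"
  have "(LINT Y|\<mu>s. F Y) = (LINT Y|\<mu>. (real (card (nbrs Y)) / mean_deg) *\<^sub>R F Y)"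
    unfolding mu_star_eq using mean_deg_ge_1 by (intro integral_density) auto
  also have "\<dots> = (LINT Y|\<mu>. of_real (1 / mean_deg) * ?H Y)"
    by (simp add: scaleR_conv_of_real)
  also have "\<dots> = of_real (1 / mean_deg) * (LINT Y|\<mu>. ?H Y)" by (rule integral_mult_right_zero)
  also have "(LINT Y|\<mu>. ?H Y) = (LINT X|\<nu>. LINT Y|class_kernel D X. ?H Y)"
  proof (rule integral_bernoulli_measure)
    show "cmod (?H Y) \<le> real D * c" if Y: "Y \<in> space L" for Y
      using card_nbrs_bounds(2)[OF Y] F(2)[OF Y] by (simp add: norm_mult mult_mono)
  qed measurable
  also have "\<dots> = (LINT X|\<nu>. of_nat (root_deg X) * label_mean D F X)"
  proof (rule Bochner_Integration.integral_cong[OF refl])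
    fix X assume "X \<in> space \<nu>"
    then obtain G p where X: "rep X = (G, p)" "(G, p) \<in> rooted D" by (rule nu_cases)
    have "(LINT Y|label_kernel D G p. ?H Y) = (LINT \<xi>|label_measure G. ?H (lclass (G, \<xi>, p)))"
      by (rule integral_label_kernel[OF X(2)]) measurable
    also have "\<dots> = (LINT \<xi>|label_measure G. of_nat (deg (edges G) p) * F (lclass (G, \<xi>, p)))"
      by (rule Bochner_Integration.integral_cong[OF refl]) (use X(2) card_nbrs_lclass in \<open>simp add: labelled_iff\<close>)
    also have "\<dots> = of_nat (deg (edges G) p) * (LINT Y|label_kernel D G p. F Y)"
      by (simp add: integral_label_kernel[OF X(2) F(1)])
    finally show "(LINT Y|class_kernel D X. ?H Y) = of_nat (root_deg X) * label_mean D F X"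
      by (simp add: class_kernel_def root_deg_def label_mean_def X)
  qed
  finally show ?thesis .
qed

lemma label_mean_rep:
  assumes "F \<in> borel_measurable L" "rep X = (G, p)" "(G, p) \<in> rooted D"
  shows "label_mean D F X = (LINT \<xi>|label_measure G. F (lclass (G, \<xi>, p)))"
  unfolding label_mean_def class_kernel_def assms(2) split by (rule integral_label_kernel[OF assms(3,1)])

text \<open>
  The density of \<open>mu_star\<close> is at most \<open>D\<close>, because the mean degree is at least 1.
\<close>

lemma integral_mu_star_bound:
  assumes F: "F \<in> borel_measurable L" "\<And>Y. Y \<in> space L \<Longrightarrow> cmod (F Y) \<le> c"
    and C: "0 \<le> C" "AE X in \<nu>. cmod (label_mean D F X) \<le> C"
  shows "cmod (LINT Y|\<mu>s. F Y) \<le> real D * C"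
proof -
  interpret \<nu>: prob_space \<nu> by (rule prob_space_nu)
  have deg: "root_deg X \<le> D" if "X \<in> space \<nu>" for X
    using that by (rule nu_cases) (simp add: root_deg_def bounded_graphD(5)[OF rootedD(1,3)])
  have "AE X in \<nu>. X \<in> space \<nu>" by simp
  with C(2) have "AE X in \<nu>. cmod (of_nat (root_deg X) * label_mean D F X) \<le> real D * C"
    by eventually_elim (auto simp: norm_mult deg intro!: mult_mono)
  then have "cmod (LINT X|\<nu>. of_nat (root_deg X) * label_mean D F X) \<le> real D * C"
    by (rule \<nu>.norm_integral_le) (use C in simp)
  moreover have "1 / mean_deg \<le> 1" "0 \<le> 1 / mean_deg" using mean_deg_ge_1 by simp_all
  ultimately have "1 / mean_deg * cmod (LINT X|\<nu>. of_nat (root_deg X) * label_mean D F X) \<le> 1 * (real D * C)"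
    by (intro mult_mono) auto
  moreover have "cmod (LINT Y|\<mu>s. F Y)
      = 1 / mean_deg * cmod (LINT X|\<nu>. of_nat (root_deg X) * label_mean D F X)"
    using arg_cong[OF integral_mu_star[OF F], of cmod] \<open>0 \<le> 1 / mean_deg\<close>
    by (simp only: norm_mult norm_of_real abs_of_nonneg)
  ultimately show ?thesis by simp
qed

subsection \<open>The structured and the random subspace\<close>

text \<open>The degree is a function of the graph, so biasing by it commutes with forgetting the labels.\<close>

lemma nn_integral_forget:
  assumes h[measurable]: "h \<in> borel_measurable (rooted_space D)"
  shows "(\<integral>\<^sup>+Y. h (forget_labels Y) \<partial>\<mu>s) = (\<integral>\<^sup>+X. h X \<partial>nu_star \<nu>)"
proof -
  have [measurable]: "(\<lambda>X. real (root_deg X)) \<in> borel_measurable (rooted_space D)"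
    using root_deg_measurable[of D] by measurable
  have [measurable]: "(\<lambda>X. of_nat (card (nbrs X)) :: ennreal) \<in> borel_measurable L"
    using card_nbrs_measurable[of D] by measurable
  note [measurable] = forget_measurable[of D]
  have "(\<integral>\<^sup>+Y. h (forget_labels Y) \<partial>\<mu>s)
      = ennreal (1 / mean_deg) * (\<integral>\<^sup>+Y. of_nat (card (nbrs Y)) * h (forget_labels Y) \<partial>\<mu>)"
    by (rule nn_integral_mu_star) measurable
  also have "(\<integral>\<^sup>+Y. of_nat (card (nbrs Y)) * h (forget_labels Y) \<partial>\<mu>)
      = (\<integral>\<^sup>+X. (case rep X of (G, p) \<Rightarrow> \<integral>\<^sup>+\<xi>. of_nat (card (nbrs (lclass (G, \<xi>, p))))
          * h (forget_labels (lclass (G, \<xi>, p))) \<partial>label_measure G) \<partial>\<nu>)"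
    by (rule nn_integral_mu) measurable
  also have "\<dots> = (\<integral>\<^sup>+X. ennreal (real (root_deg X)) * h X \<partial>\<nu>)"
  proof (rule nn_integral_cong)
    fix X assume "X \<in> space \<nu>"
    then obtain G p where X: "rep X = (G, p)" "(G, p) \<in> rooted D" "X = rclass (G, p)" by (rule nu_cases)
    interpret prob_space "label_measure G" by (rule prob_space_label_measure)
    have "(\<integral>\<^sup>+\<xi>. of_nat (card (nbrs (lclass (G, \<xi>, p)))) * h (forget_labels (lclass (G, \<xi>, p))) \<partial>label_measure G)
        = (\<integral>\<^sup>+\<xi>. of_nat (deg (edges G) p) * h (rclass (G, p)) \<partial>label_measure G)"
      by (rule nn_integral_cong) (use X(2) card_nbrs_lclass forget_lclass in \<open>simp add: labelled_iff\<close>)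
    also have "\<dots> = ennreal (real (root_deg X)) * h X"
      unfolding root_deg_def X(1) split X(3)[symmetric]
      by (simp add: emeasure_space_1 ennreal_of_nat_eq_real_of_nat)
    finally show "(case rep X of (G, p) \<Rightarrow> \<integral>\<^sup>+\<xi>. of_nat (card (nbrs (lclass (G, \<xi>, p))))
          * h (forget_labels (lclass (G, \<xi>, p))) \<partial>label_measure G) = ennreal (real (root_deg X)) * h X"
      unfolding X(1) split .
  qed
  also have "ennreal (1 / mean_deg) * (\<integral>\<^sup>+X. ennreal (real (root_deg X)) * h X \<partial>\<nu>)
      = (\<integral>\<^sup>+X. ennreal (1 / mean_deg) * (ennreal (real (root_deg X)) * h X) \<partial>\<nu>)"
    by (rule nn_integral_cmult[symmetric]) measurable
  also have "\<dots> = (\<integral>\<^sup>+X. ennreal (real (root_deg X) / mean_deg) * h X \<partial>\<nu>)"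
  proof (rule nn_integral_cong)
    fix X
    have "ennreal (real (root_deg X) / mean_deg) = ennreal (1 / mean_deg) * ennreal (real (root_deg X))"
      using mean_deg_ge_1 by (simp add: ennreal_mult[symmetric])
    then show "ennreal (1 / mean_deg) * (ennreal (real (root_deg X)) * h X) = ennreal (real (root_deg X) / mean_deg) * h X"
      by (simp add: mult.assoc)
  qed
  also have "\<dots> = (\<integral>\<^sup>+X. h X \<partial>nu_star \<nu>)"
    unfolding nu_star_def degree_biased_def mean_deg_root_deg by (rule nn_integral_density[symmetric]) measurable
  finally show ?thesis .
qed

text \<open>By change of variables. Structured functions can thus be recognised without the measure \<open>nu_star\<close>.\<close>

lemma L2_nu_star_iff:
  assumes f: "f \<in> borel_measurable (rooted_space D)"
  shows "f \<in> L2_space (nu_star \<nu>) \<longleftrightarrow> (f \<circ> forget_labels) \<in> L2_space \<mu>s"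
proof -
  note [measurable] = f
  have m1: "f \<in> borel_measurable (nu_star \<nu>)"
    unfolding measurable_cong_sets[OF sets_nu_star refl] by (rule f)
  have m2: "(f \<circ> forget_labels) \<in> borel_measurable \<mu>s"
    unfolding measurable_cong_sets[OF sets_mu_star refl] by (rule measurable_comp[OF forget_measurable f])
  have "(\<integral>\<^sup>+Y. ennreal ((cmod (f (forget_labels Y)))\<^sup>2) \<partial>\<mu>s) = (\<integral>\<^sup>+X. ennreal ((cmod (f X))\<^sup>2) \<partial>nu_star \<nu>)"
    by (rule nn_integral_forget) measurable
  moreover have "(\<lambda>Y. f (forget_labels Y)) \<in> borel_measurable \<mu>s" using m2 by (simp only: o_def)
  then have "(\<lambda>Y. (cmod (f (forget_labels Y)))\<^sup>2) \<in> borel_measurable \<mu>s" by measurable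
  ultimately show ?thesis
    using m1 m2 by (simp add: L2_space_def integrable_iff_bounded)
qed

lemma structuredI:
  assumes f: "f \<in> borel_measurable (rooted_space D)" and g: "g \<in> L2_space \<mu>s"
    and eq: "AE Y in \<mu>s. g Y = (f \<circ> forget_labels) Y"
  shows "g \<in> structured_subspace D \<nu>"
proof -
  have "(f \<circ> forget_labels) \<in> borel_measurable \<mu>s"
    unfolding measurable_cong_sets[OF sets_mu_star refl] by (rule measurable_comp[OF forget_measurable f])
  then have "(f \<circ> forget_labels) \<in> L2_space \<mu>s"
    by (rule L2_cong_AE[OF g]) (use eq in \<open>auto elim: AE_mp\<close>)
  then show ?thesis using f g eq L2_nu_star_iff by (auto simp: structured_subspace_def)
qed

lemma structuredE:
  assumes "g \<in> structured_subspace D \<nu>"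
  obtains f where "f \<in> borel_measurable (rooted_space D)" "(f \<circ> forget_labels) \<in> L2_space \<mu>s"
    "AE Y in \<mu>s. g Y = (f \<circ> forget_labels) Y" "g \<in> L2_space \<mu>s"
proof -
  obtain f where f: "f \<in> L2_space (nu_star \<nu>)" "AE Y in \<mu>s. g Y = (f \<circ> forget_labels) Y" "g \<in> L2_space \<mu>s"
    using assms by (auto simp: structured_subspace_def)
  have m: "f \<in> borel_measurable (rooted_space D)"
    using L2_measurable[OF f(1)] unfolding measurable_cong_sets[OF sets_nu_star refl] .
  show ?thesis by (rule that[OF m _ f(2,3)]) (use L2_nu_star_iff[OF m] f(1) in blast)
qed

lemma avg_lclass:
  assumes "(G, \<xi>, p) \<in> labelled D"
  shows "avg nbrs move_root f (lclass (G, \<xi>, p)) = markov_op (edges G) (\<lambda>v. f (lclass (G, \<xi>, v))) p"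
  by (simp add: avg_def markov_op_def sum_nbrs_lclass[OF assms] card_nbrs_lclass[OF assms])

text \<open>
  The average of a function of the graph over the neighbours does not depend on the labels, so
  it equals its own mean over the labels, which is Borel on the space of graphs.
\<close>

lemma avg_structured:
  assumes s: "s \<in> structured_subspace D \<nu>"
  shows "avg nbrs move_root s \<in> structured_subspace D \<nu>"
proof -
  obtain f where f: "f \<in> borel_measurable (rooted_space D)" "(f \<circ> forget_labels) \<in> L2_space \<mu>s"
    "AE Y in \<mu>s. s Y = (f \<circ> forget_labels) Y" "s \<in> L2_space \<mu>s" using s by (rule structuredE)
  let ?u = "avg nbrs move_root (f \<circ> forget_labels)"
  have u: "?u \<in> borel_measurable L"
    using L2_measurable[OF avg_L2[OF f(2)]] unfolding measurable_cong_sets[OF sets_mu_star refl] .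
  have const: "?u (lclass (G, \<xi>, p)) = markov_op (edges G) (\<lambda>v. f (rclass (G, v))) p"
    if x: "(G, \<xi>, p) \<in> labelled D" for G \<xi> p
    unfolding avg_lclass[OF x]
    by (rule markov_op_cong) (use forget_lclass[OF labelled_move[OF x neighbour_verts[OF x]]] in simp)
  have eq: "given_graph D ?u Y = ?u Y" if Y: "Y \<in> space L" for Y
  proof -
    obtain G \<xi> p where x: "(G, \<xi>, p) \<in> labelled D" "Y = lclass (G, \<xi>, p)" using Y by (rule labelled_space_cases)
    interpret prob_space "label_measure G" by (rule prob_space_label_measure)
    have "given_graph D ?u Y = (LINT \<xi>'|label_measure G. ?u (lclass (G, \<xi>', p)))"
      unfolding x(2) by (rule given_graph_lclass[OF x(1) u])
    also have "\<dots> = (LINT \<xi>'|label_measure G. markov_op (edges G) (\<lambda>v. f (rclass (G, v))) p)"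
      by (rule Bochner_Integration.integral_cong[OF refl], rule const)
        (use labelled_rooted[OF x(1)] in \<open>simp add: labelled_iff\<close>)
    also have "\<dots> = ?u Y" unfolding x(2) const[OF x(1)] by (simp add: prob_space)
    finally show ?thesis .
  qed
  have eq': "(label_mean D ?u \<circ> forget_labels) Y = ?u Y" if "Y \<in> space L" for Y
    using eq[OF that] by (simp only: given_graph_def o_apply)
  show ?thesis
  proof (rule structuredI[OF label_mean_measurable[OF u] avg_L2[OF f(4)]])
    have "AE Y in \<mu>s. Y \<in> space L" using AE_space[of \<mu>s] by simp
    with avg_cong_AE[OF f(3)]
    show "AE Y in \<mu>s. avg nbrs move_root s Y = (label_mean D ?u \<circ> forget_labels) Y"
      by eventually_elim (simp only: eq')
  qed
qed

lemma random_L2: "random_subspace D \<nu> \<subseteq> L2_space \<mu>s"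
  and structured_L2: "structured_subspace D \<nu> \<subseteq> L2_space \<mu>s"
  by (auto simp: random_subspace_def structured_subspace_def)

text \<open>
  The orthogonal complement of an invariant subspace of a symmetric operator is invariant, and
  closed by the Cauchy--Schwarz inequality.
\<close>

lemma random_symmetric_operator: "L2_symmetric_operator \<mu>s (random_subspace D \<nu>) (avg nbrs move_root)"
proof (rule avg_symmetric_operator[OF random_L2])
  show "(\<lambda>x. 0) \<in> random_subspace D \<nu>"
    by (simp add: random_subspace_def L2_zero L2_inner_def)
  show "(\<lambda>x. f x + g x) \<in> random_subspace D \<nu>" if "f \<in> random_subspace D \<nu>" "g \<in> random_subspace D \<nu>" for f g
    using that structured_L2 by (auto simp: random_subspace_def L2_add L2_inner_add_left subset_iff)
  show "(\<lambda>x. c * f x) \<in> random_subspace D \<nu>" if "f \<in> random_subspace D \<nu>" for f c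
    using that by (auto simp: random_subspace_def L2_scale L2_inner_scale_left)
  show "avg nbrs move_root f \<in> random_subspace D \<nu>" if f: "f \<in> random_subspace D \<nu>" for f
  proof -
    have fL: "f \<in> L2_space \<mu>s" using f random_L2 by blast
    have "L2_inner \<mu>s (avg nbrs move_root f) s = 0" if s: "s \<in> structured_subspace D \<nu>" for s
      using avg_symmetric[OF fL subsetD[OF structured_L2 s]] f avg_structured[OF s]
      by (simp add: random_subspace_def)
    then show ?thesis using avg_L2[OF fL] by (simp add: random_subspace_def)
  qed
  fix F and f :: "lgraph set \<Rightarrow> complex"
  assume F: "\<And>n. F n \<in> random_subspace D \<nu>" and f: "f \<in> L2_space \<mu>s"
    and lim: "(\<lambda>n. L2_norm \<mu>s (\<lambda>x. f x - F n x)) \<longlonglongrightarrow> 0"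
  have "L2_inner \<mu>s f s = 0" if s: "s \<in> structured_subspace D \<nu>" for s
  proof -
    have sL: "s \<in> L2_space \<mu>s" using s structured_L2 by blast
    have FL: "F n \<in> L2_space \<mu>s" for n using F random_L2 by blast
    have le: "cmod (L2_inner \<mu>s f s) \<le> L2_norm \<mu>s (\<lambda>x. f x - F n x) * L2_norm \<mu>s s" for n
    proof -
      have "L2_inner \<mu>s (F n) s = 0" using F[of n] s by (simp add: random_subspace_def)
      then have "L2_inner \<mu>s f s = L2_inner \<mu>s (\<lambda>x. f x - F n x) s"
        using L2_inner_diff_left[OF f FL sL] by simp
      then show ?thesis using L2_Cauchy_Schwarz[OF L2_diff[OF f FL] sL] by simp
    qed
    have "(\<lambda>n. L2_norm \<mu>s (\<lambda>x. f x - F n x) * L2_norm \<mu>s s) \<longlonglongrightarrow> 0 * L2_norm \<mu>s s"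
      by (intro tendsto_intros lim)
    then have "cmod (L2_inner \<mu>s f s) \<le> 0"
      using le by (intro tendsto_lowerbound[where F=sequentially]) auto
    then show ?thesis by simp
  qed
  then show "f \<in> random_subspace D \<nu>" using f by (simp add: random_subspace_def)
qed

end

section \<open>Decay of correlations for local functions\<close>

text \<open>
  Locality concerns the labels only: the dependence on the graph is arbitrary, so that the mean
  given the graph is local too.
\<close>

definition local_fun :: "nat \<Rightarrow> nat \<Rightarrow> (lgraph set \<Rightarrow> complex) \<Rightarrow> bool" where
  "local_fun D n g \<longleftrightarrow> g \<in> borel_measurable (labelled_space D)
     \<and> (\<exists>c. \<forall>Y\<in>space (labelled_space D). cmod (g Y) \<le> c)
     \<and> (\<forall>G \<xi> \<eta> p. (G, \<xi>, p) \<in> labelled D \<longrightarrow> (G, \<eta>, p) \<in> labelled D \<longrightarrow> (\<forall>v\<in>bverts G p n. \<xi> v = \<eta> v)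
        \<longrightarrow> g (lclass (G, \<xi>, p)) = g (lclass (G, \<eta>, p)))"

lemma local_funI:
  assumes "g \<in> borel_measurable (labelled_space D)" "\<And>Y. Y \<in> space (labelled_space D) \<Longrightarrow> cmod (g Y) \<le> c"
    "\<And>G \<xi> \<eta> p. (G, \<xi>, p) \<in> labelled D \<Longrightarrow> (G, \<eta>, p) \<in> labelled D \<Longrightarrow> (\<forall>v\<in>bverts G p n. \<xi> v = \<eta> v)
        \<Longrightarrow> g (lclass (G, \<xi>, p)) = g (lclass (G, \<eta>, p))"
  shows "local_fun D n g"
  using assms unfolding local_fun_def by blast

lemma local_funD:
  assumes "local_fun D n g"
  shows "g \<in> borel_measurable (labelled_space D)"
    "(G, \<xi>, p) \<in> labelled D \<Longrightarrow> (G, \<eta>, p) \<in> labelled D \<Longrightarrow> (\<And>v. v \<in> bverts G p n \<Longrightarrow> \<xi> v = \<eta> v)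
      \<Longrightarrow> g (lclass (G, \<xi>, p)) = g (lclass (G, \<eta>, p))"
  using assms unfolding local_fun_def by blast+

lemma local_fun_bound:
  assumes "local_fun D n g"
  shows "\<exists>c\<ge>0. \<forall>Y\<in>space (labelled_space D). cmod (g Y) \<le> c"
proof -
  obtain c where c: "\<forall>Y\<in>space (labelled_space D). cmod (g Y) \<le> c" using assms unfolding local_fun_def by blast
  show ?thesis
    by (intro exI[of _ "max 0 c"] conjI ballI max.cobounded1 max.coboundedI2 bspec[OF c])
qed

lemma local_fun_mono:
  assumes g: "local_fun D n g" and le: "n \<le> N" shows "local_fun D N g"
proof -
  obtain c where c: "\<And>Y. Y \<in> space (labelled_space D) \<Longrightarrow> cmod (g Y) \<le> c" using local_fun_bound[OF g] by blast
  show ?thesis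
    by (rule local_funI[OF local_funD(1)[OF g] c], assumption, rule local_funD(2)[OF g])
      (use bverts_mono[OF le] in blast)+
qed

lemma local_fun_lin:
  assumes f: "local_fun D n f" and g: "local_fun D n g"
  shows "local_fun D n (\<lambda>Y. f Y + b * g Y)"
proof -
  obtain c where c: "0 \<le> c" "\<And>Y. Y \<in> space (labelled_space D) \<Longrightarrow> cmod (f Y) \<le> c" using local_fun_bound[OF f] by blast
  obtain d where d: "0 \<le> d" "\<And>Y. Y \<in> space (labelled_space D) \<Longrightarrow> cmod (g Y) \<le> d" using local_fun_bound[OF g] by blast
  note [measurable] = local_funD(1)[OF f] local_funD(1)[OF g]
  show ?thesis
  proof (rule local_funI)
    show "cmod (f Y + b * g Y) \<le> c + cmod b * d" if "Y \<in> space (labelled_space D)" for Y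
      by (rule order_trans[OF norm_triangle_ineq]) (use c d that in \<open>auto simp: norm_mult intro!: add_mono mult_left_mono\<close>)
    show "f (lclass (G, \<xi>, p)) + b * g (lclass (G, \<xi>, p)) = f (lclass (G, \<eta>, p)) + b * g (lclass (G, \<eta>, p))"
      if *: "(G, \<xi>, p) \<in> labelled D" "(G, \<eta>, p) \<in> labelled D" "\<forall>v\<in>bverts G p n. \<xi> v = \<eta> v" for G \<xi> \<eta> p
      using local_funD(2)[OF f *(1,2)] local_funD(2)[OF g *(1,2)] *(3) by simp
  qed measurable
qed

lemma local_fun_indicator:
  assumes A: "A \<in> local_sets D n" shows "local_fun D n (\<lambda>Y. complex_of_real (indicator A Y))"
proof (rule local_funI[where c=1])
  note [measurable] = local_sets_measurable[OF A]
  show "(\<lambda>Y. complex_of_real (indicator A Y)) \<in> borel_measurable (labelled_space D)" by measurable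
  show "cmod (complex_of_real (indicator A Y)) \<le> 1" for Y by (simp split: split_indicator)
  fix G \<xi> \<eta> p assume *: "(G, \<xi>, p) \<in> labelled D" "(G, \<eta>, p) \<in> labelled D" "\<forall>v\<in>bverts G p n. \<xi> v = \<eta> v"
  have "lclass (G, \<xi>, p) \<in> A \<longleftrightarrow> lclass (G, \<eta>, p) \<in> A"
    by (rule local_setsD[OF A *(1,2) ball_iso_id]) (use *(3) in simp)
  then show "complex_of_real (indicator A (lclass (G, \<xi>, p))) = complex_of_real (indicator A (lclass (G, \<eta>, p)))"
    by (simp split: split_indicator)
qed

lemma local_fun_given_graph:
  assumes g: "local_fun D n g" shows "local_fun D n (given_graph D g)"
proof -
  obtain c where c: "\<And>Y. Y \<in> space (labelled_space D) \<Longrightarrow> cmod (g Y) \<le> c" using local_fun_bound[OF g] by blast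
  note m = local_funD(1)[OF g]
  show ?thesis
    by (rule local_funI[OF given_graph_measurable[OF m] given_graph_bounded[OF m c]])
      (simp_all add: given_graph_lclass[OF _ m])
qed

text \<open>
  Labels in disjoint balls are independent, so the correlation of a centred local function at two
  distant vertices vanishes.
\<close>

lemma far_correlation_zero:
  assumes f: "local_fun D n f" and G: "(G, p) \<in> rooted D" and v: "v \<in> verts G"
    and disj: "bverts G v n \<inter> bverts G p n = {}"
    and mean0: "(LINT \<xi>|label_measure G. f (lclass (G, \<xi>, p))) = 0"
  shows "(LINT \<xi>|label_measure G. f (lclass (G, \<xi>, v)) * cnj (f (lclass (G, \<xi>, p)))) = 0"
proof -
  interpret U: product_sigma_finite "\<lambda>_::nat. unif"
    by (intro product_sigma_finite.intro prob_space_imp_sigma_finite prob_space_unif)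
  let ?I = "bverts G v n" and ?J = "bverts G p n"
  let ?P = "\<lambda>K. PiM K (\<lambda>_::nat. unif)"
  have Gv: "(G, v) \<in> rooted D" by (rule rooted_move[OF G v])
  have fin: "finite ?I" "finite ?J"
    using finite_bverts[OF rootedD(1,3)[OF Gv]] finite_bverts[OF rootedD(1,3)[OF G]] by blast+
  have sub: "?I \<union> ?J \<subseteq> verts G" using bverts_subset by blast
  obtain c where c: "0 \<le> c" "\<And>Y. Y \<in> space (labelled_space D) \<Longrightarrow> cmod (f Y) \<le> c" using local_fun_bound[OF f] by blast
  \<comment> \<open>Labels outside the two balls are irrelevant; \<open>ext\<close> sets them to 0, which reduces the integral
      to the finite product over the balls.\<close>
  define ext where "ext \<zeta> = (\<lambda>w\<in>verts G. if w \<in> ?I \<union> ?J then \<zeta> w else 0)" for \<zeta> :: "nat \<Rightarrow> real"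
  have ext_meas: "ext \<in> measurable (?P (?I \<union> ?J)) (label_measure G)"
    unfolding ext_def label_measure_def
  proof (rule measurable_restrict)
    fix w
    show "(\<lambda>\<zeta>. if w \<in> ?I \<union> ?J then \<zeta> w else 0) \<in> measurable (?P (?I \<union> ?J)) unif"
      using measurable_component_singleton[of w "?I \<union> ?J" "\<lambda>_. unif"]
      by (cases "w \<in> ?I \<union> ?J") (simp_all add: space_unif)
  qed
  define a where "a \<zeta> = f (lclass (G, ext \<zeta>, v))" for \<zeta>
  define b where "b \<zeta> = f (lclass (G, ext \<zeta>, p))" for \<zeta>
  have meas: "(\<lambda>\<zeta>. f (lclass (G, ext \<zeta>, w))) \<in> borel_measurable (?P (?I \<union> ?J))" if "w \<in> verts G" for w
    using measurable_compose[OF measurable_compose[OF ext_meas lclass_measurable[OF rooted_move[OF G that]]] local_funD(1)[OF f]] .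
  have ab_meas[measurable]: "a \<in> borel_measurable (?P (?I \<union> ?J))" "b \<in> borel_measurable (?P (?I \<union> ?J))"
    unfolding a_def[abs_def] b_def[abs_def] using meas[OF v] meas[OF rootedD(3)[OF G]] by simp_all
  have lab: "(G, ext \<zeta>, w) \<in> labelled D" if "\<zeta> \<in> space (?P (?I \<union> ?J))" "w \<in> verts G" for \<zeta> w
    using measurable_space[OF ext_meas that(1)] rooted_move[OF G that(2)] by (simp add: labelled_iff)
  have bd: "cmod (a \<zeta>) \<le> c" "cmod (b \<zeta>) \<le> c" if "\<zeta> \<in> space (?P (?I \<union> ?J))" for \<zeta>
    unfolding a_def b_def using lab[OF that] v rootedD(3)[OF G] by (auto intro!: c(2) lclass_in_space)
  interpret PIJ: prob_space "?P (?I \<union> ?J)" by (intro prob_space_PiM prob_space_unif)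
  have int: "integrable (?P (?I \<union> ?J)) (\<lambda>\<zeta>. a \<zeta> * cnj (b \<zeta>))"
  proof (rule PIJ.integrable_const_bound[where B="c * c"])
    show "AE \<zeta> in ?P (?I \<union> ?J). cmod (a \<zeta> * cnj (b \<zeta>)) \<le> c * c"
      by (rule AE_I2) (use bd c(1) in \<open>auto simp: norm_mult intro!: mult_mono\<close>)
  qed measurable
  have restr_meas: "(\<lambda>\<xi>. \<lambda>w\<in>?I \<union> ?J. \<xi> w) \<in> measurable (label_measure G) (?P (?I \<union> ?J))"
    unfolding label_measure_def using sub by (intro measurable_restrict measurable_component_singleton) auto
  have distr: "distr (label_measure G) (?P (?I \<union> ?J)) (\<lambda>\<xi>. \<lambda>w\<in>?I \<union> ?J. \<xi> w) = ?P (?I \<union> ?J)"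
    unfolding label_measure_def
    using distr_PiM_reindex[OF prob_space_unif, where K="verts G" and f="\<lambda>w. w" and I="?I \<union> ?J"] sub by auto
  have ext_restrict: "f (lclass (G, ext (\<lambda>w\<in>?I \<union> ?J. \<xi> w), w)) = f (lclass (G, \<xi>, w))"
    if \<xi>: "\<xi> \<in> space (label_measure G)" and w: "w \<in> verts G" "bverts G w n \<subseteq> ?I \<union> ?J" for \<xi> w
  proof (rule local_funD(2)[OF f])
    show "(G, ext (\<lambda>w\<in>?I \<union> ?J. \<xi> w), w) \<in> labelled D"
      by (rule lab[OF measurable_space[OF restr_meas \<xi>] w(1)])
    show "(G, \<xi>, w) \<in> labelled D" using \<xi> rooted_move[OF G w(1)] by (simp add: labelled_iff)
    show "ext (\<lambda>w\<in>?I \<union> ?J. \<xi> w) u = \<xi> u" if "u \<in> bverts G w n" for u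
      using that w(2) sub by (auto simp: ext_def)
  qed
  have pull: "(LINT \<zeta>|?P (?I \<union> ?J). h \<zeta>) = (LINT \<xi>|label_measure G. h (\<lambda>w\<in>?I \<union> ?J. \<xi> w))"
    if "h \<in> borel_measurable (?P (?I \<union> ?J))" for h :: "_ \<Rightarrow> complex"
    using integral_distr[OF restr_meas that] unfolding distr .
  have "(LINT \<xi>|label_measure G. f (lclass (G, \<xi>, v)) * cnj (f (lclass (G, \<xi>, p))))
      = (LINT \<zeta>|?P (?I \<union> ?J). a \<zeta> * cnj (b \<zeta>))"
    unfolding pull[OF borel_measurable_integrable[OF int]]
    by (rule Bochner_Integration.integral_cong[OF refl])
      (simp add: a_def b_def ext_restrict v rootedD(3)[OF G])
  also have "\<dots> = (LINT x|?P ?I. (LINT y|?P ?J. a (merge ?I ?J (x, y)) * cnj (b (merge ?I ?J (x, y)))))"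
    by (rule U.product_integral_fold[OF disj fin int])
  also have "\<dots> = (LINT x|?P ?I. 0)"
  proof (rule Bochner_Integration.integral_cong[OF refl])
    fix x assume x: "x \<in> space (?P ?I)"
    have mS: "merge ?I ?J (x, y) \<in> space (?P (?I \<union> ?J))" if "y \<in> space (?P ?J)" for y
      using x that by (auto simp: space_PiM PiE_iff merge_def extensional_def)
    \<comment> \<open>For fixed labels \<open>x\<close> around \<open>v\<close> the first factor does not depend on the labels \<open>y\<close> around
        \<open>p\<close>, and the mean of the second over \<open>y\<close> is zero. The labelling \<open>y0\<close> is a reference point to
        express this.\<close>
    define y0 :: "nat \<Rightarrow> real" where "y0 = (\<lambda>w\<in>?J. 0)"
    have y0: "y0 \<in> space (?P ?J)" by (auto simp: y0_def space_PiM space_unif)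
    have a_const: "a (merge ?I ?J (x, y)) = a (merge ?I ?J (x, y0))" if y: "y \<in> space (?P ?J)" for y
      unfolding a_def
    proof (rule local_funD(2)[OF f lab[OF mS[OF y] v] lab[OF mS[OF y0] v]])
      show "ext (merge ?I ?J (x, y)) w = ext (merge ?I ?J (x, y0)) w" if "w \<in> ?I" for w
        using that by (simp add: ext_def merge_def)
    qed
    have b_const: "b (merge ?I ?J (x', y)) = b (merge ?I ?J (x, y))"
      if x': "x' \<in> space (?P ?I)" and y: "y \<in> space (?P ?J)" for x' y
      unfolding b_def
    proof (rule local_funD(2)[OF f])
      show "(G, ext (merge ?I ?J (x', y)), p) \<in> labelled D"
        by (rule lab[OF _ rootedD(3)[OF G]]) (use x' y in \<open>auto simp: space_PiM PiE_iff merge_def extensional_def\<close>)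
      show "(G, ext (merge ?I ?J (x, y)), p) \<in> labelled D" by (rule lab[OF mS[OF y] rootedD(3)[OF G]])
      show "ext (merge ?I ?J (x', y)) w = ext (merge ?I ?J (x, y)) w" if "w \<in> ?J" for w
        using that disj by (auto simp: ext_def)
    qed
    interpret PI: prob_space "?P ?I" by (intro prob_space_PiM prob_space_unif)
    have intb: "integrable (?P (?I \<union> ?J)) b"
      by (rule PIJ.integrable_const_bound[where B=c, OF AE_I2]) (use bd in auto)
    have "0 = (LINT \<xi>|label_measure G. f (lclass (G, \<xi>, p)))" using mean0 by simp
    also have "\<dots> = (LINT \<zeta>|?P (?I \<union> ?J). b \<zeta>)"
      unfolding pull[OF ab_meas(2)]
      by (rule Bochner_Integration.integral_cong[OF refl]) (simp add: b_def ext_restrict rootedD(3)[OF G])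
    also have "\<dots> = (LINT x'|?P ?I. (LINT y|?P ?J. b (merge ?I ?J (x', y))))"
      by (rule U.product_integral_fold[OF disj fin intb])
    also have "\<dots> = (LINT x'|?P ?I. (LINT y|?P ?J. b (merge ?I ?J (x, y))))"
      by (intro Bochner_Integration.integral_cong refl b_const)
    also have "\<dots> = (LINT y|?P ?J. b (merge ?I ?J (x, y)))" by (simp add: PI.prob_space)
    finally have b0: "(LINT y|?P ?J. b (merge ?I ?J (x, y))) = 0" by simp
    have "(LINT y|?P ?J. a (merge ?I ?J (x, y)) * cnj (b (merge ?I ?J (x, y))))
        = (LINT y|?P ?J. a (merge ?I ?J (x, y0)) * cnj (b (merge ?I ?J (x, y))))"
      by (rule Bochner_Integration.integral_cong[OF refl]) (simp add: a_const)
    also have "\<dots> = a (merge ?I ?J (x, y0)) * cnj (LINT y|?P ?J. b (merge ?I ?J (x, y)))"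
      by (simp only: integral_mult_right_zero Bochner_Integration.integral_cnj)
    finally show "(LINT y|?P ?J. a (merge ?I ?J (x, y)) * cnj (b (merge ?I ?J (x, y)))) = 0"
      unfolding b0 by simp
  qed
  finally show ?thesis by simp
qed

lemma far_balls_disjoint:
  assumes G: "bounded_graph D G" and p: "p \<in> verts G" and v: "v \<in> verts G" "v \<notin> bverts G p (2 * n)"
  shows "bverts G v n \<inter> bverts G p n = {}"
proof (rule ccontr)
  assume "bverts G v n \<inter> bverts G p n \<noteq> {}"
  then obtain w where w: "w \<in> bverts G v n" "w \<in> bverts G p n" by blast
  have "v \<in> bverts G w n" by (rule bverts_sym[OF bounded_graphD(1)[OF G] v(1) w(1)])
  then have "v \<in> bverts G p (n + n)" by (rule bverts_trans[OF w(2)])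
  then show False using v(2) by (simp add: mult_2)
qed

context measurable_degree
begin

text \<open>
  Along the orbit of a fixed labelled graph under moving the root, the walk on labelled graphs
  is the simple random walk on the graph.
\<close>

lemma avg_pow_lclass:
  assumes "(G, \<xi>, p) \<in> labelled D"
  shows "(avg nbrs move_root ^^ k) f (lclass (G, \<xi>, p))
    = (markov_op (edges G) ^^ k) (\<lambda>v. f (lclass (G, \<xi>, v))) p"
  using assms
proof (induction k arbitrary: p)
  case (Suc k)
  show ?case
    unfolding funpow.simps o_apply avg_lclass[OF Suc.prems]
    by (rule markov_op_cong, rule Suc.IH, rule labelled_move[OF Suc.prems neighbour_verts[OF Suc.prems]]) simp
qed simp

lemma avg_pow_bounded:
  assumes f: "f \<in> borel_measurable L" and c: "\<And>Y. Y \<in> space L \<Longrightarrow> cmod (f Y) \<le> c"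
  shows "(avg nbrs move_root ^^ k) f \<in> borel_measurable L"
    and "Y \<in> space L \<Longrightarrow> cmod ((avg nbrs move_root ^^ k) f Y) \<le> c"
proof -
  have m: "avg nbrs move_root g \<in> borel_measurable L" if "g \<in> borel_measurable L" for g
    using avg_measurable[of g] that unfolding measurable_cong_sets[OF sets_mu_star refl] by blast
  show "(avg nbrs move_root ^^ k) f \<in> borel_measurable L" by (induction k) (auto intro: f m)
  show "cmod ((avg nbrs move_root ^^ k) f Y) \<le> c" if "Y \<in> space L"
    using that
  proof (induction k arbitrary: Y)
    case (Suc k)
    let ?h = "(avg nbrs move_root ^^ k) f"
    have n: "0 < card (nbrs Y)" using card_nbrs_bounds(1)[OF Suc.prems] by simp
    have "cmod (\<Sum>i\<in>nbrs Y. ?h (move_root Y i)) \<le> real (card (nbrs Y)) * c"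
      by (rule sum_norm_bound) (use Suc.IH walk.step[of Y] Suc.prems in simp)
    moreover have "avg nbrs move_root ?h Y = (\<Sum>i\<in>nbrs Y. ?h (move_root Y i)) / of_nat (card (nbrs Y))"
      by (simp add: avg_def)
    ultimately show ?case using n by (simp add: norm_divide pos_divide_le_eq mult.commute)
  qed (simp add: c)
qed

text \<open>
  In \<open>\<langle>T\<^sup>k f, f\<rangle>\<close> only walks ending within distance \<open>2n\<close> of the start contribute, and the
  probability of being at a given vertex after \<open>k\<close> steps is at most \<open>sqrt D * \<rho>\<^sup>k\<close>.
\<close>

lemma local_correlations_decay:
  assumes f: "local_fun D n f"
    and mean0: "\<And>G p. (G, p) \<in> rooted D \<Longrightarrow> (LINT \<xi>|label_measure G. f (lclass (G, \<xi>, p))) = 0"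
    and nb: "AE X in \<nu>. markov_norm_le (fst (rep X)) \<rho>" and \<rho>: "0 \<le> \<rho>"
  obtains C where "\<And>k. cmod (L2_inner \<mu>s ((avg nbrs move_root ^^ k) f) f) \<le> C * \<rho> ^ k"
proof -
  obtain c where c: "0 \<le> c" "\<And>Y. Y \<in> space L \<Longrightarrow> cmod (f Y) \<le> c" using local_fun_bound[OF f] by blast
  note fm[measurable] = local_funD(1)[OF f]
  \<comment> \<open>The number of vertices within distance \<open>2n\<close>, times the bounds on the probability to be there
      and on the correlation, without the factor \<open>\<rho>\<^sup>k\<close>.\<close>
  define C0 where "C0 = real (Suc D ^ (2 * n)) * (sqrt (real D) * (c * c))"
  have C0: "0 \<le> C0" using c by (simp add: C0_def)
  have "cmod (L2_inner \<mu>s ((avg nbrs move_root ^^ k) f) f) \<le> (real D * C0) * \<rho> ^ k" for k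
  proof -
    let ?h = "(avg nbrs move_root ^^ k) f"
    let ?F = "\<lambda>Y. ?h Y * cnj (f Y)"
    note [measurable] = avg_pow_bounded(1)[OF fm c(2), of k]
    have F: "?F \<in> borel_measurable L" by measurable
    have Fb: "cmod (?F Y) \<le> c * c" if "Y \<in> space L" for Y
      using avg_pow_bounded(2)[OF fm c(2) that, of k] c(2)[OF that] c(1) by (auto simp: norm_mult intro!: mult_mono)
    have "AE X in \<nu>. X \<in> space \<nu>" by simp
    with nb have "AE X in \<nu>. cmod (label_mean D ?F X) \<le> C0 * \<rho> ^ k"
    proof eventually_elim
      case (elim X)
      from elim(2) obtain G p where X: "rep X = (G, p)" "(G, p) \<in> rooted D" by (rule nu_cases)
      have nbG: "markov_norm_le G \<rho>" using elim(1) X(1) by simp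
      note Gp = rootedD(1,3)[OF X(2)]
      interpret prob_space "label_measure G" by (rule prob_space_label_measure)
      let ?P = "\<lambda>v. (markov_op (edges G) ^^ k) (point_mass v) p"
      let ?c = "\<lambda>v. LINT \<xi>|label_measure G. f (lclass (G, \<xi>, v)) * cnj (f (lclass (G, \<xi>, p)))"
      have fv: "(\<lambda>\<xi>. f (lclass (G, \<xi>, v))) \<in> borel_measurable (label_measure G)" if "v \<in> verts G" for v
        by (rule measurable_compose[OF lclass_measurable[OF rooted_move[OF X(2) that]] fm])
      have fvb: "cmod (f (lclass (G, \<xi>, v))) \<le> c" if "v \<in> verts G" "\<xi> \<in> space (label_measure G)" for v \<xi>
        by (intro c(2) lclass_in_space) (use rooted_move[OF X(2) that(1)] that(2) in \<open>simp add: labelled_iff\<close>)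
      have cb: "AE \<xi> in label_measure G. cmod (f (lclass (G, \<xi>, v)) * cnj (f (lclass (G, \<xi>, p)))) \<le> c * c"
        if v: "v \<in> verts G" for v
        by (rule AE_I2) (use fvb[OF v] fvb[OF Gp(2)] c(1) in \<open>auto simp: norm_mult intro!: mult_mono\<close>)
      have int: "integrable (label_measure G) (\<lambda>\<xi>. f (lclass (G, \<xi>, v)) * cnj (f (lclass (G, \<xi>, p))))"
        if v: "v \<in> verts G" for v
        by (rule integrable_const_bound[OF cb[OF v]]) (use fv[OF v] fv[OF Gp(2)] in measurable)
      have "label_mean D ?F X = (LINT \<xi>|label_measure G. ?F (lclass (G, \<xi>, p)))"
        by (rule label_mean_rep[OF F X])
      also have "\<dots> = (LINT \<xi>|label_measure G. (\<Sum>v\<in>bverts G p k. ?P v * (f (lclass (G, \<xi>, v)) * cnj (f (lclass (G, \<xi>, p))))))"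
      proof (rule Bochner_Integration.integral_cong[OF refl])
        fix \<xi> assume "\<xi> \<in> space (label_measure G)"
        then have x: "(G, \<xi>, p) \<in> labelled D" using X(2) by (simp add: labelled_iff)
        show "?F (lclass (G, \<xi>, p)) = (\<Sum>v\<in>bverts G p k. ?P v * (f (lclass (G, \<xi>, v)) * cnj (f (lclass (G, \<xi>, p)))))"
          unfolding avg_pow_lclass[OF x] markov_pow_eq_sum[OF Gp, of k "\<lambda>v. f (lclass (G, \<xi>, v))"]
          by (simp only: sum_distrib_left mult_ac)
      qed
      also have "\<dots> = (\<Sum>v\<in>bverts G p k. ?P v * ?c v)"
        using int bverts_subset[of G p k]
        by (subst Bochner_Integration.integral_sum) (auto intro!: integrable_mult_right sum.cong simp: subset_iff)
      also have "\<dots> = (\<Sum>v\<in>bverts G p k \<inter> bverts G p (2 * n). ?P v * ?c v)"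
      proof (rule sum.mono_neutral_right)
        show "\<forall>v\<in>bverts G p k - bverts G p k \<inter> bverts G p (2 * n). ?P v * ?c v = 0"
        proof
          fix v assume "v \<in> bverts G p k - bverts G p k \<inter> bverts G p (2 * n)"
          then have v: "v \<in> verts G" "v \<notin> bverts G p (2 * n)" using bverts_subset[of G p k] by auto
          have "?c v = 0"
            by (rule far_correlation_zero[OF f X(2) v(1) far_balls_disjoint[OF Gp v] mean0[OF X(2)]])
          then show "?P v * ?c v = 0" by simp
        qed
      qed (use finite_bverts[OF Gp] in auto)
      finally have eq: "label_mean D ?F X = (\<Sum>v\<in>bverts G p k \<inter> bverts G p (2 * n). ?P v * ?c v)" .
      have "cmod (label_mean D ?F X) \<le> (\<Sum>v\<in>bverts G p k \<inter> bverts G p (2 * n). cmod (?P v * ?c v))"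
        unfolding eq by (rule norm_sum)
      also have "\<dots> \<le> (\<Sum>v\<in>bverts G p k \<inter> bverts G p (2 * n). (sqrt (real D) * \<rho> ^ k) * (c * c))"
      proof (rule sum_mono)
        fix v assume "v \<in> bverts G p k \<inter> bverts G p (2 * n)"
        then have v: "v \<in> verts G" using bverts_subset[of G p k] by auto
        have "cmod (?c v) \<le> c * c" by (rule norm_integral_le[OF cb[OF v]]) (use c in simp)
        then show "cmod (?P v * ?c v) \<le> (sqrt (real D) * \<rho> ^ k) * (c * c)"
          unfolding norm_mult using markov_pow_point_mass_le[OF Gp v nbG \<rho>, of k] \<rho>
          by (intro mult_mono) auto
      qed
      also have "\<dots> = real (card (bverts G p k \<inter> bverts G p (2 * n))) * ((sqrt (real D) * \<rho> ^ k) * (c * c))"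
        by simp
      also have "\<dots> \<le> real (Suc D ^ (2 * n)) * ((sqrt (real D) * \<rho> ^ k) * (c * c))"
      proof (rule mult_right_mono)
        have "card (bverts G p k \<inter> bverts G p (2 * n)) \<le> card (bverts G p (2 * n))"
          using finite_bverts[OF Gp] by (intro card_mono) auto
        then show "real (card (bverts G p k \<inter> bverts G p (2 * n))) \<le> real (Suc D ^ (2 * n))"
          using card_bverts_le[OF Gp, of "2 * n"] by (meson of_nat_le_iff order_trans)
      qed (use c \<rho> in simp)
      also have "\<dots> = C0 * \<rho> ^ k" by (simp only: C0_def mult_ac)
      finally show ?case .
    qed
    then have "cmod (LINT Y|\<mu>s. ?F Y) \<le> real D * (C0 * \<rho> ^ k)"
      by (intro integral_mu_star_bound[OF F Fb]) (use C0 \<rho> in auto)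
    then show ?thesis by (simp add: L2_inner_def mult_ac)
  qed
  then show ?thesis by (rule that)
qed

subsection \<open>Density of local functions\<close>

definition local_closure :: "(lgraph set \<Rightarrow> complex) set" where
  "local_closure = {h \<in> L2_space \<mu>s. \<forall>\<epsilon>>0. \<exists>n g. local_fun D n g \<and> L2_norm \<mu>s (\<lambda>Y. h Y - g Y) < \<epsilon>}"

lemma local_fun_L2:
  assumes g: "local_fun D n g" shows "g \<in> L2_space \<mu>s"
proof -
  obtain c where c: "\<And>Y. Y \<in> space L \<Longrightarrow> cmod (g Y) \<le> c" using local_fun_bound[OF g] by blast
  show ?thesis
    by (rule L2_bounded[OF prob_space.finite_measure[OF prob_space_mu_star], where c=c])
      (use local_funD(1)[OF g] c in \<open>simp_all add: measurable_cong_sets[OF sets_mu_star refl]\<close>)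
qed

lemma local_closure_local: "local_fun D n g \<Longrightarrow> g \<in> local_closure"
  unfolding local_closure_def
  by (auto simp: local_fun_L2 L2_norm_def intro!: exI[of _ n] exI[of _ g])

lemma local_closure_limit:
  assumes h: "h \<in> L2_space \<mu>s" and F: "\<And>i. F i \<in> local_closure"
    and lim: "(\<lambda>i. L2_norm \<mu>s (\<lambda>Y. h Y - F i Y)) \<longlonglongrightarrow> 0"
  shows "h \<in> local_closure"
  unfolding local_closure_def mem_Collect_eq
proof (intro conjI h allI impI)
  fix \<epsilon> :: real assume "0 < \<epsilon>"
  then have "\<forall>\<^sub>F i in sequentially. L2_norm \<mu>s (\<lambda>Y. h Y - F i Y) < \<epsilon> / 2" by (intro order_tendstoD(2)[OF lim]) simp
  then obtain i where i: "L2_norm \<mu>s (\<lambda>Y. h Y - F i Y) < \<epsilon> / 2" by (auto simp: eventually_sequentially)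
  obtain n g where g: "local_fun D n g" "L2_norm \<mu>s (\<lambda>Y. F i Y - g Y) < \<epsilon> / 2"
    using F[of i] half_gt_zero[OF \<open>0 < \<epsilon>\<close>] unfolding local_closure_def by blast
  have Fi: "F i \<in> L2_space \<mu>s" using F[of i] by (simp add: local_closure_def)
  have "L2_norm \<mu>s (\<lambda>Y. h Y - g Y) \<le> L2_norm \<mu>s (\<lambda>Y. h Y - F i Y) + L2_norm \<mu>s (\<lambda>Y. F i Y - g Y)"
    using L2_norm_triangle[OF L2_diff[OF h Fi] L2_diff[OF Fi local_fun_L2[OF g(1)]]] by simp
  then show "\<exists>n g. local_fun D n g \<and> L2_norm \<mu>s (\<lambda>Y. h Y - g Y) < \<epsilon>" using g i by (intro exI[of _ n] exI[of _ g]) simp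
qed

lemma local_closure_lin:
  assumes f: "f \<in> local_closure" and g: "g \<in> local_closure"
  shows "(\<lambda>Y. f Y + b * g Y) \<in> local_closure"
  unfolding local_closure_def mem_Collect_eq
proof (intro conjI allI impI)
  have fL: "f \<in> L2_space \<mu>s" and gL: "g \<in> L2_space \<mu>s" using f g by (simp_all add: local_closure_def)
  show "(\<lambda>Y. f Y + b * g Y) \<in> L2_space \<mu>s" by (intro L2_add L2_scale fL gL)
  fix \<epsilon> :: real assume e: "0 < \<epsilon>"
  define d where "d = \<epsilon> / 2 / (1 + cmod b)"
  have b1: "0 < 1 + cmod b" by (simp add: add_pos_nonneg)
  have d: "0 < d" using e b1 by (simp add: d_def)
  obtain m f' where f': "local_fun D m f'" "L2_norm \<mu>s (\<lambda>Y. f Y - f' Y) < \<epsilon> / 2"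
    using f half_gt_zero[OF e] unfolding local_closure_def by blast
  obtain n g' where g': "local_fun D n g'" "L2_norm \<mu>s (\<lambda>Y. g Y - g' Y) < d"
    using g d unfolding local_closure_def by blast
  have loc: "local_fun D (max m n) (\<lambda>Y. f' Y + b * g' Y)"
    by (intro local_fun_lin local_fun_mono[OF f'(1)] local_fun_mono[OF g'(1)]) simp_all
  have "L2_norm \<mu>s (\<lambda>Y. f Y + b * g Y - (f' Y + b * g' Y))
      = L2_norm \<mu>s (\<lambda>Y. (f Y - f' Y) + b * (g Y - g' Y))"
    by (rule arg_cong[where f="L2_norm \<mu>s"]) (simp add: fun_eq_iff algebra_simps)
  also have "\<dots> \<le> L2_norm \<mu>s (\<lambda>Y. f Y - f' Y) + L2_norm \<mu>s (\<lambda>Y. b * (g Y - g' Y))"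
    by (intro L2_norm_triangle L2_diff L2_scale fL gL local_fun_L2[OF f'(1)] local_fun_L2[OF g'(1)])
  also have "\<dots> < \<epsilon> / 2 + cmod b * d"
    unfolding L2_norm_scale using f'(2) g'(2) by (intro add_less_le_mono mult_left_mono) auto
  also have "\<dots> \<le> \<epsilon>"
  proof -
    have "cmod b * d \<le> (1 + cmod b) * d" using d by (intro mult_right_mono) auto
    also have "\<dots> = \<epsilon> / 2"
      using b1 nonzero_mult_div_cancel_left[of "1 + cmod b" "\<epsilon> / 2"] unfolding d_def
      by (metis less_irrefl times_divide_eq_right)
    finally show ?thesis by simp
  qed
  finally show "\<exists>n' h. local_fun D n' h \<and> L2_norm \<mu>s (\<lambda>Y. f Y + b * g Y - h Y) < \<epsilon>" using loc by blast
qed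

lemma local_closure_sum:
  assumes "finite I" "\<And>i. i \<in> I \<Longrightarrow> f i \<in> local_closure"
  shows "(\<lambda>Y. \<Sum>i\<in>I. c i * f i Y) \<in> local_closure"
  using assms
proof (induction I rule: finite_induct)
  case empty
  have "local_fun D 0 (\<lambda>Y. complex_of_real (indicator (space L) Y))" by (rule local_fun_indicator[OF space_local_sets])
  from local_fun_lin[OF this this, of "-1"] show ?case by (intro local_closure_local) simp
next
  case (insert i I)
  then have "(\<lambda>Y. (\<Sum>i\<in>I. c i * f i Y) + c i * f i Y) \<in> local_closure" by (intro local_closure_lin) auto
  then show ?case using insert(1,2) by (simp add: add.commute)
qed

lemma local_closure_dominated:
  assumes h: "h \<in> L2_space \<mu>s" and F: "\<And>i. F i \<in> local_closure"
    and lim: "\<And>Y. Y \<in> space L \<Longrightarrow> (\<lambda>i. F i Y) \<longlonglongrightarrow> h Y"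
    and w: "integrable \<mu>s w" "\<And>i Y. Y \<in> space L \<Longrightarrow> (cmod (h Y - F i Y))\<^sup>2 \<le> w Y"
  shows "h \<in> local_closure"
proof (rule local_closure_limit[OF h F])
  have FL: "F i \<in> L2_space \<mu>s" for i using F[of i] by (simp add: local_closure_def)
  note [measurable] = L2_measurable[OF h] L2_measurable[OF FL]
  have "(\<lambda>i. LINT Y|\<mu>s. (cmod (h Y - F i Y))\<^sup>2) \<longlonglongrightarrow> (LINT Y|\<mu>s. 0)"
  proof (rule integral_dominated_convergence[OF _ _ w(1)])
    show "AE Y in \<mu>s. (\<lambda>i. (cmod (h Y - F i Y))\<^sup>2) \<longlonglongrightarrow> 0"
    proof (rule AE_I2)
      fix Y assume "Y \<in> space \<mu>s"
      then have "(\<lambda>i. (cmod (h Y - F i Y))\<^sup>2) \<longlonglongrightarrow> (cmod (h Y - h Y))\<^sup>2" by (intro tendsto_intros lim) simp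
      then show "(\<lambda>i. (cmod (h Y - F i Y))\<^sup>2) \<longlonglongrightarrow> 0" by simp
    qed
    show "AE Y in \<mu>s. norm ((cmod (h Y - F i Y))\<^sup>2) \<le> w Y" for i by (rule AE_I2) (use w(2) in simp)
  qed measurable
  then have "(\<lambda>i. sqrt (LINT Y|\<mu>s. (cmod (h Y - F i Y))\<^sup>2)) \<longlonglongrightarrow> sqrt 0" by (intro tendsto_real_sqrt) simp
  then show "(\<lambda>i. L2_norm \<mu>s (\<lambda>Y. h Y - F i Y)) \<longlonglongrightarrow> 0" by (simp add: L2_norm_def)
qed

lemma local_closure_indicator:
  assumes A: "A \<in> sets L"
  shows "(\<lambda>Y. complex_of_real (indicator A Y)) \<in> local_closure"
  using local_sets_Int_stable local_sets_subset A[unfolded sets_labelled_space_local]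
proof (induction rule: sigma_sets_induct_disjoint)
  case (basic A)
  then show ?case using local_closure_local[OF local_fun_indicator] by blast
next
  case empty
  show ?case using local_closure_sum[of "{}"] by simp
next
  case (compl A)
  have "(\<lambda>Y. complex_of_real (indicator (space L) Y) + (-1) * complex_of_real (indicator A Y)) \<in> local_closure"
    by (intro local_closure_lin compl local_closure_local[OF local_fun_indicator[OF space_local_sets]])
  moreover have "A \<subseteq> space L" using compl(1) unfolding sets_labelled_space_local[symmetric] by (rule sets.sets_into_space)
  then have "(\<lambda>Y. complex_of_real (indicator (space L) Y) + (-1) * complex_of_real (indicator A Y))
      = (\<lambda>Y. complex_of_real (indicator (space L - A) Y))"
    by (auto simp: fun_eq_iff split: split_indicator)
  ultimately show ?case by (simp only:)
next
  case (union A)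
  have A: "A i \<in> sets L" for i using union(2) unfolding sets_labelled_space_local[symmetric] by blast
  interpret prob_space \<mu>s by (rule prob_space_mu_star)
  let ?F = "\<lambda>n Y. \<Sum>i<n. 1 * complex_of_real (indicator (A i) Y)"
  have F_eq: "?F n Y = complex_of_real (indicator (\<Union>i<n. A i) Y)" for n Y
  proof -
    have "(\<Sum>i<n. indicator (A i) Y) = (indicator (\<Union>i<n. A i) Y :: real)"
      using union(1) by (intro indicator_UN_disjoint[symmetric]) (auto simp: disjoint_family_on_def)
    then show ?thesis by (simp flip: of_real_sum)
  qed
  show ?case
  proof (rule local_closure_dominated[where F="?F" and w="\<lambda>_. 1"])
    have U: "(\<Union>i. A i) \<in> sets \<mu>s" using A by (simp only: sets_mu_star) blast
    show "(\<lambda>Y. complex_of_real (indicator (\<Union>i. A i) Y)) \<in> L2_space \<mu>s"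
      by (rule L2_bounded[where c=1, OF finite_measure_axioms measurable_compose[OF borel_measurable_indicator[OF U] borel_measurable_of_real]])
        (simp split: split_indicator)
    show "?F n \<in> local_closure" for n by (intro local_closure_sum union) simp
    show "(\<lambda>n. ?F n Y) \<longlonglongrightarrow> complex_of_real (indicator (\<Union>i. A i) Y)" for Y
    proof -
      have "(\<lambda>n. indicator (\<Union>i<n. A i) Y :: real) \<longlonglongrightarrow> indicator (\<Union>i. A i) Y"
        by (rule LIMSEQ_indicator_UN)
      then show ?thesis unfolding F_eq by (rule tendsto_of_real)
    qed
    show "(cmod (complex_of_real (indicator (\<Union>i. A i) Y) - ?F n Y))\<^sup>2 \<le> 1" for n Y
      unfolding F_eq of_real_diff[symmetric] norm_of_real by (simp split: split_indicator)
  qed simp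
qed

text \<open>
  Limits of local functions contain the indicators of local sets, hence those of all measurable
  sets by the \<open>\<pi>\<close>-\<open>\<lambda>\<close> theorem, hence simple functions and their dominated limits.
\<close>

lemma local_closure_eq: "L2_space \<mu>s \<subseteq> local_closure"
proof
  fix h assume h: "h \<in> L2_space \<mu>s"
  obtain s where s0: "\<forall>i. simple_function \<mu>s (s i)" "\<forall>Y\<in>space \<mu>s. (\<lambda>i. s i Y) \<longlonglongrightarrow> h Y"
    "\<forall>i. \<forall>Y\<in>space \<mu>s. dist (s i Y) 0 \<le> 2 * dist (h Y) 0"
    by (rule exE[OF borel_measurable_implies_sequence_metric[OF L2_measurable[OF h], of 0]]) (elim conjE, rule that)
  note s = spec[OF s0(1)] bspec[OF s0(2)] bspec[OF spec[OF s0(3)]]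
  let ?F = "\<lambda>i Y. \<Sum>z\<in>s i ` space \<mu>s. z * complex_of_real (indicator (s i -` {z} \<inter> space \<mu>s) Y)"
  have F_eq: "?F i Y = s i Y" if "Y \<in> space \<mu>s" for i Y
  proof -
    have "?F i Y = (\<Sum>z\<in>s i ` space \<mu>s. indicator (s i -` {z} \<inter> space \<mu>s) Y *\<^sub>R z)"
      by (simp add: scaleR_conv_of_real mult.commute)
    also have "\<dots> = s i Y" by (rule simple_function_indicator_representation_banach[OF s(1) that, symmetric])
    finally show ?thesis .
  qed
  show "h \<in> local_closure"
  proof (rule local_closure_dominated[OF h, where F="?F" and w="\<lambda>Y. 9 * (cmod (h Y))\<^sup>2"])
    show "?F i \<in> local_closure" for i
    proof (rule local_closure_sum)
      show "finite (s i ` space \<mu>s)" by (rule simple_functionD(1)[OF s(1)])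
      show "(\<lambda>Y. complex_of_real (indicator (s i -` {z} \<inter> space \<mu>s) Y)) \<in> local_closure" for z
        using simple_functionD(2)[OF s(1), of i "{z}"] by (intro local_closure_indicator) simp
    qed
    show "(\<lambda>i. ?F i Y) \<longlonglongrightarrow> h Y" if "Y \<in> space L" for Y
      using s(2)[of Y] F_eq[of Y] that by simp
    show "integrable \<mu>s (\<lambda>Y. 9 * (cmod (h Y))\<^sup>2)" using L2_square_integrable[OF h] by simp
    show "(cmod (h Y - ?F i Y))\<^sup>2 \<le> 9 * (cmod (h Y))\<^sup>2" if "Y \<in> space L" for i Y
    proof -
      have Y: "Y \<in> space \<mu>s" using that by simp
      have "cmod (h Y - s i Y) \<le> cmod (h Y) + cmod (s i Y)" by (rule norm_triangle_ineq4)
      also have "\<dots> \<le> 3 * cmod (h Y)" using s(3)[OF Y, of i] by simp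
      finally have "(cmod (h Y - s i Y))\<^sup>2 \<le> (3 * cmod (h Y))\<^sup>2" by (rule power_mono) simp
      then show ?thesis unfolding F_eq[OF Y] by (simp add: power_mult_distrib)
    qed
  qed
qed

subsection \<open>The bound on the random subspace\<close>

text \<open>
  The mean given the graph is the orthogonal projection: for a fixed graph it is constant in the
  labels.
\<close>

lemma inner_given_graph:
  assumes g: "local_fun D n g"
  shows "L2_inner \<mu>s g (given_graph D g) = L2_inner \<mu>s (given_graph D g) (given_graph D g)"
proof -
  let ?e = "given_graph D g"
  note gm[measurable] = local_funD(1)[OF g] local_funD(1)[OF local_fun_given_graph[OF g]]
  obtain c where c: "0 \<le> c" "\<And>Y. Y \<in> space L \<Longrightarrow> cmod (g Y) \<le> c" using local_fun_bound[OF g] by blast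
  have e: "cmod (?e Y) \<le> c" if "Y \<in> space L" for Y by (rule given_graph_bounded[OF gm(1) c(2) that])
  have F1: "(\<lambda>Y. g Y * cnj (?e Y)) \<in> borel_measurable L" "\<And>Y. Y \<in> space L \<Longrightarrow> cmod (g Y * cnj (?e Y)) \<le> c * c"
    using c e by (measurable, auto simp: norm_mult intro!: mult_mono)
  have F2: "(\<lambda>Y. ?e Y * cnj (?e Y)) \<in> borel_measurable L" "\<And>Y. Y \<in> space L \<Longrightarrow> cmod (?e Y * cnj (?e Y)) \<le> c * c"
    using c e by (measurable, auto simp: norm_mult intro!: mult_mono)
  have "label_mean D (\<lambda>Y. g Y * cnj (?e Y)) X = label_mean D (\<lambda>Y. ?e Y * cnj (?e Y)) X" if "X \<in> space \<nu>" for X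
  proof -
    from that obtain G p where X: "rep X = (G, p)" "(G, p) \<in> rooted D" by (rule nu_cases)
    interpret prob_space "label_measure G" by (rule prob_space_label_measure)
    define m where "m = (LINT \<xi>|label_measure G. g (lclass (G, \<xi>, p)))"
    have em: "?e (lclass (G, \<xi>, p)) = m" if "\<xi> \<in> space (label_measure G)" for \<xi>
      unfolding m_def by (rule given_graph_lclass[OF _ gm(1)]) (use that X(2) in \<open>simp add: labelled_iff\<close>)
    have "(LINT \<xi>|label_measure G. g (lclass (G, \<xi>, p)) * cnj (?e (lclass (G, \<xi>, p))))
        = (LINT \<xi>|label_measure G. g (lclass (G, \<xi>, p)) * cnj m)"
      by (rule Bochner_Integration.integral_cong[OF refl]) (simp add: em)
    also have "\<dots> = m * cnj m" unfolding m_def by (rule integral_mult_left_zero)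
    also have "\<dots> = (LINT \<xi>|label_measure G. m * cnj m)" by (simp add: prob_space)
    also have "\<dots> = (LINT \<xi>|label_measure G. ?e (lclass (G, \<xi>, p)) * cnj (?e (lclass (G, \<xi>, p))))"
      by (rule Bochner_Integration.integral_cong[OF refl]) (simp add: em)
    finally show ?thesis unfolding label_mean_rep[OF F1(1) X] label_mean_rep[OF F2(1) X] .
  qed
  then have "(LINT X|\<nu>. of_nat (root_deg X) * label_mean D (\<lambda>Y. g Y * cnj (?e Y)) X)
      = (LINT X|\<nu>. of_nat (root_deg X) * label_mean D (\<lambda>Y. ?e Y * cnj (?e Y)) X)"
    by (intro Bochner_Integration.integral_cong refl) simp
  then show ?thesis
    unfolding L2_inner_def using integral_mu_star[OF F1] integral_mu_star[OF F2] by simp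
qed

text \<open>
  Let \<open>g\<close> be local with \<open>\<parallel>h - g\<parallel> < \<epsilon>\<close> and let \<open>e\<close> be its mean given the graph. As \<open>h\<close> is
  orthogonal to \<open>e\<close>, \<open>\<parallel>e\<parallel>\<^sup>2 = \<langle>g - h, e\<rangle>\<close>, so \<open>\<parallel>e\<parallel> \<le> \<epsilon>\<close>. Hence \<open>f = g - e\<close> is a centred local
  function within \<open>2 \<epsilon>\<close> of \<open>h\<close>, and the bound for \<open>f\<close> passes to \<open>h\<close>.
\<close>

lemma random_norm_le:
  assumes h: "h \<in> random_subspace D \<nu>"
    and nb: "AE X in \<nu>. markov_norm_le (fst (rep X)) \<rho>" and \<rho>: "0 \<le> \<rho>"
  shows "L2_norm \<mu>s (avg nbrs move_root h) \<le> \<rho> * L2_norm \<mu>s h"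
proof -
  let ?T = "avg nbrs move_root"
  interpret all: L2_symmetric_operator \<mu>s "L2_space \<mu>s" ?T
    by (rule avg_symmetric_operator[OF subset_refl L2_zero L2_add L2_scale _ avg_L2])
  have hL: "h \<in> L2_space \<mu>s" using h random_L2 by blast
  have approx: "L2_norm \<mu>s (?T h) \<le> \<rho> * L2_norm \<mu>s h + (\<rho> + 1) * (2 * \<epsilon>)" if e: "0 < \<epsilon>" for \<epsilon>
  proof -
    obtain n g where g: "local_fun D n g" and hg: "L2_norm \<mu>s (\<lambda>Y. h Y - g Y) < \<epsilon>"
      using subsetD[OF local_closure_eq hL] e unfolding local_closure_def by blast
    let ?e = "given_graph D g"
    have eloc: "local_fun D n ?e" by (rule local_fun_given_graph[OF g])
    have gL: "g \<in> L2_space \<mu>s" and eL: "?e \<in> L2_space \<mu>s" using local_fun_L2 g eloc by blast+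
    have eS: "?e \<in> structured_subspace D \<nu>"
      by (rule structuredI[OF label_mean_measurable[OF local_funD(1)[OF g]] eL]) (simp add: given_graph_def)
    have "L2_norm \<mu>s ?e \<le> \<epsilon>"
    proof (cases "L2_norm \<mu>s ?e = 0")
      case False
      then have pos: "0 < L2_norm \<mu>s ?e" using L2_norm_nonneg[of \<mu>s ?e] by linarith
      have "L2_inner \<mu>s h ?e = 0" using h eS by (simp add: random_subspace_def)
      then have "L2_inner \<mu>s (\<lambda>Y. g Y - h Y) ?e = of_real ((L2_norm \<mu>s ?e)\<^sup>2)"
        using L2_inner_diff_left[OF gL hL eL] inner_given_graph[OF g] by (simp add: L2_inner_self)
      then have "(L2_norm \<mu>s ?e)\<^sup>2 = cmod (L2_inner \<mu>s (\<lambda>Y. g Y - h Y) ?e)" by (metis abs_power2 norm_of_real)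
      also have "\<dots> \<le> L2_norm \<mu>s (\<lambda>Y. g Y - h Y) * L2_norm \<mu>s ?e"
        by (rule L2_Cauchy_Schwarz[OF L2_diff[OF gL hL] eL])
      also have "\<dots> \<le> \<epsilon> * L2_norm \<mu>s ?e"
        using hg L2_norm_minus_commute[of \<mu>s g h] by (intro mult_right_mono) auto
      finally show ?thesis using pos by (simp add: power2_eq_square)
    qed (use e in simp)
    moreover define f where "f = (\<lambda>Y. g Y + (-1) * ?e Y)"
    have floc: "local_fun D n f" unfolding f_def by (rule local_fun_lin[OF g eloc])
    have fL: "f \<in> L2_space \<mu>s" by (rule local_fun_L2[OF floc])
    have "L2_norm \<mu>s (\<lambda>Y. h Y - f Y) = L2_norm \<mu>s (\<lambda>Y. (h Y - g Y) + ?e Y)"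
      by (rule arg_cong[where f="L2_norm \<mu>s"]) (simp add: f_def fun_eq_iff)
    moreover have "\<dots> \<le> L2_norm \<mu>s (\<lambda>Y. h Y - g Y) + L2_norm \<mu>s ?e"
      by (rule L2_norm_triangle[OF L2_diff[OF hL gL] eL])
    ultimately have hf: "L2_norm \<mu>s (\<lambda>Y. h Y - f Y) \<le> 2 * \<epsilon>" using hg by linarith
    have mean0: "(LINT \<xi>|label_measure G. f (lclass (G, \<xi>, p))) = 0" if G: "(G, p) \<in> rooted D" for G p
    proof -
      interpret prob_space "label_measure G" by (rule prob_space_label_measure)
      obtain c where c: "\<And>Y. Y \<in> space L \<Longrightarrow> cmod (g Y) \<le> c" using local_fun_bound[OF g] by blast
      define m where "m = (LINT \<xi>|label_measure G. g (lclass (G, \<xi>, p)))"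
      have lab: "(G, \<xi>, p) \<in> labelled D" if "\<xi> \<in> space (label_measure G)" for \<xi>
        using that G by (simp add: labelled_iff)
      have int: "integrable (label_measure G) (\<lambda>\<xi>. g (lclass (G, \<xi>, p)))"
        by (rule integrable_const_bound[where B=c, OF AE_I2])
          (use c lclass_in_space[OF lab] measurable_compose[OF lclass_measurable[OF G] local_funD(1)[OF g]] in auto)
      have "(LINT \<xi>|label_measure G. f (lclass (G, \<xi>, p))) = (LINT \<xi>|label_measure G. g (lclass (G, \<xi>, p)) - m)"
        by (rule Bochner_Integration.integral_cong[OF refl])
          (simp add: f_def m_def given_graph_lclass[OF lab local_funD(1)[OF g]])
      also have "\<dots> = 0" using int by (simp add: m_def prob_space)
      finally show ?thesis .
    qed
    obtain C where "\<And>k. cmod (L2_inner \<mu>s ((?T ^^ k) f) f) \<le> C * \<rho> ^ k"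
      using local_correlations_decay[OF floc mean0 nb \<rho>] by metis
    then have Tf: "L2_norm \<mu>s (?T f) \<le> \<rho> * L2_norm \<mu>s f"
      by (rule all.norm_le_if_correlations_decay[OF fL \<rho>])
    have "L2_norm \<mu>s (?T h) \<le> L2_norm \<mu>s (\<lambda>Y. ?T h Y - ?T f Y) + L2_norm \<mu>s (?T f)"
      by (rule L2_norm_triangle_diff[OF avg_L2[OF hL] avg_L2[OF fL]])
    also have "L2_norm \<mu>s (\<lambda>Y. ?T h Y - ?T f Y) \<le> L2_norm \<mu>s (\<lambda>Y. h Y - f Y)"
      using avg_contraction[OF L2_diff[OF hL fL]] by (simp only: all.T_diff)
    also have "L2_norm \<mu>s (?T f) \<le> \<rho> * (L2_norm \<mu>s h + L2_norm \<mu>s (\<lambda>Y. h Y - f Y))"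
    proof (rule order_trans[OF Tf mult_left_mono[OF _ \<rho>]])
      show "L2_norm \<mu>s f \<le> L2_norm \<mu>s h + L2_norm \<mu>s (\<lambda>Y. h Y - f Y)"
        using L2_norm_triangle_diff[OF fL hL] L2_norm_minus_commute[of \<mu>s f h] by simp
    qed
    finally have "L2_norm \<mu>s (?T h) \<le> \<rho> * L2_norm \<mu>s h + (\<rho> + 1) * L2_norm \<mu>s (\<lambda>Y. h Y - f Y)"
      by (simp add: algebra_simps)
    also have "(\<rho> + 1) * L2_norm \<mu>s (\<lambda>Y. h Y - f Y) \<le> (\<rho> + 1) * (2 * \<epsilon>)"
      using hf \<rho> by (intro mult_left_mono) auto
    finally show ?thesis by simp
  qed
  show ?thesis
  proof (rule field_le_epsilon)
    fix e :: real assume "0 < e"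
    then have "0 < e / (2 * (\<rho> + 1))" using \<rho> by simp
    from approx[OF this] have "L2_norm \<mu>s (?T h) \<le> \<rho> * L2_norm \<mu>s h + 2 * (\<rho> + 1) * (e / (2 * (\<rho> + 1)))"
      by (simp only: mult_ac)
    moreover have "2 * (\<rho> + 1) * (e / (2 * (\<rho> + 1))) = e"
      unfolding times_divide_eq_right using \<rho> by (intro nonzero_mult_div_cancel_left) simp
    ultimately show "L2_norm \<mu>s (?T h) \<le> \<rho> * L2_norm \<mu>s h + e" by (simp only:)
  qed
qed

end

text \<open>All functions agree almost everywhere, so the identity is an inverse of every operator.\<close>

lemma spectrum_null_measure:
  assumes "\<And>P. AE x in M. P x"
  shows "L2_spectrum M H T = {}"
proof -
  have "L2_norm M f = 0" for f :: "'a \<Rightarrow> complex"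
    using integral_cong_AE by (metis L2_norm_def assms integral_eq_zero_AE real_sqrt_zero)
  then have "\<forall>f\<in>H. f \<in> H \<and> L2_norm M f \<le> 0 * L2_norm M f
      \<and> (AE x in M. T f x - z * f x = f x) \<and> (AE x in M. (\<lambda>y. T f y - z * f y) x = f x)" for z
    using assms by simp
  then have "z \<notin> L2_spectrum M H T" for z
    unfolding L2_spectrum_def mem_Collect_eq not_not by (intro exI[of _ "\<lambda>f. f"] exI[of _ 0]) blast
  then show ?thesis by blast
qed

theorem theorem1p1:
  fixes D :: nat and \<nu> :: "rgraph set measure"
  assumes "unimodular_random_graph D \<nu>"
    and "ergodic_random_graph D \<nu>"
  shows "\<exists>\<rho>::real. (AE X in \<nu>. spectral_radius X = \<rho>)
           \<and> random_spectrum D \<nu> \<subseteq> complex_of_real ` {- \<rho>..\<rho>}"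
proof -
  obtain \<rho> where \<rho>: "0 \<le> \<rho>" "AE X in \<nu>. spectral_radius X = \<rho>"
    using spectral_radius_constant[OF assms] by metis
  interpret unimodular_graph D \<nu> by (rule unimodular_graph.intro[OF assms(1)])
  have "random_spectrum D \<nu> \<subseteq> complex_of_real ` {- \<rho>..\<rho>}"
  proof (cases "(\<lambda>X. real (deg (bernoulli_graph D) X)) \<in> borel_measurable (bernoulli_measure D \<nu>)")
    case True
    interpret measurable_degree D \<nu> by unfold_locales (rule True)
    interpret R: L2_symmetric_operator "mu_star D \<nu>" "random_subspace D \<nu>" "avg nbrs move_root"
      by (rule random_symmetric_operator)
    have "AE X in \<nu>. X \<in> space \<nu>" by simp
    with \<rho>(2) have nb: "AE X in \<nu>. markov_norm_le (fst (rep X)) \<rho>"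
    proof eventually_elim
      case (elim X)
      from elim(2) obtain G p where X: "rep X = (G, p)" "(G, p) \<in> rooted D" by (rule nu_cases)
      show ?case using spectral_radius_le_iff(2)[OF X \<rho>(1)] elim(1) X(1) by simp
    qed
    show ?thesis
      unfolding random_spectrum_def
      by (rule R.spectrum_in_interval[OF AE_markov_op \<rho>(1) random_norm_le[OF _ nb \<rho>(1)]])
  next
    case False
    \<comment> \<open>Then the integral that normalises \<open>mu_star\<close> is 0 by convention, and so is its density,
        as \<open>x / 0 = 0\<close>.\<close>
    then have "(LINT X|bernoulli_measure D \<nu>. real (deg (bernoulli_graph D) X)) = 0"
      by (intro not_integrable_integral_eq) (auto dest: borel_measurable_integrable)
    then have "mu_star D \<nu> = density (bernoulli_measure D \<nu>) (\<lambda>_. 0)"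
      by (simp add: mu_star_def degree_biased_def)
    then have "AE X in mu_star D \<nu>. P X" for P by (simp only: AE_density[OF borel_measurable_const]) simp
    then show ?thesis unfolding random_spectrum_def by (simp add: spectrum_null_measure)
  qed
  then show ?thesis using \<rho>(2) by blast
qed

end
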